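(* Consider the blow up $X$ of $\mathbb{P}^2$ at $9$ generic points $p_1,\dots,p_9$. Let $C'$ be an exceptional divisor on $X$ of type $(d,m_1,\dots,m_9)=(2d',2m_1'+1,\dots,2m_9'+1)$ with $d'\ge 2$, and consider the fat point subscheme $Z=(3m_1'+1)p_1+\cdots+(3m_9'+1)p_9\subset\mathbb{P}^2$. Then: (i) $Z$ has maximal Hilbert function and $\alpha(Z)=3d'-1$; (ii) $\mu_\alpha$ is expected to be injective with $\dim\operatorname{coker}(\mu_\alpha)=1$, i.e. $\dim (I_Z)_{\alpha+1}-3\dim (I_Z)_\alpha=1$; but in fact (iii) $\dim\operatorname{coker}(\mu_\alpha)\ge 2$. Hence $Z$ does not have generic resolution (i.e. $\mu_\alpha$ does not have maximal rank). Here $\alpha=\alpha(Z)$.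
   Context: Work over an algebraically closed field $K$ of arbitrary characteristic. The points $p_1,\dots,p_9\in\mathbb{P}^2$ are generic (in the usual sense: e.g. their affine coordinates are $18$ elements of $K$ algebraically independent over the prime field). Let $\pi:X\to\mathbb{P}^2$ be the blow up, $L$ the pullback of a line, $E_i=\pi^{-1}(p_i)$. An exceptional divisor on $X$ is a smooth rational curve $C'\subset X$ with $C'^2=-1$; it has type $(d,m_1,\dots,m_9)$ if $[C']=[dL-m_1E_1-\cdots-m_9E_9]$. Let $R=K[x_0,x_1,x_2]$. For non-negative integers $n_i$, the fat point subscheme $Z=n_1p_1+\cdots+n_9p_9$ is the subscheme of $\mathbb{P}^2$ defined by the homogeneous ideal $I_Z=\bigcap_i I(p_i)^{n_i}\subset R$; its degree (length) is $\deg Z=\sum_i\binom{n_i+1}{2}$. $\alpha(Z)$ is the least degree $t$ with $(I_Z)_t\ne0$. The Hilbert function is $h_Z(k)=\dim R_k-\dim(I_Z)_k$; it is maximal if $h_Z(k)=\min\left(\binom{k+2}{2},\deg Z\right)$ for all $k\ge0$. The map $\mu_k:(I_Z)_k\otimes R_1\to(I_Z)_{k+1}$ is multiplication. "Expected" refers to what would happen if $\mu_\alpha$ had maximal rank. *)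

theory Defs
  imports
    "HOL-Library.Poly_Mapping"
    "HOL-Library.Numeral_Type"
    "HOL-Computational_Algebra.Polynomial"
    "HOL-Computational_Algebra.Fraction_Field"
begin

section \<open>Polynomials\<close>

type_synonym ('v, 'k) mpol = "('v \<Rightarrow>\<^sub>0 nat) \<Rightarrow>\<^sub>0 'k"

definition Const :: "'k::zero \<Rightarrow> ('v, 'k) mpol" where
  "Const c = Poly_Mapping.single 0 c"

definition Var :: "'v \<Rightarrow> ('v, 'k::zero_neq_one) mpol" where
  "Var v = Poly_Mapping.single (Poly_Mapping.single v 1) 1"

definition ev :: "('v::finite \<Rightarrow> 'k::comm_ring_1) \<Rightarrow> ('v, 'k) mpol \<Rightarrow> 'k" where
  "ev p P = (\<Sum>m\<in>Poly_Mapping.keys P.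
      Poly_Mapping.lookup P m * (\<Prod>v\<in>UNIV. p v ^ Poly_Mapping.lookup m v))"

definition substitute ::
    "('v::finite \<Rightarrow> ('w, 'k::comm_ring_1) mpol) \<Rightarrow> ('v, 'k) mpol \<Rightarrow> ('w, 'k) mpol" where
  "substitute s P = (\<Sum>m\<in>Poly_Mapping.keys P.
      Const (Poly_Mapping.lookup P m) * (\<Prod>v\<in>UNIV. s v ^ Poly_Mapping.lookup m v))"

global_interpretation mpol_vs:
  vector_space "\<lambda>(c::'k::field) (P::('v, 'k) mpol). Const c * P"
  by unfold_locales
    (simp_all add: Const_def algebra_simps single_add mult_single single_one flip: mult.assoc)

global_interpretation ideal:
  module "(*) :: 'r::comm_ring_1 \<Rightarrow> 'r \<Rightarrow> 'r"
  by unfold_locales (simp_all add: algebra_simps)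

primrec ideal_power :: "'r::comm_ring_1 set \<Rightarrow> nat \<Rightarrow> 'r set" where
  "ideal_power I 0 = UNIV"
| "ideal_power I (Suc n) = ideal.span {f * g | f g. f \<in> I \<and> g \<in> ideal_power I n}"

text \<open>In positive characteristic the quotients with zero denominator are \<open>0\<close>.\<close>

definition prime_subfield :: "'k::field set" where
  "prime_subfield = {of_int m / of_int n | m n. True}"

definition alg_independent :: "('v::finite \<Rightarrow> 'k::field) \<Rightarrow> bool" where
  "alg_independent x \<longleftrightarrow>
     (\<forall>P. (\<forall>m. Poly_Mapping.lookup P m \<in> prime_subfield) \<longrightarrow> ev x P = 0 \<longrightarrow> P = 0)"


section \<open>Subvarieties of products of projective spaces\<close>

text \<open>
  A product of projective spaces is given by its homogeneous coordinates, indexed by a finite type,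
  together with the partition \<open>B\<close> of that type into the coordinate blocks of the factors.
  Points are represented by coordinate vectors, each block being defined up to a nonzero factor;
  a set of points is a set of coordinate vectors closed under this equivalence.
\<close>

definition multiproj :: "'v set set \<Rightarrow> ('v \<Rightarrow> 'k::field) set" where
  "multiproj B = {p. \<forall>b\<in>B. \<exists>v\<in>b. p v \<noteq> 0}"

definition proj_equiv :: "'v set set \<Rightarrow> ('v \<Rightarrow> 'k::field) \<Rightarrow> ('v \<Rightarrow> 'k) \<Rightarrow> bool" where
  "proj_equiv B p q \<longleftrightarrow> (\<forall>b\<in>B. \<exists>c. c \<noteq> 0 \<and> (\<forall>v\<in>b. q v = c * p v))"

definition point_class :: "'v set set \<Rightarrow> ('v \<Rightarrow> 'k::field) \<Rightarrow> ('v \<Rightarrow> 'k) set" where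
  "point_class B p = {q. proj_equiv B p q}"

definition multihomogeneous :: "'v set set \<Rightarrow> ('v set \<Rightarrow> nat) \<Rightarrow> ('v, 'k::zero) mpol \<Rightarrow> bool" where
  "multihomogeneous B e P \<longleftrightarrow>
     (\<forall>m\<in>Poly_Mapping.keys P. \<forall>b\<in>B. (\<Sum>v\<in>b. Poly_Mapping.lookup m v) = e b)"

definition zariski_closed :: "'v::finite set set \<Rightarrow> ('v \<Rightarrow> 'k::field) set \<Rightarrow> bool" where
  "zariski_closed B C \<longleftrightarrow> (\<exists>S. (\<forall>P\<in>S. \<exists>e. multihomogeneous B e P) \<and>
     C = {p \<in> multiproj B. \<forall>P\<in>S. ev p P = 0})"

definition zariski_irreducible :: "'v::finite set set \<Rightarrow> ('v \<Rightarrow> 'k::field) set \<Rightarrow> bool" where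
  "zariski_irreducible B C \<longleftrightarrow> C \<noteq> {} \<and>
     (\<forall>S T. zariski_closed B S \<longrightarrow> zariski_closed B T \<longrightarrow> C \<subseteq> S \<union> T \<longrightarrow> C \<subseteq> S \<or> C \<subseteq> T)"

text \<open>
  A morphism between locally closed sets is a map that near every point is given by polynomials
  in the coordinates, those for one block of the target being forms of the same multidegree.
\<close>

definition is_morphism ::
    "'v::finite set set \<Rightarrow> ('v \<Rightarrow> 'k::field) set \<Rightarrow> 'w set set \<Rightarrow> ('w \<Rightarrow> 'k) set
      \<Rightarrow> (('v \<Rightarrow> 'k) \<Rightarrow> ('w \<Rightarrow> 'k)) \<Rightarrow> bool" where
  "is_morphism B S B' T \<psi> \<longleftrightarrow> (\<forall>p\<in>S. \<psi> p \<in> T) \<and>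
     (\<forall>p\<in>S. \<exists>G :: 'w \<Rightarrow> ('v, 'k) mpol.
        (\<forall>b\<in>B'. \<exists>e. \<forall>w\<in>b. multihomogeneous B e (G w)) \<and>
        (\<lambda>w. ev p (G w)) \<in> multiproj B' \<and>
        (\<forall>r\<in>S. (\<lambda>w. ev r (G w)) \<in> multiproj B' \<longrightarrow> proj_equiv B' (\<lambda>w. ev r (G w)) (\<psi> r)))"

definition isomorphic_sets ::
    "'v::finite set set \<Rightarrow> ('v \<Rightarrow> 'k::field) set \<Rightarrow> 'w::finite set set \<Rightarrow> ('w \<Rightarrow> 'k) set \<Rightarrow> bool" where
  "isomorphic_sets B S B' T \<longleftrightarrow> (\<exists>\<psi> \<theta>. is_morphism B S B' T \<psi> \<and> is_morphism B' T B S \<theta> \<and>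
     (\<forall>p\<in>S. proj_equiv B p (\<theta> (\<psi> p))) \<and> (\<forall>q\<in>T. proj_equiv B' q (\<psi> (\<theta> q))))"

abbreviation P1_blocks :: "2 set set" where "P1_blocks \<equiv> {UNIV}"
abbreviation P2_blocks :: "3 set set" where "P2_blocks \<equiv> {UNIV}"


section \<open>The blow up of the plane at nine points\<close>

text \<open>
  The points are \<open>p\<^sub>i = [1 : a\<^sub>i : b\<^sub>i]\<close>, indexed by the nine-element type \<^typ>\<open>9\<close>.
  Generic points lie in the chart \<open>x\<^sub>0 \<noteq> 0\<close>, so nothing is lost by this normalisation.
\<close>

definition pt :: "(9 \<Rightarrow> 'k) \<Rightarrow> (9 \<Rightarrow> 'k) \<Rightarrow> 9 \<Rightarrow> (3 \<Rightarrow> 'k::field)" where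
  "pt a b i = (\<lambda>j. if j = 0 then 1 else if j = 1 then a i else b i)"

definition generic_points :: "(9 \<Rightarrow> 'k::field) \<Rightarrow> (9 \<Rightarrow> 'k) \<Rightarrow> bool" where
  "generic_points a b \<longleftrightarrow> alg_independent (case_sum a b :: 9 + 9 \<Rightarrow> 'k)"

text \<open>
  The linear forms \<open>x\<^sub>1 - a\<^sub>i x\<^sub>0\<close> and \<open>x\<^sub>2 - b\<^sub>i x\<^sub>0\<close> generate the ideal of \<open>p\<^sub>i\<close>.
  The blow up is the closed subvariety of \<open>\<bbbP>\<^sup>2 \<times> (\<bbbP>\<^sup>1)\<^sup>9\<close>
  on which, for all \<open>i\<close>, this pair is proportional to the coordinates of the \<open>i\<close>-th line.
\<close>

type_synonym amb = "3 + 9 \<times> 2"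

definition amb_blocks :: "amb set set" where
  "amb_blocks = insert (range Inl) ((\<lambda>i. Inr ` ({i} \<times> UNIV)) ` UNIV)"

definition lin :: "(9 \<Rightarrow> 'k) \<Rightarrow> (9 \<Rightarrow> 'k) \<Rightarrow> 9 \<Rightarrow> 2 \<Rightarrow> (3, 'k::field) mpol" where
  "lin a b i j = (if j = 0 then Var 1 - Const (a i) * Var 0 else Var 2 - Const (b i) * Var 0)"

definition blowup :: "(9 \<Rightarrow> 'k) \<Rightarrow> (9 \<Rightarrow> 'k) \<Rightarrow> (amb \<Rightarrow> 'k::field) set" where
  "blowup a b = {q \<in> multiproj amb_blocks. \<forall>i.
     q (Inr (i, 0)) * ev (q \<circ> Inl) (lin a b i 1) = q (Inr (i, 1)) * ev (q \<circ> Inl) (lin a b i 0)}"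

definition exc :: "(9 \<Rightarrow> 'k) \<Rightarrow> (9 \<Rightarrow> 'k) \<Rightarrow> 9 \<Rightarrow> (amb \<Rightarrow> 'k::field) set" where
  "exc a b i = {q \<in> blowup a b. proj_equiv P2_blocks (pt a b i) (q \<circ> Inl)}"

text \<open>The pullback of the line \<open>x\<^sub>0 = 0\<close>, which contains none of the points \<open>p\<^sub>i\<close>.\<close>

definition line_pullback :: "(9 \<Rightarrow> 'k) \<Rightarrow> (9 \<Rightarrow> 'k) \<Rightarrow> (amb \<Rightarrow> 'k::field) set" where
  "line_pullback a b = {q \<in> blowup a b. q (Inl 0) = 0}"

text \<open>
  Prime divisors of the irreducible surface \<open>X\<close>: its irreducible closed subsets are \<open>X\<close>,
  the curves on \<open>X\<close>, and the points.
\<close>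

definition curve_on_X :: "(9 \<Rightarrow> 'k) \<Rightarrow> (9 \<Rightarrow> 'k) \<Rightarrow> (amb \<Rightarrow> 'k::field) set \<Rightarrow> bool" where
  "curve_on_X a b C \<longleftrightarrow> zariski_closed amb_blocks C \<and> zariski_irreducible amb_blocks C \<and>
     C \<subseteq> blowup a b \<and> C \<noteq> blowup a b \<and> (\<forall>q. C \<noteq> point_class amb_blocks q)"


section \<open>Local rings and divisors\<close>

text \<open>
  Since \<open>\<pi> : X \<rightarrow> \<bbbP>\<^sup>2\<close> is birational, \<open>K(X)\<close> is the subfield \<open>K(\<bbbP>\<^sup>2)\<close> of degree zero elements of
  the fraction field of \<open>R = K[x\<^sub>0, x\<^sub>1, x\<^sub>2]\<close>: a quotient of forms on the ambient space is
  identified with its value at the generic point of \<open>X\<close>, at which the coordinates of the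
  \<open>i\<close>-th line are the two linear forms of the previous section.
\<close>

definition at_generic_point ::
    "(9 \<Rightarrow> 'k) \<Rightarrow> (9 \<Rightarrow> 'k) \<Rightarrow> (amb, 'k::field) mpol \<Rightarrow> (3, 'k) mpol" where
  "at_generic_point a b = substitute (case_sum Var (\<lambda>(i, j). lin a b i j))"

text \<open>
  The stalk at \<open>q\<close> of the ideal sheaf on \<open>X\<close> of a closed set \<open>D\<close>. The choice \<open>D = {}\<close> gives the
  local ring of \<open>X\<close> at \<open>q\<close>, and \<open>D = {q}\<close> gives its maximal ideal.
\<close>

definition ideal_stalk ::
    "(9 \<Rightarrow> 'k) \<Rightarrow> (9 \<Rightarrow> 'k) \<Rightarrow> (amb \<Rightarrow> 'k::field) set \<Rightarrow> (amb \<Rightarrow> 'k) \<Rightarrow> (3, 'k) mpol fract set" where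
  "ideal_stalk a b D q =
     {Fract (at_generic_point a b G) (at_generic_point a b H) | G H.
        (\<exists>e. multihomogeneous amb_blocks e G \<and> multihomogeneous amb_blocks e H) \<and>
        ev q H \<noteq> 0 \<and> (\<forall>r\<in>D. ev r G = 0)}"

abbreviation local_ring ::
    "(9 \<Rightarrow> 'k) \<Rightarrow> (9 \<Rightarrow> 'k) \<Rightarrow> (amb \<Rightarrow> 'k::field) \<Rightarrow> (3, 'k) mpol fract set" where
  "local_ring a b q \<equiv> ideal_stalk a b {} q"

definition local_equation ::
    "(9 \<Rightarrow> 'k) \<Rightarrow> (9 \<Rightarrow> 'k) \<Rightarrow> (amb \<Rightarrow> 'k::field) set \<Rightarrow> (amb \<Rightarrow> 'k) \<Rightarrow> (3, 'k) mpol fract \<Rightarrow> bool" where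
  "local_equation a b C q f \<longleftrightarrow> ideal_stalk a b C q = (\<lambda>h. f * h) ` local_ring a b q"

type_synonym 'k divisor = "(amb \<Rightarrow> 'k) set \<Rightarrow>\<^sub>0 int"

definition divisors :: "(9 \<Rightarrow> 'k) \<Rightarrow> (9 \<Rightarrow> 'k::field) \<Rightarrow> 'k divisor set" where
  "divisors a b = {D. \<forall>C\<in>Poly_Mapping.keys D. curve_on_X a b C}"

abbreviation prime_divisor :: "(amb \<Rightarrow> 'k) set \<Rightarrow> 'k divisor" where
  "prime_divisor C \<equiv> Poly_Mapping.single C 1"

text \<open>
  On the smooth surface \<open>X\<close>, \<open>D\<close> is the divisor of the rational function \<open>g\<close> iff \<open>g\<close> is at every
  point a local equation of \<open>D\<close>, that is, the product of the powers of the local equations of the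
  components of \<open>D\<close>, up to a unit of the local ring.
\<close>

definition is_divisor_of ::
    "(9 \<Rightarrow> 'k) \<Rightarrow> (9 \<Rightarrow> 'k::field) \<Rightarrow> 'k divisor \<Rightarrow> (3, 'k) mpol fract \<Rightarrow> bool" where
  "is_divisor_of a b D g \<longleftrightarrow> (\<forall>q\<in>blowup a b. \<exists>f u.
     (\<forall>C\<in>Poly_Mapping.keys D. local_equation a b C q (f C)) \<and>
     u \<noteq> 0 \<and> u \<in> local_ring a b q \<and> inverse u \<in> local_ring a b q \<and>
     g = u * (\<Prod>C\<in>Poly_Mapping.keys D. f C powi Poly_Mapping.lookup D C))"

definition lin_equiv :: "(9 \<Rightarrow> 'k) \<Rightarrow> (9 \<Rightarrow> 'k::field) \<Rightarrow> 'k divisor \<Rightarrow> 'k divisor \<Rightarrow> bool" where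
  "lin_equiv a b D D' \<longleftrightarrow> (\<exists>g. g \<noteq> 0 \<and> is_divisor_of a b (D - D') g)"

text \<open>
  Transversality at a common point: local equations of the two curves generate the maximal ideal.
\<close>

definition transversal ::
    "(9 \<Rightarrow> 'k) \<Rightarrow> (9 \<Rightarrow> 'k) \<Rightarrow> (amb \<Rightarrow> 'k::field) set \<Rightarrow> (amb \<Rightarrow> 'k) set \<Rightarrow> bool" where
  "transversal a b C D \<longleftrightarrow> (\<forall>q\<in>C \<inter> D.
     {f + g | f g. f \<in> ideal_stalk a b C q \<and> g \<in> ideal_stalk a b D q} = ideal_stalk a b {q} q)"

text \<open>
  The intersection pairing of a smooth projective surface, by its characterisation: it is the unique
  symmetric biadditive pairing on divisors that respects linear equivalence and counts the common
  points of transversal curves.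
\<close>

definition intersection_pairing ::
    "(9 \<Rightarrow> 'k) \<Rightarrow> (9 \<Rightarrow> 'k::field) \<Rightarrow> ('k divisor \<Rightarrow> 'k divisor \<Rightarrow> int) \<Rightarrow> bool" where
  "intersection_pairing a b I \<longleftrightarrow>
     (\<forall>D\<in>divisors a b. \<forall>D'\<in>divisors a b. I D D' = I D' D) \<and>
     (\<forall>D\<in>divisors a b. \<forall>D'\<in>divisors a b. \<forall>F\<in>divisors a b. I (D + D') F = I D F + I D' F) \<and>
     (\<forall>D\<in>divisors a b. \<forall>D'\<in>divisors a b. \<forall>F\<in>divisors a b.
        lin_equiv a b D D' \<longrightarrow> I D F = I D' F) \<and>
     (\<forall>C D. curve_on_X a b C \<longrightarrow> curve_on_X a b D \<longrightarrow> transversal a b C D \<longrightarrow>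
        I (prime_divisor C) (prime_divisor D) = int (card (point_class amb_blocks ` (C \<inter> D))))"

text \<open>
  A smooth rational projective curve is one that is isomorphic to the projective line.
\<close>

definition exceptional_divisor ::
    "(9 \<Rightarrow> 'k) \<Rightarrow> (9 \<Rightarrow> 'k) \<Rightarrow> (amb \<Rightarrow> 'k::field) set \<Rightarrow> bool" where
  "exceptional_divisor a b C \<longleftrightarrow> curve_on_X a b C \<and>
     isomorphic_sets P1_blocks (multiproj P1_blocks :: (2 \<Rightarrow> 'k) set) amb_blocks C \<and>
     (\<exists>I. intersection_pairing a b I \<and> I (prime_divisor C) (prime_divisor C) = -1)"

definition has_type ::
    "(9 \<Rightarrow> 'k) \<Rightarrow> (9 \<Rightarrow> 'k) \<Rightarrow> (amb \<Rightarrow> 'k::field) set \<Rightarrow> int \<Rightarrow> (9 \<Rightarrow> int) \<Rightarrow> bool" where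
  "has_type a b C d m \<longleftrightarrow> lin_equiv a b (prime_divisor C)
     (Poly_Mapping.single (line_pullback a b) d - (\<Sum>i\<in>UNIV. Poly_Mapping.single (exc a b i) (m i)))"


section \<open>Fat points\<close>

text \<open>\<open>R\<^sub>k\<close> for \<open>R = K[x\<^sub>0, x\<^sub>1, x\<^sub>2]\<close>\<close>

definition forms :: "nat \<Rightarrow> (3, 'k::field) mpol set" where
  "forms k = {P. multihomogeneous P2_blocks (\<lambda>_. k) P}"

definition point_ideal :: "(3 \<Rightarrow> 'k::field) \<Rightarrow> (3, 'k) mpol set" where
  "point_ideal p = ideal.span {P. (\<exists>k. P \<in> forms k) \<and> ev p P = 0}"

definition fat_ideal :: "(9 \<Rightarrow> 'k) \<Rightarrow> (9 \<Rightarrow> 'k) \<Rightarrow> (9 \<Rightarrow> nat) \<Rightarrow> (3, 'k::field) mpol set" where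
  "fat_ideal a b n = (\<Inter>i. ideal_power (point_ideal (pt a b i)) (n i))"

definition fat_degree :: "(9 \<Rightarrow> nat) \<Rightarrow> nat" where
  "fat_degree n = (\<Sum>i\<in>UNIV. (n i + 1) choose 2)"

definition fat_forms :: "(9 \<Rightarrow> 'k) \<Rightarrow> (9 \<Rightarrow> 'k) \<Rightarrow> (9 \<Rightarrow> nat) \<Rightarrow> nat \<Rightarrow> (3, 'k::field) mpol set" where
  "fat_forms a b n k = fat_ideal a b n \<inter> forms k"

definition alpha :: "(9 \<Rightarrow> 'k) \<Rightarrow> (9 \<Rightarrow> 'k::field) \<Rightarrow> (9 \<Rightarrow> nat) \<Rightarrow> nat" where
  "alpha a b n = (LEAST t. fat_forms a b n t \<noteq> {0})"

definition hilbert_function :: "(9 \<Rightarrow> 'k) \<Rightarrow> (9 \<Rightarrow> 'k::field) \<Rightarrow> (9 \<Rightarrow> nat) \<Rightarrow> nat \<Rightarrow> nat" where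
  "hilbert_function a b n k =
     mpol_vs.dim (forms k :: (3, 'k) mpol set) - mpol_vs.dim (fat_forms a b n k)"

definition maximal_hilbert_function :: "(9 \<Rightarrow> 'k) \<Rightarrow> (9 \<Rightarrow> 'k::field) \<Rightarrow> (9 \<Rightarrow> nat) \<Rightarrow> bool" where
  "maximal_hilbert_function a b n \<longleftrightarrow>
     (\<forall>k. hilbert_function a b n k = min ((k + 2) choose 2) (fat_degree n))"

text \<open>
  Since \<open>x\<^sub>0, x\<^sub>1, x\<^sub>2\<close> is a basis of \<open>R\<^sub>1\<close>, the elements \<open>\<Sum>\<^sub>j f\<^sub>j \<otimes> x\<^sub>j\<close> of \<open>(I\<^sub>Z)\<^sub>k \<otimes> R\<^sub>1\<close> are
  represented by the triples \<open>f\<close> of elements of \<open>(I\<^sub>Z)\<^sub>k\<close>.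
\<close>

definition mu_source ::
    "(9 \<Rightarrow> 'k) \<Rightarrow> (9 \<Rightarrow> 'k) \<Rightarrow> (9 \<Rightarrow> nat) \<Rightarrow> nat \<Rightarrow> (3 \<Rightarrow> (3, 'k::field) mpol) set" where
  "mu_source a b n k = {f. \<forall>j. f j \<in> fat_forms a b n k}"

definition mu :: "(3 \<Rightarrow> (3, 'k::field) mpol) \<Rightarrow> (3, 'k) mpol" where
  "mu f = (\<Sum>j\<in>UNIV. f j * Var j)"

definition dim_coker_mu :: "(9 \<Rightarrow> 'k) \<Rightarrow> (9 \<Rightarrow> 'k::field) \<Rightarrow> (9 \<Rightarrow> nat) \<Rightarrow> nat \<Rightarrow> nat" where
  "dim_coker_mu a b n k =
     mpol_vs.dim (fat_forms a b n (k + 1)) - mpol_vs.dim (mu ` mu_source a b n k)"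

definition mu_maximal_rank :: "(9 \<Rightarrow> 'k) \<Rightarrow> (9 \<Rightarrow> 'k::field) \<Rightarrow> (9 \<Rightarrow> nat) \<Rightarrow> nat \<Rightarrow> bool" where
  "mu_maximal_rank a b n k \<longleftrightarrow>
     inj_on mu (mu_source a b n k) \<or> mu ` mu_source a b n k = fat_forms a b n (k + 1)"

end

theory Submission imports Defs
begin

text \<open>
  Intersecting with \<open>L\<close>, \<open>E\<^sub>i\<close> and the strict transform of the line joining \<open>p\<^sub>i\<close> to \<open>(0 : 0 : 1)\<close> determines
  the pairing on the span of \<open>L, E\<^sub>1, \<dots>, E\<^sub>9\<close>, so \<open>C'\<^sup>2 = -1\<close> becomes \<open>4 d'\<^sup>2 - \<Sum> (2 m'\<^sub>i + 1)\<^sup>2 = -1\<close>.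
  The rational function realising the linear equivalence of \<open>C'\<close> with its class, multiplied by \<open>x\<^sub>0\<close> to the
  power \<open>2 d'\<close>, is a prime form \<open>\<Phi>\<close> of degree \<open>2 d'\<close> with multiplicity \<open>2 m'\<^sub>i + 1\<close> at \<open>p\<^sub>i\<close>.

  Dimensions of spaces of forms with assigned multiplicities can only grow when the points are specialised.
  For points on a cuspidal cubic they are bounded by restricting to the cubic, and quadratic
  transformations reduce every numerically nef class to one for which this bound is the expected dimension.

  The class \<open>F\<close> of degree \<open>3 d' - 1\<close> with multiplicities \<open>3 m'\<^sub>i + 1\<close> satisfies \<open>2 F = 3 C' + K + L\<close>, hence
  \<open>F\<close> and \<open>F + L\<close> have the expected dimension, and \<open>F - L\<close> has no sections.
  Moreover \<open>F = H + C'\<close>, where \<open>H\<close> has degree \<open>d' - 1\<close> and multiplicities \<open>m'\<^sub>i\<close>. There are so many forms in \<open>H\<close>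
  that multiplication by linear forms has a kernel on them; multiplied by \<open>\<Phi>\<close>
  it gives a kernel of \<open>\<mu>\<^sub>\<alpha>\<close>, so the cokernel is larger than expected.
\<close>

text \<open>The pairing is known only through its values on transversal curves, so it is used just
  to obtain C'^2 and to tell C' apart from L and the \<open>E i\<close>. Everything after that is
  counted in dimensions of spaces of forms, including a Bezout inequality and the value -K.C' = 1.
  The cuspidal cubic is chosen because in every characteristic it has the polynomial parametrisation
  t -> (1 : t^2 : t^3), with the exponent 1 as its only gap. Restricting a class F to it costs at
  most F.(-K) conditions as long as this number is positive, and removing the cubic changes \<chi>
  by exactly F.(-K). Quadratic transformations change neither number. For the class F of the theorem
  F.(-K) = 3, which is small enough for the descent along the cubic to end in degrees where the
  count is immediate. Passing from C' to \<Phi> rests on an extension property: what is regular off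
  the nine points is a form. The line x_0 = 0 misses all nine points, so the form can be built up by
  restricting to this line, subtracting and dividing by x_0.\<close>

section \<open>Ring homomorphisms and evaluation of polynomials\<close>

definition rhom :: "('a::comm_ring_1 \<Rightarrow> 'b::comm_ring_1) \<Rightarrow> bool" where
  "rhom h \<longleftrightarrow> h 1 = 1 \<and> (\<forall>x y. h (x + y) = h x + h y) \<and> (\<forall>x y. h (x * y) = h x * h y)"

lemma rhomI: "h 1 = 1 \<Longrightarrow> (\<And>x y. h (x + y) = h x + h y) \<Longrightarrow> (\<And>x y. h (x * y) = h x * h y) \<Longrightarrow> rhom h"
  by (simp add: rhom_def)

context
  fixes h :: "'a::comm_ring_1 \<Rightarrow> 'b::comm_ring_1"
  assumes h: "rhom h"
begin

lemma rhom_one: "h 1 = 1" and rhom_add: "h (x + y) = h x + h y" and rhom_mult: "h (x * y) = h x * h y"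
  using h by (simp_all add: rhom_def)

lemma rhom_zero: "h 0 = 0"
  using rhom_add[of 0 0] by simp

lemma rhom_uminus: "h (- x) = - h x"
  using rhom_add[of "-x" x] rhom_zero by (simp add: eq_neg_iff_add_eq_0)

lemma rhom_diff: "h (x - y) = h x - h y"
  using rhom_add[of x "-y"] rhom_uminus by simp

lemma rhom_power: "h (x ^ n) = h x ^ n"
  by (induction n) (simp_all add: rhom_one rhom_mult)

lemma rhom_sum: "h (sum f A) = (\<Sum>x\<in>A. h (f x))"
  by (induction A rule: infinite_finite_induct) (simp_all add: rhom_zero rhom_add)

lemma rhom_prod: "h (prod f A) = (\<Prod>x\<in>A. h (f x))"
  by (induction A rule: infinite_finite_induct) (simp_all add: rhom_one rhom_mult)

end

lemmas rhom_simps = rhom_one rhom_zero rhom_add rhom_mult rhom_uminus rhom_diff rhom_power rhom_sum rhom_prod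

lemma rhom_comp: "rhom f \<Longrightarrow> rhom g \<Longrightarrow> rhom (\<lambda>x. f (g x))"
  by (simp add: rhom_def)

lemma rhom_id: "rhom (\<lambda>x. x)"
  by (simp add: rhom_def)

lemma rhom_Const: "rhom Const"
  by (rule rhomI) (simp_all add: Const_def single_add mult_single single_one)

lemmas Const_simps = rhom_simps[OF rhom_Const]

lemma mpol_eq_sum_single: "P = (\<Sum>m\<in>Poly_Mapping.keys P. Poly_Mapping.single m (Poly_Mapping.lookup P m))"
proof (rule poly_mapping_eqI)
  fix k
  have "(\<Sum>m\<in>Poly_Mapping.keys P. Poly_Mapping.lookup (Poly_Mapping.single m (Poly_Mapping.lookup P m)) k)
      = (\<Sum>m\<in>Poly_Mapping.keys P. if m = k then Poly_Mapping.lookup P m else 0)"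
    by (rule sum.cong) (auto simp: lookup_single when_def)
  also have "\<dots> = Poly_Mapping.lookup P k"
    by (auto simp: in_keys_iff)
  finally show "Poly_Mapping.lookup P k = Poly_Mapping.lookup (\<Sum>m\<in>Poly_Mapping.keys P. Poly_Mapping.single m (Poly_Mapping.lookup P m)) k"
    by (simp add: lookup_sum)
qed

text \<open>The universal homomorphism out of a polynomial ring: \<open>c\<close> acts on the
  coefficients and \<open>s\<close> gives the images of the variables. Evaluation, substitution and
  restriction to a cubic, a line, an arc or a chart are all instances.\<close>

definition evh :: "('k::comm_ring_1 \<Rightarrow> 'r::comm_ring_1) \<Rightarrow> ('v::finite \<Rightarrow> 'r) \<Rightarrow> ('v, 'k) mpol \<Rightarrow> 'r" where
  "evh c s P = (\<Sum>m\<in>Poly_Mapping.keys P. c (Poly_Mapping.lookup P m) * (\<Prod>v\<in>UNIV. s v ^ Poly_Mapping.lookup m v))"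

lemma evh_superset:
  assumes "rhom c" "finite A" "Poly_Mapping.keys P \<subseteq> A"
  shows "evh c s P = (\<Sum>m\<in>A. c (Poly_Mapping.lookup P m) * (\<Prod>v\<in>UNIV. s v ^ Poly_Mapping.lookup m v))"
  unfolding evh_def using assms
  by (intro sum.mono_neutral_left) (auto simp: in_keys_iff rhom_zero)

lemma evh_single:
  assumes "rhom c"
  shows "evh c s (Poly_Mapping.single m a) = c a * (\<Prod>v\<in>UNIV. s v ^ Poly_Mapping.lookup m v)"
  by (subst evh_superset[OF assms, of "{m}"]) auto

lemma evh_add:
  assumes "rhom c"
  shows "evh c s (P + Q) = evh c s P + evh c s Q"
proof -
  let ?A = "Poly_Mapping.keys P \<union> Poly_Mapping.keys Q"
  have "finite ?A" "Poly_Mapping.keys P \<subseteq> ?A" "Poly_Mapping.keys Q \<subseteq> ?A" "Poly_Mapping.keys (P + Q) \<subseteq> ?A"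
    using keys_add[of P Q] by auto
  then show ?thesis
    by (simp add: evh_superset[OF assms, of ?A] lookup_add rhom_add[OF assms] algebra_simps sum.distrib)
qed

lemma evh_sum:
  assumes "rhom c"
  shows "evh c s (sum f A) = (\<Sum>x\<in>A. evh c s (f x))"
proof -
  have "evh c s 0 = 0" by (simp add: evh_def)
  then show ?thesis
    by (induction A rule: infinite_finite_induct) (simp_all add: evh_add[OF assms])
qed

lemma evh_mult:
  assumes "rhom c"
  shows "evh c s (P * Q) = evh c s P * evh c s Q"
proof -
  let ?s = "\<lambda>P m. Poly_Mapping.single m (Poly_Mapping.lookup P m)"
  have "P * Q = (\<Sum>m\<in>Poly_Mapping.keys P. ?s P m) * (\<Sum>m\<in>Poly_Mapping.keys Q. ?s Q m)"
    by (simp flip: mpol_eq_sum_single)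
  also have "\<dots> = (\<Sum>m\<in>Poly_Mapping.keys P. \<Sum>n\<in>Poly_Mapping.keys Q.
      Poly_Mapping.single (m + n) (Poly_Mapping.lookup P m * Poly_Mapping.lookup Q n))"
    by (simp add: sum_product mult_single)
  finally have "evh c s (P * Q) = evh c s (\<Sum>m\<in>Poly_Mapping.keys P. \<Sum>n\<in>Poly_Mapping.keys Q.
      Poly_Mapping.single (m + n) (Poly_Mapping.lookup P m * Poly_Mapping.lookup Q n))"
    by (rule arg_cong)
  also have "\<dots> = (\<Sum>m\<in>Poly_Mapping.keys P. \<Sum>n\<in>Poly_Mapping.keys Q. evh c s (?s P m) * evh c s (?s Q n))"
    unfolding evh_sum[OF assms] evh_single[OF assms] lookup_add power_add prod.distrib rhom_mult[OF assms]
    by (intro sum.cong refl) (simp only: mult_ac)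
  also have "\<dots> = evh c s (\<Sum>m\<in>Poly_Mapping.keys P. ?s P m) * evh c s (\<Sum>m\<in>Poly_Mapping.keys Q. ?s Q m)"
    by (simp only: evh_sum[OF assms] sum_product)
  finally show ?thesis by (simp flip: mpol_eq_sum_single)
qed

lemma evh_Const: "rhom c \<Longrightarrow> evh c s (Const a) = c a"
  by (simp add: Const_def evh_single)

lemma evh_Var:
  assumes "rhom c"
  shows "evh c s (Var v) = s v"
proof -
  have "(\<Prod>w\<in>UNIV. s w ^ Poly_Mapping.lookup (Poly_Mapping.single v 1) w) = (\<Prod>w\<in>UNIV. if w = v then s w else 1)"
    by (rule prod.cong) (auto simp: lookup_single when_def)
  then show ?thesis by (simp add: Var_def evh_single assms rhom_one)
qed

lemma rhom_evh: "rhom c \<Longrightarrow> rhom (evh c s)"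
  by (rule rhomI) (simp_all add: evh_add evh_mult rhom_one evh_single flip: single_one)

lemma ev_eq_evh: "ev = evh (\<lambda>x. x)"
  by (intro ext) (simp add: ev_def evh_def)

lemma substitute_eq_evh: "substitute = evh Const"
  by (intro ext) (simp add: substitute_def evh_def)

lemma rhom_ev: "rhom (ev p)"
  by (simp add: ev_eq_evh rhom_evh rhom_id)

lemma rhom_substitute: "rhom (substitute s)"
  by (simp add: substitute_eq_evh rhom_evh rhom_Const)

lemma ev_Const [simp]: "ev p (Const c) = c" and ev_Var [simp]: "ev p (Var v) = p v"
  by (simp_all add: ev_eq_evh evh_Const evh_Var rhom_id)

lemma substitute_Const [simp]: "substitute s (Const c) = Const c"
  and substitute_Var [simp]: "substitute s (Var v) = s v"
  by (simp_all add: substitute_eq_evh evh_Const evh_Var rhom_Const)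

lemmas ev_simps [simp] = rhom_simps[OF rhom_ev]
lemmas substitute_simps [simp] = rhom_simps[OF rhom_substitute]

lemma prod_Var_power:
  "(\<Prod>v\<in>UNIV. Var v ^ Poly_Mapping.lookup m v) = (Poly_Mapping.single m 1 :: ('v::finite, 'k::comm_ring_1) mpol)"
proof -
  have p: "(Var v :: ('v, 'k) mpol) ^ n = Poly_Mapping.single (Poly_Mapping.single v n) 1" for v n
    by (induction n) (simp_all add: Var_def mult_single single_add[symmetric])
  have "(\<Prod>v\<in>A. Poly_Mapping.single (Poly_Mapping.single v (Poly_Mapping.lookup m v)) (1::'k))
      = Poly_Mapping.single (\<Sum>v\<in>A. Poly_Mapping.single v (Poly_Mapping.lookup m v)) 1" if "finite A" for A :: "'v set"
    using that by (induction A rule: finite_induct) (simp_all add: mult_single)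
  moreover have "(\<Sum>v\<in>UNIV. Poly_Mapping.single v (Poly_Mapping.lookup m v)) = m"
    by (subst (2) mpol_eq_sum_single, rule sum.mono_neutral_right) (auto simp: in_keys_iff)
  ultimately show ?thesis by (simp add: p)
qed

lemma single_eq_Const_mult: "Poly_Mapping.single m c = Const c * Poly_Mapping.single m (1::'k::comm_ring_1)"
  by (simp add: Const_def mult_single)

text \<open>Constants and variables generate, so their images determine a homomorphism. Identities
  between homomorphisms are therefore checked on generators only.\<close>

lemma rhom_eq_evh:
  assumes h: "rhom h"
  shows "h P = evh (\<lambda>c. h (Const c)) (\<lambda>v. h (Var v)) (P :: ('v::finite, 'k::comm_ring_1) mpol)"
proof -
  have "h P = h (\<Sum>m\<in>Poly_Mapping.keys P. Const (Poly_Mapping.lookup P m) * (\<Prod>v\<in>UNIV. Var v ^ Poly_Mapping.lookup m v))"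
    by (simp add: prod_Var_power flip: single_eq_Const_mult mpol_eq_sum_single)
  then show ?thesis by (simp add: rhom_simps[OF h] evh_def)
qed

lemma rhom_eqI:
  assumes "rhom h" "rhom g" "\<And>c. h (Const c) = g (Const c)" "\<And>v. h (Var v) = g (Var v)"
  shows "h P = g (P :: ('v::finite, 'k::comm_ring_1) mpol)"
  by (simp add: rhom_eq_evh[OF assms(1), of P] rhom_eq_evh[OF assms(2), of P] assms(3,4))

lemma ev_substitute: "ev p (substitute s P) = ev (\<lambda>v. ev p (s v)) P"
  by (rule rhom_eqI[of "\<lambda>P. ev p (substitute s P)"]) (auto intro!: rhom_comp[OF rhom_ev] rhom_substitute rhom_ev)

lemma substitute_substitute: "substitute t (substitute s P) = substitute (\<lambda>v. substitute t (s v)) P"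
  by (rule rhom_eqI[of "\<lambda>P. substitute t (substitute s P)"])
    (auto intro!: rhom_comp[OF rhom_substitute] rhom_substitute)

lemma substitute_id [simp]: "substitute Var P = P"
  by (rule rhom_eqI[of "substitute Var"]) (auto intro!: rhom_substitute rhom_id)

text \<open>Over a finite field the polynomial 1 + \<Prod>(x - c), with c running over the whole
  field, would have no root.\<close>

lemma infinite_alg_closed: "infinite (UNIV :: 'k::alg_closed_field set)"
proof
  assume fin: "finite (UNIV :: 'k set)"
  define p :: "'k poly" where "p = (\<Prod>c\<in>UNIV. [:- c, 1:]) + 1"
  have "degree (\<Prod>c\<in>(UNIV::'k set). [:- c, 1:]) = card (UNIV :: 'k set)"
    by (subst degree_prod_eq_sum_degree) auto
  then have "degree p = card (UNIV :: 'k set)"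
    using fin finite_UNIV_card_ge_0[OF fin] by (simp add: p_def degree_add_eq_left)
  then have "degree p > 0" using fin by (simp add: card_gt_0_iff)
  then obtain x where "poly p x = 0" using alg_closed_imp_poly_has_root by blast
  moreover have "poly p x = 1" using fin by (simp add: p_def poly_prod prod_zero_iff) 
  ultimately show False by simp
qed

text \<open>Uniqueness of base \<open>N\<close> digits; it keeps the monomials apart under the
  Kronecker substitution.\<close>

lemma base_expansion_inj:
  fixes f g :: "nat \<Rightarrow> nat"
  assumes "\<And>i. i < n \<Longrightarrow> f i < N" "\<And>i. i < n \<Longrightarrow> g i < N" "(\<Sum>i<n. f i * N ^ i) = (\<Sum>i<n. g i * N ^ i)"
  shows "\<forall>i<n. f i = g i"
  using assms
proof (induction n arbitrary: f g)
  case (Suc n)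
  have eq: "f 0 + N * (\<Sum>i<n. f (Suc i) * N ^ i) = g 0 + N * (\<Sum>i<n. g (Suc i) * N ^ i)"
    using Suc.prems(3) by (simp add: sum.lessThan_Suc_shift sum_distrib_left algebra_simps del: sum.lessThan_Suc)
  have "f 0 < N" "g 0 < N" using Suc.prems by auto
  moreover from this have "(f 0 + N * (\<Sum>i<n. f (Suc i) * N ^ i)) mod N = f 0"
    "(g 0 + N * (\<Sum>i<n. g (Suc i) * N ^ i)) mod N = g 0" by simp_all
  ultimately have f0: "f 0 = g 0" using eq by simp
  with eq \<open>f 0 < N\<close> have "(\<Sum>i<n. f (Suc i) * N ^ i) = (\<Sum>i<n. g (Suc i) * N ^ i)" by simp
  then have "\<forall>i<n. f (Suc i) = g (Suc i)" using Suc.prems by (intro Suc.IH) auto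
  with f0 show ?case by (auto simp: less_Suc_eq_0_disj)
qed simp

text \<open>Kronecker substitution turns a polynomial into a univariate one without losing coefficients.\<close>

lemma ev_eq_zero_imp:
  fixes P :: "('v::finite, 'k::alg_closed_field) mpol"
  assumes "\<And>x. ev x P = 0"
  shows "P = 0"
proof (rule ccontr)
  assume "P \<noteq> 0"
  then obtain m0 where m0: "m0 \<in> Poly_Mapping.keys P" by (metis keys_eq_empty equals0I poly_mapping_eqI in_keys_iff lookup_zero)
  obtain e :: "nat \<Rightarrow> 'v" where e: "bij_betw e {..<CARD('v)} UNIV"
    using ex_bij_betw_nat_finite[of "UNIV :: 'v set"] by (auto simp: atLeast0LessThan)
  define \<iota> where "\<iota> = the_inv_into {..<CARD('v)} e"
  have \<iota>: "\<iota> (e i) = i" if "i < CARD('v)" for i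
    unfolding \<iota>_def using e that by (intro the_inv_into_f_f) (auto simp: bij_betw_def)
  \<comment> \<open>\<open>N\<close> exceeds every exponent occurring in \<open>P\<close>, so
    exponent vectors become strings of base \<open>N\<close> digits.\<close>
  define N where "N = Suc (Max ((\<lambda>(m, v). Poly_Mapping.lookup m v) ` (Poly_Mapping.keys P \<times> UNIV)))"
  have N: "Poly_Mapping.lookup m v < N" if "m \<in> Poly_Mapping.keys P" for m v
    unfolding N_def less_Suc_eq_le using that by (intro Max_ge) auto
  define w where "w m = (\<Sum>v\<in>UNIV. Poly_Mapping.lookup m v * N ^ \<iota> v)" for m :: "'v \<Rightarrow>\<^sub>0 nat"
  have w: "w m = (\<Sum>i<CARD('v). Poly_Mapping.lookup m (e i) * N ^ i)" for m
    unfolding w_def by (subst sum.reindex_bij_betw[OF e, symmetric]) (simp add: \<iota>)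
  have inj: "inj_on w (Poly_Mapping.keys P)"
  proof (rule inj_onI)
    fix m n assume mn: "m \<in> Poly_Mapping.keys P" "n \<in> Poly_Mapping.keys P" "w m = w n"
    have "\<forall>i<CARD('v). Poly_Mapping.lookup m (e i) = Poly_Mapping.lookup n (e i)"
      using mn N by (intro base_expansion_inj[of _ _ N]) (auto simp: w)
    then have "Poly_Mapping.lookup m v = Poly_Mapping.lookup n v" for v
      using e unfolding bij_betw_def by (metis UNIV_I imageE lessThan_iff)
    then show "m = n" by (rule poly_mapping_eqI)
  qed
  define p :: "'k poly" where "p = (\<Sum>m\<in>Poly_Mapping.keys P. monom (Poly_Mapping.lookup P m) (w m))"
  have "coeff p (w m0) = (\<Sum>m\<in>Poly_Mapping.keys P. if m = m0 then Poly_Mapping.lookup P m else 0)"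
    unfolding p_def coeff_sum using inj m0 by (intro sum.cong) (auto simp: inj_on_eq_iff)
  also have "\<dots> \<noteq> 0" using m0 by (simp add: in_keys_iff)
  finally have "p \<noteq> 0" by auto
  moreover have "poly p t = ev (\<lambda>v. t ^ (N ^ \<iota> v)) P" for t
    unfolding p_def ev_def poly_sum poly_monom w_def power_sum
    by (intro sum.cong prod.cong refl arg_cong2[of _ _ _ _ "(*)"]) (simp add: mult.commute flip: power_mult)
  ultimately show False
    using assms poly_roots_finite[of p] infinite_alg_closed[where 'k='k] by simp
qed

lemma ex_ev_nonzero:
  fixes P :: "('v::finite, 'k::alg_closed_field) mpol"
  assumes "P \<noteq> 0"
  shows "\<exists>x. ev x P \<noteq> 0"
  using ev_eq_zero_imp assms by blast

section \<open>Weights of monomials, homogeneity and lowest parts\<close>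

text \<open>Degree in the variables of \<open>S\<close> alone: \<open>UNIV\<close> gives the total
  degree, \<open>{1, 2}\<close> the order at (1 : 0 : 0), \<open>UNIV - {v}\<close> the order at a
  coordinate point, \<open>{0}\<close> divisibility by powers of x_0, and a coordinate block one
  entry of the multidegree.\<close>

definition wt :: "'v set \<Rightarrow> ('v \<Rightarrow>\<^sub>0 nat) \<Rightarrow> nat" where
  "wt S m = (\<Sum>v\<in>S. Poly_Mapping.lookup m v)"

definition homg :: "'v set \<Rightarrow> nat \<Rightarrow> ('v, 'k::zero) mpol \<Rightarrow> bool" where
  "homg S k P \<longleftrightarrow> (\<forall>m\<in>Poly_Mapping.keys P. wt S m = k)"

definition wtge :: "'v set \<Rightarrow> nat \<Rightarrow> ('v, 'k::zero) mpol \<Rightarrow> bool" where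
  "wtge S n P \<longleftrightarrow> (\<forall>m\<in>Poly_Mapping.keys P. n \<le> wt S m)"

lemma wt_add: "wt S (m + n) = wt S m + wt S n"
  by (simp add: wt_def lookup_add sum.distrib)

lemma wt_zero [simp]: "wt S 0 = 0"
  by (simp add: wt_def)

lemma wt_single: "finite S \<Longrightarrow> wt S (Poly_Mapping.single v n) = (if v \<in> S then n else 0)"
  by (simp add: wt_def lookup_single when_def)

lemma multihomogeneous_iff: "multihomogeneous B e P \<longleftrightarrow> (\<forall>b\<in>B. homg b (e b) P)"
  by (auto simp: multihomogeneous_def homg_def wt_def)

lemma forms_iff: "P \<in> forms k \<longleftrightarrow> homg UNIV k P"
  by (simp add: forms_def multihomogeneous_iff)

lemma homg_zero [simp]: "homg S k 0" and wtge_zero [simp]: "wtge S k 0"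
  by (simp_all add: homg_def wtge_def)

lemma homg_add: "homg S k P \<Longrightarrow> homg S k Q \<Longrightarrow> homg S k (P + Q)"
  unfolding homg_def using keys_add[of P Q] by blast

lemma wtge_add: "wtge S k P \<Longrightarrow> wtge S k Q \<Longrightarrow> wtge S k (P + Q)"
  unfolding wtge_def using keys_add[of P Q] by blast

lemma homg_uminus: "homg S k P \<Longrightarrow> homg S k (- P)" for P :: "('v, 'k::comm_ring_1) mpol"
  unfolding homg_def by (simp add: in_keys_iff)

lemma wtge_uminus: "wtge S k P \<Longrightarrow> wtge S k (- P)" for P :: "('v, 'k::comm_ring_1) mpol"
  unfolding wtge_def by (simp add: in_keys_iff)

lemma homg_diff: "homg S k P \<Longrightarrow> homg S k Q \<Longrightarrow> homg S k (P - Q)" for P :: "('v, 'k::comm_ring_1) mpol"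
  using homg_add[of S k P "- Q"] homg_uminus by auto

lemma wtge_diff: "wtge S k P \<Longrightarrow> wtge S k Q \<Longrightarrow> wtge S k (P - Q)" for P :: "('v, 'k::comm_ring_1) mpol"
  using wtge_add[of S k P "- Q"] wtge_uminus by auto

lemma homg_sum: "(\<And>x. x \<in> A \<Longrightarrow> homg S k (f x)) \<Longrightarrow> homg S k (sum f A)"
  by (induction A rule: infinite_finite_induct) (auto intro: homg_add)

lemma wtge_sum: "(\<And>x. x \<in> A \<Longrightarrow> wtge S k (f x)) \<Longrightarrow> wtge S k (sum f A)"
  by (induction A rule: infinite_finite_induct) (auto intro: wtge_add)

lemma homg_mult:
  fixes P Q :: "('v, 'k::comm_ring_1) mpol"
  assumes "homg S k P" "homg S l Q"
  shows "homg S (k + l) (P * Q)"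
  unfolding homg_def
proof
  fix m assume "m \<in> Poly_Mapping.keys (P * Q)"
  then obtain a b where "a \<in> Poly_Mapping.keys P" "b \<in> Poly_Mapping.keys Q" "m = a + b"
    using keys_mult[of P Q] by blast
  with assms show "wt S m = k + l" by (simp add: homg_def wt_add)
qed

lemma wtge_mult:
  fixes P Q :: "('v, 'k::comm_ring_1) mpol"
  assumes "wtge S k P" "wtge S l Q"
  shows "wtge S (k + l) (P * Q)"
  unfolding wtge_def
proof
  fix m assume "m \<in> Poly_Mapping.keys (P * Q)"
  then obtain a b where "a \<in> Poly_Mapping.keys P" "b \<in> Poly_Mapping.keys Q" "m = a + b"
    using keys_mult[of P Q] by blast
  with assms show "k + l \<le> wt S m" by (simp add: wtge_def wt_add add_mono)
qed

lemma wtge_0 [simp]: "wtge S 0 P"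
  by (simp add: wtge_def)

lemma wtge_mono: "wtge S n P \<Longrightarrow> m \<le> n \<Longrightarrow> wtge S m P"
  by (auto simp: wtge_def)

lemma homg_imp_wtge: "homg S k P \<Longrightarrow> n \<le> k \<Longrightarrow> wtge S n P"
  by (auto simp: wtge_def homg_def)

lemma wtge_mult_right: "wtge S k P \<Longrightarrow> wtge S k (P * Q)"
  and wtge_mult_left: "wtge S k P \<Longrightarrow> wtge S k (Q * P)" for P :: "('v, 'k::comm_ring_1) mpol"
  using wtge_mult[of S k P 0 Q] wtge_mult[of S 0 Q k P] by simp_all

lemma homg_Const [simp]: "homg S 0 (Const c)"
  by (simp add: homg_def Const_def)

lemma homg_one [simp]: "homg S 0 1"
  by (simp add: homg_def)

lemma homg_Const_mult: "homg S k P \<Longrightarrow> homg S k (Const c * P)" for P :: "('v, 'k::comm_ring_1) mpol"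
  using homg_mult[OF homg_Const[of S c]] by auto

lemma homg_Var: "finite S \<Longrightarrow> homg S (if v \<in> S then 1 else 0) (Var v)"
  by (simp add: homg_def Var_def wt_single)

lemma homg_power: "homg S k P \<Longrightarrow> homg S (n * k) (P ^ n)" for P :: "('v, 'k::comm_ring_1) mpol"
  by (induction n) (auto intro: homg_mult)

lemma wtge_power: "wtge S k P \<Longrightarrow> wtge S (n * k) (P ^ n)" for P :: "('v, 'k::comm_ring_1) mpol"
  by (induction n) (auto intro: wtge_mult)

lemma homg_prod: "(\<And>x. x \<in> A \<Longrightarrow> homg S (k x) (f x)) \<Longrightarrow> homg S (sum k A) (prod f A)"
  for f :: "'a \<Rightarrow> ('v, 'k::comm_ring_1) mpol"
  by (induction A rule: infinite_finite_induct) (auto intro: homg_mult)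

lemma wtge_prod: "(\<And>x. x \<in> A \<Longrightarrow> wtge S (k x) (f x)) \<Longrightarrow> wtge S (sum k A) (prod f A)"
  for f :: "'a \<Rightarrow> ('v, 'k::comm_ring_1) mpol"
  by (induction A rule: infinite_finite_induct) (auto intro: wtge_mult)

lemma homg_substitute:
  assumes "\<And>m. m \<in> Poly_Mapping.keys P \<Longrightarrow> (\<Sum>v\<in>UNIV. Poly_Mapping.lookup m v * dg v) = k"
    and "\<And>v. homg S (dg v) (s v)"
  shows "homg S k (substitute s P)"
  unfolding substitute_def
proof (intro homg_sum homg_Const_mult)
  fix m assume "m \<in> Poly_Mapping.keys P"
  then show "homg S k (\<Prod>v\<in>UNIV. s v ^ Poly_Mapping.lookup m v)"
    using homg_prod[of UNIV S "\<lambda>v. Poly_Mapping.lookup m v * dg v" "\<lambda>v. s v ^ Poly_Mapping.lookup m v"]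
      homg_power[OF assms(2)] assms(1) by simp
qed

lemma wtge_substitute:
  assumes "\<And>m. m \<in> Poly_Mapping.keys P \<Longrightarrow> n \<le> (\<Sum>v\<in>UNIV. Poly_Mapping.lookup m v * dg v)"
    and "\<And>v. wtge S (dg v) (s v)"
  shows "wtge S n (substitute s P)"
  unfolding substitute_def
proof (intro wtge_sum wtge_mult_left)
  fix m assume "m \<in> Poly_Mapping.keys P"
  then show "wtge S n (\<Prod>v\<in>UNIV. s v ^ Poly_Mapping.lookup m v)"
    using wtge_prod[of UNIV S "\<lambda>v. Poly_Mapping.lookup m v * dg v" "\<lambda>v. s v ^ Poly_Mapping.lookup m v"]
      wtge_power[OF assms(2)] assms(1) wtge_mono by blast
qed

lemma homg_substitute_forms:
  assumes "homg UNIV k P" "\<And>v. homg S d (s v)"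
  shows "homg S (k * d) (substitute s P)"
  using assms by (intro homg_substitute[where dg = "\<lambda>_. d"]) (auto simp: homg_def wt_def simp flip: sum_distrib_right)

lemma wtge_substitute_forms:
  assumes "homg UNIV k P" "\<And>v. wtge S d (s v)"
  shows "wtge S (k * d) (substitute s P)"
  using assms by (intro wtge_substitute[where dg = "\<lambda>_. d"]) (auto simp: homg_def wt_def simp flip: sum_distrib_right)

lemma ev_homg_scale:
  assumes "homg UNIV k P"
  shows "ev (\<lambda>v. c * x v) P = c ^ k * ev x P"
proof -
  have "(\<Prod>v\<in>UNIV. (c * x v) ^ Poly_Mapping.lookup m v) = c ^ k * (\<Prod>v\<in>UNIV. x v ^ Poly_Mapping.lookup m v)"
    if "m \<in> Poly_Mapping.keys P" for m
  proof -
    have "(\<Sum>v\<in>UNIV. Poly_Mapping.lookup m v) = k"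
      using assms that by (simp add: homg_def wt_def)
    then have "(\<Prod>v\<in>UNIV. c ^ Poly_Mapping.lookup m v) = c ^ k"
      by (metis power_sum)
    then show ?thesis by (simp only: power_mult_distrib prod.distrib)
  qed
  then have "Poly_Mapping.lookup P m * (\<Prod>v\<in>UNIV. (c * x v) ^ Poly_Mapping.lookup m v)
      = c ^ k * (Poly_Mapping.lookup P m * (\<Prod>v\<in>UNIV. x v ^ Poly_Mapping.lookup m v))"
    if "m \<in> Poly_Mapping.keys P" for m
    using that by (simp only: mult.left_commute)
  then show ?thesis
    unfolding ev_def sum_distrib_left by (rule sum.cong[OF refl])
qed

lemma ev_multihomogeneous_scale:
  fixes P :: "('v::finite, 'k::field) mpol"
  assumes P: "multihomogeneous B e P" and B: "\<And>b c. b \<in> B \<Longrightarrow> c \<in> B \<Longrightarrow> b \<noteq> c \<Longrightarrow> b \<inter> c = {}" "\<Union>B = UNIV"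
    and q: "\<And>b v. b \<in> B \<Longrightarrow> v \<in> b \<Longrightarrow> q v = c b * p v"
  shows "ev q P = (\<Prod>b\<in>B. c b ^ e b) * ev p P"
proof -
  have split: "(\<Prod>v\<in>UNIV. f v) = (\<Prod>b\<in>B. \<Prod>v\<in>b. f v)" for f :: "'v \<Rightarrow> 'k"
    using B(1) by (subst B(2)[symmetric], subst prod.Union_disjoint) auto
  have "(\<Prod>v\<in>UNIV. q v ^ Poly_Mapping.lookup m v) = (\<Prod>b\<in>B. c b ^ e b) * (\<Prod>v\<in>UNIV. p v ^ Poly_Mapping.lookup m v)"
    if m: "m \<in> Poly_Mapping.keys P" for m
  proof -
    have "(\<Prod>v\<in>b. q v ^ Poly_Mapping.lookup m v) = c b ^ e b * (\<Prod>v\<in>b. p v ^ Poly_Mapping.lookup m v)" if b: "b \<in> B" for b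
    proof -
      have "(\<Prod>v\<in>b. q v ^ Poly_Mapping.lookup m v) = (\<Prod>v\<in>b. c b ^ Poly_Mapping.lookup m v * p v ^ Poly_Mapping.lookup m v)"
        using q b by (intro prod.cong) (auto simp: power_mult_distrib)
      also have "\<dots> = c b ^ e b * (\<Prod>v\<in>b. p v ^ Poly_Mapping.lookup m v)"
      proof -
        have "(\<Sum>v\<in>b. Poly_Mapping.lookup m v) = e b"
          using P m b by (simp add: multihomogeneous_def)
        then have "(\<Prod>v\<in>b. c b ^ Poly_Mapping.lookup m v) = c b ^ e b"
          by (metis power_sum)
        then show ?thesis by (simp only: prod.distrib)
      qed
      finally show ?thesis .
    qed
    then show ?thesis by (simp add: split prod.distrib)
  qed
  then have "Poly_Mapping.lookup P m * (\<Prod>v\<in>UNIV. q v ^ Poly_Mapping.lookup m v)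
      = (\<Prod>b\<in>B. c b ^ e b) * (Poly_Mapping.lookup P m * (\<Prod>v\<in>UNIV. p v ^ Poly_Mapping.lookup m v))"
    if "m \<in> Poly_Mapping.keys P" for m
    using that by (simp only: mult.left_commute)
  then show ?thesis
    unfolding ev_def sum_distrib_left by (rule sum.cong[OF refl])
qed

definition part :: "'v set \<Rightarrow> nat \<Rightarrow> ('v, 'k::comm_ring_1) mpol \<Rightarrow> ('v, 'k) mpol" where
  "part S k P = (\<Sum>m | m \<in> Poly_Mapping.keys P \<and> wt S m = k. Poly_Mapping.single m (Poly_Mapping.lookup P m))"

lemma lookup_part: "Poly_Mapping.lookup (part S k P) m = (if wt S m = k then Poly_Mapping.lookup P m else 0)"
proof -
  have "Poly_Mapping.lookup (part S k P) m
      = (\<Sum>n | n \<in> Poly_Mapping.keys P \<and> wt S n = k. if n = m then Poly_Mapping.lookup P n else 0)"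
    unfolding part_def lookup_sum by (rule sum.cong) (auto simp: lookup_single when_def)
  also have "\<dots> = (if wt S m = k then Poly_Mapping.lookup P m else 0)"
    by (auto simp: in_keys_iff)
  finally show ?thesis .
qed

lemma homg_part: "homg S k (part S k P)"
  by (auto simp: homg_def in_keys_iff lookup_part split: if_splits)

lemma homg_part_part: "homg T l P \<Longrightarrow> homg T l (part S k P)"
  by (auto simp: homg_def in_keys_iff lookup_part split: if_splits)

lemma wtge_minus_part:
  assumes "wtge S k P" shows "wtge S (Suc k) (P - part S k P)"
  using assms unfolding wtge_def
  by (metis (no_types, lifting) Suc_leI diff_self diff_zero in_keys_iff le_neq_implies_less lookup_minus lookup_part)

lemma part_nonzero:
  assumes "wtge S k P" "\<not> wtge S (Suc k) P" shows "part S k P \<noteq> 0"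
  using wtge_minus_part[OF assms(1)] assms(2) by auto

lemma wtge_exact:
  assumes "\<not> wtge S n P"
  shows "\<exists>k<n. wtge S k P \<and> \<not> wtge S (Suc k) P"
  using assms by (induction n) (auto simp: less_Suc_eq)

text \<open>The lowest parts of two polynomials multiply to the lowest part of the product.\<close>

lemma wtge_cancel:
  fixes P Q :: "('v::{finite,linorder}, 'k::idom) mpol"
  assumes "wtge S (n + m) (P * Q)" "\<not> wtge S (Suc n) P"
  shows "wtge S m Q"
proof (rule ccontr)
  assume "\<not> wtge S m Q"
  then obtain j where j: "j < m" "wtge S j Q" "\<not> wtge S (Suc j) Q"
    using wtge_exact by blast
  obtain i where i: "i < Suc n" "wtge S i P" "\<not> wtge S (Suc i) P"
    using wtge_exact assms(2) by blast
  define P0 Q0 where PQ0: "P0 = part S i P" "Q0 = part S j Q"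
  have "wtge S (Suc (i + j)) ((P - P0) * Q)" "wtge S (Suc (i + j)) (P0 * (Q - Q0))"
    using wtge_mult[OF wtge_minus_part[OF i(2)] j(2)] wtge_mult[of S i P0 "Suc j" "Q - Q0"] wtge_minus_part[OF j(2)]
      homg_imp_wtge[OF homg_part[of S i P]]
    by (auto simp: PQ0)
  \<comment> \<open>Here i \<le> n and j < m, so i + j lies below n + m.\<close>
  moreover have "wtge S (Suc (i + j)) (P * Q)"
    using assms(1) by (rule wtge_mono) (use i j in auto)
  moreover have "P0 * Q0 = P * Q - (P - P0) * Q - P0 * (Q - Q0)"
    by (simp add: algebra_simps)
  ultimately have 1: "wtge S (Suc (i + j)) (P0 * Q0)"
    by (metis wtge_diff)
  have "homg S (i + j) (P0 * Q0)"
    by (simp add: PQ0 homg_mult homg_part)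
  with 1 have "Poly_Mapping.keys (P0 * Q0) = {}"
    by (fastforce simp: wtge_def homg_def)
  then have "P0 = 0 \<or> Q0 = 0" by simp
  then show False using part_nonzero i j by (auto simp: PQ0)
qed

section \<open>Plane coordinates, translation to a point, and multiplicity\<close>

lemma UNIV_3: "(UNIV :: 3 set) = {0, 1, 2}"
proof -
  have "card {0, 1, 2 :: 3} = CARD(3)" by simp
  then show ?thesis by (metis card_eq_UNIV_imp_eq_UNIV finite)
qed

lemma neq_3 [simp]: "(0::3) \<noteq> 1" "(1::3) \<noteq> 0" "(0::3) \<noteq> 2" "(2::3) \<noteq> 0" "(1::3) \<noteq> 2" "(2::3) \<noteq> 1"
  by simp_all

lemma exhaust_3: "(v::3) = 0 \<or> v = 1 \<or> v = 2"
  using UNIV_3 by blast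

lemma UNIV_2: "(UNIV :: 2 set) = {0, 1}"
proof -
  have "card {0, 1 :: 2} = CARD(2)" by simp
  then show ?thesis by (metis card_eq_UNIV_imp_eq_UNIV finite)
qed

lemma exhaust_2: "(v::2) = 0 \<or> v = 1"
  using UNIV_2 by blast

text \<open>The pullback along the linear map that takes (1 : 0 : 0) to (1 : a : b) and fixes the
  line x_0 = 0 pointwise.\<close>

definition shift :: "'k::comm_ring_1 \<Rightarrow> 'k \<Rightarrow> (3, 'k) mpol \<Rightarrow> (3, 'k) mpol" where
  "shift a b = substitute (\<lambda>v. if v = 0 then Var 0 else if v = 1 then Var 1 + Const a * Var 0 else Var 2 + Const b * Var 0)"

lemma rhom_shift: "rhom (shift a b)"
  by (simp add: shift_def rhom_substitute)

lemmas shift_simps [simp] = rhom_simps[OF rhom_shift]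

lemma shift_Var [simp]: "shift a b (Var 0) = Var 0" "shift a b (Var 1) = Var 1 + Const a * Var 0"
    "shift a b (Var 2) = Var 2 + Const b * Var 0" "shift a b (Const c) = Const c"
  by (simp_all add: shift_def)

lemma shift_shift: "shift a b (shift (- a) (- b) P) = P"
proof (rule rhom_eqI[of "\<lambda>P. shift a b (shift (- a) (- b) P)" "\<lambda>P. P"])
  show "shift a b (shift (- a) (- b) (Var v)) = Var v" for v
    using exhaust_3[of v] by (auto simp: Const_simps)
qed (auto intro!: rhom_comp[OF rhom_shift] rhom_shift rhom_id)

lemma shift_shift': "shift (- a) (- b) (shift a b P) = P"
  using shift_shift[of "- a" "- b" P] by simp

lemma homg_shift:
  fixes P :: "(3, 'k::comm_ring_1) mpol"
  assumes P: "homg UNIV k P" shows "homg UNIV k (shift a b P)"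
proof -
  have V: "homg UNIV (Suc 0) (Var v :: (3, 'k) mpol)" for v using homg_Var[of UNIV v] by simp
  have "homg UNIV (k * 1) (shift a b P)"
    unfolding shift_def by (rule homg_substitute_forms[OF P]) (auto intro!: homg_add V homg_Const_mult)
  then show ?thesis by simp
qed

lemma ev_shift: "ev x (shift a b P) = ev (\<lambda>v. if v = 0 then x 0 else if v = 1 then x 1 + a * x 0 else x 2 + b * x 0) P"
  unfolding shift_def ev_substitute by (rule arg_cong[where f = "\<lambda>g. ev g P"]) auto

text \<open>Multiplicity at (1 : a : b), read off as the order in x_1, x_2 after translation. It is
  a lower bound rather than an exact value, so that it holds of 0 and is closed under sums.\<close>

definition ordge :: "'k::comm_ring_1 \<Rightarrow> 'k \<Rightarrow> nat \<Rightarrow> (3, 'k) mpol \<Rightarrow> bool" where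
  "ordge a b n P \<longleftrightarrow> wtge {1, 2} n (shift a b P)"

lemma ordge_zero [simp]: "ordge a b n 0" and ordge_0 [simp]: "ordge a b 0 P"
  by (simp_all add: ordge_def)

lemma ordge_add: "ordge a b n P \<Longrightarrow> ordge a b n Q \<Longrightarrow> ordge a b n (P + Q)"
  by (simp add: ordge_def wtge_add)

lemma ordge_mult: "ordge a b n P \<Longrightarrow> ordge a b m Q \<Longrightarrow> ordge a b (n + m) (P * Q)"
  by (simp add: ordge_def wtge_mult)

lemma ordge_mult_left: "ordge a b n P \<Longrightarrow> ordge a b n (Q * P)"
  and ordge_mult_right: "ordge a b n P \<Longrightarrow> ordge a b n (P * Q)"
  by (simp_all add: ordge_def wtge_mult_left wtge_mult_right)

lemma ordge_mono: "ordge a b n P \<Longrightarrow> m \<le> n \<Longrightarrow> ordge a b m P"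
  by (auto simp: ordge_def intro: wtge_mono)

lemma ordge_exact: "\<not> ordge a b n P \<Longrightarrow> \<exists>k<n. ordge a b k P \<and> \<not> ordge a b (Suc k) P"
  using wtge_exact[of "{1,2}" n "shift a b P"] by (simp add: ordge_def)

text \<open>Lowest parts multiply without cancellation in a domain. This strips from a product a
  factor \<open>P\<close> whose multiplicity is at most \<open>n\<close>.\<close>

lemma ordge_cancel:
  fixes P :: "(3, 'k::idom) mpol"
  shows "ordge a b (n + m) (P * Q) \<Longrightarrow> \<not> ordge a b (Suc n) P \<Longrightarrow> ordge a b m Q"
  unfolding ordge_def shift_simps by (rule wtge_cancel)

definition unit_pt :: "'v \<Rightarrow> 'v \<Rightarrow> 'k::zero_neq_one" where
  "unit_pt v w = (if w = v then 1 else 0)"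

text \<open>At a coordinate point every monomial vanishes except the pure power of its variable, so
  the value there is the coefficient of that one monomial.\<close>

lemma ev_unit_pt_wtge:
  fixes P :: "('v::finite, 'k::comm_ring_1) mpol"
  assumes P: "homg UNIV k P" and 0: "ev (unit_pt v) P = 0"
  shows "wtge (UNIV - {v}) 1 P"
  unfolding wtge_def
proof
  fix m assume m: "m \<in> Poly_Mapping.keys P"
  let ?vk = "Poly_Mapping.single v k"
  have un: "n = ?vk" if n: "n \<in> Poly_Mapping.keys P" "wt (UNIV - {v}) n = 0" for n
  proof (rule poly_mapping_eqI)
    fix w
    have z: "Poly_Mapping.lookup n u = 0" if "u \<noteq> v" for u using n that by (simp add: wt_def)
    have "k = wt UNIV n" using P n by (simp add: homg_def)
    also have "\<dots> = Poly_Mapping.lookup n v + wt (UNIV - {v}) n" unfolding wt_def by (subst sum.remove[of _ v]) auto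
    finally show "Poly_Mapping.lookup n w = Poly_Mapping.lookup ?vk w"
      using n z[of w] by (cases "w = v") (auto simp: lookup_single when_def)
  qed
  have val: "(\<Prod>w\<in>UNIV. (unit_pt v w :: 'k) ^ Poly_Mapping.lookup n w) = (if n = ?vk then 1 else 0)"
    if n: "n \<in> Poly_Mapping.keys P" for n
  proof (cases "n = ?vk")
    case True
    then show ?thesis by (auto simp: unit_pt_def lookup_single when_def intro!: prod.neutral)
  next
    case False
    then have "wt (UNIV - {v}) n \<noteq> 0" using un n by blast
    then obtain u where "u \<noteq> v" "Poly_Mapping.lookup n u \<noteq> 0" by (auto simp: wt_def)
    then have "\<exists>w. (unit_pt v w :: 'k) ^ Poly_Mapping.lookup n w = 0"
      by (intro exI[of _ u]) (simp add: unit_pt_def power_0_left)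
    then show ?thesis using False by (auto intro!: prod_zero)
  qed
  have "ev (unit_pt v) P = (\<Sum>n\<in>Poly_Mapping.keys P. if n = ?vk then Poly_Mapping.lookup P n else 0)"
    unfolding ev_def by (intro sum.cong) (auto simp: val)
  also have "\<dots> = Poly_Mapping.lookup P ?vk" by (auto simp: in_keys_iff)
  finally have "?vk \<notin> Poly_Mapping.keys P" using 0 by (simp add: in_keys_iff)
  then have "wt (UNIV - {v}) m \<noteq> 0" using un[OF m] m by auto
  then show "1 \<le> wt (UNIV - {v}) m" by simp
qed

section \<open>Powers of the ideal of a point\<close>

text \<open>Induction over products of forms vanishing at \<open>p\<close>, for a homomorphism into
  any filtration that such forms raise by one. With the identity it compares ideal powers with
  multiplicities; with a quadratic map it transports multiplicities to other points.\<close>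

lemma ideal_power_filtration:
  assumes \<theta>: "rhom \<theta>"
    and J: "\<And>n. 0 \<in> J n" "\<And>n x y. x \<in> J n \<Longrightarrow> y \<in> J n \<Longrightarrow> x + y \<in> J n" "\<And>n r x. x \<in> J n \<Longrightarrow> r * x \<in> J n"
      "J 0 = UNIV"
    and gen: "\<And>k f n x. f \<in> forms k \<Longrightarrow> ev p f = 0 \<Longrightarrow> x \<in> J n \<Longrightarrow> \<theta> f * x \<in> J (Suc n)"
    and P: "P \<in> ideal_power (point_ideal p) n"
  shows "\<theta> P \<in> J n"
  using P
proof (induction n arbitrary: P)
  case (Suc n)
  have 1: "\<theta> f * x \<in> J (Suc n)" if f: "f \<in> point_ideal p" and x: "x \<in> J n" for f x
    using f[unfolded point_ideal_def]
  proof (induction rule: ideal.span_induct_alt)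
    case (step c f g)
    then obtain k where "f \<in> forms k" "ev p f = 0" by blast
    then have "\<theta> c * (\<theta> f * x) + \<theta> g * x \<in> J (Suc n)"
      using gen[OF _ _ x] J(3) J(2) step by blast
    then show ?case
      by (simp only: rhom_simps[OF \<theta>] distrib_right mult.assoc)
  next
    case base
    show ?case by (simp only: rhom_zero[OF \<theta>] mult_zero_left J)
  qed
  from Suc.prems have "P \<in> ideal.span {f * g | f g. f \<in> point_ideal p \<and> g \<in> ideal_power (point_ideal p) n}"
    by simp
  then show ?case
  proof (induction rule: ideal.span_induct_alt)
    case (step c x y)
    then obtain f g where "x = f * g" "f \<in> point_ideal p" "g \<in> ideal_power (point_ideal p) n" by blast
    then have "\<theta> x \<in> J (Suc n)" using 1[of f "\<theta> g"] Suc.IH[of g] by (simp only: rhom_mult[OF \<theta>])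
    then have "\<theta> c * \<theta> x + \<theta> y \<in> J (Suc n)" using step J by blast
    then show ?case by (simp only: rhom_simps[OF \<theta>])
  next
    case base
    show ?case by (simp only: rhom_zero[OF \<theta>] J)
  qed
qed (simp add: J)

lemma ideal_power_mult: "x \<in> ideal_power I n \<Longrightarrow> r * x \<in> ideal_power I n"
  by (cases n) (auto intro: ideal.span_scale)

lemma ideal_power_add: "x \<in> ideal_power I n \<Longrightarrow> y \<in> ideal_power I n \<Longrightarrow> x + y \<in> ideal_power I n"
  by (cases n) (auto intro: ideal.span_add)

lemma ideal_power_0: "0 \<in> ideal_power I n"
  by (cases n) (auto intro: ideal.span_zero)

lemma ideal_power_step: "f \<in> I \<Longrightarrow> x \<in> ideal_power I n \<Longrightarrow> f * x \<in> ideal_power I (Suc n)"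
  by (auto intro: ideal.span_base)

lemma ideal_power_mono: "ideal_power I (Suc n) \<subseteq> ideal_power I n"
proof
  fix x assume "x \<in> ideal_power I (Suc n)"
  then have "x \<in> ideal.span {f * g | f g. f \<in> I \<and> g \<in> ideal_power I n}" by simp
  then show "x \<in> ideal_power I n"
    by (induction rule: ideal.span_induct_alt) (auto intro!: ideal_power_add ideal_power_mult ideal_power_0)
qed

lemma ideal_power_power: "f \<in> I \<Longrightarrow> x \<in> ideal_power I n \<Longrightarrow> f ^ k * x \<in> ideal_power I (k + n)"
proof (induction k)
  case (Suc k)
  then have "f * (f ^ k * x) \<in> ideal_power I (Suc (k + n))" by (intro ideal_power_step)
  then show ?case by (simp only: power_Suc mult.assoc add_Suc)
qed simp

lemma ideal_power_antimono: "m \<le> n \<Longrightarrow> ideal_power I n \<subseteq> ideal_power I m"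
  using lift_Suc_antimono_le[of "ideal_power I"] ideal_power_mono by blast

lemma ideal_power_sum:
  assumes "\<And>x. x \<in> A \<Longrightarrow> f x \<in> ideal_power I n"
  shows "sum f A \<in> ideal_power I n"
  using assms
proof (induction A rule: infinite_finite_induct)
  case (insert x F)
  then have "f x + sum f F \<in> ideal_power I n" by (intro ideal_power_add) simp_all
  then show ?case by (subst sum.insert[OF insert.hyps])
next
  case (infinite A)
  show ?case unfolding sum.infinite[OF infinite.hyps] by (rule ideal_power_0)
next
  case empty
  show ?case unfolding sum.empty by (rule ideal_power_0)
qed

lemma pt_simps [simp]: "pt a b i 0 = 1" "pt a b i 1 = a i" "pt a b i 2 = b i"
  by (simp_all add: pt_def)

lemma ordge_1_iff:
  assumes "f \<in> forms k" "ev (pt a b i) f = 0"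
  shows "ordge (a i) (b i) 1 f"
proof -
  have "ev (unit_pt 0) (shift (a i) (b i) f) = ev (pt a b i) f"
    unfolding ev_shift by (rule arg_cong[where f = "\<lambda>g. ev g f"]) (auto simp: unit_pt_def pt_def)
  then have "wtge (UNIV - {0}) 1 (shift (a i) (b i) f)"
    using assms by (intro ev_unit_pt_wtge[of k]) (auto simp: forms_iff homg_shift)
  moreover have "UNIV - {0} = {1, 2 :: 3}" using UNIV_3 by auto
  ultimately show ?thesis by (simp add: ordge_def)
qed

lemma ideal_power_imp_ordge:
  assumes "P \<in> ideal_power (point_ideal (pt a b i)) n"
  shows "ordge (a i) (b i) n P"
proof -
  have "P \<in> {P. ordge (a i) (b i) n P}"
    using assms
  proof (rule ideal_power_filtration[where \<theta> = "\<lambda>P. P" and J = "\<lambda>n. {P. ordge (a i) (b i) n P}", rotated -1])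
    fix k f n x assume "f \<in> forms k" "ev (pt a b i) f = 0" "x \<in> {P. ordge (a i) (b i) n P}"
    then show "f * x \<in> {P. ordge (a i) (b i) (Suc n) P}"
      using ordge_mult[of "a i" "b i" 1 f n x] ordge_1_iff[of f k a b i] by simp
  qed (auto simp: rhom_id ordge_add ordge_mult_left)
  then show ?thesis by simp
qed

lemma homg_UNIV_Var [simp]: "homg UNIV (Suc 0) (Var v :: ('v::finite, 'k::comm_ring_1) mpol)"
  using homg_Var[of UNIV v] by simp

lemma lin_forms: "lin a b i j \<in> forms 1"
  unfolding forms_iff lin_def by (auto intro!: homg_diff homg_Const_mult)

lemma lin_point_ideal: "lin a b i j \<in> point_ideal (pt a b i)"
proof -
  have "ev (pt a b i) (lin a b i j) = 0" by (simp add: lin_def)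
  then show ?thesis unfolding point_ideal_def using lin_forms by (intro ideal.span_base) blast
qed

text \<open>In translated coordinates a monomial of order at least \<open>n\<close> is a multiple of
  a product of \<open>n\<close> of the linear forms \<open>lin\<close>, and these lie in the ideal
  of the point.\<close>

lemma ordge_imp_ideal_power:
  assumes "ordge (a i) (b i) n P"
  shows "P \<in> ideal_power (point_ideal (pt a b i)) n"
proof -
  let ?I = "point_ideal (pt a b i)" and ?Q = "shift (a i) (b i) P" and ?s = "shift (- a i) (- b i)"
  have "?s (Poly_Mapping.single m c) \<in> ideal_power ?I n" if m: "n \<le> wt {1, 2} m" for m c
  proof -
    have "?s (Poly_Mapping.single m c) = Const c * (\<Prod>v\<in>UNIV. ?s (Var v) ^ Poly_Mapping.lookup m v)"
    proof -
      have "Poly_Mapping.single m c = Const c * (\<Prod>v\<in>UNIV. Var v ^ Poly_Mapping.lookup m v)"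
        by (simp only: prod_Var_power single_eq_Const_mult[of m c])
      then show ?thesis by (simp only: shift_simps shift_Var)
    qed
    also have "\<dots> = Const c * Var 0 ^ Poly_Mapping.lookup m 0 *
        (lin a b i 0 ^ Poly_Mapping.lookup m 1 * (lin a b i 1 ^ Poly_Mapping.lookup m 2 * 1))"
    proof -
      have v: "?s (Var 1) = lin a b i 0" "?s (Var 2) = lin a b i 1" "?s (Var 0) = Var 0"
        by (simp_all add: lin_def Const_simps)
      have "(\<Prod>v\<in>UNIV. ?s (Var v) ^ Poly_Mapping.lookup m v) = ?s (Var 0) ^ Poly_Mapping.lookup m 0 *
          (?s (Var 1) ^ Poly_Mapping.lookup m 1 * ?s (Var 2) ^ Poly_Mapping.lookup m 2)"
        unfolding UNIV_3 by (subst prod.insert, simp, simp, subst prod.insert, simp, simp) simp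
      then show ?thesis by (simp only: v mult.assoc mult_1_right)
    qed
    finally have "?s (Poly_Mapping.single m c) \<in> ideal_power ?I (Poly_Mapping.lookup m 1 + (Poly_Mapping.lookup m 2 + 0))"
      using ideal_power_mult[OF ideal_power_power[OF lin_point_ideal ideal_power_power[OF lin_point_ideal]], of 1 a b i 0]
      by simp
    moreover have "n \<le> Poly_Mapping.lookup m 1 + (Poly_Mapping.lookup m 2 + 0)" using m by (simp add: wt_def)
    ultimately show ?thesis using ideal_power_antimono by blast
  qed
  then have 1: "?s (Poly_Mapping.single m (Poly_Mapping.lookup ?Q m)) \<in> ideal_power ?I n" if "m \<in> Poly_Mapping.keys ?Q" for m
    using assms that by (auto simp: ordge_def wtge_def)
  have "P = ?s (\<Sum>m\<in>Poly_Mapping.keys ?Q. Poly_Mapping.single m (Poly_Mapping.lookup ?Q m))"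
    by (simp only: mpol_eq_sum_single[symmetric] shift_shift')
  also have "\<dots> \<in> ideal_power ?I n"
    unfolding shift_simps using 1 by (rule ideal_power_sum)
  finally show ?thesis .
qed

text \<open>The bridge away from ideal powers: from here on fat points are handled through
  multiplicities.\<close>

lemma fat_forms_iff: "P \<in> fat_forms a b n k \<longleftrightarrow> P \<in> forms k \<and> (\<forall>i. ordge (a i) (b i) (n i) P)"
  by (auto simp: fat_forms_def fat_ideal_def intro: ordge_imp_ideal_power ideal_power_imp_ordge)

section \<open>Finite-dimensional spaces of polynomials\<close>

text \<open>An infinite-dimensional space has \<open>dim\<close> equal to \<open>0\<close> by
  convention, so comparisons of dimensions have to carry this condition.\<close>

definition fdim :: "('v, 'k::field) mpol set \<Rightarrow> bool" where
  "fdim V \<longleftrightarrow> (\<exists>W. finite W \<and> V \<subseteq> mpol_vs.span W)"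

lemma fdim_mono: "fdim W \<Longrightarrow> V \<subseteq> W \<Longrightarrow> fdim V"
  unfolding fdim_def by blast

lemma fdim_basis:
  assumes "fdim V"
  obtains B where "B \<subseteq> V" "mpol_vs.independent B" "V \<subseteq> mpol_vs.span B" "card B = mpol_vs.dim V" "finite B"
proof -
  obtain W where W: "finite W" "V \<subseteq> mpol_vs.span W" using assms unfolding fdim_def by blast
  obtain B where B: "B \<subseteq> V" "mpol_vs.independent B" "V \<subseteq> mpol_vs.span B" "card B = mpol_vs.dim V" using mpol_vs.basis_exists by blast
  then have "finite B" using mpol_vs.independent_span_bound[OF W(1) B(2)] W(2) by blast
  with B that show thesis by blast
qed

lemma independent_card_fdim:
  assumes "fdim V" "B \<subseteq> V" "mpol_vs.independent B"
  shows "finite B \<and> card B \<le> mpol_vs.dim V"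
proof -
  obtain B0 where B0: "B0 \<subseteq> V" "V \<subseteq> mpol_vs.span B0" "card B0 = mpol_vs.dim V" "finite B0"
    using fdim_basis[OF assms(1)] by metis
  then show ?thesis using mpol_vs.independent_span_bound[OF B0(4) assms(3)] assms(2) by auto
qed

lemma dim_mono_fdim:
  assumes "fdim W" "V \<subseteq> W" shows "mpol_vs.dim V \<le> mpol_vs.dim W"
proof -
  obtain B where B: "B \<subseteq> V" "mpol_vs.independent B" "card B = mpol_vs.dim V" using mpol_vs.basis_exists by metis
  then show ?thesis using independent_card_fdim[OF assms(1) _ B(2)] assms(2) by auto
qed

lemma extend_basis_fdim:
  assumes "fdim V" "S \<subseteq> V" "mpol_vs.independent S"
  obtains B where "S \<subseteq> B" "B \<subseteq> V" "mpol_vs.independent B" "V \<subseteq> mpol_vs.span B" "card B = mpol_vs.dim V" "finite B"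
proof -
  obtain B where B: "S \<subseteq> B" "B \<subseteq> V" "mpol_vs.independent B" "V \<subseteq> mpol_vs.span B"
    using mpol_vs.maximal_independent_subset_extend[OF assms(2,3)] by metis
  moreover have "card B = mpol_vs.dim V" using mpol_vs.basis_card_eq_dim[OF B(2,4,3)] .
  moreover have "finite B" using independent_card_fdim[OF assms(1) B(2,3)] by blast
  ultimately show thesis using that by blast
qed

lemma subspace_eqI_fdim:
  assumes "fdim W" "mpol_vs.subspace V" "V \<subseteq> W" "mpol_vs.dim W \<le> mpol_vs.dim V"
  shows "V = W"
proof (rule ccontr)
  assume "V \<noteq> W"
  then obtain w where w: "w \<in> W" "w \<notin> V" using assms(3) by blast
  obtain B where B: "B \<subseteq> V" "mpol_vs.independent B" "V \<subseteq> mpol_vs.span B" "card B = mpol_vs.dim V" "finite B"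
    using fdim_basis[OF fdim_mono[OF assms(1,3)]] by metis
  have "mpol_vs.span B \<subseteq> V" using B(1) assms(2) mpol_vs.span_minimal by blast
  then have wB: "w \<notin> mpol_vs.span B" using w by blast
  then have "mpol_vs.independent (insert w B)" using B(2) by (rule mpol_vs.independent_insertI)
  then have "card (insert w B) \<le> mpol_vs.dim W"
    using independent_card_fdim[OF assms(1), of "insert w B"] w(1) B(1) assms(3) by blast
  moreover have "w \<notin> B" using wB mpol_vs.span_base by blast
  ultimately show False using B(4,5) assms(4) by simp
qed

definition functional :: "(('v, 'k::field) mpol \<Rightarrow> 'k) \<Rightarrow> bool" where
  "functional f \<longleftrightarrow> (\<forall>x y. f (x + y) = f x + f y) \<and> (\<forall>c x. f (Const c * x) = c * f x)"

lemma functionalD: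
  fixes f :: "('v, 'k::field) mpol \<Rightarrow> 'k"
  assumes "functional f" shows "f (x + y) = f x + f y" "f (Const c * x) = c * f x"
  using assms by (simp_all add: functional_def)

lemma functional_diff:
  fixes f :: "('v, 'k::field) mpol \<Rightarrow> 'k"
  assumes "functional f" shows "f (x - y) = f x - f y"
  using functionalD(1)[OF assms, of "x - y" y] by (simp add: algebra_simps)

lemma functional_0: "functional f \<Longrightarrow> f 0 = 0"
  using functionalD(2)[of f 0 0] by simp

lemma subspace_kernel:
  assumes "mpol_vs.subspace V" "functional f"
  shows "mpol_vs.subspace {x \<in> V. f x = 0}"
proof (rule mpol_vs.subspaceI)
  show "0 \<in> {x \<in> V. f x = 0}" using assms by (simp add: mpol_vs.subspace_0 functional_0)
  show "\<And>x y. x \<in> {x \<in> V. f x = 0} \<Longrightarrow> y \<in> {x \<in> V. f x = 0} \<Longrightarrow> x + y \<in> {x \<in> V. f x = 0}"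
    using assms(1) by (simp add: mpol_vs.subspace_add functionalD[OF assms(2)])
  show "\<And>c x. x \<in> {x \<in> V. f x = 0} \<Longrightarrow> Const c * x \<in> {x \<in> V. f x = 0}"
    using assms(1) by (simp add: mpol_vs.subspace_scale functionalD[OF assms(2)])
qed

lemma dim_le_kernel:
  assumes V: "fdim V" "mpol_vs.subspace V" and f: "functional f"
  shows "mpol_vs.dim V \<le> mpol_vs.dim {x \<in> V. f x = 0} + 1"
proof (cases "\<exists>v\<in>V. f v \<noteq> 0")
  case False
  then have "{x \<in> V. f x = 0} = V" by blast
  then show ?thesis by simp
next
  case True
  then obtain v where v: "v \<in> V" "f v \<noteq> 0" by blast
  let ?U = "{x \<in> V. f x = 0}"
  have fdU: "fdim ?U" using V(1) by (rule fdim_mono) blast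
  obtain B where B: "?U \<subseteq> mpol_vs.span B" "card B = mpol_vs.dim ?U" "finite B"
    by (rule fdim_basis[OF fdU])
  have "V \<subseteq> mpol_vs.span (insert v B)"
  proof
    fix x assume x: "x \<in> V"
    let ?y = "x - Const (f x / f v) * v"
    have "?y \<in> ?U" using x v V(2)
      by (simp add: mpol_vs.subspace_diff mpol_vs.subspace_scale functional_diff[OF f] functionalD[OF f])
    then have "?y \<in> mpol_vs.span (insert v B)" using B(1) mpol_vs.span_mono[of B "insert v B"] by blast
    moreover have "Const (f x / f v) * v \<in> mpol_vs.span (insert v B)" by (intro mpol_vs.span_scale mpol_vs.span_base) simp
    ultimately have "?y + Const (f x / f v) * v \<in> mpol_vs.span (insert v B)" by (rule mpol_vs.span_add)
    then show "x \<in> mpol_vs.span (insert v B)" by simp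
  qed
  then have "mpol_vs.dim V \<le> card (insert v B)" using B(3) by (intro mpol_vs.dim_le_card) auto
  also have "\<dots> \<le> Suc (card B)" using B(3) by (simp add: card_insert_if)
  finally show ?thesis using B(2) by simp
qed

text \<open>Each linear condition costs at most one dimension. Upper bounds on spaces of forms arise
  by listing conditions and then showing that their common kernel is small.\<close>

lemma dim_le_kernels:
  assumes "finite I" "fdim V" "mpol_vs.subspace V" "\<And>i. i \<in> I \<Longrightarrow> functional (f i)"
  shows "mpol_vs.dim V \<le> mpol_vs.dim {x \<in> V. \<forall>i\<in>I. f i x = 0} + card I \<and> mpol_vs.subspace {x \<in> V. \<forall>i\<in>I. f i x = 0}"
  using assms(1,4)
proof (induction I rule: finite_induct)
  case empty
  then show ?case using assms(3) by simp
next
  case (insert j I)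
  let ?U = "{x \<in> V. \<forall>i\<in>I. f i x = 0}"
  have IH: "mpol_vs.dim V \<le> mpol_vs.dim ?U + card I" "mpol_vs.subspace ?U" using insert by auto
  have eq: "{x \<in> V. \<forall>i\<in>insert j I. f i x = 0} = {x \<in> ?U. f j x = 0}" by blast
  have "fdim ?U" using assms(2) by (rule fdim_mono) blast
  then show ?case unfolding eq
    using dim_le_kernel[OF _ IH(2), of "f j"] subspace_kernel[OF IH(2), of "f j"] IH(1) insert by auto
qed

lemma independent_image_inj:
  fixes f :: "('v, 'k::field) mpol \<Rightarrow> ('v, 'k) mpol"
  assumes "\<And>x y. f (x + y) = f x + f y" "\<And>c x. f (Const c * x) = Const c * f x"
    and "mpol_vs.independent B" "\<And>x. x \<in> mpol_vs.span B \<Longrightarrow> f x = 0 \<Longrightarrow> x = 0"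
  shows "mpol_vs.independent (f ` B) \<and> inj_on f B"
proof -
  interpret f: Vector_Spaces.linear "\<lambda>(c::'k) P. Const c * P" "\<lambda>(c::'k) P. Const c * P" f
    using assms(1,2) by unfold_locales auto
  have "inj_on f (mpol_vs.span B)"
  proof (rule inj_onI)
    fix x y assume xy: "x \<in> mpol_vs.span B" "y \<in> mpol_vs.span B" "f x = f y"
    then have "f (x - y) = 0" by (simp add: f.diff)
    then show "x = y" using assms(4)[of "x - y"] xy by (simp add: mpol_vs.span_diff)
  qed
  then show ?thesis
    using f.dependent_inj_imageD[of B] assms(3) inj_on_subset mpol_vs.span_superset by blast
qed

lemma dim_le_inj:
  fixes f :: "('v, 'k::field) mpol \<Rightarrow> ('v, 'k) mpol"
  assumes f: "\<And>x y. f (x + y) = f x + f y" "\<And>c x. f (Const c * x) = Const c * f x"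
    and V: "mpol_vs.subspace V" "f ` V \<subseteq> W" "fdim W" and inj: "\<And>x. x \<in> V \<Longrightarrow> f x = 0 \<Longrightarrow> x = 0"
  shows "mpol_vs.dim V \<le> mpol_vs.dim W"
proof -
  obtain B where B: "B \<subseteq> V" "mpol_vs.independent B" "card B = mpol_vs.dim V" using mpol_vs.basis_exists by metis
  have "mpol_vs.span B \<subseteq> V" using B(1) V(1) mpol_vs.span_minimal by blast
  then have fB: "mpol_vs.independent (f ` B)" "inj_on f B"
    using independent_image_inj[of f B, OF f B(2)] inj by blast+
  have "card (f ` B) \<le> mpol_vs.dim W" using independent_card_fdim[OF V(3) _ fB(1)] B(1) V(2) by blast
  then show ?thesis using card_image[OF fB(2)] B(3) by simp
qed

text \<open>One half of the dimension formula: a basis of \<open>A\<close> stays independent when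
  the vectors that extend a basis of \<open>A \<inter> B\<close> to one of \<open>B\<close> are
  added to it.\<close>

lemma dim_sums_Int_le:
  assumes A: "mpol_vs.subspace A" "fdim A" and B: "mpol_vs.subspace B" "fdim B"
    and W: "fdim W" "\<And>x y. x \<in> A \<Longrightarrow> y \<in> B \<Longrightarrow> x + y \<in> W"
  shows "mpol_vs.dim A + mpol_vs.dim B \<le> mpol_vs.dim W + mpol_vs.dim (A \<inter> B)"
proof -
  obtain C where C: "C \<subseteq> A \<inter> B" "mpol_vs.independent C" "A \<inter> B \<subseteq> mpol_vs.span C" "card C = mpol_vs.dim (A \<inter> B)" "finite C"
    using fdim_basis[OF fdim_mono[OF A(2), of "A \<inter> B"]] by auto
  obtain CA where CA: "CA \<subseteq> A" "mpol_vs.independent CA" "A \<subseteq> mpol_vs.span CA" "card CA = mpol_vs.dim A" "finite CA"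
    using fdim_basis[OF A(2)] by metis
  obtain CB where CB: "C \<subseteq> CB" "CB \<subseteq> B" "mpol_vs.independent CB" "B \<subseteq> mpol_vs.span CB" "card CB = mpol_vs.dim B" "finite CB"
    using extend_basis_fdim[OF B(2) _ C(2)] C(1) by (metis le_inf_iff)
  have sA: "mpol_vs.span CA = A" using CA A(1) mpol_vs.span_subspace by blast
  \<comment> \<open>Stated for every part of the extending vectors, so that they can be added one at
    a time.\<close>
  have "mpol_vs.independent (CA \<union> D) \<and> card (CA \<union> D) = card CA + card D" if "D \<subseteq> CB - C" for D
  proof -
    have "finite D" using that CB(6) finite_subset by blast
    then show ?thesis using that
    proof (induction D rule: finite_induct)
      case empty
      then show ?case using CA by simp
    next
      case (insert d D)
      have "d \<notin> mpol_vs.span (CA \<union> D)"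
      proof
        assume "d \<in> mpol_vs.span (CA \<union> D)"
        then obtain a s where as: "d = a + s" "a \<in> A" "s \<in> mpol_vs.span D" unfolding mpol_vs.span_Un sA by blast
        have "mpol_vs.span D \<subseteq> B" using insert.prems CB(2) B(1) mpol_vs.span_minimal[of D B] by blast
        then have "a \<in> B" using as insert.prems CB(2) mpol_vs.subspace_diff[OF B(1), of d s] by auto
        then have "a \<in> mpol_vs.span C" using as C(3) by blast
        then have "a + s \<in> mpol_vs.span (C \<union> D)" using as(3) unfolding mpol_vs.span_Un by blast
        moreover have "C \<union> D \<subseteq> CB - {d}" using insert CB(1) by blast
        ultimately have "d \<in> mpol_vs.span (CB - {d})" using as(1) mpol_vs.span_mono by blast
        then show False using CB(3) insert.prems unfolding mpol_vs.dependent_def by blast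
      qed
      moreover from this have "d \<notin> CA \<union> D" using mpol_vs.span_base by blast
      ultimately show ?case using insert CA(5) mpol_vs.independent_insertI[of d "CA \<union> D"] by auto
    qed
  qed
  from this[of "CB - C"] have ind: "mpol_vs.independent (CA \<union> (CB - C))" "card (CA \<union> (CB - C)) = card CA + card (CB - C)"
    by auto
  have "x \<in> W" if "x \<in> CA \<union> (CB - C)" for x
    using that W(2)[of x 0] W(2)[of 0 x] CA(1) CB(2) mpol_vs.subspace_0[OF A(1)] mpol_vs.subspace_0[OF B(1)] by auto
  then have "card (CA \<union> (CB - C)) \<le> mpol_vs.dim W" using independent_card_fdim[OF W(1) _ ind(1)] by blast
  moreover have "card (CB - C) = card CB - card C" "card C \<le> card CB"
    using C(5) CB(1,6) by (auto intro: card_Diff_subset card_mono)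
  ultimately show ?thesis using ind(2) C(4) CA(4) CB(5) by simp
qed

section \<open>Spaces of forms\<close>

text \<open>The exponent of x_0 is a truncated difference, so this monomial has degree
  \<open>k\<close> only while \<open>i + j\<close> does not exceed \<open>k\<close>.\<close>

definition mono3 :: "nat \<Rightarrow> nat \<Rightarrow> nat \<Rightarrow> 3 \<Rightarrow>\<^sub>0 nat" where
  "mono3 k i j = Poly_Mapping.single 0 (k - i - j) + Poly_Mapping.single 1 i + Poly_Mapping.single 2 j"

lemma lookup_mono3 [simp]: "Poly_Mapping.lookup (mono3 k i j) 0 = k - i - j"
    "Poly_Mapping.lookup (mono3 k i j) 1 = i" "Poly_Mapping.lookup (mono3 k i j) 2 = j"
  by (simp_all add: mono3_def lookup_add lookup_single)

lemma sum_3: "(\<Sum>v\<in>UNIV. f v) = f 0 + f 1 + f (2::3)" for f :: "3 \<Rightarrow> 'a::comm_monoid_add"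
  unfolding UNIV_3 by (subst sum.insert, simp, simp, subst sum.insert, simp, simp) (simp add: add.assoc)

lemma prod_3: "(\<Prod>v\<in>UNIV. f v) = f 0 * f 1 * f (2::3)" for f :: "3 \<Rightarrow> 'a::comm_monoid_mult"
  unfolding UNIV_3 by (subst prod.insert, simp, simp, subst prod.insert, simp, simp) (simp add: mult.assoc)

lemma wt_UNIV3: "wt UNIV m = Poly_Mapping.lookup m 0 + Poly_Mapping.lookup m 1 + Poly_Mapping.lookup m (2::3)"
  by (simp only: wt_def sum_3)

lemma wt_12: "wt {1, 2} m = Poly_Mapping.lookup m 1 + Poly_Mapping.lookup m (2::3)"
  by (simp add: wt_def)

lemma poly_mapping_eqI3:
  assumes "Poly_Mapping.lookup m 0 = Poly_Mapping.lookup n 0" "Poly_Mapping.lookup m 1 = Poly_Mapping.lookup n 1"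
    "Poly_Mapping.lookup m 2 = Poly_Mapping.lookup n (2::3)"
  shows "m = n"
proof (rule poly_mapping_eqI)
  fix v :: 3
  show "Poly_Mapping.lookup m v = Poly_Mapping.lookup n v" using exhaust_3[of v] assms by auto
qed

definition mon :: "nat \<Rightarrow> (3 \<Rightarrow>\<^sub>0 nat) set" where
  "mon k = {m. wt UNIV m = k}"

text \<open>The triangle counts the monomials of degree \<open>n - 1\<close> as well as the
  conditions imposed by a point of multiplicity \<open>n\<close>.\<close>

definition tri :: "nat \<Rightarrow> (nat \<times> nat) set" where
  "tri n = {(i, j). i + j < n}"

lemma tri_eq: "tri n = (SIGMA i:{..<n}. {..<n - i})"
  by (auto simp: tri_def)

lemma finite_tri [simp]: "finite (tri n)"
  by (simp add: tri_eq)

lemma card_tri: "card (tri n) = (n + 1) choose 2"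
proof -
  have "card (tri n) = (\<Sum>i<n. n - i)" by (simp add: tri_eq)
  also have "\<dots> = (n + 1) choose 2"
  proof (induction n)
    case (Suc n)
    have "(\<Sum>i<Suc n. Suc n - i) = (\<Sum>i<n. n - i) + Suc n"
      by (simp only: sum.lessThan_Suc_shift diff_Suc_Suc diff_zero add.commute)
    then show ?case using Suc by (simp add: numeral_2_eq_2)
  qed simp
  finally show ?thesis .
qed

lemma mono3_mon: "i + j \<le> k \<Longrightarrow> mono3 k i j \<in> mon k"
  by (simp add: mon_def wt_UNIV3)

lemma mon_eq: "mon k = (\<lambda>(i, j). mono3 k i j) ` tri (k + 1)"
proof (intro equalityI subsetI)
  fix m assume m: "m \<in> mon k"
  have "m = mono3 k (Poly_Mapping.lookup m 1) (Poly_Mapping.lookup m 2)"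
    using m by (intro poly_mapping_eqI3) (simp_all add: mon_def wt_UNIV3)
  moreover have "(Poly_Mapping.lookup m 1, Poly_Mapping.lookup m 2) \<in> tri (k + 1)"
    using m by (simp add: mon_def wt_UNIV3 tri_def)
  ultimately show "m \<in> (\<lambda>(i, j). mono3 k i j) ` tri (k + 1)" by force
next
  fix m assume "m \<in> (\<lambda>(i, j). mono3 k i j) ` tri (k + 1)"
  then show "m \<in> mon k" by (auto simp: tri_def intro: mono3_mon)
qed

lemma inj_mono3: "inj_on (\<lambda>(i, j). mono3 k i j) A"
  by (rule inj_onI) (metis (no_types, lifting) case_prod_beta lookup_mono3(2,3) prod_eqI)

lemma finite_mon [simp]: "finite (mon k)"
  by (simp add: mon_eq)

lemma card_mon: "card (mon k) = (k + 2) choose 2"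
  by (simp add: mon_eq card_image[OF inj_mono3] card_tri)

lemma forms_iff_keys: "P \<in> forms k \<longleftrightarrow> Poly_Mapping.keys P \<subseteq> mon k"
  by (auto simp: forms_iff homg_def mon_def)

lemma forms_0I:
  assumes "P \<in> forms k" "\<And>m. m \<in> mon k \<Longrightarrow> Poly_Mapping.lookup P m = 0"
  shows "P = 0"
proof -
  have "m \<notin> Poly_Mapping.keys P" for m
    using assms in_keys_iff[of m P] unfolding forms_iff_keys by blast
  then have "Poly_Mapping.keys P = {}" by blast
  then show ?thesis using keys_eq_empty by blast
qed

lemma Var_nonzero [simp]: "Var v \<noteq> (0 :: ('v, 'k::zero_neq_one) mpol)"
proof
  assume "Var v = (0 :: ('v, 'k) mpol)"
  then have "Poly_Mapping.lookup (Var v :: ('v, 'k) mpol) (Poly_Mapping.single v 1) = 0" by simp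
  then show False by (simp add: Var_def)
qed

lemma lookup_Const_mult: "Poly_Mapping.lookup (Const c * P) m = c * Poly_Mapping.lookup P m"
  for P :: "('v, 'k::comm_ring_1) mpol"
  unfolding Const_def by (simp flip: mult_map_scale_conv_mult)
    (simp add: Poly_Mapping.map.rep_eq when_def)

lemma functional_lookup: "functional (\<lambda>P. Poly_Mapping.lookup P m)"
  by (simp add: functional_def lookup_add lookup_Const_mult)

lemma functional_lookup_shift: "functional (\<lambda>P. Poly_Mapping.lookup (shift a b P) m)"
  by (simp add: functional_def lookup_add lookup_Const_mult)

lemma subspace_forms: "mpol_vs.subspace (forms k)"
  by (rule mpol_vs.subspaceI) (auto simp: forms_iff homg_add homg_Const_mult)

lemma fdim_forms: "fdim (forms k :: (3, 'k::field) mpol set)"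
  unfolding fdim_def
proof (intro exI conjI subsetI)
  let ?W = "(\<lambda>m. Poly_Mapping.single m (1::'k)) ` mon k"
  show "finite ?W" by simp
  fix P :: "(3, 'k) mpol" assume P: "P \<in> forms k"
  have "P = (\<Sum>m\<in>Poly_Mapping.keys P. Const (Poly_Mapping.lookup P m) * Poly_Mapping.single m 1)"
    using mpol_eq_sum_single[of P] by (simp add: single_eq_Const_mult[symmetric])
  also have "\<dots> \<in> mpol_vs.span ?W"
    using P unfolding forms_iff_keys by (intro mpol_vs.span_sum mpol_vs.span_scale mpol_vs.span_base) blast
  finally show "P \<in> mpol_vs.span ?W" .
qed

lemma dim_forms: "mpol_vs.dim (forms k :: (3, 'k::field) mpol set) = (k + 2) choose 2"
proof -
  let ?s = "\<lambda>m. Poly_Mapping.single m (1::'k)"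
  let ?W = "?s ` mon k"
  have inj: "inj_on ?s (mon k)" by (rule inj_onI) (metis keys_single one_neq_zero singleton_inject)
  have ind: "mpol_vs.independent ?W"
  proof (rule mpol_vs.independent_if_scalars_zero)
    fix f :: "(3, 'k) mpol \<Rightarrow> 'k" and x
    assume 0: "(\<Sum>x\<in>?W. Const (f x) * x) = 0" and "x \<in> ?W"
    then obtain m where m: "m \<in> mon k" "x = ?s m" by blast
    have "0 = (\<Sum>x\<in>?W. Poly_Mapping.lookup (Const (f x) * x) m)"
      unfolding lookup_sum[symmetric] 0 by simp
    also have "\<dots> = (\<Sum>n\<in>mon k. f (?s n) * Poly_Mapping.lookup (?s n) m)"
      by (subst sum.reindex[OF inj]) (simp add: lookup_Const_mult)
    also have "\<dots> = (\<Sum>n\<in>mon k. if n = m then f (?s n) else 0)"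
      by (rule sum.cong) (auto simp: lookup_single when_def)
    finally show "f x = 0" using m by simp
  qed simp
  have "?W \<subseteq> forms k" by (auto simp: forms_iff_keys)
  then have "card ?W \<le> mpol_vs.dim (forms k :: (3, 'k) mpol set)"
    using independent_card_fdim[OF fdim_forms _ ind] by blast
  moreover have "mpol_vs.dim (forms k :: (3, 'k) mpol set) \<le> card (mon k)"
  proof -
    have "{P \<in> forms k. \<forall>m\<in>mon k. Poly_Mapping.lookup P m = 0} \<subseteq> {0 :: (3, 'k) mpol}"
    proof
      fix P :: "(3, 'k) mpol" assume "P \<in> {P \<in> forms k. \<forall>m\<in>mon k. Poly_Mapping.lookup P m = 0}"
      then have "P = 0" using forms_0I[of P k] by blast
      then show "P \<in> {0}" by simp
    qed
    then have "mpol_vs.dim {P \<in> forms k. \<forall>m\<in>mon k. Poly_Mapping.lookup P m = (0::'k)} \<le> card ({} :: (3, 'k) mpol set)"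
      by (intro mpol_vs.dim_le_card) auto
    then show ?thesis
      using dim_le_kernels[of "mon k" "forms k :: (3, 'k) mpol set" "\<lambda>m P. Poly_Mapping.lookup P m",
          OF finite_mon fdim_forms subspace_forms functional_lookup] by simp
  qed
  ultimately show ?thesis using card_image[OF inj] by (simp add: card_mon)
qed

text \<open>Multiplicity becomes a finite list of vanishing coefficients, that is, a system of
  linear conditions on the form.\<close>

lemma ordge_iff_lookup:
  assumes "P \<in> forms k"
  shows "ordge a b n P \<longleftrightarrow> (\<forall>i j. i + j < n \<longrightarrow> i + j \<le> k \<longrightarrow> Poly_Mapping.lookup (shift a b P) (mono3 k i j) = 0)"
proof
  assume "ordge a b n P"
  then show "\<forall>i j. i + j < n \<longrightarrow> i + j \<le> k \<longrightarrow> Poly_Mapping.lookup (shift a b P) (mono3 k i j) = 0"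
    unfolding ordge_def wtge_def wt_12 by (metis in_keys_iff linorder_not_less lookup_mono3(2,3))
next
  assume R: "\<forall>i j. i + j < n \<longrightarrow> i + j \<le> k \<longrightarrow> Poly_Mapping.lookup (shift a b P) (mono3 k i j) = 0"
  show "ordge a b n P"
    unfolding ordge_def wtge_def wt_12
  proof
    fix m assume m: "m \<in> Poly_Mapping.keys (shift a b P)"
    have "shift a b P \<in> forms k" using assms by (simp add: forms_iff homg_shift)
    then have "m \<in> mon k" using m by (auto simp: forms_iff_keys)
    then obtain i j where ij: "m = mono3 k i j" "i + j \<le> k" unfolding mon_eq tri_def by auto
    then have "\<not> i + j < n" using R m by (auto simp: in_keys_iff)
    then show "n \<le> Poly_Mapping.lookup m 1 + Poly_Mapping.lookup m 2" using ij by simp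
  qed
qed

lemma subspace_fat_forms: "mpol_vs.subspace (fat_forms a b n k)"
  by (rule mpol_vs.subspaceI)
    (auto simp: fat_forms_iff forms_iff homg_add homg_Const_mult ordge_add ordge_mult_left)

lemma fdim_fat_forms: "fdim (fat_forms a b n k)"
  using fdim_forms by (rule fdim_mono) (auto simp: fat_forms_def)

text \<open>The expected dimension is a lower bound for any position of the points, because a point
  of multiplicity r imposes at most r (r + 1) / 2 conditions.\<close>

lemma dim_fat_forms_ge:
  "(k + 2) choose 2 \<le> mpol_vs.dim (fat_forms a b n k) + (\<Sum>i\<in>UNIV. (n i + 1) choose 2)"
proof -
  let ?I = "SIGMA i:UNIV. tri (n i)"
  \<comment> \<open>Pairs with \<open>j + l > k\<close> belong to no monomial of degree
    \<open>k\<close>; dropping them only lowers the number of conditions.\<close>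
  let ?J = "{(i, j, l). (j, l) \<in> tri (n i) \<and> j + l \<le> k}"
  have sub: "?J \<subseteq> ?I" by auto
  have fin: "finite ?I" by simp
  define f where "f = (\<lambda>(i, j, l) P. Poly_Mapping.lookup (shift (a i) (b i) P) (mono3 k j l))"
  have f: "functional (f x)" for x
    using functional_lookup_shift by (cases x) (simp add: f_def)
  have "fat_forms a b n k = {P \<in> forms k. \<forall>x\<in>?J. f x P = 0}"
  proof (intro equalityI subsetI)
    fix P assume "P \<in> fat_forms a b n k"
    then have P: "P \<in> forms k" "\<And>i. ordge (a i) (b i) (n i) P" by (auto simp: fat_forms_iff)
    have "f x P = 0" if "x \<in> ?J" for x
      using that P(2) unfolding ordge_iff_lookup[OF P(1)] by (auto simp: f_def tri_def)
    then show "P \<in> {P \<in> forms k. \<forall>x\<in>?J. f x P = 0}" using P by blast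
  next
    fix P assume "P \<in> {P \<in> forms k. \<forall>x\<in>?J. f x P = 0}"
    then have P: "P \<in> forms k" "\<And>x. x \<in> ?J \<Longrightarrow> f x P = 0" by auto
    have "ordge (a i) (b i) (n i) P" for i
      unfolding ordge_iff_lookup[OF P(1)]
    proof (intro allI impI)
      fix j l assume "j + l < n i" "j + l \<le> k"
      then show "Poly_Mapping.lookup (shift (a i) (b i) P) (mono3 k j l) = 0"
        using P(2)[of "(i, j, l)"] by (simp add: f_def tri_def)
    qed
    then show "P \<in> fat_forms a b n k" using P by (simp add: fat_forms_iff)
  qed
  moreover have "mpol_vs.dim (forms k :: (3, 'a) mpol set) \<le> mpol_vs.dim {P \<in> forms k. \<forall>x\<in>?J. f x P = 0} + card ?J"
    using dim_le_kernels[OF finite_subset[OF sub fin] fdim_forms subspace_forms, of f k] f by blast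
  moreover have "card ?J \<le> card ?I" using card_mono[OF fin sub] .
  moreover have "card ?I = (\<Sum>i\<in>UNIV. (n i + 1) choose 2)" by (simp add: card_tri)
  ultimately show ?thesis by (simp add: dim_forms)
qed

lemma Var_dvdI:
  fixes P :: "('v, 'k::comm_ring_1) mpol"
  assumes "\<And>m. m \<in> Poly_Mapping.keys P \<Longrightarrow> Poly_Mapping.lookup m v \<noteq> 0"
  shows "\<exists>Q. P = Var v * Q"
proof -
  let ?e = "Poly_Mapping.single v 1"
  have "Poly_Mapping.single m c = Var v * Poly_Mapping.single (m - ?e) c" if "Poly_Mapping.lookup m v \<noteq> 0" for m and c :: 'k
  proof -
    have "?e + (m - ?e) = m"
      by (rule poly_mapping_eqI) (use that in \<open>auto simp: lookup_add lookup_minus lookup_single when_def\<close>)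
    then show ?thesis by (simp add: Var_def mult_single)
  qed
  then have "P = (\<Sum>m\<in>Poly_Mapping.keys P. Var v * Poly_Mapping.single (m - ?e) (Poly_Mapping.lookup P m))"
    using assms mpol_eq_sum_single[of P] by simp
  then show ?thesis unfolding sum_distrib_left[symmetric] by blast
qed

text \<open>Multiplication by \<open>P\<close> moves the component of degree j to degree k + j
  without mixing, so every component of \<open>Q\<close> outside degree \<open>l\<close> is killed
  by \<open>P\<close> and hence zero.\<close>

lemma homg_cancel:
  fixes P Q :: "('v::{finite,linorder}, 'k::idom) mpol"
  assumes "homg S (k + l) (P * Q)" "homg S k P" "P \<noteq> 0"
  shows "homg S l Q"
proof -
  have 1: "homg S j R \<and> P * R = 0 \<or> j = l" if "R = part S j Q" for j R
  proof (cases "j = l")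
    case False
    have keys0: "Poly_Mapping.lookup (P * part S j Q) m = Poly_Mapping.lookup (P * Q) m" if "wt S m = k + j" for m
    proof -
      have "Q - part S j Q = 0 \<or> Q - part S j Q \<noteq> 0" by simp
      have "m \<notin> Poly_Mapping.keys (P * (Q - part S j Q))"
      proof
        assume "m \<in> Poly_Mapping.keys (P * (Q - part S j Q))"
        then obtain x y where xy: "x \<in> Poly_Mapping.keys P" "y \<in> Poly_Mapping.keys (Q - part S j Q)" "m = x + y"
          using keys_mult[of P "Q - part S j Q"] by blast
        have "wt S x = k" using xy assms(2) by (simp add: homg_def)
        moreover have "wt S y \<noteq> j" using xy(2) by (auto simp: in_keys_iff lookup_minus lookup_part split: if_splits)
        ultimately show False using that xy(3) by (simp add: wt_add)
      qed
      then have "Poly_Mapping.lookup (P * (Q - part S j Q)) m = 0" by (simp add: in_keys_iff)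
      then show ?thesis by (simp add: right_diff_distrib lookup_minus)
    qed
    have "Poly_Mapping.lookup (P * part S j Q) m = 0" for m
    proof (cases "wt S m = k + j")
      case True
      then have "m \<notin> Poly_Mapping.keys (P * Q)" using assms(1) False by (auto simp: homg_def)
      then show ?thesis using keys0[OF True] by (simp add: in_keys_iff)
    next
      case F: False
      have "homg S (k + j) (P * part S j Q)" by (intro homg_mult assms homg_part)
      then have "m \<notin> Poly_Mapping.keys (P * part S j Q)" using F by (auto simp: homg_def)
      then show ?thesis by (simp add: in_keys_iff)
    qed
    then have "P * part S j Q = 0" by (intro poly_mapping_eqI) simp
    then show ?thesis using that homg_part by blast
  qed simp
  have "part S j Q = 0" if "j \<noteq> l" for j
    using 1[OF refl, of j] that assms(3) by auto
  then show ?thesis unfolding homg_def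
    by (metis in_keys_iff lookup_part lookup_zero)
qed

lemma not_ordge_1_Var0: "\<not> ordge a b 1 (Var 0 :: (3, 'k::comm_ring_1) mpol)"
proof -
  have "Poly_Mapping.single 0 1 \<in> Poly_Mapping.keys (Var 0 :: (3, 'k) mpol)" by (simp add: Var_def)
  moreover have "wt {1, 2} (Poly_Mapping.single (0::3) 1) = 0" by (simp add: wt_12 lookup_single)
  ultimately show ?thesis unfolding ordge_def wtge_def shift_Var by (metis not_one_le_zero)
qed

text \<open>Restriction to the line x_0 = 0, which misses all the points. The kernel is x_0 times
  the forms of degree \<open>k\<close> with the same multiplicities, and the image lies in the
  binary forms of degree \<open>k + 1\<close>.\<close>

lemma dim_fat_forms_Suc_le:
  "mpol_vs.dim (fat_forms a b n (Suc k)) \<le> mpol_vs.dim (fat_forms a b n k) + (k + 2)"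
proof -
  let ?I = "{..Suc k}"
  let ?f = "\<lambda>i P. Poly_Mapping.lookup P (mono3 (Suc k) i (Suc k - i))"
  let ?U = "{P \<in> fat_forms a b n (Suc k). \<forall>i\<in>?I. ?f i P = 0}"
  have div: "\<exists>Q. P = Var 0 * Q \<and> Q \<in> fat_forms a b n k" if P: "P \<in> ?U" for P
  proof -
    have Pf: "P \<in> forms (Suc k)" using P by (simp add: fat_forms_iff)
    have "Poly_Mapping.lookup m 0 \<noteq> 0" if m: "m \<in> Poly_Mapping.keys P" for m
    proof
      assume m0: "Poly_Mapping.lookup m 0 = 0"
      have "m \<in> mon (Suc k)" using m Pf by (auto simp: forms_iff_keys)
      then have "m = mono3 (Suc k) (Poly_Mapping.lookup m 1) (Suc k - Poly_Mapping.lookup m 1)" "Poly_Mapping.lookup m 1 \<le> Suc k"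
        using m0 by (auto intro!: poly_mapping_eqI3 simp: mon_def wt_UNIV3)
      then have "Poly_Mapping.lookup P m = 0" using P by (metis (mono_tags, lifting) atMost_iff mem_Collect_eq)
      then show False using m by (simp add: in_keys_iff)
    qed
    then obtain Q where Q: "P = Var 0 * Q" using Var_dvdI[of P 0] by blast
    have "homg UNIV k Q" using homg_cancel[of UNIV 1 k "Var 0" Q] Pf Q by (simp add: forms_iff)
    moreover have "ordge (a i) (b i) (n i) Q" for i
      using ordge_cancel[of "a i" "b i" 0 "n i" "Var 0" Q] P Q not_ordge_1_Var0[of "a i" "b i"] by (simp add: fat_forms_iff)
    ultimately show ?thesis using Q by (auto simp: fat_forms_iff forms_iff)
  qed
  have le: "mpol_vs.dim (fat_forms a b n (Suc k)) \<le> mpol_vs.dim ?U + card ?I" and sub: "mpol_vs.subspace ?U"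
    using dim_le_kernels[OF _ fdim_fat_forms subspace_fat_forms functional_lookup, of ?I a b n "Suc k" "\<lambda>i. mono3 (Suc k) i (Suc k - i)"]
    by blast+
  have UQ: "?U \<subseteq> (\<lambda>Q. Var 0 * Q) ` fat_forms a b n k" using div by blast
  obtain B where B: "fat_forms a b n k \<subseteq> mpol_vs.span B" "card B = mpol_vs.dim (fat_forms a b n k)" "finite B"
    using fdim_basis[OF fdim_fat_forms] by metis
  have "Var 0 * Q \<in> mpol_vs.span ((\<lambda>Q. Var 0 * Q) ` B)" if "Q \<in> mpol_vs.span B" for Q
    using that
  proof (induction rule: mpol_vs.span_induct_alt)
    case (step c x y)
    have "Const c * (Var 0 * x) + Var 0 * y \<in> mpol_vs.span ((\<lambda>Q. Var 0 * Q) ` B)"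
      using step by (intro mpol_vs.span_add[OF mpol_vs.span_scale[OF mpol_vs.span_base]]) auto
    then show ?case by (simp only: distrib_left mult.left_commute)
  next
    case base
    show ?case using mpol_vs.span_zero by simp
  qed
  then have "?U \<subseteq> mpol_vs.span ((\<lambda>Q. Var 0 * Q) ` B)" using UQ B(1) by blast
  then have "mpol_vs.dim ?U \<le> card ((\<lambda>Q. Var 0 * Q) ` B)" using B(3) by (intro mpol_vs.dim_le_card) auto
  also have "\<dots> \<le> card B" using B(3) by (rule card_image_le)
  finally show ?thesis using le B(2) by simp
qed

section \<open>Semicontinuity\<close>

text \<open>Gaussian elimination, carried out simultaneously for a matrix and a specialisation of it.\<close>

lemma trivial_kernel_specialise:
  fixes S :: "('k::field \<times> 'k) set" and A1 A2 :: "'r \<Rightarrow> 'c \<Rightarrow> 'k"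
  assumes S: "\<And>a a' b b'. (a, a') \<in> S \<Longrightarrow> (b, b') \<in> S \<Longrightarrow> (a * b, a' * b') \<in> S"
      "\<And>a a' b b'. (a, a') \<in> S \<Longrightarrow> (b, b') \<in> S \<Longrightarrow> (a - b, a' - b') \<in> S"
      "\<And>a a'. (a, a') \<in> S \<Longrightarrow> a' \<noteq> 0 \<Longrightarrow> a \<noteq> 0"
    and J: "finite J" and A: "\<And>r j. j \<in> J \<Longrightarrow> (A1 r j, A2 r j) \<in> S"
    and triv: "\<And>x. (\<And>r. (\<Sum>j\<in>J. A2 r j * x j) = 0) \<Longrightarrow> (\<forall>j\<in>J. x j = 0)"
    and x: "\<And>r. (\<Sum>j\<in>J. A1 r j * x j) = 0"
  shows "\<forall>j\<in>J. x j = 0"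
  using J A triv x
proof (induction J arbitrary: A1 A2 x rule: finite_induct)
  case (insert p J)
  have "\<exists>r0. A2 r0 p \<noteq> 0"
  proof (rule ccontr)
    assume "\<not> ?thesis"
    then have z: "A2 r p = 0" for r by blast
    \<comment> \<open>A zero column would put the unit vector at \<open>p\<close> into the kernel of
      \<open>A2\<close>.\<close>
    have "(\<Sum>j\<in>insert p J. A2 r j * (if j = p then 1 else 0)) = 0" for r
      using insert.hyps z by (simp add: sum.neutral)
    then have "\<forall>j\<in>insert p J. (if j = p then 1 else 0) = (0::'k)" by (rule insert.prems(2))
    then show False by simp
  qed
  then obtain r0 where r0: "A2 r0 p \<noteq> 0" by blast
  then have r1: "A1 r0 p \<noteq> 0" using S(3) insert.prems(1)[of p r0] by blast
  \<comment> \<open>Elimination of column \<open>p\<close> without division, so that corresponding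
    entries remain related by \<open>S\<close>.\<close>
  define B1 where "B1 r j = A1 r0 p * A1 r j - A1 r p * A1 r0 j" for r j
  define B2 where "B2 r j = A2 r0 p * A2 r j - A2 r p * A2 r0 j" for r j
  have B: "(B1 r j, B2 r j) \<in> S" if "j \<in> J" for r j
    unfolding B1_def B2_def using that insert.prems(1) by (intro S(1,2)) auto
  have B1x: "(\<Sum>j\<in>J. B1 r j * x j) = 0" for r
  proof -
    have e1: "(\<Sum>j\<in>J. B1 r j * x j) = A1 r0 p * (\<Sum>j\<in>J. A1 r j * x j) - A1 r p * (\<Sum>j\<in>J. A1 r0 j * x j)"
      unfolding B1_def sum_distrib_left sum_subtractf[symmetric]
      by (rule sum.cong[OF refl]) (simp only: left_diff_distrib mult.assoc)
    have e2: "(\<Sum>j\<in>J. A1 r j * x j) = - (A1 r p * x p)" for r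
      using insert.prems(3)[of r] insert.hyps by (simp add: eq_neg_iff_add_eq_0 add.commute)
    have "a * - (b * c) - b * - (a * c) = 0" for a b c :: 'k by (simp add: mult.left_commute)
    then show ?thesis unfolding e1 e2[of r] e2[of r0] .
  qed
  have trB: "\<forall>j\<in>J. y j = 0" if y: "\<And>r. (\<Sum>j\<in>J. B2 r j * y j) = 0" for y
  proof -
    define s where "s = (\<Sum>j\<in>J. A2 r0 j * y j)"
    define z where "z = y(p := - s / A2 r0 p)"
    have zJ: "(\<Sum>j\<in>J. A2 r j * z j) = (\<Sum>j\<in>J. A2 r j * y j)" for r
      using insert.hyps by (intro sum.cong) (auto simp: z_def)
    have "(\<Sum>j\<in>insert p J. A2 r j * z j) = 0" for r
    proof -
      have "0 = A2 r0 p * (\<Sum>j\<in>J. A2 r j * y j) - A2 r p * s"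
        unfolding y[of r, symmetric] B2_def s_def sum_distrib_left sum_subtractf[symmetric]
        by (rule sum.cong[OF refl]) (simp only: left_diff_distrib mult.assoc)
      then have "(\<Sum>j\<in>J. A2 r j * y j) = A2 r p * s / A2 r0 p"
        using r0 by (simp add: field_simps)
      then show ?thesis using insert.hyps zJ by (simp add: z_def)
    qed
    then have z0: "\<forall>j\<in>insert p J. z j = 0" by (rule insert.prems(2))
    show ?thesis
    proof
      fix j assume j: "j \<in> J"
      then have "j \<noteq> p" using insert.hyps by blast
      then have "z j = y j" by (simp add: z_def)
      then show "y j = 0" using z0 j by simp
    qed
  qed
  have xJ: "\<forall>j\<in>J. x j = 0" by (rule insert.IH[OF B trB B1x])
  then have "(\<Sum>j\<in>J. A1 r0 j * x j) = 0" by (simp add: sum.neutral)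
  then have "A1 r0 p * x p = 0" using insert.prems(3)[of r0] insert.hyps by simp
  then show ?case using xJ r1 by simp
qed simp

lemma prime_subfield_add:
  assumes "x \<in> prime_subfield" "y \<in> prime_subfield" shows "x + y \<in> prime_subfield"
proof -
  obtain m n m' n' where x: "x = of_int m / of_int n" and y: "y = of_int m' / of_int n'"
    using assms unfolding prime_subfield_def by blast
  show ?thesis
  proof (cases "of_int n = (0::'a) \<or> of_int n' = (0::'a)")
    case True
    then show ?thesis using x y assms by auto
  next
    case False
    then have "x + y = of_int (m * n' + m' * n) / of_int (n * n')"
      by (simp add: x y add_divide_eq_iff divide_add_eq_iff field_simps)
    then show ?thesis unfolding prime_subfield_def by blast
  qed
qed

lemma prime_subfield_mult:
  assumes "x \<in> prime_subfield" "y \<in> prime_subfield" shows "x * y \<in> prime_subfield"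
proof -
  obtain m n m' n' where x: "x = of_int m / of_int n" and y: "y = of_int m' / of_int n'"
    using assms unfolding prime_subfield_def by blast
  have "x * y = of_int (m * m') / of_int (n * n')" by (simp add: x y)
  then show ?thesis unfolding prime_subfield_def by blast
qed

lemma prime_subfield_of_int: "of_int m \<in> prime_subfield"
proof -
  have "of_int m = of_int m / (of_int 1 :: 'a::field)" by simp
  then show ?thesis unfolding prime_subfield_def by blast
qed

lemma prime_subfield_0: "0 \<in> prime_subfield" and prime_subfield_1: "1 \<in> prime_subfield"
  using prime_subfield_of_int[of 0] prime_subfield_of_int[of 1] by simp_all

lemma prime_subfield_uminus: "x \<in> prime_subfield \<Longrightarrow> - x \<in> prime_subfield"
  using prime_subfield_mult[of x "- 1"] prime_subfield_of_int[of "- 1"] by simp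

lemma prime_subfield_sum: "(\<And>x. x \<in> A \<Longrightarrow> f x \<in> prime_subfield) \<Longrightarrow> sum f A \<in> prime_subfield"
  by (induction A rule: infinite_finite_induct) (auto intro: prime_subfield_add prime_subfield_0)

text \<open>Summing over supersets of the supports allows a product to be compared term by term with
  its specialisation, whose support may be different.\<close>

lemma lookup_mult_superset:
  fixes P Q :: "('v, 'k::comm_ring_1) mpol"
  assumes A: "finite A" "Poly_Mapping.keys P \<subseteq> A" and B: "finite B" "Poly_Mapping.keys Q \<subseteq> B"
  shows "Poly_Mapping.lookup (P * Q) k
    = (\<Sum>m\<in>A. \<Sum>n\<in>B. if m + n = k then Poly_Mapping.lookup P m * Poly_Mapping.lookup Q n else 0)"
proof -
  have eq: "P' = (\<Sum>m\<in>A'. Poly_Mapping.single m (Poly_Mapping.lookup P' m))"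
    if "finite A'" "Poly_Mapping.keys P' \<subseteq> A'" for P' :: "('v, 'k) mpol" and A'
  proof -
    have "(\<Sum>m\<in>A'. Poly_Mapping.single m (Poly_Mapping.lookup P' m))
        = (\<Sum>m\<in>Poly_Mapping.keys P'. Poly_Mapping.single m (Poly_Mapping.lookup P' m))"
      using that by (intro sum.mono_neutral_right) (auto simp: in_keys_iff)
    then show ?thesis using mpol_eq_sum_single[of P'] by argo
  qed
  have "P * Q = (\<Sum>m\<in>A. Poly_Mapping.single m (Poly_Mapping.lookup P m)) * (\<Sum>n\<in>B. Poly_Mapping.single n (Poly_Mapping.lookup Q n))"
    using eq[OF A] eq[OF B] by argo
  also have "\<dots> = (\<Sum>m\<in>A. \<Sum>n\<in>B. Poly_Mapping.single (m + n) (Poly_Mapping.lookup P m * Poly_Mapping.lookup Q n))"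
    by (simp add: sum_product mult_single)
  finally have "Poly_Mapping.lookup (P * Q) k
      = Poly_Mapping.lookup (\<Sum>m\<in>A. \<Sum>n\<in>B. Poly_Mapping.single (m + n) (Poly_Mapping.lookup P m * Poly_Mapping.lookup Q n)) k"
    by (rule arg_cong)
  then show ?thesis by (simp add: lookup_sum lookup_single when_def)
qed

definition prime_poly :: "('v, 'k::field) mpol \<Rightarrow> bool" where
  "prime_poly Q \<longleftrightarrow> (\<forall>m. Poly_Mapping.lookup Q m \<in> prime_subfield)"

lemma prime_poly_mult: "prime_poly P \<Longrightarrow> prime_poly Q \<Longrightarrow> prime_poly (P * Q)"
  unfolding prime_poly_def lookup_mult_superset[OF finite_keys order_refl finite_keys order_refl]
  by (intro allI prime_subfield_sum) (simp add: prime_subfield_mult prime_subfield_0)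

lemma prime_poly_add: "prime_poly P \<Longrightarrow> prime_poly Q \<Longrightarrow> prime_poly (P + Q)"
  unfolding prime_poly_def by (simp add: lookup_add prime_subfield_add)

lemma prime_poly_uminus: "prime_poly P \<Longrightarrow> prime_poly (- P)"
  unfolding prime_poly_def by (simp add: prime_subfield_uminus)

lemma prime_poly_diff: "prime_poly P \<Longrightarrow> prime_poly Q \<Longrightarrow> prime_poly (P - Q)"
  using prime_poly_add[of P "- Q"] prime_poly_uminus by auto

lemma prime_poly_Var: "prime_poly (Var v)" and prime_poly_1: "prime_poly 1" and prime_poly_0: "prime_poly 0"
  unfolding prime_poly_def
  by (simp_all add: Var_def lookup_single lookup_one when_def prime_subfield_0 prime_subfield_1)

text \<open>Pairs of values of one polynomial over the prime field. When \<open>x\<close> is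
  algebraically independent, a nonzero second entry forces a nonzero first entry, which is all that
  elimination asks of a specialisation.\<close>

definition specialisations :: "('v::finite \<Rightarrow> 'k::field) \<Rightarrow> ('v \<Rightarrow> 'k) \<Rightarrow> ('k \<times> 'k) set" where
  "specialisations x y = {(ev x Q, ev y Q) | Q. prime_poly Q}"

context
  fixes x y :: "'v::finite \<Rightarrow> 'k::field"
begin

lemma specialisationsI: "prime_poly Q \<Longrightarrow> (ev x Q, ev y Q) \<in> specialisations x y"
  unfolding specialisations_def by blast

lemma specialisations_add: "(a, a') \<in> specialisations x y \<Longrightarrow> (b, b') \<in> specialisations x y \<Longrightarrow> (a + b, a' + b') \<in> specialisations x y"
  unfolding specialisations_def by (smt (verit) ev_simps(3) mem_Collect_eq prime_poly_add prod.inject)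

lemma specialisations_mult: "(a, a') \<in> specialisations x y \<Longrightarrow> (b, b') \<in> specialisations x y \<Longrightarrow> (a * b, a' * b') \<in> specialisations x y"
  unfolding specialisations_def by (smt (verit) ev_simps(4) mem_Collect_eq prime_poly_mult prod.inject)

lemma specialisations_diff: "(a, a') \<in> specialisations x y \<Longrightarrow> (b, b') \<in> specialisations x y \<Longrightarrow> (a - b, a' - b') \<in> specialisations x y"
  unfolding specialisations_def by (smt (verit) ev_simps(6) mem_Collect_eq prime_poly_diff prod.inject)

lemma specialisations_Var: "(x v, y v) \<in> specialisations x y"
  and specialisations_0: "(0, 0) \<in> specialisations x y" and specialisations_1: "(1, 1) \<in> specialisations x y"
  using specialisationsI[OF prime_poly_Var, of v] specialisationsI[OF prime_poly_0] specialisationsI[OF prime_poly_1]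
  by simp_all

lemma specialisations_sum: "(\<And>i. i \<in> A \<Longrightarrow> (f i, g i) \<in> specialisations x y) \<Longrightarrow> (sum f A, sum g A) \<in> specialisations x y"
  by (induction A rule: infinite_finite_induct) (auto intro: specialisations_add specialisations_0)

lemma specialisations_nonzero:
  assumes "alg_independent x" "(a, a') \<in> specialisations x y" "a' \<noteq> 0" shows "a \<noteq> 0"
proof
  assume "a = 0"
  obtain Q where Q: "a = ev x Q" "a' = ev y Q" "prime_poly Q" using assms(2) unfolding specialisations_def by blast
  then have "Q = 0" using assms(1) \<open>a = 0\<close> unfolding alg_independent_def prime_poly_def by auto
  then show False using Q assms(3) by simp
qed

definition spec_rel :: "('w, 'k) mpol \<Rightarrow> ('w, 'k) mpol \<Rightarrow> bool" where
  "spec_rel P Q \<longleftrightarrow> (\<forall>m. (Poly_Mapping.lookup P m, Poly_Mapping.lookup Q m) \<in> specialisations x y)"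

lemma spec_rel_mult:
  assumes "spec_rel P P'" "spec_rel Q Q'" shows "spec_rel (P * Q) (P' * Q')"
proof -
  let ?A = "Poly_Mapping.keys P \<union> Poly_Mapping.keys P'" and ?B = "Poly_Mapping.keys Q \<union> Poly_Mapping.keys Q'"
  have AB: "finite ?A" "finite ?B" "Poly_Mapping.keys P \<subseteq> ?A" "Poly_Mapping.keys P' \<subseteq> ?A"
      "Poly_Mapping.keys Q \<subseteq> ?B" "Poly_Mapping.keys Q' \<subseteq> ?B" by auto
  show ?thesis
    unfolding spec_rel_def lookup_mult_superset[OF AB(1,3,2,5)] lookup_mult_superset[OF AB(1,4,2,6)]
    using assms unfolding spec_rel_def
    by (intro allI specialisations_sum) (auto intro: specialisations_mult specialisations_0)
qed

lemma spec_rel_add: "spec_rel P P' \<Longrightarrow> spec_rel Q Q' \<Longrightarrow> spec_rel (P + Q) (P' + Q')"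
  unfolding spec_rel_def by (simp add: lookup_add specialisations_add)

lemma spec_rel_Const: "(a, a') \<in> specialisations x y \<Longrightarrow> spec_rel (Const a) (Const a')"
  unfolding spec_rel_def Const_def by (simp add: lookup_single when_def specialisations_0)

lemma spec_rel_Var: "spec_rel (Var v) (Var v)"
  unfolding spec_rel_def Var_def by (simp add: lookup_single when_def specialisations_0 specialisations_1)

lemma spec_rel_power: "spec_rel P Q \<Longrightarrow> spec_rel (P ^ n) (Q ^ n)"
proof (induction n)
  case 0
  show ?case using spec_rel_Const[OF specialisations_1] by (simp add: Const_simps)
qed (simp add: spec_rel_mult)

lemma spec_rel_shift:
  assumes "(a, a') \<in> specialisations x y" "(b, b') \<in> specialisations x y"
  shows "spec_rel (shift a b (Poly_Mapping.single m 1)) (shift a' b' (Poly_Mapping.single m 1))"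
proof -
  have "shift c e (Poly_Mapping.single m 1) = Var 0 ^ Poly_Mapping.lookup m 0 *
      (Var 1 + Const c * Var 0) ^ Poly_Mapping.lookup m 1 * (Var 2 + Const e * Var 0) ^ Poly_Mapping.lookup m 2"
    for c e :: 'k
    unfolding prod_Var_power[symmetric] shift_simps prod_3 shift_Var ..
  then show ?thesis
    using assms by (simp only:) (intro spec_rel_mult spec_rel_power spec_rel_add spec_rel_Var spec_rel_Const)
qed

end

text \<open>A coordinate that does not vanish on \<open>V\<close> cuts out a proper subspace, so
  \<open>dim V\<close> coordinates suffice to detect zero. They serve to enlarge a linear system to
  one with trivial kernel.\<close>

lemma pivot_coordinates:
  fixes V :: "(3, 'k::field) mpol set"
  assumes "mpol_vs.subspace V" "V \<subseteq> forms k"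
  shows "\<exists>S. S \<subseteq> mon k \<and> card S \<le> mpol_vs.dim V \<and> (\<forall>P\<in>V. (\<forall>m\<in>S. Poly_Mapping.lookup P m = 0) \<longrightarrow> P = 0)"
  using assms
proof (induction "mpol_vs.dim V" arbitrary: V rule: less_induct)
  case less
  have fd: "fdim V" using fdim_forms less.prems(2) by (rule fdim_mono)
  show ?case
  proof (cases "V \<subseteq> {0}")
    case True
    then show ?thesis by (intro exI[of _ "{}"]) auto
  next
    case False
    then obtain P where P: "P \<in> V" "P \<noteq> 0" by blast
    then have "\<not> (\<forall>m\<in>mon k. Poly_Mapping.lookup P m = 0)" using forms_0I[of P k] less.prems(2) by blast
    then obtain s where s: "s \<in> mon k" "Poly_Mapping.lookup P s \<noteq> 0" by blast
    let ?U = "{P \<in> V. Poly_Mapping.lookup P s = 0}"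
    have U: "mpol_vs.subspace ?U" by (rule subspace_kernel[OF less.prems(1) functional_lookup])
    have "mpol_vs.dim ?U < mpol_vs.dim V"
    proof (rule ccontr)
      assume "\<not> ?thesis"
      then have "mpol_vs.dim V \<le> mpol_vs.dim ?U" by simp
      moreover have "?U \<subseteq> V" by blast
      ultimately have "?U = V" using subspace_eqI_fdim[OF fd U] by blast
      then show False using P s by blast
    qed
    from less.hyps[OF this U] less.prems(2) obtain S where S: "S \<subseteq> mon k" "card S \<le> mpol_vs.dim ?U"
        "\<forall>P\<in>?U. (\<forall>m\<in>S. Poly_Mapping.lookup P m = 0) \<longrightarrow> P = 0" by blast
    have "finite S" using S(1) finite_mon finite_subset by blast
    then have "card (insert s S) \<le> Suc (card S)" by (simp add: card_insert_if)
    then have "card (insert s S) \<le> mpol_vs.dim V"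
      using S(2) \<open>mpol_vs.dim ?U < mpol_vs.dim V\<close> by linarith
    then show ?thesis using S s by (intro exI[of _ "insert s S"]) auto
  qed
qed

lemma forms_eq_sum:
  assumes "P \<in> forms k"
  shows "P = (\<Sum>m\<in>mon k. Const (Poly_Mapping.lookup P m) * Poly_Mapping.single m 1)"
proof -
  have "(\<Sum>m\<in>mon k. Poly_Mapping.single m (Poly_Mapping.lookup P m))
      = (\<Sum>m\<in>Poly_Mapping.keys P. Poly_Mapping.single m (Poly_Mapping.lookup P m))"
    using assms unfolding forms_iff_keys by (intro sum.mono_neutral_right) (auto simp: in_keys_iff)
  then have "P = (\<Sum>m\<in>mon k. Poly_Mapping.single m (Poly_Mapping.lookup P m))"
    using mpol_eq_sum_single[of P] by argo
  then show ?thesis by (simp add: single_eq_Const_mult[symmetric])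
qed

lemma lookup_shift_sum:
  assumes "P \<in> forms k"
  shows "Poly_Mapping.lookup (shift a b P) \<nu>
    = (\<Sum>m\<in>mon k. Poly_Mapping.lookup (shift a b (Poly_Mapping.single m 1)) \<nu> * Poly_Mapping.lookup P m)"
proof -
  have "Poly_Mapping.lookup (shift a b P) \<nu>
      = Poly_Mapping.lookup (shift a b (\<Sum>m\<in>mon k. Const (Poly_Mapping.lookup P m) * Poly_Mapping.single m 1)) \<nu>"
    using forms_eq_sum[OF assms] by argo
  then show ?thesis by (simp add: lookup_sum lookup_Const_mult mult.commute)
qed

text \<open>Upper semicontinuity. The equations of the special space together with its pivot
  coordinates have only the zero solution; elimination carries this over to the generic points,
  where the number of pivots then bounds the dimension.\<close>

theorem dim_fat_forms_generic_le:
  fixes a b c e :: "9 \<Rightarrow> 'k::field"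
  assumes gen: "generic_points a b"
  shows "mpol_vs.dim (fat_forms a b n k) \<le> mpol_vs.dim (fat_forms c e n k)"
proof -
  let ?x = "case_sum a b" and ?y = "case_sum c e"
  have ind: "alg_independent ?x" using gen by (simp add: generic_points_def)
  obtain S where S: "S \<subseteq> mon k" "card S \<le> mpol_vs.dim (fat_forms c e n k)"
      "\<forall>P\<in>fat_forms c e n k. (\<forall>m\<in>S. Poly_Mapping.lookup P m = 0) \<longrightarrow> P = 0"
    using pivot_coordinates[OF subspace_fat_forms, of c e n k k] by (auto simp: fat_forms_def)
  have finS: "finite S" using S(1) finite_mon finite_subset by blast
  \<comment> \<open>The rows \<open>Inl\<close> are the vanishing conditions at the points, the rows
    \<open>Inr\<close> the pivot coordinates of the special space.\<close>
  define M :: "(9 \<Rightarrow> 'k) \<Rightarrow> (9 \<Rightarrow> 'k) \<Rightarrow> (9 \<times> nat \<times> nat) + (3 \<Rightarrow>\<^sub>0 nat) \<Rightarrow> (3 \<Rightarrow>\<^sub>0 nat) \<Rightarrow> 'k" where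
    "M a b r m = (case r of
        Inl (i, j, l) \<Rightarrow> if j + l < n i \<and> j + l \<le> k
          then Poly_Mapping.lookup (shift (a i) (b i) (Poly_Mapping.single m 1)) (mono3 k j l) else 0
      | Inr s \<Rightarrow> if s \<in> S \<and> m = s then 1 else 0)" for a b r m
  have MS: "(M a b r m, M c e r m) \<in> specialisations ?x ?y" for r m
  proof (cases r)
    case (Inl p)
    obtain i j l where p: "p = (i, j, l)" by (cases p)
    have "(a i, c i) \<in> specialisations ?x ?y" "(b i, e i) \<in> specialisations ?x ?y"
      using specialisations_Var[of ?x "Inl i" ?y] specialisations_Var[of ?x "Inr i" ?y] by simp_all
    then have "spec_rel ?x ?y (shift (a i) (b i) (Poly_Mapping.single m 1)) (shift (c i) (e i) (Poly_Mapping.single m 1))"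
      by (rule spec_rel_shift)
    then show ?thesis
      using specialisations_0[of ?x ?y] unfolding M_def Inl p spec_rel_def by simp
  next
    case (Inr s)
    then show ?thesis using specialisations_0[of ?x ?y] specialisations_1[of ?x ?y] by (simp add: M_def)
  qed
  have M: "P \<in> fat_forms a b n k \<and> (\<forall>m\<in>S. Poly_Mapping.lookup P m = 0)
      \<longleftrightarrow> (\<forall>r. (\<Sum>m\<in>mon k. M a b r m * Poly_Mapping.lookup P m) = 0)" if P: "P \<in> forms k" for P a b
  proof -
    have l: "(\<Sum>m\<in>mon k. M a b (Inl (i, j, l)) m * Poly_Mapping.lookup P m)
        = (if j + l < n i \<and> j + l \<le> k then Poly_Mapping.lookup (shift (a i) (b i) P) (mono3 k j l) else 0)" for i j l
      unfolding M_def lookup_shift_sum[OF P, of "a i" "b i"]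
      by (cases "j + l < n i"; cases "j + l \<le> k"; simp)
    have "(\<Sum>m\<in>mon k. M a b (Inr s) m * Poly_Mapping.lookup P m)
        = (\<Sum>m\<in>mon k. if m = s then (if s \<in> S then Poly_Mapping.lookup P s else 0) else 0)" for s
      by (rule sum.cong) (auto simp: M_def)
    then have r: "(\<Sum>m\<in>mon k. M a b (Inr s) m * Poly_Mapping.lookup P m)
        = (if s \<in> S then Poly_Mapping.lookup P s else 0)" for s
      using S(1) by auto
    have "(\<forall>r. (\<Sum>m\<in>mon k. M a b r m * Poly_Mapping.lookup P m) = 0) \<longleftrightarrow>
        (\<forall>i j l. j + l < n i \<longrightarrow> j + l \<le> k \<longrightarrow> Poly_Mapping.lookup (shift (a i) (b i) P) (mono3 k j l) = 0)
        \<and> (\<forall>s\<in>S. Poly_Mapping.lookup P s = 0)"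
      unfolding split_sum_all split_paired_All l r by auto
    then show ?thesis unfolding fat_forms_iff ordge_iff_lookup[OF P] using P by blast
  qed
  have triv: "\<forall>m\<in>mon k. x m = 0" if x: "\<And>r. (\<Sum>m\<in>mon k. M c e r m * x m) = 0" for x
  proof -
    define P where "P = (\<Sum>m\<in>mon k. Poly_Mapping.single m (x m))"
    have lk: "Poly_Mapping.lookup P m = x m" if "m \<in> mon k" for m
    proof -
      have "Poly_Mapping.lookup P m = (\<Sum>n\<in>mon k. if n = m then x n else 0)"
        unfolding P_def lookup_sum by (rule sum.cong) (auto simp: lookup_single when_def)
      then show ?thesis using that by simp
    qed
    have "P \<in> forms k" unfolding P_def forms_iff
      by (rule homg_sum) (auto simp: homg_def mon_def split: if_splits)
    moreover have "(\<Sum>m\<in>mon k. M c e r m * Poly_Mapping.lookup P m) = 0" for r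
      using x[of r] lk by simp
    ultimately have "P = 0" using M[of P c e] S(3) by blast
    then show ?thesis using lk by simp
  qed
  have "{P \<in> fat_forms a b n k. \<forall>m\<in>S. Poly_Mapping.lookup P m = 0} \<subseteq> {0}"
  proof
    fix P assume P: "P \<in> {P \<in> fat_forms a b n k. \<forall>m\<in>S. Poly_Mapping.lookup P m = 0}"
    then have Pf: "P \<in> forms k" by (simp add: fat_forms_iff)
    have "\<forall>m\<in>mon k. Poly_Mapping.lookup P m = 0"
    proof (rule trivial_kernel_specialise[where S = "specialisations ?x ?y" and ?A1.0 = "M a b" and ?A2.0 = "M c e"])
      show "(\<Sum>j\<in>mon k. M a b r j * Poly_Mapping.lookup P j) = 0" for r
        using M[OF Pf, of a b] P by blast
      show "\<And>x'. (\<And>r. (\<Sum>j\<in>mon k. M c e r j * x' j) = 0) \<Longrightarrow> \<forall>j\<in>mon k. x' j = 0" by (rule triv)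
      show "(M a b r j, M c e r j) \<in> specialisations ?x ?y" for r j by (rule MS)
      show "(u, u') \<in> specialisations ?x ?y \<Longrightarrow> (v, v') \<in> specialisations ?x ?y \<Longrightarrow> (u * v, u' * v') \<in> specialisations ?x ?y"
        for u u' v v' by (rule specialisations_mult)
      show "(u, u') \<in> specialisations ?x ?y \<Longrightarrow> (v, v') \<in> specialisations ?x ?y \<Longrightarrow> (u - v, u' - v') \<in> specialisations ?x ?y"
        for u u' v v' by (rule specialisations_diff)
      show "(u, u') \<in> specialisations ?x ?y \<Longrightarrow> u' \<noteq> 0 \<Longrightarrow> u \<noteq> 0" for u u'
        by (rule specialisations_nonzero[OF ind])
    qed (rule finite_mon)
    then show "P \<in> {0}" using forms_0I[OF Pf] by blast
  qed
  then have "mpol_vs.dim {P \<in> fat_forms a b n k. \<forall>m\<in>S. Poly_Mapping.lookup P m = 0} \<le> card ({} :: (3, 'k) mpol set)"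
    by (intro mpol_vs.dim_le_card) auto
  then have "mpol_vs.dim (fat_forms a b n k) \<le> card S"
    using dim_le_kernels[of S "fat_forms a b n k" "\<lambda>m P. Poly_Mapping.lookup P m",
        OF finS fdim_fat_forms subspace_fat_forms functional_lookup] by simp
  then show ?thesis using S(2) by simp
qed

section \<open>Points on a cuspidal cubic\<close>

text \<open>Its only singular point, in every characteristic, is the cusp (1 : 0 : 0).\<close>

definition cubic :: "(3, 'k::comm_ring_1) mpol" where
  "cubic = Var 1 ^ 3 - Var 0 * Var 2 ^ 2"

text \<open>Restriction to the cubic along t -> (1 : t^2 : t^3), which reaches every point of the
  curve except (0 : 0 : 1).\<close>

definition cusp :: "(3, 'k::comm_ring_1) mpol \<Rightarrow> 'k poly" where
  "cusp = evh (\<lambda>c. [:c:]) (\<lambda>v. if v = 0 then 1 else if v = 1 then monom 1 2 else monom 1 3)"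

lemma rhom_const_poly: "rhom (\<lambda>c. [:c:])"
  by (rule rhomI) (simp_all add: one_pCons)

lemma rhom_cusp: "rhom cusp"
  by (simp add: cusp_def rhom_evh rhom_const_poly)

lemma cusp_Var [simp]: "cusp (Var 0) = 1" "cusp (Var 1) = monom 1 2" "cusp (Var 2) = monom 1 3"
    "cusp (Const c) = [:c:]"
  by (simp_all add: cusp_def evh_Var evh_Const rhom_const_poly)

lemma cusp_single: "cusp (Poly_Mapping.single m c) = monom c (2 * Poly_Mapping.lookup m 1 + 3 * Poly_Mapping.lookup m 2)"
proof -
  have "cusp (Poly_Mapping.single m c) = [:c:] * (1 ^ Poly_Mapping.lookup m 0 *
      monom 1 2 ^ Poly_Mapping.lookup m 1 * monom 1 3 ^ Poly_Mapping.lookup m 2)"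
    unfolding single_eq_Const_mult[of m c] prod_Var_power[symmetric] rhom_simps[OF rhom_cusp] prod_3 cusp_Var ..
  also have "\<dots> = monom c (2 * Poly_Mapping.lookup m 1 + 3 * Poly_Mapping.lookup m 2)"
    by (simp add: monom_power mult_monom smult_monom)
  finally show ?thesis .
qed

lemma coeff_cusp:
  assumes "P \<in> forms d"
  shows "coeff (cusp P) j = (\<Sum>m\<in>Poly_Mapping.keys P.
    if 2 * Poly_Mapping.lookup m 1 + 3 * Poly_Mapping.lookup m 2 = j then Poly_Mapping.lookup P m else 0)"
proof -
  have "cusp P = (\<Sum>m\<in>Poly_Mapping.keys P. cusp (Poly_Mapping.single m (Poly_Mapping.lookup P m)))"
    unfolding rhom_sum[OF rhom_cusp, symmetric] mpol_eq_sum_single[symmetric] ..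
  then show ?thesis by (simp add: cusp_single coeff_sum)
qed

lemma functional_coeff_cusp: "functional (\<lambda>P. coeff (cusp P) j)"
  by (simp add: functional_def rhom_simps[OF rhom_cusp])

lemma degree_cusp:
  assumes "P \<in> forms d" shows "degree (cusp P) \<le> 3 * d"
proof (rule degree_le, intro allI impI)
  fix j assume j: "3 * d < j"
  have "2 * Poly_Mapping.lookup m 1 + 3 * Poly_Mapping.lookup m 2 \<noteq> j" if "m \<in> Poly_Mapping.keys P" for m
  proof -
    have "m \<in> mon d" using that assms by (auto simp: forms_iff_keys)
    then show ?thesis using j by (simp add: mon_def wt_UNIV3)
  qed
  then show "coeff (cusp P) j = 0" unfolding coeff_cusp[OF assms] by (intro sum.neutral) simp
qed

text \<open>1 is not of the form 2 i + 3 j. This gap of the cusp lowers the count of conditions from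
  3 d + 1 to 3 d.\<close>

lemma coeff_cusp_1:
  assumes "P \<in> forms d" shows "coeff (cusp P) 1 = 0"
  unfolding coeff_cusp[OF assms] by (rule sum.neutral) (auto, presburger)

lemma homg_cubic: "homg UNIV 3 (cubic :: (3, 'k::comm_ring_1) mpol)"
proof -
  have "homg UNIV (3 * 1) (Var 1 ^ 3 :: (3, 'k) mpol)" "homg UNIV (1 + 2 * 1) (Var 0 * Var 2 ^ 2 :: (3, 'k) mpol)"
    by (intro homg_mult homg_power; simp)+
  then show ?thesis unfolding cubic_def by (intro homg_diff) (simp_all add: numeral_3_eq_3)
qed

lemma cusp_cubic: "cusp cubic = 0"
  unfolding cubic_def rhom_simps[OF rhom_cusp] cusp_Var by (simp add: monom_power)

text \<open>Replacing x_1^3 by x_0 x_2^2 keeps the degree and lowers the exponent of x_1, so it can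
  be repeated until that exponent is below 3.\<close>

lemma cubic_division_single:
  "\<exists>Q R. Poly_Mapping.single m (c :: 'k::comm_ring_1) = cubic * Q + R \<and>
    (\<forall>n\<in>Poly_Mapping.keys R. Poly_Mapping.lookup n 1 < 3 \<and> wt UNIV n = wt UNIV m)"
proof (induction "Poly_Mapping.lookup m 1" arbitrary: m rule: less_induct)
  case less
  show ?case
  proof (cases "Poly_Mapping.lookup m 1 < 3")
    case True
    then show ?thesis by (intro exI[of _ 0] exI[of _ "Poly_Mapping.single m c"]) auto
  next
    case False
    let ?e = "Poly_Mapping.single 1 3 :: 3 \<Rightarrow>\<^sub>0 nat" and ?f = "Poly_Mapping.single 0 1 + Poly_Mapping.single 2 2 :: 3 \<Rightarrow>\<^sub>0 nat"
    let ?m = "m - ?e"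
    have m: "?e + ?m = m"
      by (rule poly_mapping_eqI3) (use False in \<open>auto simp: lookup_add lookup_minus lookup_single when_def\<close>)
    have wtm: "wt UNIV m = wt UNIV ?m + 3"
      by (subst m[symmetric]) (simp add: wt_add wt_single)
    have "Poly_Mapping.lookup (?f + ?m) 1 < Poly_Mapping.lookup m 1"
      using False by (simp add: lookup_add lookup_minus lookup_single)
    from less[OF this] obtain Q R where QR: "Poly_Mapping.single (?f + ?m) c = cubic * Q + R"
        "\<forall>n\<in>Poly_Mapping.keys R. Poly_Mapping.lookup n 1 < 3 \<and> wt UNIV n = wt UNIV (?f + ?m)" by blast
    have V: "(Var v :: (3, 'k) mpol) ^ n = Poly_Mapping.single (Poly_Mapping.single v n) 1" for v n
      by (induction n) (simp_all add: Var_def mult_single single_add[symmetric])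
    have V1: "(Var v :: (3, 'k) mpol) = Poly_Mapping.single (Poly_Mapping.single v 1) 1" for v by (simp add: Var_def)
    have "Poly_Mapping.single m c = Var 1 ^ 3 * Poly_Mapping.single ?m c"
      unfolding V mult_single by (simp add: m)
    also have "\<dots> = cubic * Poly_Mapping.single ?m c + Var 0 * Var 2 ^ 2 * Poly_Mapping.single ?m c"
      unfolding distrib_right[symmetric] by (simp add: cubic_def)
    also have "Var 0 * Var 2 ^ 2 * Poly_Mapping.single ?m c = Poly_Mapping.single (?f + ?m) c"
      unfolding V V1[of 0] mult_single by simp
    finally have "Poly_Mapping.single m c = cubic * (Poly_Mapping.single ?m c + Q) + R"
      unfolding QR(1) by (simp only: distrib_left add.assoc)
    moreover have "wt UNIV (?f + ?m) = wt UNIV m" by (simp add: wtm wt_add wt_single)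
    ultimately show ?thesis using QR(2) by metis
  qed
qed

lemma cubic_division:
  assumes "P \<in> forms d"
  shows "\<exists>Q R. P = cubic * Q + R \<and> R \<in> forms d \<and> (\<forall>n\<in>Poly_Mapping.keys R. Poly_Mapping.lookup n 1 < 3)"
proof -
  have "\<forall>m. \<exists>Q R. Poly_Mapping.single m (Poly_Mapping.lookup P m) = cubic * Q + R \<and>
    (\<forall>n\<in>Poly_Mapping.keys R. Poly_Mapping.lookup n 1 < 3 \<and> wt UNIV n = wt UNIV m)"
    using cubic_division_single by blast
  then obtain Q R where QR: "\<And>m. Poly_Mapping.single m (Poly_Mapping.lookup P m) = cubic * Q m + R m"
    "\<And>m n. n \<in> Poly_Mapping.keys (R m) \<Longrightarrow> Poly_Mapping.lookup n 1 < 3 \<and> wt UNIV n = wt UNIV m" by metis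
  let ?K = "Poly_Mapping.keys P"
  have "P = (\<Sum>m\<in>?K. cubic * Q m + R m)"
    using mpol_eq_sum_single[of P] unfolding QR(1) .
  then have "P = cubic * (\<Sum>m\<in>?K. Q m) + (\<Sum>m\<in>?K. R m)"
    by (simp add: sum.distrib sum_distrib_left)
  moreover have "(\<Sum>m\<in>?K. R m) \<in> forms d"
    unfolding forms_iff
  proof (rule homg_sum)
    fix m assume "m \<in> ?K"
    then have "wt UNIV m = d" using assms by (auto simp: forms_iff homg_def)
    then show "homg UNIV d (R m)" using QR(2) by (auto simp: homg_def)
  qed
  moreover have "Poly_Mapping.lookup n 1 < 3" if n: "n \<in> Poly_Mapping.keys (\<Sum>m\<in>?K. R m)" for n
  proof -
    have "\<exists>m\<in>?K. Poly_Mapping.lookup (R m) n \<noteq> 0"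
    proof (rule ccontr)
      assume "\<not> ?thesis"
      then have "Poly_Mapping.lookup (\<Sum>m\<in>?K. R m) n = 0" unfolding lookup_sum by (intro sum.neutral) blast
      then show False using n by (simp add: in_keys_iff)
    qed
    then show ?thesis using QR(2) by (auto simp: in_keys_iff)
  qed
  ultimately show ?thesis by blast
qed

text \<open>Monomials of one degree with x_1-exponent below 3 have different weights 2 i + 3 j: the
  residue modulo 3 determines i, then j follows. Hence a remainder that restricts to zero has no
  terms.\<close>

lemma cusp_kernel:
  assumes P: "P \<in> forms d" and 0: "cusp P = 0"
  shows "\<exists>Q. P = cubic * Q"
proof -
  obtain Q R where QR: "P = cubic * Q + R" "R \<in> forms d" "\<forall>n\<in>Poly_Mapping.keys R. Poly_Mapping.lookup n 1 < 3"
    using cubic_division[OF P] by blast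
  have R0: "cusp R = 0" using 0 unfolding QR(1) rhom_simps[OF rhom_cusp] cusp_cubic by simp
  have "n \<notin> Poly_Mapping.keys R" for n
  proof
    assume n: "n \<in> Poly_Mapping.keys R"
    let ?w = "\<lambda>m. 2 * Poly_Mapping.lookup m 1 + 3 * Poly_Mapping.lookup m (2::3)"
    have uniq: "m = n" if m: "m \<in> Poly_Mapping.keys R" "?w m = ?w n" for m
    proof -
      have lt: "Poly_Mapping.lookup m 1 < 3" "Poly_Mapping.lookup n 1 < 3" using QR(3) m n by blast+
      have e1: "Poly_Mapping.lookup m 1 = Poly_Mapping.lookup n 1" using lt m(2) by presburger
      then have e2: "Poly_Mapping.lookup m 2 = Poly_Mapping.lookup n 2" using m(2) by simp
      have "wt UNIV m = d" "wt UNIV n = d" using QR(2) m n by (auto simp: forms_iff homg_def)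
      then have "Poly_Mapping.lookup m 0 = Poly_Mapping.lookup n 0" using e1 e2 by (simp add: wt_UNIV3)
      then show ?thesis using e1 e2 by (intro poly_mapping_eqI3)
    qed
    have "coeff (cusp R) (?w n) = (\<Sum>m\<in>Poly_Mapping.keys R. if m = n then Poly_Mapping.lookup R m else 0)"
      unfolding coeff_cusp[OF QR(2)] using uniq by (intro sum.cong) auto
    also have "\<dots> = Poly_Mapping.lookup R n" using n by simp
    finally show False using n R0 by (simp add: in_keys_iff)
  qed
  then have "R = 0" using keys_eq_empty[of R] by blast
  then show ?thesis using QR(1) by auto
qed

text \<open>The coefficients \<open>3 t\<^sup>4\<close> and \<open>2 t\<^sup>3\<close> of the tangent line cannot vanish simultaneously in any characteristic.\<close>

lemma not_ordge_2_cubic: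
  fixes t :: "'k::field"
  assumes "t \<noteq> 0"
  shows "\<not> ordge (t\<^sup>2) (t ^ 3) 2 cubic"
proof
  assume ord: "ordge (t\<^sup>2) (t ^ 3) 2 cubic"
  let ?L = "Const (3 * t ^ 4) * (Var 0 ^ 2 * Var 1) - Const (2 * t ^ 3) * (Var 0 ^ 2 * Var 2) :: (3, 'k) mpol"
  \<comment> \<open>\<open>?L\<close> is the linear part of the cubic at the point, and
    \<open>?H\<close> collects the terms of order at least 2.\<close>
  let ?H = "Var 1 ^ 2 * (Var 1 + Const (3 * t\<^sup>2) * Var 0) - Var 2 ^ 2 * Var 0 :: (3, 'k) mpol"
  have C: "Const (x * y) = Const x * Const y" "Const (x ^ n) = Const x ^ n" for x y :: 'k and n
    by (simp_all add: Const_simps)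
  have C3: "Const 3 = (3 :: (3, 'k) mpol)" "Const 2 = (2 :: (3, 'k) mpol)" by (simp_all add: Const_def)
  have "shift (t\<^sup>2) (t ^ 3) cubic = (Var 1 + Const (t\<^sup>2) * Var 0) ^ 3 - Var 0 * (Var 2 + Const (t ^ 3) * Var 0) ^ 2"
    unfolding cubic_def shift_simps shift_Var ..
  also have "\<dots> = ?L + ?H"
    unfolding C C3 by algebra
  finally have eq: "?L = shift (t\<^sup>2) (t ^ 3) cubic - ?H" by simp
  have V: "wtge {1, 2} 1 (Var 1 :: (3, 'k) mpol)" "wtge {1, 2} 1 (Var 2 :: (3, 'k) mpol)"
    using homg_imp_wtge[OF homg_Var[of "{1, 2::3}" 1], of 1] homg_imp_wtge[OF homg_Var[of "{1, 2::3}" 2], of 1] by simp_all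
  have "wtge {1, 2} (2 * 1) ?H"
    by (intro wtge_diff wtge_mult_right wtge_power V)
  then have H: "wtge {1, 2} 2 ?H" by (simp only: mult_1_right)
  have "wtge {1, 2} 2 ?L" unfolding eq by (rule wtge_diff[OF ord[unfolded ordge_def] H])
  moreover have "homg {1, 2} 1 ?L"
  proof -
    have v: "homg {1, 2} 0 (Var 0 :: (3, 'k) mpol)" "homg {1, 2} 1 (Var 1 :: (3, 'k) mpol)" "homg {1, 2} 1 (Var 2 :: (3, 'k) mpol)"
      using homg_Var[of "{1, 2::3}" 0] homg_Var[of "{1, 2::3}" 1] homg_Var[of "{1, 2::3}" 2] by simp_all
    have "homg {1, 2} (2 * 0 + 1) (Var 0 ^ 2 * Var 1 :: (3, 'k) mpol)" "homg {1, 2} (2 * 0 + 1) (Var 0 ^ 2 * Var 2 :: (3, 'k) mpol)"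
      by (intro homg_mult homg_power v)+
    then show ?thesis by (intro homg_diff homg_Const_mult) simp_all
  qed
  ultimately have "Poly_Mapping.keys ?L = {}" unfolding wtge_def homg_def by fastforce
  then have L0: "?L = 0" using keys_eq_empty by blast
  \<comment> \<open>Evaluation at (1 : 1 : 0) and at (1 : 0 : 1) isolates the two coefficients of
    the tangent line.\<close>
  have "ev (\<lambda>v. if v = 2 then 0 else 1) ?L = 3 * t ^ 4" "ev (\<lambda>v. if v = 1 then 0 else 1) ?L = - (2 * t ^ 3)"
    by (simp_all only: ev_simps ev_Const ev_Var) simp_all
  then have "3 * t ^ 4 = 0" "2 * t ^ 3 = 0" unfolding L0 by simp_all
  then have "(3::'k) = 0" "(2::'k) = 0" using assms by simp_all
  moreover have "(1::'k) = 3 - 2" by simp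
  ultimately have "(1::'k) = 0" by simp
  then show False by simp
qed

text \<open>On the curve the translated coordinates become T^2 - t^2 and T^3 - t^3, both divisible
  by T - t, so each unit of order contributes one such factor.\<close>

lemma cusp_ordge_dvd:
  fixes t :: "'k::field"
  assumes "ordge (t\<^sup>2) (t ^ 3) n P"
  shows "[:- t, 1:] ^ n dvd cusp P"
proof -
  let ?Q = "shift (t\<^sup>2) (t ^ 3) P" and ?h = "\<lambda>P. cusp (shift (- (t\<^sup>2)) (- (t ^ 3)) P)"
  have h: "rhom ?h" using rhom_cusp rhom_shift by (rule rhom_comp)
  have d1: "[:- t, 1:] dvd ?h (Var 1)" "[:- t, 1:] dvd ?h (Var 2)"
    unfolding shift_Var rhom_simps[OF rhom_cusp] cusp_Var
    by (simp_all add: poly_eq_0_iff_dvd[symmetric] poly_monom)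
  have "cusp P = ?h ?Q" by (simp only: shift_shift')
  also have "\<dots> = (\<Sum>m\<in>Poly_Mapping.keys ?Q. ?h (Const (Poly_Mapping.lookup ?Q m)) * (\<Prod>v\<in>UNIV. ?h (Var v) ^ Poly_Mapping.lookup m v))"
    unfolding rhom_eq_evh[OF h, of ?Q] evh_def ..
  also have "[:- t, 1:] ^ n dvd \<dots>"
  proof (rule dvd_sum)
    fix m assume "m \<in> Poly_Mapping.keys ?Q"
    then have n: "n \<le> Poly_Mapping.lookup m 1 + Poly_Mapping.lookup m 2"
      using assms by (auto simp: ordge_def wtge_def wt_12)
    have "[:- t, 1:] ^ Poly_Mapping.lookup m 1 * [:- t, 1:] ^ Poly_Mapping.lookup m 2
        dvd ?h (Var 1) ^ Poly_Mapping.lookup m 1 * ?h (Var 2) ^ Poly_Mapping.lookup m 2"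
      by (intro mult_dvd_mono dvd_power_same d1)
    then have "[:- t, 1:] ^ n dvd ?h (Var 1) ^ Poly_Mapping.lookup m 1 * ?h (Var 2) ^ Poly_Mapping.lookup m 2"
      unfolding power_add[symmetric] using le_imp_power_dvd[OF n] dvd_trans by blast
    then show "[:- t, 1:] ^ n dvd ?h (Const (Poly_Mapping.lookup ?Q m)) * (\<Prod>v\<in>UNIV. ?h (Var v) ^ Poly_Mapping.lookup m v)"
      unfolding prod_3 mult.assoc by (rule dvd_mult[OF dvd_mult])
  qed
  finally show ?thesis .
qed

lemma dim_mult_image_le:
  assumes "U \<subseteq> (\<lambda>Q. M * Q) ` V" "fdim V"
  shows "mpol_vs.dim U \<le> mpol_vs.dim V"
proof -
  obtain B where B: "V \<subseteq> mpol_vs.span B" "card B = mpol_vs.dim V" "finite B"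
    by (rule fdim_basis[OF assms(2)])
  have "M * Q \<in> mpol_vs.span ((\<lambda>Q. M * Q) ` B)" if "Q \<in> mpol_vs.span B" for Q
    using that
  proof (induction rule: mpol_vs.span_induct_alt)
    case (step c x y)
    have "Const c * (M * x) + M * y \<in> mpol_vs.span ((\<lambda>Q. M * Q) ` B)"
      using step by (intro mpol_vs.span_add[OF mpol_vs.span_scale[OF mpol_vs.span_base]]) auto
    then show ?case by (simp only: distrib_left mult.left_commute)
  next
    case base
    show ?case using mpol_vs.span_zero by simp
  qed
  then have "U \<subseteq> mpol_vs.span ((\<lambda>Q. M * Q) ` B)" using assms(1) B(1) by blast
  then have "mpol_vs.dim U \<le> card ((\<lambda>Q. M * Q) ` B)" using B(3) by (intro mpol_vs.dim_le_card) auto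
  also have "\<dots> \<le> card B" using B(3) by (rule card_image_le)
  finally show ?thesis using B(2) by simp
qed

text \<open>Multiplication by a polynomial with nonzero constant term is triangular and invertible
  on the low coefficients.\<close>

lemma coeff_eq_0_of_mult:
  fixes D h :: "'k::idom poly"
  assumes D: "coeff D 0 \<noteq> 0" and c: "\<And>j. j \<le> N \<Longrightarrow> coeff (D * h) j = 0" and "j \<le> N"
  shows "coeff h j = 0"
  using \<open>j \<le> N\<close>
proof (induction j rule: less_induct)
  case (less j)
  have s: "{..j} = insert 0 {1..j}" by auto
  have "0 = coeff (D * h) j" using c[OF less.prems] by simp
  also have "\<dots> = (\<Sum>i\<in>insert 0 {1..j}. coeff D i * coeff h (j - i))"
    unfolding coeff_mult s ..
  also have "\<dots> = coeff D 0 * coeff h j + (\<Sum>i\<in>{1..j}. coeff D i * coeff h (j - i))"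
    by (subst sum.insert) auto
  also have "(\<Sum>i\<in>{1..j}. coeff D i * coeff h (j - i)) = 0"
    using less by (intro sum.neutral) auto
  finally show ?case using D by simp
qed

text \<open>Nine distinct smooth points of the cubic; the parameter 0 would be the cusp.\<close>

locale cusp_points =
  fixes t :: "9 \<Rightarrow> 'k::field"
  assumes inj_t: "inj t" and t_nonzero: "\<And>i. t i \<noteq> 0"
begin

abbreviation "V n d \<equiv> fat_forms (\<lambda>i. (t i)\<^sup>2) (\<lambda>i. t i ^ 3) n d"

lemma prod_dvd_cusp:
  assumes "P \<in> V n d"
  shows "(\<Prod>i\<in>UNIV. [:- t i, 1:] ^ n i) dvd cusp P"
proof -
  have "(\<Prod>i\<in>A. [:- t i, 1:] ^ n i) dvd cusp P" if "finite A" for A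
    using that
  proof (induction A rule: finite_induct)
    case (insert i A)
    let ?D = "\<Prod>i\<in>A. [:- t i, 1:] ^ n i"
    obtain h where h: "cusp P = ?D * h" using insert.IH by blast
    have "poly ?D (t i) \<noteq> 0"
      using insert.hyps inj_t by (auto simp: poly_prod prod_zero_iff dest: injD)
    then have o: "order (t i) ?D = 0" by (simp add: order_0I)
    have "[:- t i, 1:] ^ n i dvd ?D * h"
      using assms unfolding h[symmetric] by (intro cusp_ordge_dvd) (auto simp: fat_forms_iff)
    then have "?D * h = 0 \<or> n i \<le> order (t i) (?D * h)"
      by (simp only: order_divides)
    moreover have "?D \<noteq> 0" using \<open>poly ?D (t i) \<noteq> 0\<close> by auto
    ultimately have "h = 0 \<or> n i \<le> order (t i) h"
      using o order_mult[of ?D h "t i"] by (cases "h = 0") simp_all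
    then have "[:- t i, 1:] ^ n i dvd h" by (simp add: order_divides)
    then have "?D * [:- t i, 1:] ^ n i dvd ?D * h" by (rule mult_dvd_mono[OF dvd_refl])
    then show ?case unfolding h using insert.hyps by (simp add: mult.commute)
  qed simp
  then show ?thesis by simp
qed

text \<open>After division by its forced zeros the restriction has degree at most \<open>N\<close>,
  so its coefficients up to \<open>N\<close> determine it. The one with index 1 vanishes by
  itself.\<close>

lemma cusp_eq_0I:
  assumes P: "P \<in> V n d" and N: "int N \<ge> 3 * int d - (\<Sum>i\<in>UNIV. int (n i))"
    and c: "\<And>j. j \<le> N \<Longrightarrow> j \<noteq> 1 \<Longrightarrow> coeff (cusp P) j = 0"
  shows "cusp P = 0"
proof (rule ccontr)
  assume nz: "cusp P \<noteq> 0"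
  let ?D = "\<Prod>i\<in>UNIV. [:- t i, 1:] ^ n i"
  have Pf: "P \<in> forms d" using P by (simp add: fat_forms_iff)
  obtain h where h: "cusp P = ?D * h" using prod_dvd_cusp[OF P] by blast
  have D0: "coeff ?D 0 \<noteq> 0"
    by (simp add: poly_0_coeff_0[symmetric] poly_prod prod_zero_iff t_nonzero)
  have D: "?D \<noteq> 0" using D0 by auto
  have "h \<noteq> 0" using nz h by auto
  have degD: "degree ?D = (\<Sum>i\<in>UNIV. n i)"
    by (subst degree_prod_eq_sum_degree) (auto simp: degree_power_eq)
  have "degree ?D + degree h \<le> 3 * d"
    using degree_cusp[OF Pf] degree_mult_eq[OF D \<open>h \<noteq> 0\<close>] unfolding h by simp
  then have "int (degree ?D) + int (degree h) \<le> 3 * int d" by linarith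
  moreover have "int (degree ?D) = (\<Sum>i\<in>UNIV. int (n i))" unfolding degD by (rule int_sum)
  ultimately have dh: "degree h \<le> N" using N by linarith
  have X1: "coeff (cusp P) 1 = 0" by (rule coeff_cusp_1[OF Pf])
  have cj: "coeff (?D * h) j = 0" if "j \<le> N" for j
    unfolding h[symmetric] using c[OF that] X1 by (cases "j = 1") simp_all
  have "coeff h j = 0" if "j \<le> N" for j
    using D0 cj that by (rule coeff_eq_0_of_mult)
  then have "h = 0" using dh by (metis leading_coeff_0_iff)
  then show False using \<open>h \<noteq> 0\<close> by simp
qed

text \<open>Forms that restrict to zero are the cubic times forms of degree \<open>d - 3\<close>,
  with multiplicities lowered by one because the cubic is smooth at the points. For
  \<open>d < 3\<close> nothing but 0 restricts to zero.\<close>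

lemma dim_cusp_step:
  assumes N: "int N = 3 * int d - (\<Sum>i\<in>UNIV. int (n i))" "1 \<le> N"
  shows "mpol_vs.dim (V n d) \<le> N + (if 3 \<le> d then mpol_vs.dim (V (\<lambda>i. n i - 1) (d - 3)) else 0)"
proof -
  let ?I = "{..N} - {1}"
  let ?U = "{P \<in> V n d. \<forall>j\<in>?I. coeff (cusp P) j = 0}"
  \<comment> \<open>Leaving out index 1 gives \<open>N\<close> conditions instead of
    \<open>N + 1\<close>.\<close>
  have "card ?I = N" using N(2) by (simp add: card_Diff_singleton)
  then have le: "mpol_vs.dim (V n d) \<le> mpol_vs.dim ?U + N"
    using dim_le_kernels[of ?I "V n d" "\<lambda>j P. coeff (cusp P) j", OF _ fdim_fat_forms subspace_fat_forms functional_coeff_cusp]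
    by simp
  have U: "\<exists>Q. P = cubic * Q \<and> (3 \<le> d \<longrightarrow> Q \<in> V (\<lambda>i. n i - 1) (d - 3)) \<and> (d < 3 \<longrightarrow> Q = 0)" if P: "P \<in> ?U" for P
  proof -
    have Pf: "P \<in> forms d" and ord: "\<And>i. ordge ((t i)\<^sup>2) (t i ^ 3) (n i) P" using P by (simp_all add: fat_forms_iff)
    have "cusp P = 0" by (rule cusp_eq_0I[of P n d N]) (use P N in auto)
    then obtain Q where Q: "P = cubic * Q" using cusp_kernel[OF Pf] by blast
    show ?thesis
    proof (cases "Q = 0")
      case True
      then show ?thesis using Q by (intro exI[of _ 0]) (simp add: mpol_vs.subspace_0[OF subspace_fat_forms])
    next
      case False
      have cn: "cubic \<noteq> (0 :: (3, 'k) mpol)" using not_ordge_2_cubic[OF t_nonzero] by (metis ordge_zero)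
      obtain m where "m \<in> Poly_Mapping.keys Q" using False keys_eq_empty by blast
      have d3: "3 \<le> d"
      proof (rule ccontr)
        assume "\<not> 3 \<le> d"
        have c3: "wtge UNIV 3 (cubic :: (3, 'k) mpol)" by (rule homg_imp_wtge[OF homg_cubic]) simp
        have "wtge UNIV 3 P" unfolding Q by (rule wtge_mult_right[OF c3])
        then have "Poly_Mapping.keys P = {}" using Pf \<open>\<not> 3 \<le> d\<close> unfolding forms_iff homg_def wtge_def by fastforce
        then have "P = 0" using keys_eq_empty by blast
        then show False using Q False cn by simp
      qed
      have "homg UNIV (3 + (d - 3)) (cubic * Q)" using Pf d3 Q by (simp add: forms_iff)
      then have "homg UNIV (d - 3) Q" using homg_cubic cn by (rule homg_cancel)
      moreover have "ordge ((t i)\<^sup>2) (t i ^ 3) (n i - 1) Q" for i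
      proof (cases "n i")
        case (Suc k)
        have "ordge ((t i)\<^sup>2) (t i ^ 3) (1 + k) (cubic * Q)" using ord[of i] Suc Q by simp
        moreover have "\<not> ordge ((t i)\<^sup>2) (t i ^ 3) (Suc 1) cubic"
          using not_ordge_2_cubic[OF t_nonzero[of i]] by (simp add: numeral_2_eq_2)
        ultimately have "ordge ((t i)\<^sup>2) (t i ^ 3) k Q" by (rule ordge_cancel)
        then show ?thesis using Suc by simp
      qed simp
      ultimately show ?thesis using Q d3 by (auto simp: fat_forms_iff forms_iff)
    qed
  qed
  show ?thesis
  proof (cases "3 \<le> d")
    case True
    then have "?U \<subseteq> (\<lambda>Q. cubic * Q) ` V (\<lambda>i. n i - 1) (d - 3)" using U by blast
    then have "mpol_vs.dim ?U \<le> mpol_vs.dim (V (\<lambda>i. n i - 1) (d - 3))"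
      using fdim_fat_forms by (rule dim_mult_image_le)
    then show ?thesis using le True by simp
  next
    case False
    then have "?U \<subseteq> mpol_vs.span {}" using U by fastforce
    then have "mpol_vs.dim ?U \<le> card ({} :: (3, 'k) mpol set)" by (intro mpol_vs.dim_le_card) auto
    then show ?thesis using le False by simp
  qed
qed

end

lemma infinite_imp_cusp_points:
  assumes "infinite (UNIV :: 'k::field set)"
  shows "\<exists>t :: 9 \<Rightarrow> 'k. cusp_points t"
proof -
  have "infinite (UNIV - {0 :: 'k})" using assms by simp
  then obtain S where S: "S \<subseteq> UNIV - {0 :: 'k}" "finite S" "card S = 9"
    using infinite_arbitrarily_large by blast
  then have "card S = card (UNIV :: 9 set)" by simp
  then obtain f where "bij_betw f (UNIV :: 9 set) S" using S(2) finite_same_card_bij[of "UNIV :: 9 set" S] by auto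
  then have "cusp_points f" using S(1) unfolding bij_betw_def by unfold_locales blast+
  then show ?thesis by blast
qed

section \<open>Expected dimension and anticanonical degree\<close>

text \<open>The Riemann-Roch number of a class, kept as an integer because it may be
  negative.\<close>

definition chi :: "nat \<Rightarrow> (9 \<Rightarrow> nat) \<Rightarrow> int" where
  "chi d n = int ((d + 2) choose 2) - (\<Sum>i\<in>UNIV. int ((n i + 1) choose 2))"

text \<open>The intersection number with -K = 3 L - E_1 - ... - E_9.\<close>

definition antican :: "nat \<Rightarrow> (9 \<Rightarrow> nat) \<Rightarrow> int" where
  "antican d n = 3 * int d - (\<Sum>i\<in>UNIV. int (n i))"

lemma choose_two_int: "2 * int (n choose 2) = int n * (int n - 1)"
proof (induction n)
  case (Suc n)
  then show ?case by (simp add: numeral_2_eq_2 algebra_simps)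
qed simp

lemma two_chi: "2 * chi d n = (int d + 1) * (int d + 2) - (\<Sum>i\<in>UNIV. int (n i) * (int (n i) + 1))"
  unfolding chi_def right_diff_distrib sum_distrib_left choose_two_int by (simp add: algebra_simps)

text \<open>\<chi>(F) = -K.F + \<chi>(F + K), the numerical counterpart of removing the cubic.
  Truncation at multiplicity 0 does no harm, since r (r + 1) vanishes at r = 0 as well as at r =
  -1.\<close>

lemma chi_step:
  assumes "3 \<le> d"
  shows "chi d n = antican d n + chi (d - 3) (\<lambda>i. n i - 1)"
proof -
  have 1: "int (n i) * (int (n i) + 1) - int (n i - 1) * (int (n i - 1) + 1) = 2 * int (n i)" for i
    by (cases "n i") (simp_all add: algebra_simps)
  have s: "(\<Sum>i\<in>UNIV. int (n i) * (int (n i) + 1)) - (\<Sum>i\<in>UNIV. int (n i - 1) * (int (n i - 1) + 1))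
      = 2 * (\<Sum>i\<in>UNIV. int (n i))"
    unfolding sum_subtractf[symmetric] 1 sum_distrib_left ..
  obtain k where k: "d = k + 3" using assms by (metis le_Suc_ex add.commute)
  have "int d = int k + 3" "int (d - 3) = int k" by (simp_all add: k)
  moreover have "(int k + 3 + 1) * (int k + 3 + 2) = 6 * (int k + 3) + (int k + 1) * (int k + 2)"
    by (simp add: algebra_simps)
  ultimately show ?thesis
    using s two_chi[of d n] two_chi[of "d - 3" "\<lambda>i. n i - 1"] unfolding antican_def by (smt (verit))
qed

lemma dim_fat_forms_ge_chi: "chi k n \<le> int (mpol_vs.dim (fat_forms a b n k))"
  using dim_fat_forms_ge[where a = a and b = b and n = n and k = k, THEN iffD2[OF of_nat_le_iff[where 'a = int]]]
  unfolding chi_def by simp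

lemma sorting_9:
  fixes n :: "9 \<Rightarrow> nat"
  obtains e :: "nat \<Rightarrow> 9" where "bij_betw e {..<9} UNIV" "\<And>p q. p \<le> q \<Longrightarrow> q < 9 \<Longrightarrow> n (e q) \<le> n (e p)"
proof -
  obtain xs where xs: "set xs = (UNIV :: 9 set)" "distinct xs" using finite_distinct_list[of "UNIV :: 9 set"] by auto
  define ys where "ys = rev (sort_key n xs)"
  have ys: "set ys = UNIV" "distinct ys" by (simp_all add: ys_def xs)
  then have "length ys = CARD(9)" by (metis distinct_card)
  then have len: "length ys = 9" by simp
  have "sorted (rev (map n ys))" by (simp add: ys_def rev_map)
  then have s: "n (ys ! q) \<le> n (ys ! p)" if "p \<le> q" "q < 9" for p q
    using that len sorted_rev_nth_mono[of "map n ys" p q] by simp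
  have "bij_betw ((!) ys) {..<9} UNIV" using bij_betw_nth[OF ys(2)] len ys(1) by auto
  then show thesis using s that by blast
qed

lemma sum_lessThan_9: "(\<Sum>p<9. f p) = f 0 + f 1 + f 2 + f 3 + f 4 + f 5 + f 6 + f 7 + f (8::nat)"
  for f :: "nat \<Rightarrow> 'a::comm_monoid_add"
  by (simp add: eval_nat_numeral)

lemma dim_fat_forms_le_forms: "mpol_vs.dim (fat_forms a b n d) \<le> (d + 2) choose 2"
  using dim_mono_fdim[OF fdim_forms, of "fat_forms a b n d" d] by (simp add: fat_forms_def dim_forms)

lemma chi_zero: "(\<And>i. n i = 0) \<Longrightarrow> chi d n = int ((d + 2) choose 2)"
  by (simp add: chi_def numeral_2_eq_2)

lemma dim_le_chi_zero:
  assumes "\<And>i. n i = 0" shows "int (mpol_vs.dim (fat_forms a b n d)) \<le> chi d n"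
  unfolding chi_zero[OF assms] of_nat_le_iff by (rule dim_fat_forms_le_forms)

context cusp_points
begin

lemma dim_cusp_step_int:
  assumes "1 \<le> antican d n"
  shows "int (mpol_vs.dim (V n d)) \<le> antican d n + (if 3 \<le> d then int (mpol_vs.dim (V (\<lambda>i. n i - 1) (d - 3))) else 0)"
proof -
  have N: "int (nat (antican d n)) = 3 * int d - (\<Sum>i\<in>UNIV. int (n i))" "1 \<le> nat (antican d n)"
    using assms unfolding antican_def by linarith+
  have "int (mpol_vs.dim (V n d)) \<le> int (nat (antican d n) + (if 3 \<le> d then mpol_vs.dim (V (\<lambda>i. n i - 1) (d - 3)) else 0))"
    using dim_cusp_step[OF N] by (simp only: of_nat_le_iff)
  then show ?thesis using assms by (cases "3 \<le> d") simp_all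
qed

text \<open>Removing the cubic replaces F by F + K, which is again sorted and standard, with
  \<open>antican\<close> still between 1 and 3 or with degree 0. The conditions of the successive
  steps then add up to \<chi>.\<close>

lemma dim_cusp_standard:
  fixes e :: "nat \<Rightarrow> 9"
  assumes e: "bij_betw e {..<9} (UNIV :: 9 set)"
    and s: "\<And>p q. p \<le> q \<Longrightarrow> q < 9 \<Longrightarrow> n (e q) \<le> n (e p)"
    and d: "n (e 0) + n (e 1) + n (e 2) \<le> d"
    and N: "antican d n \<le> 3" "1 \<le> antican d n \<or> d = 0"
  shows "int (mpol_vs.dim (V n d)) \<le> chi d n"
  using s d N
proof (induction d arbitrary: n rule: less_induct)
  case (less d)
  have sum9: "(\<Sum>i\<in>UNIV. f i) = f (e 0) + f (e 1) + f (e 2) + f (e 3) + f (e 4) + f (e 5) + f (e 6) + f (e 7) + f (e 8)"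
    for f :: "9 \<Rightarrow> int"
    using sum.reindex_bij_betw[OF e, of f] sum_lessThan_9[of "\<lambda>p. f (e p)"] by simp
  have ord: "n (e 1) \<le> n (e 0)" "n (e 2) \<le> n (e 1)" "n (e 3) \<le> n (e 2)" "n (e 4) \<le> n (e 3)" "n (e 5) \<le> n (e 4)"
      "n (e 6) \<le> n (e 5)" "n (e 7) \<le> n (e 6)" "n (e 8) \<le> n (e 7)"
    using less.prems(1) by simp_all
  have le0: "n i \<le> n (e 0)" for i
  proof -
    have "i \<in> e ` {..<9}" using e by (simp add: bij_betw_def)
    then show ?thesis using less.prems(1)[of 0] by auto
  qed
  have an: "antican d n = 3 * int d - (int (n (e 0)) + int (n (e 1)) + int (n (e 2)) + int (n (e 3)) + int (n (e 4))
      + int (n (e 5)) + int (n (e 6)) + int (n (e 7)) + int (n (e 8)))"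
    by (simp only: antican_def sum9)
  show ?case
  proof (cases "d = 0")
    case True
    then have "n (e 0) = 0" using less.prems(2) by simp
    then have "n i = 0" for i using le0[of i] by simp
    then show ?thesis by (rule dim_le_chi_zero)
  next
    case False
    then have N1: "1 \<le> antican d n" using less.prems(4) by simp
    show ?thesis
    proof (cases "3 \<le> d")
      case True
      let ?n = "\<lambda>i. n i - 1"
      \<comment> \<open>If the third multiplicity were 0, \<open>antican\<close> would be at least 2
        d, which is at least 6.\<close>
      have x2: "1 \<le> n (e 2)" using True less.prems(2,3) ord unfolding an by linarith
      define y where "y p = n (e p) - 1" for p
      have an': "antican (d - 3) ?n = 3 * int (d - 3) - (int (y 0) + int (y 1) + int (y 2)
          + int (y 3) + int (y 4) + int (y 5) + int (y 6) + int (y 7) + int (y 8))"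
        by (simp only: antican_def sum9 y_def)
      have d3: "int (d - 3) = int d - 3" using True by simp
      have y_ge: "int (n (e p)) \<le> int (y p) + 1" for p by (simp add: y_def)
      have y_eq: "int (n (e p)) = int (y p) + 1" if "1 \<le> n (e p)" for p using that by (simp add: y_def)
      have y_mono: "y q \<le> y p" if "p \<le> q" "q < 9" for p q
        unfolding y_def using less.prems(1)[OF that] by (rule diff_le_mono)
      have S: "antican d n = 3 * int d - (\<Sum>p<9. int (n (e p)))" "antican (d - 3) ?n = 3 * int (d - 3) - (\<Sum>p<9. int (y p))"
        unfolding an an' sum_lessThan_9 by (rule refl)+
      have "(\<Sum>p<9. int (n (e p))) \<le> (\<Sum>p<(9::nat). int (y p) + 1)" by (intro sum_mono y_ge)
      also have "\<dots> = (\<Sum>p<9. int (y p)) + 9" by (simp add: sum.distrib)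
      finally have A: "(\<Sum>p<9. int (n (e p))) \<le> (\<Sum>p<9. int (y p)) + 9" .
      have ar: "\<And>A B D :: int. A \<le> B + 9 \<Longrightarrow> 3 * (D - 3) - B \<le> 3 * D - A" by simp
      have le: "antican (d - 3) ?n \<le> antican d n" unfolding S d3 by (rule ar[OF A])
      have "1 \<le> n (e 1)" "1 \<le> n (e 0)" using x2 ord by linarith+
      then have y3: "y 0 + y 1 + y 2 \<le> d - 3"
        using less.prems(2) y_eq[of 0] y_eq[of 1] y_eq[of 2] x2 by linarith
      then have tri: "?n (e 0) + ?n (e 1) + ?n (e 2) \<le> d - 3"
        by (simp only: y_def)
      \<comment> \<open>If all nine multiplicities are positive, \<open>antican\<close> is
        unchanged, as K^2 = 0. Otherwise eight remain: the first three and the next three sum to at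
        most d - 3 each, and the last two to at most two thirds of d - 3.\<close>
      have ge: "1 \<le> antican (d - 3) ?n \<or> d - 3 = 0"
      proof (cases "1 \<le> n (e 8)")
        case True
        have "1 \<le> n (e p)" if "p < 9" for p
          using le_trans[OF True less.prems(1)[of p 8]] that by simp
        then have "(\<Sum>p<9. int (n (e p))) = (\<Sum>p<(9::nat). int (y p) + 1)" by (intro sum.cong y_eq) auto
        also have "\<dots> = (\<Sum>p<9. int (y p)) + 9" by (simp add: sum.distrib)
        finally have A: "(\<Sum>p<9. int (n (e p))) = (\<Sum>p<9. int (y p)) + 9" .
        have "antican (d - 3) ?n = antican d n" unfolding S d3 A by simp
        then show ?thesis using N1 by simp
      next
        case False
        have "y 8 = 0" using False by (simp add: y_def)
        moreover have "y 1 \<le> y 0" "y 2 \<le> y 1" "y 3 \<le> y 2" "y 4 \<le> y 3" "y 5 \<le> y 4" "y 6 \<le> y 5" "y 7 \<le> y 6"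
          by (rule y_mono; simp)+
        moreover have "int (y 0) + int (y 1) + int (y 2) \<le> int (d - 3)" using y3 by linarith
        ultimately have "d - 3 \<noteq> 0 \<Longrightarrow> 1 \<le> antican (d - 3) ?n" unfolding an' by linarith
        then show ?thesis by blast
      qed
      have "int (mpol_vs.dim (V ?n (d - 3))) \<le> chi (d - 3) ?n"
      proof (rule less.IH)
        show "d - 3 < d" using True by simp
        show "?n (e q) \<le> ?n (e p)" if "p \<le> q" "q < 9" for p q
          using less.prems(1)[OF that] by (rule diff_le_mono)
      qed (use tri ge le less.prems(3) in linarith)+
      then show ?thesis using dim_cusp_step_int[OF N1] True chi_step[OF True, of n] by simp
    next
      case F: False
      \<comment> \<open>In degree 2 the third multiplicity is 0 and \<open>antican\<close> is at
        least 6 - 2 = 4.\<close>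
      have d1: "d = 1"
      proof (rule ccontr)
        assume "d \<noteq> 1"
        then have d2: "d = 2" using F \<open>d \<noteq> 0\<close> by simp
        then have "n (e 2) = 0" using less.prems(2) ord by linarith
        then show False using less.prems(2,3) ord d2 unfolding an by linarith
      qed
      have n1: "n i \<le> 1" for i using le0[of i] less.prems(2) d1 by simp
      have "int ((n i + 1) choose 2) = int (n i)" for i
      proof (cases "n i = 0")
        case True
        show ?thesis unfolding True by (simp add: numeral_2_eq_2)
      next
        case False
        then have "n i = 1" using n1[of i] by simp
        show ?thesis unfolding \<open>n i = 1\<close> by (simp add: numeral_2_eq_2)
      qed
      then have eq: "(\<Sum>i\<in>UNIV. int ((n i + 1) choose 2)) = (\<Sum>i\<in>UNIV. int (n i))" by (intro sum.cong refl)
      have "chi d n = antican d n" unfolding chi_def antican_def d1 eq by (simp add: numeral_2_eq_2)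
      then show ?thesis using dim_cusp_step_int[OF N1] F by simp
    qed
  qed
qed

text \<open>Nine multiplicities of size at most d / 9 sum to at most d, so \<open>antican\<close> is
  positive. The bound survives each step: where a multiplicity drops by one the left side drops by
  9, while the degree drops by 3.\<close>

lemma dim_cusp_big:
  assumes "\<And>i. 9 * n i \<le> d"
  shows "int (mpol_vs.dim (V n d)) \<le> chi d n"
  using assms
proof (induction d arbitrary: n rule: less_induct)
  case (less d)
  show ?case
  proof (cases "\<forall>i. n i = 0")
    case True
    show ?thesis by (rule dim_le_chi_zero) (use True in blast)
  next
    case False
    then obtain i where "n i \<noteq> 0" by blast
    then have d: "9 \<le> d" using less.prems[of i] by linarith
    have "9 * (\<Sum>i\<in>UNIV. int (n i)) \<le> (\<Sum>i\<in>(UNIV :: 9 set). int d)"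
      unfolding sum_distrib_left using less.prems by (intro sum_mono) (metis of_nat_le_iff of_nat_mult of_nat_numeral)
    then have N1: "1 \<le> antican d n" unfolding antican_def using d by simp
    have "9 * (n i - 1) \<le> d - 3" for i using less.prems[of i] d by linarith
    then have "int (mpol_vs.dim (V (\<lambda>i. n i - 1) (d - 3))) \<le> chi (d - 3) (\<lambda>i. n i - 1)"
      using d by (intro less.IH) simp_all
    then show ?thesis using dim_cusp_step_int[OF N1] d chi_step[of d n] by simp
  qed
qed

end

text \<open>One explicit configuration suffices to show that a polynomial condition over the prime
  field fails at generic points.\<close>

lemma generic_specialise:
  assumes "generic_points a b" "prime_poly Q" "ev (case_sum c e) Q \<noteq> 0"
  shows "ev (case_sum a b) Q \<noteq> 0"
  using specialisations_nonzero[OF assms(1)[unfolded generic_points_def] specialisationsI[OF assms(2)] assms(3)] .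

text \<open>Supplies the exact dimension of the ambient space in Bezout's inequality.\<close>

lemma dim_fat_forms_big:
  fixes a b :: "9 \<Rightarrow> 'k::alg_closed_field"
  assumes "generic_points a b" "\<And>i. 9 * n i \<le> d"
  shows "int (mpol_vs.dim (fat_forms a b n d)) = chi d n"
proof -
  obtain t :: "9 \<Rightarrow> 'k" where "cusp_points t" using infinite_imp_cusp_points[OF infinite_alg_closed] by blast
  then interpret cusp_points t .
  have "int (mpol_vs.dim (fat_forms a b n d)) \<le> int (mpol_vs.dim (V n d))"
    using dim_fat_forms_generic_le[OF assms(1)] by simp
  then show ?thesis using dim_cusp_big[of n d, OF assms(2)] dim_fat_forms_ge_chi[of d n a b] by simp
qed

section \<open>Quadratic transformations\<close>

text \<open>The determinant of the two points and the variable point.\<close>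

definition line_thru :: "(9 \<Rightarrow> 'k) \<Rightarrow> (9 \<Rightarrow> 'k) \<Rightarrow> 9 \<Rightarrow> 9 \<Rightarrow> (3, 'k::field) mpol" where
  "line_thru a b i j = Const (a i * b j - a j * b i) * Var 0 + Const (b i - b j) * Var 1 + Const (a j - a i) * Var 2"

lemma ev_line_thru: "ev x (line_thru a b i j) = (a i * b j - a j * b i) * x 0 + (b i - b j) * x 1 + (a j - a i) * x 2"
  by (simp add: line_thru_def)

lemma homg_line_thru: "homg UNIV 1 (line_thru a b i j)"
  unfolding line_thru_def by (intro homg_add homg_Const_mult) simp_all

lemma ev_line_thru_pt: "ev (pt a b i) (line_thru a b i j) = 0" "ev (pt a b j) (line_thru a b i j) = 0"
  unfolding ev_line_thru pt_simps by (simp_all add: algebra_simps)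

lemma generic_not_collinear:
  assumes gen: "generic_points a b" and ijl: "i \<noteq> j" "l \<noteq> i" "l \<noteq> j"
  shows "ev (pt a b l) (line_thru a b i j) \<noteq> 0"
proof -
  let ?A = "\<lambda>i. Var (Inl i) :: (9 + 9, 'a) mpol" and ?B = "\<lambda>i. Var (Inr i) :: (9 + 9, 'a) mpol"
  let ?Q = "(?A i * ?B j - ?A j * ?B i) + (?B i - ?B j) * ?A l + (?A j - ?A i) * ?B l"
  have "prime_poly ?Q"
    by (intro prime_poly_add prime_poly_mult prime_poly_diff prime_poly_Var)
  \<comment> \<open>Specialises the three points to the affine points (0, 0), (1, 0) and (0,
    1).\<close>
  moreover have "ev (case_sum (\<lambda>v. if v = j then 1 else 0) (\<lambda>v. if v = l then 1 else 0)) ?Q = (1 :: 'a)"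
    using ijl by simp
  ultimately have "ev (case_sum a b) ?Q \<noteq> 0"
    using generic_specialise[OF gen] by (metis one_neq_zero)
  then show ?thesis unfolding ev_line_thru pt_simps by simp
qed

lemma ordge_1_imp_ev:
  assumes "ordge (a i) (b i) 1 P" shows "ev (pt a b i) P = 0"
proof -
  have "ev (pt a b i) P = ev (unit_pt 0) (shift (a i) (b i) P)"
    unfolding ev_shift by (rule arg_cong[where f = "\<lambda>g. ev g P"]) (auto simp: unit_pt_def pt_def)
  also have "\<dots> = 0"
    unfolding ev_def
  proof (rule sum.neutral, rule ballI)
    fix m assume "m \<in> Poly_Mapping.keys (shift (a i) (b i) P)"
    then have "Poly_Mapping.lookup m 1 \<noteq> 0 \<or> Poly_Mapping.lookup m 2 \<noteq> 0"
      using assms by (fastforce simp: ordge_def wtge_def wt_12)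
    then show "Poly_Mapping.lookup (shift (a i) (b i) P) m * (\<Prod>v\<in>UNIV. unit_pt 0 v ^ Poly_Mapping.lookup m v) = 0"
      unfolding prod_3 by (auto simp: unit_pt_def power_0_left)
  qed
  finally show ?thesis .
qed

lemma ordge_forms_0:
  assumes "P \<in> forms k" "ordge a b n P" "k < n" shows "P = 0"
proof -
  have "homg UNIV k (shift a b P)" using assms(1) by (simp add: forms_iff homg_shift)
  then have "m \<notin> Poly_Mapping.keys (shift a b P)" for m
    using assms(2,3) unfolding ordge_def wtge_def homg_def wt_12 wt_UNIV3 by fastforce
  then have "shift a b P = 0" using keys_eq_empty[of "shift a b P"] by blast
  then show ?thesis using shift_shift'[of a b P] by simp
qed

lemma not_ordge_mult:
  fixes P :: "(3, 'k::idom) mpol"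
  assumes "\<not> ordge a b (Suc n) P" "\<not> ordge a b (Suc m) Q"
  shows "\<not> ordge a b (Suc (n + m)) (P * Q)"
  using ordge_cancel[of a b n "Suc m" P Q] assms by auto

lemma not_ordge_power:
  fixes P :: "(3, 'k::idom) mpol"
  assumes "\<not> ordge a b (Suc n) P"
  shows "\<not> ordge a b (Suc (k * n)) (P ^ k)"
proof (induction k)
  case 0
  have "\<not> ordge a b (Suc 0) (1 :: (3, 'k) mpol)"
    unfolding ordge_def shift_simps wtge_def by simp
  then show ?case unfolding mult_0 power_0 .
next
  case (Suc k)
  then show ?case using not_ordge_mult[OF assms Suc.IH] by (simp add: add.commute)
qed

lemma ordge_substitute:
  assumes "P \<in> forms d" "\<And>v. ordge a b 1 (s v)"
  shows "ordge a b d (substitute s P)"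
proof -
  have "shift a b (substitute s P) = substitute (\<lambda>v. shift a b (s v)) P"
    unfolding shift_def substitute_substitute ..
  then show ?thesis
    using wtge_substitute_forms[of d P "{1, 2}" 1 "\<lambda>v. shift a b (s v)"] assms by (simp add: ordge_def forms_iff)
qed

text \<open>Each vector gives a nonzero polynomial in \<open>s\<close>, and together they have
  finitely many roots. The resulting linear form is nonzero at nine given points, which brings them
  into the chart x_0 \<noteq> 0.\<close>

lemma ex_nonroot_vectors:
  fixes T :: "9 \<Rightarrow> 3 \<Rightarrow> 'k::field"
  assumes "infinite (UNIV :: 'k set)" "\<And>l. \<exists>v. T l v \<noteq> 0"
  shows "\<exists>s. \<forall>l. T l 0 + s * T l 1 + s\<^sup>2 * T l 2 \<noteq> 0"
proof -
  let ?p = "\<lambda>l. [:T l 0, T l 1, T l 2:]"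
  have "?p l \<noteq> 0" for l using assms(2)[of l] exhaust_3 by (metis pCons_eq_0_iff)
  then have "finite {s. poly (?p l) s = 0}" for l by (rule poly_roots_finite)
  then have "finite (\<Union>l. {s. poly (?p l) s = 0})" by (intro finite_UN_I) auto
  then have "\<exists>s. s \<notin> (\<Union>l. {s. poly (?p l) s = 0})" by (rule ex_new_if_finite[OF assms(1)])
  then obtain s where "s \<notin> (\<Union>l. {s. poly (?p l) s = 0})" by (rule exE)
  then have nz: "poly (?p l) s \<noteq> 0" for l by simp
  have quad: "poly [:u, v, w:] s = u + s * v + s\<^sup>2 * w" for u v w
    by (simp only: poly_pCons poly_0 power2_eq_square mult_zero_right add_0_right distrib_left mult.assoc add.assoc)
  show ?thesis
  proof (intro exI[of _ s] allI)
    show "T l 0 + s * T l 1 + s\<^sup>2 * T l 2 \<noteq> 0" for l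
      using nz[of l] unfolding quad .
  qed
qed

text \<open>On monomials the standard quadratic transformation is an exact correspondence:
  the orders at the coordinate points are what makes the exponents non-negative.\<close>

lemma quadratic_division:
  fixes P :: "(3, 'k::field) mpol"
  assumes P: "P \<in> forms d" and w: "wtge (UNIV - {0}) n0 P" "wtge (UNIV - {1}) n1 P" "wtge (UNIV - {2}) n2 P"
  shows "\<exists>Q. Q \<in> forms (2 * d - n0 - n1 - n2) \<and>
    substitute (\<lambda>v. if v = 0 then Var 1 * Var 2 else if v = 1 then Var 0 * Var 2 else Var 0 * Var 1) P
      = Var 0 ^ n0 * Var 1 ^ n1 * Var 2 ^ n2 * Q"
proof -
  let ?s = "\<lambda>v::3. if v = 0 then Var 1 * Var 2 else if v = 1 then Var 0 * Var 2 else Var 0 * Var 1 :: (3, 'k) mpol"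
  let ?l = Poly_Mapping.lookup
  \<comment> \<open>On the monomials of \<open>P\<close> these truncated differences are exact, by
    the three order conditions.\<close>
  define q where "q m = Poly_Mapping.single 0 (?l m 1 + ?l m 2 - n0) + Poly_Mapping.single 1 (?l m 0 + ?l m 2 - n1)
      + Poly_Mapping.single (2::3) (?l m 0 + ?l m 1 - n2)" for m :: "3 \<Rightarrow>\<^sub>0 nat"
  define Q where "Q = (\<Sum>m\<in>Poly_Mapping.keys P. Poly_Mapping.single (q m) (?l P m))"
  have ql: "?l (q m) 0 = ?l m 1 + ?l m 2 - n0" "?l (q m) 1 = ?l m 0 + ?l m 2 - n1" "?l (q m) 2 = ?l m 0 + ?l m 1 - n2" for m
    by (simp_all add: q_def lookup_add lookup_single)
  have U: "UNIV - {0} = {1, 2::3}" "UNIV - {1} = {0, 2::3}" "UNIV - {2} = {0, 1::3}" unfolding UNIV_3 by auto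
  have m: "n0 \<le> ?l m 1 + ?l m 2 \<and> n1 \<le> ?l m 0 + ?l m 2 \<and> n2 \<le> ?l m 0 + ?l m 1 \<and> ?l m 0 + ?l m 1 + ?l m 2 = d"
    if "m \<in> Poly_Mapping.keys P" for m
  proof -
    have "wt {1, 2} m = ?l m 1 + ?l m (2::3)" "wt {0, 2} m = ?l m 0 + ?l m (2::3)" "wt {0, 1} m = ?l m 0 + ?l m (1::3)"
      by (simp_all add: wt_def)
    then show ?thesis using w that P unfolding U wtge_def forms_iff homg_def wt_UNIV3 by metis
  qed
  have "Q \<in> forms (2 * d - n0 - n1 - n2)"
    unfolding Q_def forms_iff
  proof (rule homg_sum)
    fix n assume n: "n \<in> Poly_Mapping.keys P"
    have "wt UNIV (q n) = 2 * d - n0 - n1 - n2" unfolding wt_UNIV3 ql using m[OF n] by linarith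
    then show "homg UNIV (2 * d - n0 - n1 - n2) (Poly_Mapping.single (q n) (?l P n))" by (simp add: homg_def)
  qed
  moreover have "substitute ?s P = Var 0 ^ n0 * Var 1 ^ n1 * Var 2 ^ n2 * Q"
  proof -
    have "substitute ?s P = (\<Sum>m\<in>Poly_Mapping.keys P. substitute ?s (Poly_Mapping.single m (?l P m)))"
      unfolding rhom_sum[OF rhom_substitute, symmetric] mpol_eq_sum_single[symmetric] ..
    also have "\<dots> = (\<Sum>m\<in>Poly_Mapping.keys P. Var 0 ^ n0 * Var 1 ^ n1 * Var 2 ^ n2 * Poly_Mapping.single (q m) (?l P m))"
    proof (rule sum.cong[OF refl])
      fix n assume n: "n \<in> Poly_Mapping.keys P"
      have s: "substitute t (Poly_Mapping.single n' c) = Const c * (t 0 ^ ?l n' 0 * t 1 ^ ?l n' 1 * t 2 ^ ?l n' 2)"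
        for t :: "3 \<Rightarrow> (3, 'k) mpol" and n' c
        unfolding single_eq_Const_mult[of n' c] prod_Var_power[symmetric]
        by (simp only: substitute_simps substitute_Const substitute_Var prod_3)
      have e: "x ^ ?l (q n) 0 * x ^ n0 = x ^ (?l n 1 + ?l n 2)" "x ^ ?l (q n) 1 * x ^ n1 = x ^ (?l n 0 + ?l n 2)"
        "x ^ ?l (q n) 2 * x ^ n2 = x ^ (?l n 0 + ?l n 1)" for x :: "(3, 'k) mpol"
        unfolding power_add[symmetric] ql using m[OF n] by simp_all
      have "Poly_Mapping.single (q n) (?l P n) = Const (?l P n) * (Var 0 ^ ?l (q n) 0 * Var 1 ^ ?l (q n) 1 * Var 2 ^ ?l (q n) 2)"
        using s[of Var "q n" "?l P n"] by simp
      then have "Var 0 ^ n0 * Var 1 ^ n1 * Var 2 ^ n2 * Poly_Mapping.single (q n) (?l P n)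
          = Const (?l P n) * ((Var 0 ^ ?l (q n) 0 * Var 0 ^ n0) * (Var 1 ^ ?l (q n) 1 * Var 1 ^ n1) * (Var 2 ^ ?l (q n) 2 * Var 2 ^ n2))"
        by (simp only: mult_ac)
      also have "\<dots> = Const (?l P n) * ((Var 1 * Var 2) ^ ?l n 0 * (Var 0 * Var 2) ^ ?l n 1 * (Var 0 * Var 1) ^ ?l n 2)"
        unfolding e power_add power_mult_distrib by (simp only: mult_ac)
      also have "\<dots> = substitute ?s (Poly_Mapping.single n (?l P n))"
        unfolding s by simp
      finally show "substitute ?s (Poly_Mapping.single n (?l P n))
          = Var 0 ^ n0 * Var 1 ^ n1 * Var 2 ^ n2 * Poly_Mapping.single (q n) (?l P n)" ..
    qed
    finally show ?thesis unfolding Q_def sum_distrib_left .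
  qed
  ultimately show ?thesis by blast
qed

text \<open>As simplification rules for products, these loop together with commutativity.\<close>

declare ideal.scale_scale [simp del] mpol_vs.scale_scale [simp del]

lemma fdim_mult_image: "fdim ((\<lambda>Q. M * Q) ` fat_forms a b n k)" if "M \<in> forms l" for M :: "(3, 'k::field) mpol"
proof -
  have "(\<lambda>Q. M * Q) ` fat_forms a b n k \<subseteq> forms (l + k)"
    using that by (auto simp: fat_forms_iff forms_iff intro: homg_mult)
  then show ?thesis using fdim_forms fdim_mono by blast
qed

text \<open>The image points of the transformation are not known to be generic. Semicontinuity
  passes from the generic points to these images, and pulling forms back along the quadratic map
  returns to the generic points with the transformed class. Both steps point in the direction of the
  inequality.\<close>

theorem dim_fat_forms_Cremona_le:
  fixes a b :: "9 \<Rightarrow> 'k::alg_closed_field"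
  assumes gen: "generic_points a b" and ijk: "i \<noteq> j" "i \<noteq> k" "j \<noteq> k"
    and n: "n i + n j \<le> d" "n i + n k \<le> d" "n j + n k \<le> d"
  defines "n' \<equiv> n(i := d - n j - n k, j := d - n i - n k, k := d - n i - n j)"
  shows "mpol_vs.dim (fat_forms a b n d) \<le> mpol_vs.dim (fat_forms a b n' (2 * d - n i - n j - n k))"
proof -
  \<comment> \<open>The sides of the triangle of base points, each numbered by the opposite
    vertex.\<close>
  define L :: "3 \<Rightarrow> (3, 'k) mpol" where
    "L v = (if v = 0 then line_thru a b j k else if v = 1 then line_thru a b i k else line_thru a b i j)" for v
  let ?p = "\<lambda>l. pt a b l" and ?L0 = "L 0" and ?L1 = "L 1" and ?L2 = "L 2"
  define \<psi> :: "3 \<Rightarrow> (3, 'k) mpol" where "\<psi> v = (if v = 0 then ?L1 * ?L2 else if v = 1 then ?L0 * ?L2 else ?L0 * ?L1)" for v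
  have L012: "?L0 = line_thru a b j k" "?L1 = line_thru a b i k" "?L2 = line_thru a b i j" by (simp_all only: L_def neq_3 if_True if_False simp_thms)
  have hL: "homg UNIV 1 (L v)" for v unfolding L_def by (simp add: homg_line_thru del: One_nat_def)
  have psi012: "\<psi> 0 = ?L1 * ?L2" "\<psi> 1 = ?L0 * ?L2" "\<psi> 2 = ?L0 * ?L1" by (simp_all only: \<psi>_def neq_3 if_True if_False simp_thms)
  have h\<psi>: "homg UNIV 2 (\<psi> v)" for v
  proof -
    have 2: "homg UNIV 2 (L u * L w)" for u w
      using homg_mult[OF hL[of u] hL[of w]] by (simp only: one_add_one)
    show ?thesis unfolding \<psi>_def by (simp only: 2 split: if_split) simp
  qed
  have z: "ev (?p j) ?L0 = 0" "ev (?p k) ?L0 = 0" "ev (?p i) ?L1 = 0" "ev (?p k) ?L1 = 0" "ev (?p i) ?L2 = 0" "ev (?p j) ?L2 = 0"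
    unfolding L012 by (rule ev_line_thru_pt)+
  have nz: "ev (?p i) ?L0 \<noteq> 0" "ev (?p j) ?L1 \<noteq> 0" "ev (?p k) ?L2 \<noteq> 0"
    unfolding L012 using generic_not_collinear[OF gen ijk(3,1,2)] generic_not_collinear[OF gen ijk(2) ijk(1)[symmetric] ijk(3)]
      generic_not_collinear[OF gen ijk(1) ijk(2,3)[symmetric]] by blast+
  have nzl: "ev (?p l) (L v) \<noteq> 0" if "l \<noteq> i" "l \<noteq> j" "l \<noteq> k" for l v
    unfolding L_def using generic_not_collinear[OF gen ijk(3) that(2,3)] generic_not_collinear[OF gen ijk(2) that(1,3)]
      generic_not_collinear[OF gen ijk(1) that(1,2)] by simp
  \<comment> \<open>The target points: base points correspond to the coordinate points, all other
    points to their images under \<open>\<psi>\<close>.\<close>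
  define T :: "9 \<Rightarrow> 3 \<Rightarrow> 'k" where "T l = (if l = i then unit_pt 0 else if l = j then unit_pt 1 else if l = k then unit_pt 2
      else (\<lambda>v. ev (?p l) (\<psi> v)))" for l
  have "\<exists>v. T l v \<noteq> 0" for l
  proof -
    have "T l 0 \<noteq> 0 \<or> T l 1 \<noteq> 0 \<or> T l 2 \<noteq> 0"
      using nzl[of l] unfolding T_def by (simp add: unit_pt_def psi012)
    then show ?thesis by blast
  qed
  then obtain s where s: "\<And>l. T l 0 + s * T l 1 + s\<^sup>2 * T l 2 \<noteq> 0"
    using ex_nonroot_vectors[OF infinite_alg_closed, of T] by blast
  \<comment> \<open>The first coordinate of the target after the linear change
    \<open>\<sigma>\<close>; dividing by it normalises the target to (1 : c : e).\<close>
  define sc where "sc l = T l 0 + s * T l 1 + s\<^sup>2 * T l 2" for l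
  define c e where "c l = T l 1 / sc l" and "e l = T l 2 / sc l" for l
  define \<sigma> :: "3 \<Rightarrow> (3, 'k) mpol" where
    "\<sigma> v = (if v = 0 then Var 0 + Const s * Var 1 + Const (s\<^sup>2) * Var 2 else Var v)" for v
  have h\<sigma>: "homg UNIV 1 (\<sigma> v)" for v
    unfolding \<sigma>_def by (auto intro!: homg_add homg_Const_mult)
  have \<sigma>T: "ev (T l) (\<sigma> v) = sc l * pt c e l v" for l v
  proof -
    have "sc l \<noteq> 0" using s by (simp add: sc_def)
    then show ?thesis using exhaust_3[of v] unfolding \<sigma>_def by (auto simp: c_def e_def pt_def sc_def)
  qed
  have \<sigma>0: "ev (T l) (substitute \<sigma> f) = 0" if "f \<in> forms m" "ev (pt c e l) f = 0" for f m l
  proof -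
    have "ev (T l) (substitute \<sigma> f) = ev (\<lambda>v. sc l * pt c e l v) f"
      unfolding ev_substitute by (rule arg_cong[where f = "\<lambda>g. ev g f"]) (simp add: \<sigma>T)
    also have "\<dots> = sc l ^ m * ev (pt c e l) f" using that(1) by (intro ev_homg_scale) (simp add: forms_iff)
    finally show ?thesis using that(2) by simp
  qed
  \<comment> \<open>The factor split off by the pullback: each side of the triangle, to the power of
    the multiplicity at its opposite vertex.\<close>
  let ?M = "?L0 ^ n i * ?L1 ^ n j * ?L2 ^ n k"
  let ?d = "2 * d - n i - n j - n k"
  define \<theta> where "\<theta> P = substitute \<psi> (substitute \<sigma> P)" for P
  have rh: "rhom \<theta>" unfolding \<theta>_def by (intro rhom_comp[OF rhom_substitute] rhom_substitute)
  have ordp: "ordge (a l) (b l) 1 (L v)" if "ev (?p l) (L v) = 0" for l v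
    using hL that by (intro ordge_1_iff[of _ 1]) (auto simp: forms_iff)
  have L_nz: "L v \<noteq> 0" for v
    using nz exhaust_3[of v] by auto
  have n2: "\<not> ordge (a l) (b l) (Suc 1) (L v)" for l v
    using ordge_forms_0[of "L v" 1 "a l" "b l" "Suc 1"] hL[of v] L_nz[of v] by (auto simp: forms_iff)
  have n1: "\<not> ordge (a l) (b l) (Suc 0) (L v)" if "ev (?p l) (L v) \<noteq> 0" for l v
    using ordge_1_imp_ev[of a l b "L v"] that by auto
  have main: "\<exists>Q\<in>fat_forms a b n' ?d. \<theta> P = ?M * Q" if P: "P \<in> fat_forms c e n d" for P
  proof -
    have Pf: "P \<in> forms d" using P by (simp add: fat_forms_iff)
    have Pi: "P \<in> ideal_power (point_ideal (pt c e l)) (n l)" for l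
      using P by (simp add: fat_forms_def fat_ideal_def)
    let ?P1 = "substitute \<sigma> P"
    have P1f: "?P1 \<in> forms d" using homg_substitute_forms[of d P UNIV 1 \<sigma>, OF _ h\<sigma>] Pf by (simp add: forms_iff)
    have w: "wtge (UNIV - {v}) (n l) ?P1" if T: "T l = unit_pt v" for l v
    proof -
      have "?P1 \<in> {P. wtge (UNIV - {v}) (n l) P}"
        using Pi[of l]
      proof (rule ideal_power_filtration[where \<theta> = "substitute \<sigma>" and J = "\<lambda>n. {P. wtge (UNIV - {v}) n P}", rotated -1])
        fix m n' :: nat and f x :: "(3, 'k) mpol" assume f: "f \<in> forms m" "ev (pt c e l) f = 0" and x: "x \<in> {P. wtge (UNIV - {v}) n' P}"
        have "homg UNIV (m * 1) (substitute \<sigma> f)" using f(1) h\<sigma> by (intro homg_substitute_forms) (auto simp: forms_iff)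
        then have "wtge (UNIV - {v}) 1 (substitute \<sigma> f)"
          using \<sigma>0[OF f] unfolding T by (intro ev_unit_pt_wtge[of "m * 1"])
        then have "wtge (UNIV - {v}) (1 + n') (substitute \<sigma> f * x)" using x by (intro wtge_mult) simp_all
        then show "substitute \<sigma> f * x \<in> {P. wtge (UNIV - {v}) (Suc n') P}" by simp
      qed (auto simp: rhom_substitute wtge_add wtge_mult_left)
      then show ?thesis by simp
    qed
    have T3: "T i = unit_pt 0" "T j = unit_pt 1" "T k = unit_pt 2" using ijk by (simp_all add: T_def)
    obtain Q0 where Q0: "Q0 \<in> forms ?d" "substitute (\<lambda>v. if v = 0 then Var 1 * Var 2 else if v = 1 then Var 0 * Var 2 else Var 0 * Var 1) ?P1
      = Var 0 ^ n i * Var 1 ^ n j * Var 2 ^ n k * Q0"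
      using quadratic_division[OF P1f w[OF T3(1)] w[OF T3(2)] w[OF T3(3)]] by blast
    define Q where "Q = substitute L Q0"
    have Qf: "Q \<in> forms ?d"
      using homg_substitute_forms[of ?d Q0 UNIV 1 L, OF _ hL] Q0(1) by (simp add: forms_iff Q_def)
    have \<theta>Q: "\<theta> P = ?M * Q"
    proof -
      have "substitute L (substitute (\<lambda>v. if v = 0 then Var 1 * Var 2 else if v = 1 then Var 0 * Var 2 else Var 0 * Var 1) ?P1)
          = substitute \<psi> ?P1"
        unfolding substitute_substitute[of L _ ?P1] by (rule arg_cong[where f = "\<lambda>g. substitute g ?P1"]) (auto simp: \<psi>_def)
      then show ?thesis unfolding Q0(2) \<theta>_def Q_def by simp
    qed
    \<comment> \<open>Off the triangle \<open>?M\<close> does not vanish, so the multiplicity passes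
      entirely to the cofactor.\<close>
    have o1: "ordge (a l) (b l) (n l) Q" if l: "l \<noteq> i" "l \<noteq> j" "l \<noteq> k" for l
    proof -
      have Tl: "T l = (\<lambda>v. ev (?p l) (\<psi> v))" using l by (simp add: T_def)
      have "\<theta> P \<in> {P. ordge (a l) (b l) (n l) P}"
        using Pi[of l]
      proof (rule ideal_power_filtration[where \<theta> = \<theta> and J = "\<lambda>n. {P. ordge (a l) (b l) n P}", rotated -1])
        fix m n' :: nat and f x :: "(3, 'k) mpol" assume f: "f \<in> forms m" "ev (pt c e l) f = 0" and x: "x \<in> {P. ordge (a l) (b l) n' P}"
        have "homg UNIV (m * 1 * 2) (\<theta> f)"
          unfolding \<theta>_def using f(1) h\<sigma> h\<psi> by (intro homg_substitute_forms) (auto simp: forms_iff)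
        moreover have "ev (?p l) (\<theta> f) = 0"
          unfolding \<theta>_def ev_substitute[of "?p l"] using \<sigma>0[OF f] unfolding Tl .
        ultimately have "ordge (a l) (b l) 1 (\<theta> f)"
          by (intro ordge_1_iff[of _ "m * 1 * 2"]) (auto simp: forms_iff)
        then have "ordge (a l) (b l) (1 + n') (\<theta> f * x)" using x by (intro ordge_mult) simp_all
        then show "\<theta> f * x \<in> {P. ordge (a l) (b l) (Suc n') P}" by simp
      qed (auto simp: rh ordge_add ordge_mult_left)
      then have "ordge (a l) (b l) (0 + n l) (?M * Q)" using \<theta>Q by simp
      moreover have "\<not> ordge (a l) (b l) (Suc 0) ?M"
      proof
        assume "ordge (a l) (b l) (Suc 0) ?M"
        then have "ev (?p l) ?M = 0" using ordge_1_imp_ev[of a l b ?M] by simp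
        then show False using nzl[OF l] by simp
      qed
      ultimately show ?thesis by (rule ordge_cancel)
    qed
    \<comment> \<open>At a base point all components of \<open>\<psi>\<close> vanish, so the
      pullback has order \<open>d\<close>, of which \<open>?M\<close> absorbs the powers of the two
      sides through that point.\<close>
    have o2: "ordge (a l) (b l) (d - m) Q"
      if ps: "\<And>v. ordge (a l) (b l) 1 (\<psi> v)" and M: "\<not> ordge (a l) (b l) (Suc m) ?M" and m: "m \<le> d" for l m
    proof -
      have "ordge (a l) (b l) d (\<theta> P)" unfolding \<theta>_def by (rule ordge_substitute[OF P1f ps])
      then have "ordge (a l) (b l) (m + (d - m)) (?M * Q)" using m \<theta>Q by simp
      then show ?thesis using M by (rule ordge_cancel)
    qed
    have pw: "\<not> ordge (a l) (b l) (Suc x) (L v ^ x)" for l v x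
      using not_ordge_power[OF n2, of l x v] by simp
    have pw0: "\<not> ordge (a l) (b l) (Suc 0) (L v ^ x)" if "ev (?p l) (L v) \<noteq> 0" for l v x
      using not_ordge_power[OF n1[OF that], of x] by simp
    have psi_ord: "ordge (a l) (b l) 1 (\<psi> v)"
      if two: "u \<noteq> w" "ev (?p l) (L u) = 0" "ev (?p l) (L w) = 0" for l u w v
      using exhaust_3[of v] exhaust_3[of u] exhaust_3[of w] two(1) ordp[OF two(2)] ordp[OF two(3)]
      by (auto simp: psi012 intro: ordge_mult_left ordge_mult_right)
    have oi: "ordge (a i) (b i) (d - (0 + n j + n k)) Q"
      by (rule o2[OF psi_ord[OF neq_3(5) z(3,5)] not_ordge_mult[OF not_ordge_mult[OF pw0[OF nz(1)] pw] pw]]) (use n in simp)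
    have oj: "ordge (a j) (b j) (d - (n i + 0 + n k)) Q"
      by (rule o2[OF psi_ord[OF neq_3(3) z(1,6)] not_ordge_mult[OF not_ordge_mult[OF pw pw0[OF nz(2)]] pw]]) (use n in simp)
    have ok: "ordge (a k) (b k) (d - (n i + n j + 0)) Q"
      by (rule o2[OF psi_ord[OF neq_3(1) z(2,4)] not_ordge_mult[OF not_ordge_mult[OF pw pw] pw0[OF nz(3)]]]) (use n in simp)
    have "ordge (a l) (b l) (n' l) Q" for l
    proof -
      consider "l = i" | "l = j" | "l = k" | "l \<noteq> i" "l \<noteq> j" "l \<noteq> k" by blast
      then show ?thesis
      proof cases
        case 1
        then show ?thesis using oi ijk by (simp add: n'_def)
      next
        case 2
        then show ?thesis using oj ijk by (simp add: n'_def)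
      next
        case 3
        then show ?thesis using ok ijk by (simp add: n'_def)
      next
        case 4
        then show ?thesis using o1[OF 4] by (simp add: n'_def)
      qed
    qed
    then show ?thesis using Qf \<theta>Q by (auto simp: fat_forms_iff)
  qed
  have inj: "P = 0" if P: "P \<in> forms d" and 0: "\<theta> P = 0" for P
  proof -
    let ?P1 = "substitute \<sigma> P"
    have P1f: "homg UNIV d ?P1" using homg_substitute_forms[of d P UNIV 1 \<sigma>, OF _ h\<sigma>] P by (simp add: forms_iff)
    have surj: "\<exists>x. \<forall>v. ev x (L v) = y v" for y
    proof -
      let ?x = "\<lambda>v. y 0 / ev (?p i) ?L0 * ?p i v + y 1 / ev (?p j) ?L1 * ?p j v + y 2 / ev (?p k) ?L2 * ?p k v"
      have lin: "ev (\<lambda>v. \<alpha> * p v + \<beta> * q v + \<gamma> * r v) (L u) = \<alpha> * ev p (L u) + \<beta> * ev q (L u) + \<gamma> * ev r (L u)"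
        for \<alpha> \<beta> \<gamma> p q r u
        unfolding L_def by (simp add: ev_line_thru algebra_simps)
      have "ev ?x (L v) = y v" for v
        unfolding lin using z nz exhaust_3[of v] by auto
      then show ?thesis by blast
    qed
    \<comment> \<open>The quadratic map inverts coordinates up to a common factor, so
      \<open>y\<close> is reached from a point where the three sides take the values 1 / y.\<close>
    have P10: "ev y ?P1 = 0" if y: "y 0 \<noteq> 0" "y 1 \<noteq> 0" "y 2 \<noteq> 0" for y
    proof -
      obtain x where x: "\<And>v. ev x (L v) = 1 / y v" using surj[of "\<lambda>v. 1 / y v"] by blast
      have "ev x (\<psi> v) = 1 / (y 0 * y 1 * y 2) * y v" for v
        using exhaust_3[of v] y by (auto simp: psi012 x)
      then have "(\<lambda>v. ev x (\<psi> v)) = (\<lambda>v. 1 / (y 0 * y 1 * y 2) * y v)" by (rule ext)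
      then have "ev x (\<theta> P) = (1 / (y 0 * y 1 * y 2)) ^ d * ev y ?P1"
        unfolding \<theta>_def ev_substitute[of x \<psi>] by (simp only: ev_homg_scale[OF P1f])
      then show ?thesis using 0 y by simp
    qed
    have "ev y (Var 0 * Var 1 * Var 2 * ?P1) = 0" for y
      using P10[of y] by auto
    then have "Var 0 * Var 1 * Var 2 * ?P1 = 0" by (rule ev_eq_zero_imp)
    then have P1z: "?P1 = 0" by simp
    have "ev x P = 0" for x
    proof -
      let ?y = "\<lambda>v. if v = 0 then x 0 - s * x 1 - s\<^sup>2 * x 2 else x v"
      have "ev ?y (\<sigma> v) = x v" for v using exhaust_3[of v] by (auto simp: \<sigma>_def)
      then have "ev ?y ?P1 = ev x P" unfolding ev_substitute by simp
      then show ?thesis using P1z by simp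
    qed
    then show ?thesis by (rule ev_eq_zero_imp)
  qed
  have "homg UNIV (n i * 1 + n j * 1 + n k * 1) ?M" by (intro homg_mult homg_power hL)
  then have Mf: "?M \<in> forms (n i * 1 + n j * 1 + n k * 1)" by (simp only: forms_iff)
  have "mpol_vs.dim (fat_forms c e n d) \<le> mpol_vs.dim ((\<lambda>Q. ?M * Q) ` fat_forms a b n' ?d)"
  proof (rule dim_le_inj[where f = \<theta>])
    show "\<theta> ` fat_forms c e n d \<subseteq> (\<lambda>Q. ?M * Q) ` fat_forms a b n' ?d" using main by blast
    show "fdim ((\<lambda>Q. ?M * Q) ` fat_forms a b n' ?d)" by (rule fdim_mult_image[OF Mf])
    show "\<theta> (Const x * P) = Const x * \<theta> P" for x P unfolding \<theta>_def by simp
    show "\<theta> (P + Q) = \<theta> P + \<theta> Q" for P Q by (rule rhom_add[OF rh])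
    show "P = 0" if "P \<in> fat_forms c e n d" "\<theta> P = 0" for P using inj[OF _ that(2)] that(1) by (simp add: fat_forms_iff)
  qed (rule subspace_fat_forms)
  also have "\<dots> \<le> mpol_vs.dim (fat_forms a b n' ?d)"
    by (rule dim_mult_image_le[OF order_refl fdim_fat_forms])
  finally show ?thesis using dim_fat_forms_generic_le[OF gen, of n d c e] by simp
qed

section \<open>Numerically nef classes\<close>

text \<open>The numerical conditions E^2 = K.E = -1 on an integer vector; negative multiplicities
  such as those of the \<open>E i\<close> are included.\<close>

definition exc_class :: "int \<Rightarrow> (9 \<Rightarrow> int) \<Rightarrow> bool" where
  "exc_class d m \<longleftrightarrow> d\<^sup>2 - (\<Sum>i\<in>UNIV. (m i)\<^sup>2) = -1 \<and> 3 * d - (\<Sum>i\<in>UNIV. m i) = 1"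

text \<open>Tested on all numerical classes, whether or not they come from curves; this makes the
  condition invariant under the reflections below.\<close>

definition num_nef :: "nat \<Rightarrow> (9 \<Rightarrow> nat) \<Rightarrow> bool" where
  "num_nef d n \<longleftrightarrow> (\<forall>\<delta> \<mu>. exc_class \<delta> \<mu> \<longrightarrow> 0 \<le> int d * \<delta> - (\<Sum>i\<in>UNIV. int (n i) * \<mu> i))"

lemma sum_ind3:
  fixes f :: "9 \<Rightarrow> int"
  assumes "i \<noteq> j" "i \<noteq> k" "j \<noteq> k"
  shows "(\<Sum>l\<in>UNIV. if l = i \<or> l = j \<or> l = k then f l else 0) = f i + f j + f k"
proof -
  have "(\<Sum>l\<in>UNIV. if l = i \<or> l = j \<or> l = k then f l else 0) = (\<Sum>l\<in>{i, j, k}. f l)"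
    by (rule sum.mono_neutral_cong_right) auto
  also have "\<dots> = f i + f j + f k" using assms by simp
  finally show ?thesis .
qed

text \<open>The map is the reflection in L - E_i - E_j - E_k, an isometry that fixes K.\<close>

lemma exc_class_reflect:
  assumes ijk: "i \<noteq> j" "i \<noteq> k" "j \<noteq> k" and e: "exc_class \<delta> \<mu>"
  defines "\<tau> \<equiv> \<delta> - \<mu> i - \<mu> j - \<mu> k"
  shows "exc_class (\<delta> + \<tau>) (\<lambda>l. \<mu> l + (if l = i \<or> l = j \<or> l = k then \<tau> else 0))"
proof -
  have 1: "(\<Sum>l\<in>UNIV. \<mu> l + (if l = i \<or> l = j \<or> l = k then \<tau> else 0)) = (\<Sum>l\<in>UNIV. \<mu> l) + 3 * \<tau>"
    using sum_ind3[OF ijk, of "\<lambda>_. \<tau>"] by (simp add: sum.distrib)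
  have "(\<Sum>l\<in>UNIV. (\<mu> l + (if l = i \<or> l = j \<or> l = k then \<tau> else 0))\<^sup>2)
      = (\<Sum>l\<in>UNIV. (\<mu> l)\<^sup>2 + (if l = i \<or> l = j \<or> l = k then 2 * \<tau> * \<mu> l + \<tau>\<^sup>2 else 0))"
    by (rule sum.cong) (auto simp: power2_eq_square algebra_simps)
  also have "\<dots> = (\<Sum>l\<in>UNIV. (\<mu> l)\<^sup>2) + (2 * \<tau> * (\<mu> i + \<mu> j + \<mu> k) + 3 * \<tau>\<^sup>2)"
    using sum_ind3[OF ijk, of "\<lambda>l. 2 * \<tau> * \<mu> l + \<tau>\<^sup>2"] by (simp add: sum.distrib algebra_simps)
  finally have 2: "(\<Sum>l\<in>UNIV. (\<mu> l + (if l = i \<or> l = j \<or> l = k then \<tau> else 0))\<^sup>2)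
      = (\<Sum>l\<in>UNIV. (\<mu> l)\<^sup>2) + (2 * \<tau> * (\<mu> i + \<mu> j + \<mu> k) + 3 * \<tau>\<^sup>2)" .
  have 3: "\<mu> i + \<mu> j + \<mu> k = \<delta> - \<tau>" by (simp add: \<tau>_def)
  show ?thesis using e unfolding exc_class_def 1 2 3
    by (simp add: power2_eq_square algebra_simps)
qed

lemma exc_class_line:
  assumes "i \<noteq> j"
  shows "exc_class 1 (\<lambda>l. if l = i \<or> l = j then 1 else 0)"
proof -
  have *: "(\<Sum>l\<in>UNIV. if l = i \<or> l = j then 1 else 0) = (2::int)"
  proof -
    have "(\<Sum>l\<in>UNIV. if l = i \<or> l = j then 1 else 0) = (\<Sum>l\<in>{i, j}. 1::int)"
      by (rule sum.mono_neutral_cong_right) auto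
    then show ?thesis using assms by simp
  qed
  have sq: "(\<lambda>l. (if l = i \<or> l = j then 1 else 0 :: int)\<^sup>2) = (\<lambda>l. if l = i \<or> l = j then 1 else 0)" by auto
  show ?thesis unfolding exc_class_def sq * by simp
qed

text \<open>The test against L - E_i - E_j; it makes the subtractions in a quadratic transformation
  exact.\<close>

lemma num_nef_line:
  assumes "num_nef d n" "i \<noteq> j" shows "n i + n j \<le> d"
proof -
  have "(\<Sum>l\<in>UNIV. int (n l) * (if l = i \<or> l = j then 1 else 0)) = (\<Sum>l\<in>{i, j}. int (n l))"
    by (rule sum.mono_neutral_cong_right) auto
  also have "\<dots> = int (n i) + int (n j)" using assms(2) by simp
  finally have *: "(\<Sum>l\<in>UNIV. int (n l) * (if l = i \<or> l = j then 1 else 0)) = int (n i) + int (n j)" .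
  have "0 \<le> int d * 1 - (\<Sum>l\<in>UNIV. int (n l) * (if l = i \<or> l = j then 1 else 0))"
    using assms(1) exc_class_line[OF assms(2)] unfolding num_nef_def by blast
  then show ?thesis unfolding * by linarith
qed

text \<open>Unless the class is already standard, the transformation at its three largest
  multiplicities lowers the degree. Being a reflection, it preserves \<open>num_nef\<close>,
  \<open>antican\<close> and \<open>chi\<close>.\<close>

theorem dim_fat_forms_num_nef:
  fixes a b :: "9 \<Rightarrow> 'k::alg_closed_field"
  assumes gen: "generic_points a b" and "num_nef d n" "1 \<le> antican d n" "antican d n \<le> 3"
  shows "int (mpol_vs.dim (fat_forms a b n d)) \<le> chi d n"
  using assms(2-)
proof (induction d arbitrary: n rule: less_induct)
  case (less d)
  obtain e :: "nat \<Rightarrow> 9" where e: "bij_betw e {..<9} UNIV" "\<And>p q. p \<le> q \<Longrightarrow> q < 9 \<Longrightarrow> n (e q) \<le> n (e p)"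
    using sorting_9 by metis
  show ?case
  proof (cases "n (e 0) + n (e 1) + n (e 2) \<le> d")
    case True
    obtain t :: "9 \<Rightarrow> 'k" where "cusp_points t" using infinite_imp_cusp_points[OF infinite_alg_closed] by blast
    then interpret cusp_points t .
    have "int (mpol_vs.dim (V n d)) \<le> chi d n"
      using less.prems by (intro dim_cusp_standard[OF e(1) e(2) True]) auto
    moreover have "int (mpol_vs.dim (fat_forms a b n d)) \<le> int (mpol_vs.dim (V n d))"
      using dim_fat_forms_generic_le[OF gen] by simp
    ultimately show ?thesis by linarith
  next
    case False
    define i j k where ijk: "i = e 0" "j = e 1" "k = e 2"
    have "inj_on e {..<9}" using e(1) by (simp add: bij_betw_def)
    then have neq: "i \<noteq> j" "i \<noteq> k" "j \<noteq> k" unfolding ijk by (auto dest: inj_onD)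
    have le: "n i + n j \<le> d" "n i + n k \<le> d" "n j + n k \<le> d" using num_nef_line[OF less.prems(1)] neq by auto
    define t where "t = int d - int (n i) - int (n j) - int (n k)"
    let ?d = "2 * d - n i - n j - n k"
    let ?n = "n(i := d - n j - n k, j := d - n i - n k, k := d - n i - n j)"
    have t: "t < 0" using False unfolding t_def ijk by linarith
    have d': "int ?d = int d + t" unfolding t_def using le by linarith
    have n': "int (?n l) = int (n l) + (if l = i \<or> l = j \<or> l = k then t else 0)" for l
      unfolding t_def using le neq by auto
    have lt: "?d < d" using t d' by linarith
    have nn: "num_nef ?d ?n"
      unfolding num_nef_def
    proof (intro allI impI)
      fix \<delta> \<mu> assume ex: "exc_class \<delta> \<mu>"
      let ?\<tau> = "\<delta> - \<mu> i - \<mu> j - \<mu> k"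
      have "(\<Sum>l\<in>UNIV. int (?n l) * \<mu> l) = (\<Sum>l\<in>UNIV. int (n l) * \<mu> l + (if l = i \<or> l = j \<or> l = k then t * \<mu> l else 0))"
        unfolding n' by (rule sum.cong) (auto simp: algebra_simps)
      also have "\<dots> = (\<Sum>l\<in>UNIV. int (n l) * \<mu> l) + t * (\<mu> i + \<mu> j + \<mu> k)"
        using sum_ind3[OF neq, of "\<lambda>l. t * \<mu> l"] by (simp add: sum.distrib algebra_simps)
      finally have 1: "(\<Sum>l\<in>UNIV. int (?n l) * \<mu> l) = (\<Sum>l\<in>UNIV. int (n l) * \<mu> l) + t * (\<mu> i + \<mu> j + \<mu> k)" .
      have "(\<Sum>l\<in>UNIV. int (n l) * (\<mu> l + (if l = i \<or> l = j \<or> l = k then ?\<tau> else 0)))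
          = (\<Sum>l\<in>UNIV. int (n l) * \<mu> l + (if l = i \<or> l = j \<or> l = k then ?\<tau> * int (n l) else 0))"
        by (rule sum.cong) (auto simp: algebra_simps)
      also have "\<dots> = (\<Sum>l\<in>UNIV. int (n l) * \<mu> l) + ?\<tau> * (int (n i) + int (n j) + int (n k))"
        using sum_ind3[OF neq, of "\<lambda>l. ?\<tau> * int (n l)"] by (simp add: sum.distrib algebra_simps)
      finally have 2: "(\<Sum>l\<in>UNIV. int (n l) * (\<mu> l + (if l = i \<or> l = j \<or> l = k then ?\<tau> else 0)))
          = (\<Sum>l\<in>UNIV. int (n l) * \<mu> l) + ?\<tau> * (int (n i) + int (n j) + int (n k))" .
      have "0 \<le> int d * (\<delta> + ?\<tau>) - (\<Sum>l\<in>UNIV. int (n l) * (\<mu> l + (if l = i \<or> l = j \<or> l = k then ?\<tau> else 0)))"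
        using less.prems(1) exc_class_reflect[OF neq ex] unfolding num_nef_def by blast
      also have "\<dots> = int ?d * \<delta> - (\<Sum>l\<in>UNIV. int (?n l) * \<mu> l)"
        unfolding 1 2 d' t_def by (simp add: algebra_simps)
      finally show "0 \<le> int ?d * \<delta> - (\<Sum>l\<in>UNIV. int (?n l) * \<mu> l)" .
    qed
    have an: "antican ?d ?n = antican d n"
    proof -
      have "(\<Sum>l\<in>UNIV. int (?n l)) = (\<Sum>l\<in>UNIV. int (n l)) + 3 * t"
        unfolding n' using sum_ind3[OF neq, of "\<lambda>_. t"] by (simp add: sum.distrib)
      then show ?thesis unfolding antican_def d' by simp
    qed
    have "int (mpol_vs.dim (fat_forms a b ?n ?d)) \<le> chi ?d ?n"
      by (rule less.IH[OF lt nn]) (simp_all only: an less.prems)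
    moreover have "chi ?d ?n = chi d n"
    proof -
      have "(\<Sum>l\<in>UNIV. int (?n l) * (int (?n l) + 1)) = (\<Sum>l\<in>UNIV. int (n l) * (int (n l) + 1)
          + (if l = i \<or> l = j \<or> l = k then 2 * t * int (n l) + t * t + t else 0))"
        unfolding n' by (rule sum.cong) (auto simp: algebra_simps)
      also have "\<dots> = (\<Sum>l\<in>UNIV. int (n l) * (int (n l) + 1)) + (2 * t * (int (n i) + int (n j) + int (n k)) + 3 * (t * t) + 3 * t)"
        using sum_ind3[OF neq, of "\<lambda>l. 2 * t * int (n l) + t * t + t"] by (simp add: sum.distrib algebra_simps)
      finally have 1: "(\<Sum>l\<in>UNIV. int (?n l) * (int (?n l) + 1)) = (\<Sum>l\<in>UNIV. int (n l) * (int (n l) + 1))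
          + (2 * t * (int (n i) + int (n j) + int (n k)) + 3 * (t * t) + 3 * t)" .
      have 2: "int (n i) + int (n j) + int (n k) = int d - t" by (simp add: t_def)
      have "2 * chi ?d ?n = 2 * chi d n"
        unfolding two_chi 1 2 d' by (simp add: algebra_simps)
      then show ?thesis by simp
    qed
    moreover have "mpol_vs.dim (fat_forms a b n d) \<le> mpol_vs.dim (fat_forms a b ?n ?d)"
      by (rule dim_fat_forms_Cremona_le[OF gen neq le])
    ultimately show ?thesis by linarith
  qed
qed

section \<open>A weak form of Bezout's theorem\<close>

text \<open>Primality among forms, which is what irreducibility of the curve yields.\<close>

definition prime_form :: "(3, 'k::field) mpol \<Rightarrow> bool" where
  "prime_form \<Phi> \<longleftrightarrow> \<Phi> \<noteq> 0 \<and> (\<forall>k l X Y. X \<in> forms k \<longrightarrow> Y \<in> forms l \<longrightarrow> \<Phi> dvd X * Y \<longrightarrow> \<Phi> dvd X \<or> \<Phi> dvd Y)"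

lemma forms_dvd:
  assumes "\<Phi> \<in> forms d" "G \<in> forms t" "G = \<Phi> * X" "G \<noteq> 0"
  shows "d \<le> t \<and> X \<in> forms (t - d)"
proof -
  have "wtge UNIV d \<Phi>" using assms(1) homg_imp_wtge[of UNIV d \<Phi> d] by (simp add: forms_iff)
  then have "wtge UNIV d G" unfolding assms(3) by (rule wtge_mult_right)
  moreover obtain m where "m \<in> Poly_Mapping.keys G" using assms(4) keys_eq_empty[of G] by blast
  ultimately have dt: "d \<le> t" using assms(2) unfolding forms_iff homg_def wtge_def by fastforce
  have "\<Phi> \<noteq> 0" using assms(3,4) by auto
  moreover have "homg UNIV (d + (t - d)) (\<Phi> * X)" using assms(2,3) dt by (simp add: forms_iff)
  ultimately show ?thesis using homg_cancel[of UNIV d "t - d" \<Phi> X] assms(1) dt by (simp add: forms_iff)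
qed

lemma forms_mult: "P \<in> forms k \<Longrightarrow> Q \<in> forms l \<Longrightarrow> P * Q \<in> forms (k + l)"
  by (simp add: forms_iff homg_mult)

lemma subspace_mult_image: "mpol_vs.subspace V \<Longrightarrow> mpol_vs.subspace ((\<lambda>Q. M * Q) ` V)"
proof (rule mpol_vs.subspaceI)
  assume V: "mpol_vs.subspace V"
  show "0 \<in> (\<lambda>Q. M * Q) ` V" using mpol_vs.subspace_0[OF V] by (intro image_eqI[of _ _ 0]) simp_all
  show "x + y \<in> (\<lambda>Q. M * Q) ` V" if "x \<in> (\<lambda>Q. M * Q) ` V" "y \<in> (\<lambda>Q. M * Q) ` V" for x y
  proof -
    from that obtain u v where uv: "u \<in> V" "v \<in> V" "x = M * u" "y = M * v" by blast
    then show ?thesis using mpol_vs.subspace_add[OF V uv(1,2)] by (intro image_eqI[of _ _ "u + v"]) (simp_all add: distrib_left)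
  qed
  show "Const c * x \<in> (\<lambda>Q. M * Q) ` V" if "x \<in> (\<lambda>Q. M * Q) ` V" for c x
  proof -
    from that obtain u where u: "u \<in> V" "x = M * u" by blast
    then show ?thesis using mpol_vs.subspace_scale[OF V u(1), of c]
      by (intro image_eqI[of _ _ "Const c * u"]) (simp_all add: mult.left_commute)
  qed
qed

lemma dim_le_mult_image:
  fixes M :: "(3, 'k::field) mpol"
  assumes "M \<noteq> 0" "mpol_vs.subspace V" "fdim ((\<lambda>Q. M * Q) ` V)"
  shows "mpol_vs.dim V \<le> mpol_vs.dim ((\<lambda>Q. M * Q) ` V)"
  by (rule dim_le_inj[where f = "\<lambda>Q. M * Q"])
    (use assms in \<open>auto simp: distrib_left mult.left_commute\<close>)

text \<open>The multiples of \<Phi> and of G lie in a common space and, by primality of \<Phi>, meet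
  only in multiples of \<Phi> G. Lower bounds for the two parts and the exact dimension of the whole
  leave the claim, because the intersection form is the polarisation of the quadratic part of
  \<open>chi\<close>.\<close>

theorem bezout_fat_forms:
  fixes a b :: "9 \<Rightarrow> 'k::alg_closed_field"
  assumes gen: "generic_points a b"
    and \<Phi>: "\<Phi> \<in> fat_forms a b m d" "prime_form \<Phi>" and G: "G \<in> fat_forms a b n t" "\<not> \<Phi> dvd G"
  shows "(\<Sum>i\<in>UNIV. int (m i) * int (n i)) \<le> int d * int t"
proof -
  \<comment> \<open>Chosen so large that the degree of the ambient space is at least nine times each
    of its multiplicities.\<close>
  define u where "u = 9 * (\<Sum>i\<in>UNIV. m i + n i)"
  define k where "k = u + d + t"
  have k9: "9 * (m i + n i) \<le> k" for i
  proof -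
    have "m i + n i \<le> (\<Sum>i\<in>UNIV. m i + n i)" by (rule member_le_sum) auto
    then show ?thesis by (simp add: k_def u_def)
  qed
  have kd: "k - d = u + t" "k - t = u + d" by (simp_all add: k_def)
  have \<Phi>f: "\<Phi> \<in> forms d" "\<Phi> \<noteq> 0" and Gf: "G \<in> forms t" "G \<noteq> 0"
    using \<Phi> G by (auto simp: fat_forms_iff prime_form_def)
  let ?V = "fat_forms a b"
  let ?A = "(\<lambda>Q. \<Phi> * Q) ` ?V n (u + t)" and ?B = "(\<lambda>Q. G * Q) ` ?V m (u + d)" and ?W = "?V (\<lambda>i. m i + n i) k"
  have fA: "fdim ?A" and fB: "fdim ?B" by (rule fdim_mult_image[OF \<Phi>f(1)], rule fdim_mult_image[OF Gf(1)])
  have AW: "\<Phi> * Q \<in> ?W" if "Q \<in> ?V n (u + t)" for Q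
    using that \<Phi>(1) forms_mult[of \<Phi> d Q "u + t"] ordge_mult[of _ _ _ \<Phi> _ Q]
    by (simp add: fat_forms_iff k_def add_ac)
  have BW: "G * Q \<in> ?W" if "Q \<in> ?V m (u + d)" for Q
  proof -
    have "ordge (a i) (b i) (n i + m i) (G * Q)" for i
      using that G(1) by (intro ordge_mult) (simp_all add: fat_forms_iff)
    then show ?thesis using that G(1) forms_mult[of G t Q "u + d"] by (simp add: fat_forms_iff k_def add_ac)
  qed
  have "mpol_vs.dim ?A + mpol_vs.dim ?B \<le> mpol_vs.dim ?W + mpol_vs.dim (?A \<inter> ?B)"
  proof (rule dim_sums_Int_le)
    show "x + y \<in> ?W" if "x \<in> ?A" "y \<in> ?B" for x y
      using that AW BW mpol_vs.subspace_add[OF subspace_fat_forms] by blast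
  qed (use fA fB fdim_fat_forms subspace_mult_image[OF subspace_fat_forms] in auto)
  moreover have "mpol_vs.dim (?V n (u + t)) \<le> mpol_vs.dim ?A"
    by (rule dim_le_mult_image[OF \<Phi>f(2) subspace_fat_forms fA])
  moreover have "mpol_vs.dim (?V m (u + d)) \<le> mpol_vs.dim ?B"
    by (rule dim_le_mult_image[OF Gf(2) subspace_fat_forms fB])
  moreover have "mpol_vs.dim (?A \<inter> ?B) \<le> (u + 2) choose 2"
  proof -
    \<comment> \<open>Multiplicities of the remaining cofactor are ignored; the space of all forms
      of degree \<open>u\<close> is already small enough.\<close>
    have "?A \<inter> ?B \<subseteq> (\<lambda>Q. (\<Phi> * G) * Q) ` forms u"
    proof
      fix z assume z: "z \<in> ?A \<inter> ?B"
      then obtain X Y where XYz: "z = \<Phi> * X" "z = G * Y" "Y \<in> ?V m (u + d)" by blast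
      have XY: "z = \<Phi> * X" "z = G * Y" "Y \<in> forms (u + d)" using XYz by (simp_all only: fat_forms_iff)
      then have "\<Phi> dvd G * Y" by (metis dvd_triv_left)
      then have "\<Phi> dvd Y" using \<Phi>(2) G(2) Gf(1) XY(3) unfolding prime_form_def by blast
      then obtain Z where Z: "Y = \<Phi> * Z" by blast
      show "z \<in> (\<lambda>Q. (\<Phi> * G) * Q) ` forms u"
      proof (cases "Y = 0")
        case True
        then show ?thesis using XY by (intro image_eqI[of _ _ 0]) (simp_all add: forms_iff)
      next
        case False
        then have "Z \<in> forms u" using forms_dvd[OF \<Phi>f(1) XY(3) Z] by simp
        then show ?thesis using XY Z by (intro image_eqI[of _ _ Z]) (simp_all add: mult_ac)
      qed
    qed
    then have "mpol_vs.dim (?A \<inter> ?B) \<le> mpol_vs.dim (forms u :: (3, 'k) mpol set)"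
      using fdim_forms by (rule dim_mult_image_le)
    then show ?thesis by (simp add: dim_forms)
  qed
  moreover have "int (mpol_vs.dim ?W) = chi k (\<lambda>i. m i + n i)" by (rule dim_fat_forms_big[OF gen k9])
  moreover have "chi (u + t) n \<le> int (mpol_vs.dim (?V n (u + t)))" "chi (u + d) m \<le> int (mpol_vs.dim (?V m (u + d)))"
    by (rule dim_fat_forms_ge_chi)+
  ultimately have "chi (u + t) n + chi (u + d) m \<le> chi k (\<lambda>i. m i + n i) + int ((u + 2) choose 2)"
    by linarith
  then have "2 * chi (u + t) n + 2 * chi (u + d) m \<le> 2 * chi k (\<lambda>i. m i + n i) + 2 * int ((u + 2) choose 2)"
    by linarith
  then have "(int (u + t) + 1) * (int (u + t) + 2) - (\<Sum>i\<in>UNIV. int (n i) * (int (n i) + 1))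
      + ((int (u + d) + 1) * (int (u + d) + 2) - (\<Sum>i\<in>UNIV. int (m i) * (int (m i) + 1)))
      \<le> (int k + 1) * (int k + 2) - (\<Sum>i\<in>UNIV. int (m i + n i) * (int (m i + n i) + 1)) + (int u + 1) * (int u + 2)"
    unfolding two_chi choose_two_int by (simp add: algebra_simps)
  moreover have "(\<Sum>i\<in>UNIV. int (m i + n i) * (int (m i + n i) + 1)) = (\<Sum>i\<in>UNIV. int (m i) * (int (m i) + 1))
      + (\<Sum>i\<in>UNIV. int (n i) * (int (n i) + 1)) + 2 * (\<Sum>i\<in>UNIV. int (m i) * int (n i))"
    unfolding sum_distrib_left sum.distrib[symmetric] by (rule sum.cong) (simp_all add: algebra_simps)
  moreover have "(int k + 1) * (int k + 2) + (int u + 1) * (int u + 2) - (int (u + t) + 1) * (int (u + t) + 2)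
      - (int (u + d) + 1) * (int (u + d) + 2) = 2 * (int d * int t)"
    unfolding k_def by (simp add: algebra_simps)
  ultimately show ?thesis by linarith
qed

section \<open>Multiplication by linear forms\<close>

text \<open>Without a relation the three spaces x_j V would be independent and fill 3 dim V
  dimensions of the target.\<close>

lemma mu_kernel_exists:
  fixes a b :: "9 \<Rightarrow> 'k::field"
  assumes "mpol_vs.dim (fat_forms a b n (Suc k)) < 3 * mpol_vs.dim (fat_forms a b n k)"
  shows "\<exists>f. (\<forall>j. f j \<in> fat_forms a b n k) \<and> mu f = 0 \<and> (\<exists>j. f j \<noteq> 0)"
proof (rule ccontr)
  assume no: "\<not> ?thesis"
  let ?V = "fat_forms a b n k" and ?W = "fat_forms a b n (Suc k)"
  let ?A = "\<lambda>j. (\<lambda>Q. Var j * Q) ` ?V"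
  let ?S = "{x + y | x y. x \<in> ?A 0 \<and> y \<in> ?A 1}"
  have Vf: "Var j \<in> forms 1" for j by (simp add: forms_iff)
  have mu3: "mu f = Var 0 * f 0 + Var 1 * f 1 + Var 2 * f 2" for f :: "3 \<Rightarrow> (3, 'k) mpol"
    unfolding mu_def sum_3 by (simp only: mult.commute)
  have triv: "u = 0 \<and> v = 0 \<and> w = 0" if "u \<in> ?V" "v \<in> ?V" "w \<in> ?V" "Var 0 * u + Var 1 * v + Var 2 * w = 0" for u v w
  proof -
    define f where "f j = (if j = 0 then u else if j = 1 then v else w)" for j :: 3
    have f012: "f 0 = u" "f 1 = v" "f 2 = w" by (simp_all add: f_def)
    have "\<forall>j. f j \<in> ?V" using that by (simp add: f_def)
    moreover have "mu f = 0" unfolding mu3 f012 by (rule that(4))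
    ultimately have "\<forall>j. f j = 0" using no by blast
    then show ?thesis using f012 by metis
  qed
  have fA: "fdim (?A j)" for j by (rule fdim_mult_image[OF Vf])
  have sA: "mpol_vs.subspace (?A j)" for j by (rule subspace_mult_image[OF subspace_fat_forms])
  have sS: "mpol_vs.subspace ?S" by (rule mpol_vs.subspace_sums[OF sA sA])
  have dA: "mpol_vs.dim ?V \<le> mpol_vs.dim (?A j)" for j
    by (rule dim_le_mult_image[OF Var_nonzero subspace_fat_forms fA])
  have AW: "Var j * Q \<in> ?W" if "Q \<in> ?V" for j Q
    using that forms_mult[OF Vf, of Q k j] by (auto simp: fat_forms_iff ordge_mult_left)
  have addW: "x + y \<in> ?W" if "x \<in> ?W" "y \<in> ?W" for x y by (rule mpol_vs.subspace_add[OF subspace_fat_forms that])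
  have SW: "?S \<subseteq> ?W" using AW addW by blast
  have fS: "fdim ?S" using fdim_fat_forms SW by (rule fdim_mono)
  have z: "0 \<in> ?V" by (rule mpol_vs.subspace_0[OF subspace_fat_forms])
  have neg: "- w \<in> ?V" if "w \<in> ?V" for w by (rule mpol_vs.subspace_neg[OF subspace_fat_forms that])
  have "?A 0 \<inter> ?A 1 \<subseteq> {0}"
  proof
    fix x assume "x \<in> ?A 0 \<inter> ?A 1"
    then obtain u v where uv: "u \<in> ?V" "v \<in> ?V" "x = Var 0 * u" "x = Var 1 * v" by blast
    then have "Var 0 * u + Var 1 * (- v) + Var 2 * 0 = 0" by simp
    then show "x \<in> {0}" using triv[OF uv(1) neg[OF uv(2)] z] uv(3) by simp
  qed
  then have i1: "mpol_vs.dim (?A 0 \<inter> ?A 1) \<le> card ({} :: (3, 'k) mpol set)" by (intro mpol_vs.dim_le_card) auto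
  have "?S \<inter> ?A 2 \<subseteq> {0}"
  proof
    fix x assume "x \<in> ?S \<inter> ?A 2"
    then obtain u v w where uvw: "u \<in> ?V" "v \<in> ?V" "w \<in> ?V" "x = Var 0 * u + Var 1 * v" "x = Var 2 * w" by blast
    then have "Var 0 * u + Var 1 * v + Var 2 * (- w) = 0" by simp
    then show "x \<in> {0}" using triv[OF uvw(1,2) neg[OF uvw(3)]] uvw(5) by simp
  qed
  then have i2: "mpol_vs.dim (?S \<inter> ?A 2) \<le> card ({} :: (3, 'k) mpol set)" by (intro mpol_vs.dim_le_card) auto
  have "mpol_vs.dim (?A 0) + mpol_vs.dim (?A 1) \<le> mpol_vs.dim ?S + mpol_vs.dim (?A 0 \<inter> ?A 1)"
    by (rule dim_sums_Int_le[OF sA fA sA fA fS]) blast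
  moreover have "mpol_vs.dim ?S + mpol_vs.dim (?A 2) \<le> mpol_vs.dim ?W + mpol_vs.dim (?S \<inter> ?A 2)"
    by (rule dim_sums_Int_le[OF sS fS sA fA fdim_fat_forms]) (use SW AW addW in blast)
  ultimately show False using i1 i2 dA[of 0] dA[of 1] dA[of 2] assms by simp
qed

lemma dim_mu_image_le:
  fixes a b :: "9 \<Rightarrow> 'k::field"
  assumes f: "\<And>j. f j \<in> fat_forms a b n k" "mu f = 0" "f j0 \<noteq> 0"
  shows "mpol_vs.dim (mu ` mu_source a b n k) + 1 \<le> 3 * mpol_vs.dim (fat_forms a b n k)"
proof -
  let ?V = "fat_forms a b n k"
  have "mpol_vs.independent {f j0}" using f(3) by simp
  then obtain B where B: "{f j0} \<subseteq> B" "B \<subseteq> ?V" "mpol_vs.independent B" "?V \<subseteq> mpol_vs.span B" "card B = mpol_vs.dim ?V" "finite B"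
    using extend_basis_fdim[OF fdim_fat_forms, of "{f j0}" a b n k] f(1)[of j0] by auto
  let ?I = "(UNIV \<times> B) - {(j0, f j0)}"
  let ?E = "(\<lambda>(j, x). Var j * x) ` ?I"
  have spanV: "Var j * x \<in> mpol_vs.span ?E"
    if "x \<in> mpol_vs.span B" and B': "\<And>y. y \<in> B \<Longrightarrow> Var j * y \<in> mpol_vs.span ?E" for j x
    using that(1)
  proof (induction rule: mpol_vs.span_induct_alt)
    case (step c x y)
    have "Const c * (Var j * x) + Var j * y \<in> mpol_vs.span ?E"
      using step B' by (intro mpol_vs.span_add[OF mpol_vs.span_scale]) auto
    then show ?case by (simp only: distrib_left mult.left_commute)
  next
    case base
    show ?case using mpol_vs.span_zero by simp
  qed
  have base: "Var j * y \<in> mpol_vs.span ?E" if "y \<in> B" "j \<noteq> j0 \<or> y \<noteq> f j0" for j y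
    using that by (intro mpol_vs.span_base) force
  have other: "Var j * x \<in> mpol_vs.span ?E" if "x \<in> ?V" "j \<noteq> j0" for j x
  proof (rule spanV)
    show "x \<in> mpol_vs.span B" using B(4) that(1) by blast
    show "Var j * y \<in> mpol_vs.span ?E" if "y \<in> B" for y using base[OF that, of j] \<open>j \<noteq> j0\<close> by blast
  qed
  have "Var j0 * f j0 = - (\<Sum>j\<in>UNIV - {j0}. Var j * f j)"
  proof -
    have "0 = (\<Sum>j\<in>UNIV. Var j * f j)" using f(2) by (simp add: mu_def mult.commute)
    also have "\<dots> = Var j0 * f j0 + (\<Sum>j\<in>UNIV - {j0}. Var j * f j)" by (rule sum.remove) auto
    finally show ?thesis by (simp add: eq_neg_iff_add_eq_0)
  qed
  also have "\<dots> \<in> mpol_vs.span ?E"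
    using other f(1) by (intro mpol_vs.span_neg mpol_vs.span_sum) auto
  finally have j0: "Var j0 * f j0 \<in> mpol_vs.span ?E" .
  have all: "Var j * x \<in> mpol_vs.span ?E" if "x \<in> ?V" for j x
  proof (rule spanV)
    show "x \<in> mpol_vs.span B" using that B(4) by blast
    show "Var j * y \<in> mpol_vs.span ?E" if "y \<in> B" for y
      using base[OF that, of j] j0 by (cases "j = j0 \<and> y = f j0") auto
  qed
  have "mu ` mu_source a b n k \<subseteq> mpol_vs.span ?E"
  proof
    fix x assume "x \<in> mu ` mu_source a b n k"
    then obtain g where g: "\<And>j. g j \<in> ?V" "x = (\<Sum>j\<in>UNIV. Var j * g j)"
      by (auto simp: mu_source_def mu_def mult.commute)
    show "x \<in> mpol_vs.span ?E" unfolding g(2) using all g(1) by (intro mpol_vs.span_sum) auto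
  qed
  then have "mpol_vs.dim (mu ` mu_source a b n k) \<le> card ?E" using B(6) by (intro mpol_vs.dim_le_card) auto
  also have "\<dots> \<le> card ?I" using B(6) by (intro card_image_le) auto
  also have "card ?I = 3 * card B - 1" using B(1,6) by (simp add: card_cartesian_product)
  finally have "mpol_vs.dim (mu ` mu_source a b n k) \<le> 3 * card B - 1" .
  moreover have "card B > 0" using B(1,6) by (auto simp: card_gt_0_iff)
  ultimately show ?thesis using B(5) by simp
qed

text \<open>Cauchy-Schwarz against the constant vector, from the sum of the squares of 9 f_i -
  S.\<close>

lemma sum_squared_le_9:
  fixes f :: "9 \<Rightarrow> int"
  shows "(\<Sum>i\<in>UNIV. f i)\<^sup>2 \<le> 9 * (\<Sum>i\<in>UNIV. (f i)\<^sup>2)"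
proof -
  let ?S = "\<Sum>i\<in>UNIV. f i" and ?Q = "\<Sum>i\<in>UNIV. (f i)\<^sup>2"
  have "(\<Sum>i\<in>UNIV. (9 * f i - ?S)\<^sup>2) = (\<Sum>i\<in>UNIV. 81 * (f i)\<^sup>2 - 18 * ?S * f i + ?S\<^sup>2)"
    by (rule sum.cong) (simp_all add: power2_eq_square algebra_simps)
  also have "\<dots> = 81 * ?Q - 18 * ?S * ?S + 9 * ?S\<^sup>2"
    unfolding sum.distrib sum_subtractf sum_distrib_left[symmetric] by simp
  also have "\<dots> = 81 * ?Q - 9 * ?S\<^sup>2" by (simp add: power2_eq_square)
  finally have "0 \<le> 81 * ?Q - 9 * ?S\<^sup>2" by (metis sum_nonneg zero_le_power2)
  then show ?thesis by linarith
qed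

text \<open>Cauchy-Schwarz gives -6 \<delta> \<le> 8, which leaves only \<delta> = -1. There the sum
  of \<mu>_i (\<mu>_i + 1) would be 2 - 4, although no term is negative.\<close>

lemma exc_class_degree_nonneg:
  assumes "exc_class \<delta> \<mu>" shows "0 \<le> \<delta>"
proof (rule ccontr)
  assume "\<not> ?thesis"
  then have neg: "\<delta> \<le> -1" by simp
  have S: "(\<Sum>i\<in>UNIV. \<mu> i) = 3 * \<delta> - 1" and Q: "(\<Sum>i\<in>UNIV. (\<mu> i)\<^sup>2) = \<delta>\<^sup>2 + 1"
    using assms by (simp_all add: exc_class_def)
  have "(3 * \<delta> - 1)\<^sup>2 \<le> 9 * (\<delta>\<^sup>2 + 1)" using sum_squared_le_9[of \<mu>] unfolding S Q .
  then have "- 6 * \<delta> \<le> 8" by (simp add: power2_eq_square algebra_simps)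
  then have d: "\<delta> = -1" using neg by linarith
  have "0 \<le> (\<Sum>i\<in>UNIV. (\<mu> i)\<^sup>2 + \<mu> i)"
  proof (rule sum_nonneg)
    fix i
    have "0 \<le> \<mu> i * (\<mu> i + 1)" by (cases "0 \<le> \<mu> i") (simp_all add: mult_nonpos_nonpos)
    then show "0 \<le> (\<mu> i)\<^sup>2 + \<mu> i" by (simp add: power2_eq_square algebra_simps)
  qed
  then show False unfolding sum.distrib S Q d by simp
qed

lemma dim_eq_0_fat_forms:
  assumes "\<And>P. P \<in> fat_forms a b n k \<Longrightarrow> P = 0" shows "mpol_vs.dim (fat_forms a b n k) = 0"
proof -
  have "mpol_vs.dim (fat_forms a b n k) \<le> card ({} :: (3, 'a) mpol set)"
    using assms by (intro mpol_vs.dim_le_card) auto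
  then show ?thesis by simp
qed

lemma ordge_max:
  assumes "P \<in> forms k" "P \<noteq> 0"
  shows "\<exists>r. ordge a b r P \<and> \<not> ordge a b (Suc r) P"
  using ordge_exact[of a b "Suc k" P] ordge_forms_0[OF assms(1), of a b "Suc k"] assms(2) by auto

section \<open>The fat points attached to an exceptional class\<close>

text \<open>What is retained of C': a prime form with its degree and multiplicities, and the
  self-intersection number.\<close>

locale odd_exceptional =
  fixes a b :: "9 \<Rightarrow> 'k::alg_closed_field" and d' :: nat and m' :: "9 \<Rightarrow> nat" and \<Phi> :: "(3, 'k) mpol"
  assumes gen: "generic_points a b" and d': "2 \<le> d'"
    and \<Phi>: "\<Phi> \<in> fat_forms a b (\<lambda>i. 2 * m' i + 1) (2 * d')" "prime_form \<Phi>"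
    and self: "4 * (int d')\<^sup>2 - (\<Sum>i\<in>UNIV. (2 * int (m' i) + 1)\<^sup>2) = -1"
begin

abbreviation "s1 \<equiv> \<Sum>i\<in>UNIV. int (m' i)"
abbreviation "s2 \<equiv> \<Sum>i\<in>UNIV. (int (m' i))\<^sup>2"
abbreviation "D \<equiv> int d'"

lemma \<Phi>_form: "\<Phi> \<in> forms (2 * d')" and \<Phi>_nz: "\<Phi> \<noteq> 0"
  using \<Phi> by (simp_all add: fat_forms_iff prime_form_def)

lemma not_dvd_low_degree:
  assumes "G \<in> forms t" "G \<noteq> 0" "t < 2 * d'" shows "\<not> \<Phi> dvd G"
  using forms_dvd[OF \<Phi>_form assms(1)] assms by (auto elim!: dvdE)

lemma sq_sum: "(\<Sum>i\<in>UNIV. (2 * int (m' i) + 1)\<^sup>2) = 4 * s2 + 4 * s1 + 9"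
proof -
  have "(\<Sum>i\<in>UNIV. (2 * int (m' i) + 1)\<^sup>2) = (\<Sum>i\<in>UNIV. 4 * (int (m' i))\<^sup>2 + 4 * int (m' i) + 1)"
    by (rule sum.cong) (simp_all add: power2_eq_square algebra_simps)
  also have "\<dots> = 4 * s2 + 4 * s1 + 9"
    unfolding sum.distrib sum_distrib_left[symmetric] by simp
  finally show ?thesis .
qed

lemma s12: "s2 + s1 = D\<^sup>2 - 2"
  using self unfolding sq_sum by linarith

text \<open>Ten coefficients and nine conditions leave a cubic through the points. Its degree is
  below that of \<Phi>, so \<Phi> does not divide it and Bezout applies.\<close>

lemma cubic_bound:
  assumes "\<Phi> \<in> fat_forms a b M (2 * d')"
  shows "(\<Sum>i\<in>UNIV. int (M i)) \<le> 6 * D"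
proof -
  have "chi 3 (\<lambda>_. 1) = 1" by (simp add: chi_def eval_nat_numeral)
  then have "\<not> fat_forms a b (\<lambda>_. 1) 3 \<subseteq> {0}"
    using dim_fat_forms_ge_chi[of 3 "\<lambda>_. 1" a b] dim_eq_0_fat_forms[of a b "\<lambda>_. 1" 3] by auto
  then obtain G where G: "G \<in> fat_forms a b (\<lambda>_. 1) 3" "G \<noteq> 0" by blast
  then have "\<not> \<Phi> dvd G" using d' by (intro not_dvd_low_degree[of G 3]) (auto simp: fat_forms_iff)
  from bezout_fat_forms[OF gen assms \<Phi>(2) G(1) this] show ?thesis by simp
qed

text \<open>This says -K.C' = 1. The number is at least 0 by \<open>cubic_bound\<close>; C'^2 < 0
  makes \<Phi> unique up to scalars, so \<chi> is at most 1 and the number is at most 1; and it is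
  odd, because nine odd multiplicities are subtracted from 6 d'.\<close>

lemma s1_eq: "s1 = 3 * D - 5"
proof -
  have e: "(\<Sum>i\<in>UNIV. int (2 * m' i + 1)) = 2 * s1 + 9"
  proof -
    have "(\<Sum>i\<in>UNIV. int (2 * m' i + 1)) = (\<Sum>i\<in>UNIV. 2 * int (m' i) + 1)" by (rule sum.cong) simp_all
    then show ?thesis unfolding sum.distrib sum_distrib_left[symmetric] by simp
  qed
  have up: "2 * s1 + 9 \<le> 6 * D" using cubic_bound[OF \<Phi>(1)] unfolding e .
  let ?V = "fat_forms a b (\<lambda>i. 2 * m' i + 1) (2 * d')"
  \<comment> \<open>A form of the same class that \<Phi> does not divide would give C'^2 \<ge>
    0.\<close>
  have "?V \<subseteq> mpol_vs.span {\<Phi>}"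
  proof
    fix \<Psi> assume \<Psi>: "\<Psi> \<in> ?V"
    have "\<Phi> dvd \<Psi>"
    proof (rule ccontr)
      assume "\<not> \<Phi> dvd \<Psi>"
      from bezout_fat_forms[OF gen \<Phi> \<Psi> this]
      have "(\<Sum>i\<in>UNIV. int (2 * m' i + 1) * int (2 * m' i + 1)) \<le> int (2 * d') * int (2 * d')" .
      moreover have "(\<Sum>i\<in>UNIV. int (2 * m' i + 1) * int (2 * m' i + 1)) = (\<Sum>i\<in>UNIV. (2 * int (m' i) + 1)\<^sup>2)"
        by (rule sum.cong) (simp_all add: power2_eq_square add.commute)
      ultimately show False using self by (simp add: power2_eq_square)
    qed
    then obtain X where X: "\<Psi> = \<Phi> * X" by blast
    show "\<Psi> \<in> mpol_vs.span {\<Phi>}"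
    proof (cases "\<Psi> = 0")
      case True
      then show ?thesis using mpol_vs.span_zero by simp
    next
      case False
      then have "X \<in> forms 0" using forms_dvd[OF \<Phi>_form _ X, of "2 * d'"] \<Psi> by (simp add: fat_forms_iff)
      have "X = Const (Poly_Mapping.lookup X 0)"
      proof (rule poly_mapping_eqI)
        fix m
        show "Poly_Mapping.lookup X m = Poly_Mapping.lookup (Const (Poly_Mapping.lookup X 0)) m"
        proof (cases "m = 0")
          case False
          then have "wt UNIV m \<noteq> 0" using poly_mapping_eqI3[of m 0] by (auto simp: wt_UNIV3)
          then have "m \<notin> Poly_Mapping.keys X" using \<open>X \<in> forms 0\<close> by (auto simp: forms_iff homg_def)
          then show ?thesis using False by (simp add: Const_def lookup_single in_keys_iff)
        qed (simp add: Const_def)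
      qed
      then have "\<Psi> = Const (Poly_Mapping.lookup X 0) * \<Phi>" using X by (metis mult.commute)
      then show ?thesis using mpol_vs.span_scale[OF mpol_vs.span_base[of \<Phi> "{\<Phi>}"]] by simp
    qed
  qed
  then have "mpol_vs.dim ?V \<le> card {\<Phi>}" by (intro mpol_vs.dim_le_card) auto
  then have "chi (2 * d') (\<lambda>i. 2 * m' i + 1) \<le> 1" using dim_fat_forms_ge_chi[of "2 * d'" "\<lambda>i. 2 * m' i + 1" a b] by simp
  then have "2 * chi (2 * d') (\<lambda>i. 2 * m' i + 1) \<le> 2" by linarith
  moreover have "(\<Sum>i\<in>UNIV. int (2 * m' i + 1) * (int (2 * m' i + 1) + 1)) = 4 * s2 + 6 * s1 + 18"
  proof -
    have "(\<Sum>i\<in>UNIV. int (2 * m' i + 1) * (int (2 * m' i + 1) + 1)) = (\<Sum>i\<in>UNIV. 4 * (int (m' i))\<^sup>2 + 6 * int (m' i) + 2)"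
      by (rule sum.cong) (simp_all add: power2_eq_square algebra_simps)
    then show ?thesis unfolding sum.distrib sum_distrib_left[symmetric] by simp
  qed
  moreover have "(int (2 * d') + 1) * (int (2 * d') + 2) = 4 * D\<^sup>2 + 6 * D + 2"
    by (simp add: power2_eq_square algebra_simps)
  ultimately have "4 * D\<^sup>2 + 6 * D + 2 - (4 * s2 + 6 * s1 + 18) \<le> 2" unfolding two_chi by simp
  then show ?thesis using up s12 by linarith
qed

lemma s2_eq: "s2 = D\<^sup>2 - 3 * D + 3"
  using s12 s1_eq by linarith

abbreviation "n \<equiv> \<lambda>i. 3 * m' i + 1"
abbreviation "\<alpha> \<equiv> 3 * d' - 1"

lemma int_\<alpha>: "int \<alpha> = 3 * D - 1"
  using d' by linarith

lemma sum_lin: "(\<Sum>i\<in>UNIV. int (m' i) * p + q) = s1 * p + 9 * q" for p q :: int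
  unfolding sum.distrib sum_distrib_right[symmetric] by simp

lemma antican_n: "antican \<alpha> n = 3"
proof -
  have "(\<Sum>i\<in>UNIV. int (n i)) = (\<Sum>i\<in>UNIV. int (m' i) * 3 + 1)" by (rule sum.cong) simp_all
  then show ?thesis unfolding antican_def int_\<alpha> sum_lin s1_eq by simp
qed

lemma sum_n: "(\<Sum>i\<in>UNIV. int (n i) * (int (n i) + 1)) = 9 * D\<^sup>2"
proof -
  have "(\<Sum>i\<in>UNIV. int (n i) * (int (n i) + 1)) = (\<Sum>i\<in>UNIV. 9 * (int (m' i))\<^sup>2 + 9 * int (m' i) + 2)"
    by (rule sum.cong) (simp_all add: power2_eq_square algebra_simps)
  also have "\<dots> = 9 * s2 + 9 * s1 + 18"
    unfolding sum.distrib sum_distrib_left[symmetric] by simp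
  finally show ?thesis using s12 by linarith
qed

lemma two_chi_n: "2 * chi k n = (int k + 1) * (int k + 2) - 9 * D\<^sup>2"
  unfolding two_chi sum_n ..

text \<open>Here \<open>2 F = 3 C' + K + L\<close> for the class \<open>F\<close> of degree \<open>\<alpha>\<close>,
  and distinct exceptional classes meet non-negatively because the form is negative semidefinite on \<open>K\<^sup>\<bottom>\<close>.\<close>

lemma num_nef_n: "num_nef \<alpha> n"
  unfolding num_nef_def
proof (intro allI impI)
  fix \<delta> \<mu> assume e: "exc_class \<delta> \<mu>"
  \<comment> \<open>The intersection number of C' with the given class.\<close>
  define c where "c = 2 * D * \<delta> - (\<Sum>i\<in>UNIV. (2 * int (m' i) + 1) * \<mu> i)"
  have S: "(\<Sum>i\<in>UNIV. \<mu> i) = 3 * \<delta> - 1" and Q: "(\<Sum>i\<in>UNIV. (\<mu> i)\<^sup>2) = \<delta>\<^sup>2 + 1"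
    using e by (simp_all add: exc_class_def)
  have SC: "(\<Sum>i\<in>UNIV. 2 * int (m' i) + 1) = 6 * D - 1"
    unfolding sum.distrib sum_distrib_left[symmetric] s1_eq by simp
  have QC: "(\<Sum>i\<in>UNIV. (2 * int (m' i) + 1)\<^sup>2) = 4 * D\<^sup>2 + 1" using self by linarith
  have dn: "0 \<le> \<delta>" by (rule exc_class_degree_nonneg[OF e])
  have F: "2 * (int \<alpha> * \<delta> - (\<Sum>i\<in>UNIV. int (n i) * \<mu> i)) = 3 * c - 1 + \<delta>"
  proof -
    have "2 * (\<Sum>i\<in>UNIV. int (n i) * \<mu> i) = (\<Sum>i\<in>UNIV. 3 * ((2 * int (m' i) + 1) * \<mu> i) - \<mu> i)"
      unfolding sum_distrib_left by (rule sum.cong) (simp_all add: algebra_simps)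
    also have "\<dots> = 3 * (\<Sum>i\<in>UNIV. (2 * int (m' i) + 1) * \<mu> i) - (3 * \<delta> - 1)"
      unfolding sum_subtractf sum_distrib_left[symmetric] S ..
    finally show ?thesis unfolding c_def int_\<alpha> by (simp add: algebra_simps)
  qed
  \<comment> \<open>\<open>x\<close> and \<open>y\<close> are degree and multiplicities of the
    difference of the two classes. It is orthogonal to K, and the sum of the (3 y_i - x)^2 is -9
    times its square.\<close>
  define x where "x = 2 * D - \<delta>"
  define y where "y i = 2 * int (m' i) + 1 - \<mu> i" for i
  have Sy: "(\<Sum>i\<in>UNIV. y i) = 3 * x" unfolding y_def sum_subtractf SC S x_def by simp
  have Qy: "(\<Sum>i\<in>UNIV. (y i)\<^sup>2) = x\<^sup>2 + 2 + 2 * c"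
  proof -
    have "(\<Sum>i\<in>UNIV. (y i)\<^sup>2) = (\<Sum>i\<in>UNIV. (2 * int (m' i) + 1)\<^sup>2 + (\<mu> i)\<^sup>2 - 2 * ((2 * int (m' i) + 1) * \<mu> i))"
      unfolding y_def by (rule sum.cong) (simp_all add: power2_eq_square algebra_simps)
    also have "\<dots> = 4 * D\<^sup>2 + 1 + (\<delta>\<^sup>2 + 1) - 2 * (\<Sum>i\<in>UNIV. (2 * int (m' i) + 1) * \<mu> i)"
      unfolding sum_subtractf sum.distrib sum_distrib_left[symmetric] QC Q ..
    finally show ?thesis unfolding c_def x_def by (simp add: power2_eq_square algebra_simps)
  qed
  have CS: "(\<Sum>i\<in>UNIV. (3 * y i - x)\<^sup>2) = 18 + 18 * c"
  proof -
    have "(\<Sum>i\<in>UNIV. (3 * y i - x)\<^sup>2) = (\<Sum>i\<in>UNIV. 9 * (y i)\<^sup>2 - 6 * x * y i + x\<^sup>2)"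
      by (rule sum.cong) (simp_all add: power2_eq_square algebra_simps)
    also have "\<dots> = 9 * (x\<^sup>2 + 2 + 2 * c) - 6 * x * (3 * x) + 9 * x\<^sup>2"
      unfolding sum.distrib sum_subtractf sum_distrib_left[symmetric] Qy Sy by simp
    finally show ?thesis by (simp add: power2_eq_square)
  qed
  have c: "-1 \<le> c"
  proof -
    have "0 \<le> (\<Sum>i\<in>UNIV. (3 * y i - x)\<^sup>2)" by (rule sum_nonneg) simp
    then show ?thesis unfolding CS by linarith
  qed
  show "0 \<le> int \<alpha> * \<delta> - (\<Sum>i\<in>UNIV. int (n i) * \<mu> i)"
  proof (cases "c = -1")
    case False
    \<comment> \<open>Now c and \<delta> are non-negative, so twice the number is at least -1, and
      parity excludes -1.\<close>
    then have "-1 \<le> 2 * (int \<alpha> * \<delta> - (\<Sum>i\<in>UNIV. int (n i) * \<mu> i))" unfolding F using c dn by linarith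
    moreover have "-1 \<le> 2 * z \<Longrightarrow> 0 \<le> z" for z :: int by presburger
    ultimately show ?thesis by blast
  next
    case True
    \<comment> \<open>Equality in Cauchy-Schwarz: the difference is a multiple z of -K. Then c = -1
      - z, so z = 0 and the given class is that of C' itself.\<close>
    have "\<forall>i\<in>UNIV. (3 * y i - x)\<^sup>2 = 0"
      by (subst sum_nonneg_eq_0_iff[symmetric]) (simp_all add: CS True)
    then have yx: "3 * y i = x" for i by simp
    define z where "z = y 0"
    have yz: "y i = z" for i using yx[of i] yx[of 0] by (simp add: z_def)
    have xz: "x = 3 * z" using yx[of 0] by (simp add: z_def)
    have mu: "\<mu> i = 2 * int (m' i) + 1 - z" for i using yz[of i] by (simp add: y_def)
    have "(\<Sum>i\<in>UNIV. (2 * int (m' i) + 1) * \<mu> i) = (\<Sum>i\<in>UNIV. (2 * int (m' i) + 1)\<^sup>2 - z * (2 * int (m' i) + 1))"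
      unfolding mu by (rule sum.cong) (simp_all add: power2_eq_square algebra_simps)
    also have "\<dots> = 4 * D\<^sup>2 + 1 - z * (6 * D - 1)"
      unfolding sum_subtractf sum_distrib_left[symmetric] QC SC ..
    finally have T: "(\<Sum>i\<in>UNIV. (2 * int (m' i) + 1) * \<mu> i) = 4 * D\<^sup>2 + 1 - z * (6 * D - 1)" .
    have \<delta>: "\<delta> = 2 * D - 3 * z" using xz by (simp add: x_def)
    have "c = -1 - z" unfolding c_def T \<delta> by (simp add: power2_eq_square algebra_simps)
    then have "z = 0" using True by simp
    then have "\<delta> = 2 * D" using xz by (simp add: x_def)
    then have "0 \<le> 2 * (int \<alpha> * \<delta> - (\<Sum>i\<in>UNIV. int (n i) * \<mu> i))" unfolding F True using d' by simp
    then show ?thesis by simp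
  qed
qed

text \<open>At \<alpha> the class is numerically nef. Beyond it, one more degree adds at most k + 2
  dimensions, which is exactly the growth of \<open>chi\<close>.\<close>

lemma dim_ge_\<alpha>: "\<alpha> \<le> k \<Longrightarrow> int (mpol_vs.dim (fat_forms a b n k)) = chi k n"
proof (induction k rule: dec_induct)
  case base
  have "int (mpol_vs.dim (fat_forms a b n \<alpha>)) \<le> chi \<alpha> n"
    by (rule dim_fat_forms_num_nef[OF gen num_nef_n]) (unfold antican_n, simp_all)
  then show ?case using dim_fat_forms_ge_chi[of \<alpha> n a b] by simp
next
  case (step k)
  have "2 * chi (Suc k) n = 2 * chi k n + 2 * (int k + 2)" unfolding two_chi_n by (simp add: algebra_simps)
  moreover have "int (mpol_vs.dim (fat_forms a b n (Suc k))) \<le> int (mpol_vs.dim (fat_forms a b n k)) + (int k + 2)"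
    using dim_fat_forms_Suc_le[of a b n k] by linarith
  moreover have "2 * x = 2 * y + 2 * r \<Longrightarrow> p \<le> q + r \<Longrightarrow> q = y \<Longrightarrow> x \<le> p \<Longrightarrow> p = x" for x y p q r :: int
    by linarith
  ultimately show ?case using step.IH dim_fat_forms_ge_chi[of "Suc k" n a b] by blast
qed

lemma two_chi_\<alpha>: "2 * chi \<alpha> n = 3 * D" and two_chi_Suc_\<alpha>: "2 * chi (Suc \<alpha>) n = 9 * D + 2"
    and two_chi_pred: "2 * chi (3 * d' - 2) n = - 3 * D"
proof -
  have "int (3 * d' - 2) = 3 * D - 2" "int (Suc \<alpha>) = 3 * D" using d' by linarith+
  then show "2 * chi \<alpha> n = 3 * D" "2 * chi (Suc \<alpha>) n = 9 * D + 2" "2 * chi (3 * d' - 2) n = - 3 * D"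
    unfolding two_chi_n int_\<alpha> by (simp_all add: power2_eq_square algebra_simps)
qed

lemma multiplicity_bound:
  assumes M: "\<Phi> \<in> fat_forms a b M (2 * d')" and ij: "i \<noteq> j"
  shows "M i + M j \<le> 2 * d'"
proof -
  let ?l = "line_thru a b i j" and ?n = "\<lambda>l. if l = i \<or> l = j then 1 else 0 :: nat"
  \<comment> \<open>A third point, not on the line, witnesses that the linear form is
    nonzero.\<close>
  obtain l where l: "l \<noteq> i" "l \<noteq> j"
  proof -
    have "card {i, j} < card (UNIV :: 9 set)" using ij by simp
    then have "{i, j} \<noteq> UNIV" by (metis less_irrefl)
    then show thesis using that by blast
  qed
  have lf: "?l \<in> forms 1" using homg_line_thru by (simp add: forms_iff del: One_nat_def)
  have "?l \<noteq> 0" using generic_not_collinear[OF gen ij l] by auto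
  then have nd: "\<not> \<Phi> dvd ?l" using not_dvd_low_degree[OF lf] d' by simp
  have "ordge (a r) (b r) (?n r) ?l" for r
    using ordge_1_iff[OF lf, of a b r] ev_line_thru_pt(1)[of a b i j] ev_line_thru_pt(2)[of a b j i] by auto
  then have "?l \<in> fat_forms a b ?n 1" using lf by (simp add: fat_forms_iff)
  from bezout_fat_forms[OF gen M \<Phi>(2) this nd]
  have "(\<Sum>r\<in>UNIV. int (M r) * int (?n r)) \<le> int (2 * d') * int 1" .
  moreover have "(\<Sum>r\<in>UNIV. int (M r) * int (?n r)) = (\<Sum>r\<in>{i, j}. int (M r))"
    by (rule sum.mono_neutral_cong_right) auto
  ultimately show ?thesis using ij by simp
qed

text \<open>C' meets F - L in -(d' + 2), so \<Phi> divides \<open>G\<close>. The quotient has degree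
  d' - 2 and would meet C' in -(d' + 1) if \<Phi> had exactly the prescribed multiplicities; the
  rest of the proof controls a possible excess.\<close>

lemma fat_forms_pred_zero:
  assumes G: "G \<in> fat_forms a b n (3 * d' - 2)"
  shows "G = 0"
proof (rule ccontr)
  assume "G \<noteq> 0"
  have D2: "int (3 * d' - 2) = 3 * D - 2" "int (d' - 2) = D - 2" using d' by linarith+
  have "\<Phi> dvd G"
  proof (rule ccontr)
    assume "\<not> \<Phi> dvd G"
    from bezout_fat_forms[OF gen \<Phi> G this]
    have "(\<Sum>i\<in>UNIV. int (2 * m' i + 1) * int (n i)) \<le> int (2 * d') * int (3 * d' - 2)" .
    moreover have "(\<Sum>i\<in>UNIV. int (2 * m' i + 1) * int (n i)) = (\<Sum>i\<in>UNIV. 6 * (int (m' i))\<^sup>2 + 5 * int (m' i) + 1)"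
      by (rule sum.cong) (simp_all add: power2_eq_square algebra_simps)
    moreover have "\<dots> = 6 * s2 + 5 * s1 + 9" unfolding sum.distrib sum_distrib_left[symmetric] by simp
    moreover have "int (2 * d') * int (3 * d' - 2) = 6 * D\<^sup>2 - 4 * D" unfolding D2 by (simp add: power2_eq_square algebra_simps)
    ultimately show False using s1_eq s2_eq by linarith
  qed
  then obtain X where X: "G = \<Phi> * X" by blast
  have Gf: "G \<in> forms (3 * d' - 2)" using G by (simp add: fat_forms_iff)
  have "3 * d' - 2 - 2 * d' = d' - 2" by simp
  then have Xf: "X \<in> forms (d' - 2)" using forms_dvd[OF \<Phi>_form Gf X \<open>G \<noteq> 0\<close>] by simp
  have "X \<noteq> 0" using X \<open>G \<noteq> 0\<close> by auto
  have nd: "\<not> \<Phi> dvd X" by (rule not_dvd_low_degree[OF Xf \<open>X \<noteq> 0\<close>]) (use d' in simp)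
  \<comment> \<open>Membership in a space of fat forms bounds multiplicities only from below;
    dividing by \<Phi> calls for their exact values.\<close>
  have "\<forall>i. \<exists>r. ordge (a i) (b i) r \<Phi> \<and> \<not> ordge (a i) (b i) (Suc r) \<Phi>"
    using ordge_max[OF \<Phi>_form \<Phi>_nz] by blast
  then obtain M where M: "\<And>i. ordge (a i) (b i) (M i) \<Phi>" "\<And>i. \<not> ordge (a i) (b i) (Suc (M i)) \<Phi>" by metis
  have MV: "\<Phi> \<in> fat_forms a b M (2 * d')" using M(1) \<Phi>_form by (simp add: fat_forms_iff)
  have Mge: "2 * m' i + 1 \<le> M i" for i
  proof (rule ccontr)
    assume "\<not> ?thesis"
    then have "Suc (M i) \<le> 2 * m' i + 1" by simp
    moreover have "ordge (a i) (b i) (2 * m' i + 1) \<Phi>" using \<Phi>(1) by (simp only: fat_forms_iff)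
    ultimately show False using M(2)[of i] ordge_mono by blast
  qed
  define \<epsilon> where "\<epsilon> i = M i - (2 * m' i + 1)" for i
  have Me: "int (M i) = 2 * int (m' i) + 1 + int (\<epsilon> i)" for i using Mge[of i] unfolding \<epsilon>_def by linarith
  \<comment> \<open>Since -K.C' = 1, the cubic through the points allows a total excess of at most
    1.\<close>
  have "(\<Sum>i\<in>UNIV. int (M i)) = (\<Sum>i\<in>UNIV. int (m' i) * 2 + 1) + (\<Sum>i\<in>UNIV. int (\<epsilon> i))"
    unfolding sum.distrib[symmetric] Me by (rule sum.cong) simp_all
  moreover have "A = (3 * B - 5) * 2 + 9 * 1 + E \<Longrightarrow> A \<le> 6 * B \<Longrightarrow> E \<le> 1" for A B E :: int
  proof -
    assume "A = (3 * B - 5) * 2 + 9 * 1 + E" "A \<le> 6 * B"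
    moreover have "(3 * B - 5) * 2 + 9 * 1 + E = 6 * B - 1 + E" by (simp add: algebra_simps)
    ultimately show "E \<le> 1" by linarith
  qed
  ultimately have se: "(\<Sum>i\<in>UNIV. int (\<epsilon> i)) \<le> 1" using cubic_bound[OF MV] unfolding sum_lin s1_eq by blast
  \<comment> \<open>Truncated: where \<Phi> alone exceeds the multiplicity asked of
    \<open>G\<close>, nothing is required of the quotient.\<close>
  define q where "q i = 3 * m' i + 1 - M i" for i
  have "ordge (a i) (b i) (q i) X" for i
  proof (cases "M i \<le> n i")
    case True
    have "ordge (a i) (b i) (M i + q i) (\<Phi> * X)" using G True X by (simp add: fat_forms_iff q_def)
    then show ?thesis using M(2) by (rule ordge_cancel)
  qed (simp add: q_def)
  then have "X \<in> fat_forms a b q (d' - 2)" using Xf by (simp add: fat_forms_iff)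
  from bezout_fat_forms[OF gen MV \<Phi>(2) this nd]
  have le: "(\<Sum>i\<in>UNIV. int (M i) * int (q i)) \<le> 2 * D * (D - 2)" unfolding D2 by simp
  have qe: "int (m' i) - int (\<epsilon> i) \<le> int (q i)" for i using Me[of i] unfolding q_def by linarith
  have "(\<Sum>i\<in>UNIV. (2 * int (m' i) + 1 + int (\<epsilon> i)) * (int (m' i) - int (\<epsilon> i))) \<le> (\<Sum>i\<in>UNIV. int (M i) * int (q i))"
    by (rule sum_mono) (simp only: Me[symmetric], intro mult_left_mono qe, simp)
  then have key: "(\<Sum>i\<in>UNIV. (2 * int (m' i) + 1 + int (\<epsilon> i)) * (int (m' i) - int (\<epsilon> i))) \<le> 2 * D * (D - 2)"
    using le by linarith
  have S: "(\<Sum>i\<in>UNIV. (2 * int (m' i) + 1) * int (m' i)) = 2 * D\<^sup>2 - 3 * D + 1"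
  proof -
    have "(\<Sum>i\<in>UNIV. (2 * int (m' i) + 1) * int (m' i)) = (\<Sum>i\<in>UNIV. 2 * (int (m' i))\<^sup>2 + int (m' i))"
      by (rule sum.cong) (simp_all add: power2_eq_square algebra_simps)
    also have "\<dots> = 2 * s2 + s1" unfolding sum.distrib sum_distrib_left[symmetric] ..
    finally show ?thesis using s1_eq s2_eq by linarith
  qed
  show False
  proof (cases "\<forall>i. \<epsilon> i = 0")
    case True
    then have "(\<Sum>i\<in>UNIV. (2 * int (m' i) + 1) * int (m' i)) \<le> 2 * D * (D - 2)" using key by simp
    then show False unfolding S by (simp add: power2_eq_square algebra_simps)
  next
    case False
    then obtain j where j: "\<epsilon> j \<noteq> 0" by blast
    have rest: "(\<Sum>i\<in>UNIV. int (\<epsilon> i)) = int (\<epsilon> j) + (\<Sum>i\<in>UNIV - {j}. int (\<epsilon> i))" by (rule sum.remove) auto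
    have "0 \<le> (\<Sum>i\<in>UNIV - {j}. int (\<epsilon> i))" by (rule sum_nonneg) simp
    then have ej: "\<epsilon> j = 1" and r0: "(\<Sum>i\<in>UNIV - {j}. int (\<epsilon> i)) = 0" using se rest j by linarith+
    have e0: "\<epsilon> i = 0" if "i \<noteq> j" for i
      using r0 that by (subst (asm) sum_nonneg_eq_0_iff) auto
    \<comment> \<open>The excess at \<open>j\<close> replaces (2 m + 1) m by (2 m + 2) (m - 1), a
      loss of m + 2.\<close>
    have "(\<Sum>i\<in>UNIV. (2 * int (m' i) + 1 + int (\<epsilon> i)) * (int (m' i) - int (\<epsilon> i)))
        = (\<Sum>i\<in>UNIV. (2 * int (m' i) + 1) * int (m' i) - (if i = j then int (m' j) + 2 else 0))"
      by (rule sum.cong) (auto simp: ej e0 algebra_simps)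
    also have "\<dots> = 2 * D\<^sup>2 - 3 * D + 1 - (int (m' j) + 2)" unfolding sum_subtractf S by simp
    finally have "2 * D\<^sup>2 - 3 * D + 1 - (int (m' j) + 2) \<le> 2 * D * (D - 2)" using key by simp
    then have m1: "D - 1 \<le> int (m' j)" by (simp add: power2_eq_square algebra_simps)
    \<comment> \<open>Any second point will do: multiplicity at least 2 d' at p_j and at least 1
      there contradicts Bezout on the line joining the two points.\<close>
    obtain i :: 9 where i: "i \<noteq> j" by (metis zero_neq_one)
    have "M j + M i \<le> 2 * d'" by (rule multiplicity_bound[OF MV i[symmetric]])
    moreover have "M j = 2 * m' j + 2" using Me[of j] ej by linarith
    ultimately show False using Mge[of i] m1 by linarith
  qed
qed

lemma Var_power_mult_fat: "P \<in> fat_forms a b n k \<Longrightarrow> Var 0 ^ r * P \<in> fat_forms a b n (r + k)"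
proof -
  assume P: "P \<in> fat_forms a b n k"
  have "homg UNIV (r * 1) (Var 0 ^ r :: (3, 'k) mpol)" by (intro homg_power) simp
  then have "homg UNIV (r + k) (Var 0 ^ r * P)" using P homg_mult[of UNIV r "Var 0 ^ r" k P] by (simp add: fat_forms_iff forms_iff)
  then show ?thesis using P by (simp add: fat_forms_iff forms_iff ordge_mult_left)
qed

text \<open>Multiplication by a power of x_0 is injective and carries every lower degree into degree
  3 d' - 2.\<close>

lemma fat_forms_below:
  assumes "k < \<alpha>" "P \<in> fat_forms a b n k" shows "P = 0"
proof -
  have "3 * d' - 2 - k + k = 3 * d' - 2" using assms(1) by simp
  then have "Var 0 ^ (3 * d' - 2 - k) * P \<in> fat_forms a b n (3 * d' - 2)" using Var_power_mult_fat[OF assms(2)] by metis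
  then have "Var 0 ^ (3 * d' - 2 - k) * P = 0" by (rule fat_forms_pred_zero)
  then show ?thesis by simp
qed

lemma alpha_eq: "alpha a b n = \<alpha>"
  unfolding alpha_def
proof (rule Least_equality)
  show "fat_forms a b n \<alpha> \<noteq> {0}"
  proof
    assume "fat_forms a b n \<alpha> = {0}"
    then have "mpol_vs.dim (fat_forms a b n \<alpha>) = 0" by (intro dim_eq_0_fat_forms) simp
    then show False using dim_ge_\<alpha>[of \<alpha>] two_chi_\<alpha> d' by simp
  qed
  show "\<alpha> \<le> t" if "fat_forms a b n t \<noteq> {0}" for t
  proof (rule ccontr)
    assume "\<not> \<alpha> \<le> t"
    then have "fat_forms a b n t \<subseteq> {0}" using fat_forms_below[of t] by auto
    then show False using that mpol_vs.subspace_0[OF subspace_fat_forms, of a b n t] by blast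
  qed
qed

lemma int_fat_degree: "chi k n = int ((k + 2) choose 2) - int (fat_degree n)"
  unfolding chi_def fat_degree_def by simp

lemma maximal_hilbert: "maximal_hilbert_function a b n"
  unfolding maximal_hilbert_function_def
proof
  fix k
  show "hilbert_function a b n k = min ((k + 2) choose 2) (fat_degree n)"
  proof (cases "\<alpha> \<le> k")
    case True
    then have "int (mpol_vs.dim (fat_forms a b n k)) = int ((k + 2) choose 2) - int (fat_degree n)"
      using dim_ge_\<alpha> int_fat_degree by simp
    then show ?thesis unfolding hilbert_function_def dim_forms by linarith
  next
    case False
    then have 0: "mpol_vs.dim (fat_forms a b n k) = 0" by (intro dim_eq_0_fat_forms fat_forms_below) auto
    have "(k + 2) choose 2 \<le> (3 * d' - 2 + 2) choose 2" 
    proof -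
      have "int (k + 2) * (int (k + 2) - 1) \<le> int (3 * d' - 2 + 2) * (int (3 * d' - 2 + 2) - 1)"
        using False by (intro mult_mono) auto
      then show ?thesis using choose_two_int[of "k + 2" ] choose_two_int[of "3 * d' - 2 + 2"] by linarith
    qed
    \<comment> \<open>In degree 3 d' - 2 the number \<chi> is negative, so the conditions already
      outnumber the forms.\<close>
    moreover have "int ((3 * d' - 2 + 2) choose 2) \<le> int (fat_degree n)"
      using int_fat_degree[of "3 * d' - 2"] two_chi_pred by linarith
    ultimately show ?thesis unfolding hilbert_function_def dim_forms 0 by linarith
  qed
qed

lemma mu_kernel:
  obtains f where "\<And>j. f j \<in> fat_forms a b n \<alpha>" "mu f = 0" "\<exists>j. f j \<noteq> 0"
proof -
  have S: "(\<Sum>i\<in>UNIV. int (m' i) * (int (m' i) + 1)) = D\<^sup>2 - 2"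
  proof -
    have "(\<Sum>i\<in>UNIV. int (m' i) * (int (m' i) + 1)) = (\<Sum>i\<in>UNIV. (int (m' i))\<^sup>2 + int (m' i))"
      by (rule sum.cong) (simp_all add: power2_eq_square algebra_simps)
    then show ?thesis unfolding sum.distrib using s12 by simp
  qed
  have Dm: "int (d' - 1) = D - 1" using d' by linarith
  have "2 * chi (d' - 1) m' = D + 2" unfolding two_chi S Dm by (simp add: power2_eq_square algebra_simps)
  then have v: "d' + 2 \<le> 2 * mpol_vs.dim (fat_forms a b m' (d' - 1))"
    using dim_fat_forms_ge_chi[of "d' - 1" m' a b] by linarith
  \<comment> \<open>Restriction to a line gives dim (H + L) \<le> dim H + d' + 1, while 2 dim H
    \<ge> d' + 2.\<close>
  have "mpol_vs.dim (fat_forms a b m' (Suc (d' - 1))) < 3 * mpol_vs.dim (fat_forms a b m' (d' - 1))"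
    using dim_fat_forms_Suc_le[of a b m' "d' - 1"] v d' by linarith
  then obtain h where h: "\<And>j. h j \<in> fat_forms a b m' (d' - 1)" "mu h = 0" "\<exists>j. h j \<noteq> 0"
    using mu_kernel_exists by blast
  have d: "2 * d' + (d' - 1) = \<alpha>" using d' by simp
  have ord: "ordge (a i) (b i) (2 * m' i + 1 + m' i) (\<Phi> * h j)" for i j
    using \<Phi>(1) h(1)[of j] by (intro ordge_mult) (simp_all only: fat_forms_iff)
  have "2 * m' i + 1 + m' i = n i" for i by simp
  then have "\<Phi> * h j \<in> fat_forms a b n \<alpha>" for j
    using ord[of _ j] forms_mult[OF \<Phi>_form, of "h j" "d' - 1"] h(1)[of j] d by (simp only: fat_forms_iff simp_thms)
  moreover have "mu (\<lambda>j. \<Phi> * h j) = \<Phi> * mu h" unfolding mu_def sum_distrib_left by (simp only: mult.assoc)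
  ultimately show thesis using that[of "\<lambda>j. \<Phi> * h j"] h(2,3) \<Phi>_nz by simp
qed

theorem conclusion:
  "maximal_hilbert_function a b n \<and> alpha a b n = 3 * d' - 1
    \<and> int (mpol_vs.dim (fat_forms a b n (alpha a b n + 1)))
        - 3 * int (mpol_vs.dim (fat_forms a b n (alpha a b n))) = 1
    \<and> dim_coker_mu a b n (alpha a b n) \<ge> 2
    \<and> \<not> mu_maximal_rank a b n (alpha a b n)"
proof -
  let ?h = "mpol_vs.dim (fat_forms a b n \<alpha>)" and ?h1 = "mpol_vs.dim (fat_forms a b n (\<alpha> + 1))"
  have "2 * int ?h = 3 * D" "2 * int ?h1 = 9 * D + 2"
    using dim_ge_\<alpha>[of \<alpha>] dim_ge_\<alpha>[of "\<alpha> + 1"] two_chi_\<alpha> two_chi_Suc_\<alpha> by simp_all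
  then have h: "int ?h1 - 3 * int ?h = 1" by linarith
  obtain f where f: "\<And>j. f j \<in> fat_forms a b n \<alpha>" "mu f = 0" "\<exists>j. f j \<noteq> 0" by (rule mu_kernel) blast
  then obtain j0 where j0: "f j0 \<noteq> 0" by blast
  have im: "mpol_vs.dim (mu ` mu_source a b n \<alpha>) + 1 \<le> 3 * ?h" by (rule dim_mu_image_le[OF f(1,2) j0])
  \<comment> \<open>The target has dimension \<open>3 * ?h + 1\<close>, and the kernel keeps the
    image strictly below \<open>3 * ?h\<close>.\<close>
  have "2 \<le> dim_coker_mu a b n \<alpha>" unfolding dim_coker_mu_def using im h by linarith
  moreover have "\<not> mu_maximal_rank a b n \<alpha>"
    unfolding mu_maximal_rank_def
  proof
    assume "inj_on mu (mu_source a b n \<alpha>) \<or> mu ` mu_source a b n \<alpha> = fat_forms a b n (\<alpha> + 1)"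
    then show False
    proof
      assume inj: "inj_on mu (mu_source a b n \<alpha>)"
      have "mu (\<lambda>_. 0) = mu f" using f(2) by (simp add: mu_def)
      moreover have "f \<in> mu_source a b n \<alpha>" "(\<lambda>_. 0) \<in> mu_source a b n \<alpha>"
        using f(1) mpol_vs.subspace_0[OF subspace_fat_forms] by (simp_all add: mu_source_def)
      ultimately have "(\<lambda>_. 0) = f" using inj by (meson inj_onD)
      then show False using j0 by auto
    next
      assume "mu ` mu_source a b n \<alpha> = fat_forms a b n (\<alpha> + 1)"
      then show False using im h by simp
    qed
  qed
  ultimately show ?thesis unfolding alpha_eq using maximal_hilbert h by blast
qed

end

section \<open>Functions on the blow up\<close>

text \<open>Coordinate vectors of the points of the plane other than the nine points.\<close>

definition good :: "(9 \<Rightarrow> 'k) \<Rightarrow> (9 \<Rightarrow> 'k::field) \<Rightarrow> (3 \<Rightarrow> 'k) \<Rightarrow> bool" where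
  "good a b x \<longleftrightarrow> (\<exists>v. x v \<noteq> 0) \<and> (\<forall>i. \<exists>j. ev x (lin a b i j) \<noteq> 0)"

text \<open>The inverse of the blow-down over these points. It uses the same linear forms as
  \<open>at_generic_point\<close>, so forms may be evaluated on either side.\<close>

definition pull :: "(9 \<Rightarrow> 'k) \<Rightarrow> (9 \<Rightarrow> 'k::field) \<Rightarrow> (3 \<Rightarrow> 'k) \<Rightarrow> amb \<Rightarrow> 'k" where
  "pull a b x = case_sum x (\<lambda>(i, j). ev x (lin a b i j))"

lemma pull_simps [simp]: "pull a b x (Inl v) = x v" "pull a b x (Inr (i, j)) = ev x (lin a b i j)"
    "pull a b x \<circ> Inl = x"
  by (auto simp: pull_def)

lemma ev_lin: "ev x (lin a b i j) = (if j = 0 then x 1 - a i * x 0 else x 2 - b i * x 0)"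
  by (simp add: lin_def)

lemma rhom_gp: "rhom (at_generic_point a b)"
  by (simp add: at_generic_point_def rhom_substitute)

lemmas gp_simps [simp] = rhom_simps[OF rhom_gp]

lemma gp_Var [simp]: "at_generic_point a b (Var (Inl v)) = Var v"
    "at_generic_point a b (Var (Inr (i, j))) = lin a b i j" "at_generic_point a b (Const c) = Const c"
  by (simp_all add: at_generic_point_def)

lemma ev_gp: "ev x (at_generic_point a b G) = ev (pull a b x) G"
  unfolding at_generic_point_def ev_substitute
  by (rule arg_cong[where f = "\<lambda>g. ev g G"]) (auto simp: pull_def split: sum.splits)

lemma amb_blocks_disjoint: "b \<in> amb_blocks \<Longrightarrow> c \<in> amb_blocks \<Longrightarrow> b \<noteq> c \<Longrightarrow> b \<inter> c = {}"
  unfolding amb_blocks_def by auto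

lemma amb_blocks_cover: "\<Union>amb_blocks = UNIV"
proof -
  have "v \<in> \<Union>amb_blocks" for v :: amb
  proof (cases v)
    case (Inr p)
    then show ?thesis unfolding amb_blocks_def by (cases p) auto
  qed (auto simp: amb_blocks_def)
  then show ?thesis by blast
qed

lemma Inl_block: "range Inl \<in> amb_blocks" and Inr_block: "Inr ` ({i} \<times> UNIV) \<in> amb_blocks"
  unfolding amb_blocks_def by auto

lemma ball_amb_blocks: "(\<forall>b\<in>amb_blocks. P b) \<longleftrightarrow> P (range Inl) \<and> (\<forall>i. P (Inr ` ({i} \<times> UNIV)))"
  unfolding amb_blocks_def by auto

lemma multiproj_amb: "q \<in> multiproj amb_blocks \<longleftrightarrow> (\<exists>v. q (Inl v) \<noteq> 0) \<and> (\<forall>i. \<exists>j. q (Inr (i, j)) \<noteq> 0)"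
  unfolding multiproj_def mem_Collect_eq ball_amb_blocks by auto

lemma proj_equiv_amb: "proj_equiv amb_blocks p q \<longleftrightarrow> (\<exists>c. c \<noteq> 0 \<and> (\<forall>v. q (Inl v) = c * p (Inl v))) \<and>
    (\<forall>i. \<exists>c. c \<noteq> 0 \<and> (\<forall>j. q (Inr (i, j)) = c * p (Inr (i, j))))"
  unfolding proj_equiv_def ball_amb_blocks by auto

lemma blowup_iff: "q \<in> blowup a b \<longleftrightarrow> q \<in> multiproj amb_blocks \<and>
    (\<forall>i. q (Inr (i, 0)) * ev (q \<circ> Inl) (lin a b i 1) = q (Inr (i, 1)) * ev (q \<circ> Inl) (lin a b i 0))"
  by (simp add: blowup_def)

lemma ev_proj_equiv:
  fixes G :: "(amb, 'k::field) mpol"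
  assumes "proj_equiv amb_blocks p q" "multihomogeneous amb_blocks e G"
  shows "\<exists>c. c \<noteq> 0 \<and> ev q G = c * ev p G"
proof -
  have "\<forall>b. \<exists>c. b \<in> amb_blocks \<longrightarrow> c \<noteq> 0 \<and> (\<forall>v\<in>b. q v = c * p v)" using assms(1) unfolding proj_equiv_def by blast
  then obtain c where c: "\<And>b. b \<in> amb_blocks \<Longrightarrow> c b \<noteq> 0 \<and> (\<forall>v\<in>b. q v = c b * p v)" by metis
  have 1: "ev q G = (\<Prod>b\<in>amb_blocks. c b ^ e b) * ev p G"
    using c by (intro ev_multihomogeneous_scale[OF assms(2) amb_blocks_disjoint amb_blocks_cover]) blast+
  have 2: "(\<Prod>b\<in>amb_blocks. c b ^ e b) \<noteq> 0" using c by (simp add: prod_zero_iff)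
  show ?thesis by (intro exI conjI, rule 2, rule 1)
qed

lemma pull_blowup: "good a b x \<Longrightarrow> pull a b x \<in> blowup a b"
  by (simp add: blowup_iff multiproj_amb good_def mult.commute)

lemma blowup_off_exc:
  assumes q: "q \<in> blowup a b" and g: "good a b (q \<circ> Inl)"
  shows "proj_equiv amb_blocks (pull a b (q \<circ> Inl)) q"
  unfolding proj_equiv_amb
proof (intro conjI allI)
  show "\<exists>c. c \<noteq> 0 \<and> (\<forall>v. q (Inl v) = c * pull a b (q \<circ> Inl) (Inl v))" by (intro exI[of _ 1]) simp
  fix i
  let ?l = "\<lambda>j. ev (q \<circ> Inl) (lin a b i j)" and ?y = "\<lambda>j. q (Inr (i, j))"
  have rel: "?y 0 * ?l 1 = ?y 1 * ?l 0" using q unfolding blowup_iff by blast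
  obtain j0 where j0: "?l j0 \<noteq> 0" using g unfolding good_def by blast
  obtain j1 where j1: "?y j1 \<noteq> 0" using q unfolding blowup_iff multiproj_amb by blast
  have pr: "?y j * ?l j' = ?y j' * ?l j" for j j' using rel exhaust_2[of j] exhaust_2[of j'] by auto
  have e: "?y j = (?y j0 / ?l j0) * ?l j" for j using pr[of j j0] j0 by (simp only: eq_divide_eq times_divide_eq_left) simp
  have n: "?y j0 \<noteq> 0"
  proof
    assume "?y j0 = 0"
    then have "?y j1 * ?l j0 = 0" using pr[of j1 j0] by simp
    then show False using j1 j0 by simp
  qed
  show "\<exists>c. c \<noteq> 0 \<and> (\<forall>j. q (Inr (i, j)) = c * pull a b (q \<circ> Inl) (Inr (i, j)))"
  proof (intro exI conjI allI)
    show "?y j0 / ?l j0 \<noteq> 0" using n j0 by simp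
    show "q (Inr (i, j)) = ?y j0 / ?l j0 * pull a b (q \<circ> Inl) (Inr (i, j))" for j
      unfolding pull_simps by (rule e)
  qed
qed

lemma ev_off_exc:
  assumes "q \<in> blowup a b" "good a b (q \<circ> Inl)" "multihomogeneous amb_blocks e G"
  shows "ev q G = 0 \<longleftrightarrow> ev (q \<circ> Inl) (at_generic_point a b G) = 0"
  using ev_proj_equiv[OF blowup_off_exc[OF assms(1,2)] assms(3)] by (auto simp: ev_gp)

lemma exc_iff: "q \<in> exc a b i \<longleftrightarrow> q \<in> blowup a b \<and> ev (q \<circ> Inl) (lin a b i 0) = 0 \<and> ev (q \<circ> Inl) (lin a b i 1) = 0"
proof
  assume "q \<in> exc a b i"
  then obtain c where "q \<in> blowup a b" "\<And>v. q (Inl v) = c * pt a b i v"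
    unfolding exc_def proj_equiv_def by auto
  then show "q \<in> blowup a b \<and> ev (q \<circ> Inl) (lin a b i 0) = 0 \<and> ev (q \<circ> Inl) (lin a b i 1) = 0"
    by (simp add: ev_lin)
next
  assume r: "q \<in> blowup a b \<and> ev (q \<circ> Inl) (lin a b i 0) = 0 \<and> ev (q \<circ> Inl) (lin a b i 1) = 0"
  then have e: "q (Inl 1) = a i * q (Inl 0)" "q (Inl 2) = b i * q (Inl 0)" by (simp_all add: ev_lin)
  obtain v where "q (Inl v) \<noteq> 0" using r unfolding blowup_iff multiproj_amb by blast
  then have n0: "q (Inl 0) \<noteq> 0" using e exhaust_3[of v] by auto
  have f: "(q \<circ> Inl) v = q (Inl 0) * pt a b i v" for v
    using e exhaust_3[of v] by (auto simp: comp_def)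
  have "proj_equiv P2_blocks (pt a b i) (q \<circ> Inl)"
    unfolding proj_equiv_def
  proof (intro ballI exI conjI)
    show "q (Inl 0) \<noteq> 0" by (rule n0)
    show "(q \<circ> Inl) v = q (Inl 0) * pt a b i v" for v by (rule f)
  qed
  then show "q \<in> exc a b i" using r unfolding exc_def by blast
qed

lemma not_exc_good:
  assumes "q \<in> blowup a b" "\<And>i. q \<notin> exc a b i"
  shows "good a b (q \<circ> Inl)"
  unfolding good_def
proof (intro conjI allI)
  show "\<exists>v. (q \<circ> Inl) v \<noteq> 0" using assms(1) unfolding blowup_iff multiproj_amb by simp
  show "\<exists>j. ev (q \<circ> Inl) (lin a b i j) \<noteq> 0" for i using assms exc_iff[of q a b i] by blast
qed

lemma sum_amb_blocks: "(\<Sum>v\<in>UNIV. f v) = (\<Sum>s\<in>amb_blocks. \<Sum>v\<in>s. f v)" for f :: "amb \<Rightarrow> nat"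
  by (subst amb_blocks_cover[symmetric], subst sum.Union_disjoint) (auto dest: amb_blocks_disjoint)

lemma gp_forms:
  assumes "multihomogeneous amb_blocks e G"
  shows "at_generic_point a b G \<in> forms (sum e amb_blocks)"
  unfolding at_generic_point_def forms_iff
proof (rule homg_substitute[where dg = "\<lambda>_. 1"])
  fix m assume m: "m \<in> Poly_Mapping.keys G"
  have "(\<Sum>v\<in>UNIV. Poly_Mapping.lookup m v * 1) = (\<Sum>s\<in>amb_blocks. \<Sum>v\<in>s. Poly_Mapping.lookup m v)"
    unfolding sum_amb_blocks by simp
  also have "\<dots> = sum e amb_blocks"
    using assms m by (intro sum.cong) (auto simp: multihomogeneous_def)
  finally show "(\<Sum>v\<in>UNIV. Poly_Mapping.lookup m v * 1) = sum e amb_blocks" .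
next
  have "homg UNIV 1 (lin a b i j)" for i j using lin_forms[of a b i j] by (simp only: forms_iff)
  then show "homg UNIV 1 (case_sum Var (\<lambda>(i, j). lin a b i j) v)" for v
    by (auto split: sum.splits)
qed

text \<open>Restriction to the arc through \<open>p\<^sub>i\<close> with tangent direction \<open>y\<close>, with parameter the variable of the univariate polynomials.\<close>

definition along :: "(9 \<Rightarrow> 'k) \<Rightarrow> (9 \<Rightarrow> 'k) \<Rightarrow> 9 \<Rightarrow> (2 \<Rightarrow> 'k::field) \<Rightarrow> (3, 'k) mpol \<Rightarrow> 'k poly" where
  "along a b i y = evh (\<lambda>c. [:c:]) (\<lambda>v. if v = 0 then 1 else if v = 1 then [:a i, y 0:] else [:b i, y 1:])"

lemma rhom_along: "rhom (along a b i y)"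
  by (simp add: along_def rhom_evh rhom_const_poly)

lemmas along_simps [simp] = rhom_simps[OF rhom_along]

lemma along_Var [simp]: "along a b i y (Var 0) = 1" "along a b i y (Var 1) = [:a i, y 0:]"
    "along a b i y (Var 2) = [:b i, y 1:]" "along a b i y (Const c) = [:c:]"
  by (simp_all add: along_def evh_Var evh_Const rhom_const_poly)

text \<open>The point of \<open>exc a b i\<close> with tangent direction \<open>y\<close>, the limit
  of the arc.\<close>

definition arc_point :: "(9 \<Rightarrow> 'k) \<Rightarrow> (9 \<Rightarrow> 'k) \<Rightarrow> 9 \<Rightarrow> (2 \<Rightarrow> 'k::field) \<Rightarrow> amb \<Rightarrow> 'k" where
  "arc_point a b i y = case_sum (pt a b i) (\<lambda>(k, j). if k = i then y j else ev (pt a b i) (lin a b k j))"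

text \<open>Along the arc the coordinates of the i-th line become the parameter times
  \<open>y\<close>. Hence the degree in this block appears as a power of the parameter, and the
  constant term of the cofactor is the value at the point of the exceptional curve.\<close>

lemma along_gp:
  assumes G: "multihomogeneous amb_blocks e G"
  shows "\<exists>h. along a b i y (at_generic_point a b G) = [:0, 1:] ^ e (Inr ` ({i} \<times> UNIV)) * h
    \<and> poly h 0 = ev (arc_point a b i y) G"
proof -
  define B where "B = (Inr ` ({i} \<times> UNIV) :: amb set)"
  define s where "s v = along a b i y (case_sum Var (\<lambda>(i, j). lin a b i j) v)" for v
  \<comment> \<open>\<open>s\<close> with the parameter removed from the i-th block.\<close>
  define t where "t v = (if v \<in> B then [:y (snd (projr v)):] else s v)" for v :: amb
  define h where "h = evh (\<lambda>c. [:c:]) t G"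
  have rs: "rhom (\<lambda>G. along a b i y (at_generic_point a b G))" by (intro rhom_comp[OF rhom_along] rhom_gp)
  have "along a b i y (at_generic_point a b G) = evh (\<lambda>c. [:c:]) s G"
  proof -
    have "(\<lambda>v. along a b i y (at_generic_point a b (Var v))) = s"
      by (rule ext) (simp add: s_def at_generic_point_def)
    moreover have "(\<lambda>c. along a b i y (at_generic_point a b (Const c))) = (\<lambda>c. [:c:])"
      by (rule ext) simp
    ultimately show ?thesis using rhom_eq_evh[OF rs, of G] by (simp only:)
  qed
  also have "\<dots> = (\<Sum>m\<in>Poly_Mapping.keys G. [:0, 1:] ^ e B * ([:Poly_Mapping.lookup G m:] * (\<Prod>v\<in>UNIV. t v ^ Poly_Mapping.lookup m v)))"
    unfolding evh_def
  proof (rule sum.cong[OF refl])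
    fix m assume m: "m \<in> Poly_Mapping.keys G"
    have st: "s v = (if v \<in> B then [:0, 1:] else 1) * t v" for v
    proof (cases v)
      case (Inr p)
      obtain k j where p: "p = (k, j)" by (cases p)
      show ?thesis unfolding Inr p t_def s_def B_def using exhaust_2[of j] by (auto simp: lin_def)
    qed (auto simp: s_def t_def B_def)
    have "s v ^ n = (if v \<in> B then [:0, 1:] ^ n else 1) * t v ^ n" for v n
      unfolding st[of v] power_mult_distrib by simp
    then have "(\<Prod>v\<in>UNIV. s v ^ Poly_Mapping.lookup m v)
        = (\<Prod>v\<in>UNIV. (if v \<in> B then [:0, 1:] ^ Poly_Mapping.lookup m v else 1)) * (\<Prod>v\<in>UNIV. t v ^ Poly_Mapping.lookup m v)"
      by (simp only: prod.distrib)
    also have "(\<Prod>v\<in>UNIV. (if v \<in> B then [:0, 1:] ^ Poly_Mapping.lookup m v else 1 :: 'a poly)) = (\<Prod>v\<in>B. [:0, 1:] ^ Poly_Mapping.lookup m v)"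
      by (rule prod.mono_neutral_cong_right) auto
    also have "\<dots> = [:0, 1:] ^ (\<Sum>v\<in>B. Poly_Mapping.lookup m v)" by (rule power_sum[symmetric])
    also have "(\<Sum>v\<in>B. Poly_Mapping.lookup m v) = e B"
      using G m Inr_block[of i] unfolding multihomogeneous_def B_def by blast
    finally show "[:Poly_Mapping.lookup G m:] * (\<Prod>v\<in>UNIV. s v ^ Poly_Mapping.lookup m v)
        = [:0, 1:] ^ e B * ([:Poly_Mapping.lookup G m:] * (\<Prod>v\<in>UNIV. t v ^ Poly_Mapping.lookup m v))"
      by (simp only: mult.left_commute)
  qed
  also have "\<dots> = [:0, 1:] ^ e B * h" unfolding h_def evh_def sum_distrib_left ..
  finally have 1: "along a b i y (at_generic_point a b G) = [:0, 1:] ^ e (Inr ` ({i} \<times> UNIV)) * h" unfolding B_def .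
  have rp: "rhom (\<lambda>p. poly p 0 :: 'a)" by (rule rhomI) simp_all
  have rh: "rhom (\<lambda>G. poly (evh (\<lambda>c. [:c:]) t G) 0)" by (rule rhom_comp[OF rp rhom_evh[OF rhom_const_poly]])
  have ra: "poly (along a b i y P) 0 = ev (pt a b i) P" for P
  proof (rule rhom_eqI[of "\<lambda>P. poly (along a b i y P) 0"])
    show "rhom (\<lambda>P. poly (along a b i y P) 0)" by (rule rhom_comp[OF rp rhom_along])
    show "poly (along a b i y (Var v)) 0 = ev (pt a b i) (Var v)" for v using exhaust_3[of v] by auto
  qed (simp_all add: rhom_ev)
  have "poly h 0 = ev (arc_point a b i y) G" unfolding h_def
  proof (rule rhom_eqI[of "\<lambda>G. poly (evh (\<lambda>c. [:c:]) t G) 0", OF rh rhom_ev])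
    show "poly (evh (\<lambda>c. [:c:]) t (Const c)) 0 = ev (arc_point a b i y) (Const c)" for c
      by (simp add: evh_Const rhom_const_poly)
    show "poly (evh (\<lambda>c. [:c:]) t (Var v)) 0 = ev (arc_point a b i y) (Var v)" for v
      unfolding evh_Var[OF rhom_const_poly] ev_Var
      by (cases v) (auto simp: arc_point_def ra t_def s_def B_def split: prod.splits)
  qed
  with 1 show ?thesis by blast
qed

text \<open>Distinct first coordinates mean that the lines joining the points to (0 : 0 : 1) are
  distinct.\<close>

definition lines_distinct :: "(9 \<Rightarrow> 'k) \<Rightarrow> (9 \<Rightarrow> 'k::field) \<Rightarrow> bool" where
  "lines_distinct a b \<longleftrightarrow> (\<forall>i j. i \<noteq> j \<longrightarrow> a i \<noteq> a j)"

lemma generic_distinct: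
  assumes "generic_points a b" shows "lines_distinct a b"
  unfolding lines_distinct_def
proof (intro allI impI)
  fix i j :: 9 assume ij: "i \<noteq> j"
  let ?Q = "Var (Inl i) - Var (Inl j) :: (9 + 9, 'a) mpol"
  have "ev (case_sum (\<lambda>v. if v = i then 1 else 0) (\<lambda>_. 0)) ?Q \<noteq> (0 :: 'a)" using ij by simp
  then have "ev (case_sum a b) ?Q \<noteq> 0"
    using generic_specialise[OF assms prime_poly_diff[OF prime_poly_Var prime_poly_Var]] by blast
  then show "a i \<noteq> a j" by simp
qed

lemma exc_arc_point:
  assumes d: "lines_distinct a b" and q: "q \<in> exc a b i"
  shows "proj_equiv amb_blocks (arc_point a b i (\<lambda>j. q (Inr (i, j)))) q"
proof -
  obtain c where qb: "q \<in> blowup a b" and c: "c \<noteq> 0" "\<And>v. q (Inl v) = c * pt a b i v"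
    using q unfolding exc_def proj_equiv_def by auto
  let ?y = "\<lambda>j. q (Inr (i, j))"
  show ?thesis
    unfolding proj_equiv_amb
  proof (intro conjI allI)
    show "\<exists>c. c \<noteq> 0 \<and> (\<forall>v. q (Inl v) = c * arc_point a b i ?y (Inl v))"
      using c by (intro exI[of _ c]) (simp add: arc_point_def)
    fix k
    show "\<exists>c. c \<noteq> 0 \<and> (\<forall>j. q (Inr (k, j)) = c * arc_point a b i ?y (Inr (k, j)))"
    proof (cases "k = i")
      case True
      then show ?thesis by (intro exI[of _ 1]) (simp add: arc_point_def)
    next
      case False
      have l: "ev (q \<circ> Inl) (lin a b k j) = c * ev (pt a b i) (lin a b k j)" for j
        using c(2) by (simp add: ev_lin algebra_simps)
      let ?l = "\<lambda>j. ev (pt a b i) (lin a b k j)"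
      have l0: "?l 0 \<noteq> 0" using d False unfolding lines_distinct_def by (simp add: ev_lin)
      have "q (Inr (k, 0)) * ev (q \<circ> Inl) (lin a b k 1) = q (Inr (k, 1)) * ev (q \<circ> Inl) (lin a b k 0)"
        using qb unfolding blowup_iff by blast
      then have "c * (q (Inr (k, 0)) * ?l 1) = c * (q (Inr (k, 1)) * ?l 0)" unfolding l by (simp only: mult.left_commute)
      then have rel: "q (Inr (k, 0)) * ?l 1 = q (Inr (k, 1)) * ?l 0" using c(1) by simp
      have e: "q (Inr (k, j)) = (q (Inr (k, 0)) / ?l 0) * ?l j" for j
      proof -
        have "q (Inr (k, j)) * ?l 0 = q (Inr (k, 0)) * ?l j"
          using exhaust_2[of j] rel[symmetric] by (elim disjE) (simp_all only:)
        then show ?thesis using l0 by (simp only: eq_divide_eq times_divide_eq_left) simp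
      qed
      obtain j1 where "q (Inr (k, j1)) \<noteq> 0" using qb unfolding blowup_iff multiproj_amb by blast
      then have n: "q (Inr (k, 0)) \<noteq> 0" using e[of j1] by (metis div_0 mult_zero_left)
      show ?thesis
      proof (intro exI conjI allI)
        show "q (Inr (k, 0)) / ?l 0 \<noteq> 0" using n l0 by simp
        have "arc_point a b i ?y (Inr (k, j)) = ?l j" for j using False by (simp add: arc_point_def)
        then show "q (Inr (k, j)) = q (Inr (k, 0)) / ?l 0 * arc_point a b i ?y (Inr (k, j))" for j
          using e[of j] by (simp only:)
      qed
    qed
  qed
qed

lemma arc_point_blowup:
  assumes d: "lines_distinct a b" and y: "y 0 \<noteq> 0 \<or> y 1 \<noteq> 0"
  shows "arc_point a b i y \<in> exc a b i"
proof -
  have "\<exists>j. arc_point a b i y (Inr (k, j)) \<noteq> 0" for k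
  proof (cases "k = i")
    case True
    then show ?thesis using y by (auto simp: arc_point_def)
  next
    case False
    then have "ev (pt a b i) (lin a b k 0) \<noteq> 0" using d unfolding lines_distinct_def by (simp add: ev_lin)
    then show ?thesis using False by (auto simp: arc_point_def intro!: exI[of _ 0])
  qed
  moreover have "\<exists>v. pt a b i v \<noteq> 0" by (intro exI[of _ 0]) simp
  moreover have "arc_point a b i y \<circ> Inl = pt a b i" by (auto simp: arc_point_def)
  moreover have "ev (pt a b i) (lin a b i j) = 0" for j by (simp add: ev_lin)
  ultimately show ?thesis
    unfolding exc_iff blowup_iff multiproj_amb by (auto simp: arc_point_def mult.commute)
qed

text \<open>It guarantees that the quotients in the stalks have nonzero denominators and are not
  default values. On an exceptional curve the arc through the point is the test.\<close>

lemma gp_nonzero: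
  assumes d: "lines_distinct a b" and q: "q \<in> blowup a b" and H: "multihomogeneous amb_blocks e H" "ev q H \<noteq> 0"
  shows "at_generic_point a b H \<noteq> 0"
proof (cases "\<exists>i. q \<in> exc a b i")
  case True
  then obtain i where i: "q \<in> exc a b i" by blast
  let ?y = "\<lambda>j. q (Inr (i, j))"
  obtain h where h: "along a b i ?y (at_generic_point a b H) = [:0, 1:] ^ e (Inr ` ({i} \<times> UNIV)) * h"
      "poly h 0 = ev (arc_point a b i ?y) H" using along_gp[OF H(1)] by blast
  have "poly h 0 \<noteq> 0" using ev_proj_equiv[OF exc_arc_point[OF d i] H(1)] H(2) h(2) by auto
  then have "along a b i ?y (at_generic_point a b H) \<noteq> 0" unfolding h(1) by auto
  then show ?thesis by auto
next
  case False
  then have "good a b (q \<circ> Inl)" using not_exc_good[OF q] by blast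
  then show ?thesis using ev_off_exc[OF q _ H(1)] H(2) by auto
qed

section \<open>Regular functions away from the points\<close>

text \<open>Each root of \<beta> is a root of \<alpha> by the quotient available there; cancelling
  it from both lowers the degree.\<close>

lemma poly_dvd_local:
  fixes \<alpha> \<beta> :: "'k::alg_closed_field poly"
  assumes "\<beta> \<noteq> 0" "\<And>t. \<exists>N M. poly M t \<noteq> 0 \<and> \<alpha> * M = N * \<beta>"
  shows "\<beta> dvd \<alpha>"
  using assms
proof (induction "degree \<beta>" arbitrary: \<alpha> \<beta>)
  case 0
  then show ?case by (metis is_unit_iff_degree unit_imp_dvd)
next
  case (Suc n)
  then have "degree \<beta> > 0" by simp
  then obtain c where c: "poly \<beta> c = 0" using alg_closed_imp_poly_has_root by blast
  then obtain \<beta>' where \<beta>': "\<beta> = [:- c, 1:] * \<beta>'" unfolding poly_eq_0_iff_dvd by blast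
  obtain N M where NM: "poly M c \<noteq> 0" "\<alpha> * M = N * \<beta>" using Suc.prems(2) by blast
  have "poly (\<alpha> * M) c = 0" unfolding NM(2) using c by simp
  then have "poly \<alpha> c = 0" using NM(1) by simp
  then obtain \<alpha>' where \<alpha>': "\<alpha> = [:- c, 1:] * \<alpha>'" unfolding poly_eq_0_iff_dvd by blast
  have b0: "\<beta>' \<noteq> 0" using Suc.prems(1) \<beta>' by auto
  then have "degree \<beta> = 1 + degree \<beta>'" unfolding \<beta>' by (subst degree_mult_eq) auto
  then have dg: "n = degree \<beta>'" using Suc.hyps(2) by simp
  have "\<exists>N M. poly M t \<noteq> 0 \<and> \<alpha>' * M = N * \<beta>'" for t
  proof -
    obtain N M where NM: "poly M t \<noteq> 0" "\<alpha> * M = N * \<beta>" using Suc.prems(2) by blast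
    then have "[:- c, 1:] * (\<alpha>' * M) = [:- c, 1:] * (N * \<beta>')" unfolding \<alpha>' \<beta>' by (simp only: mult_ac)
    then have "\<alpha>' * M = N * \<beta>'" by (simp only: mult_cancel_left) simp
    then show ?thesis using NM(1) by blast
  qed
  then have "\<beta>' dvd \<alpha>'" using Suc.hyps(1)[OF dg b0] by blast
  then show ?case unfolding \<alpha>' \<beta>' by (rule mult_dvd_mono[OF dvd_refl])
qed

text \<open>Restriction to the line x_0 = 0 with parameter t -> (0 : 1 : t). The remaining point (0
  : 0 : 1) of the line is seen only through degrees.\<close>

definition cut :: "(3, 'k::field) mpol \<Rightarrow> 'k poly" where
  "cut = evh (\<lambda>c. [:c:]) (\<lambda>v. if v = 0 then 0 else if v = 1 then 1 else [:0, 1:])"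

lemma rhom_cut: "rhom cut"
  by (simp add: cut_def rhom_evh rhom_const_poly)

lemmas cut_simps [simp] = rhom_simps[OF rhom_cut]

lemma cut_single: "cut (Poly_Mapping.single m c) = (if Poly_Mapping.lookup m 0 = 0 then monom c (Poly_Mapping.lookup m 2) else 0)"
proof -
  have "cut (Poly_Mapping.single m c) = [:c:] * (0 ^ Poly_Mapping.lookup m 0 * 1 ^ Poly_Mapping.lookup m 1 * [:0, 1:] ^ Poly_Mapping.lookup m 2)"
    unfolding cut_def evh_single[OF rhom_const_poly] prod_3 by simp
  then show ?thesis by (simp add: power_0_left monom_altdef)
qed

lemma coeff_cut: "coeff (cut P) l = (\<Sum>m\<in>Poly_Mapping.keys P.
    if Poly_Mapping.lookup m 0 = 0 \<and> Poly_Mapping.lookup m 2 = l then Poly_Mapping.lookup P m else 0)"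
proof -
  have "cut P = (\<Sum>m\<in>Poly_Mapping.keys P. cut (Poly_Mapping.single m (Poly_Mapping.lookup P m)))"
    unfolding rhom_sum[OF rhom_cut, symmetric] mpol_eq_sum_single[symmetric] ..
  then have "coeff (cut P) l = (\<Sum>m\<in>Poly_Mapping.keys P. coeff (cut (Poly_Mapping.single m (Poly_Mapping.lookup P m))) l)"
    by (simp add: coeff_sum)
  also have "\<dots> = (\<Sum>m\<in>Poly_Mapping.keys P.
      if Poly_Mapping.lookup m 0 = 0 \<and> Poly_Mapping.lookup m 2 = l then Poly_Mapping.lookup P m else 0)"
    by (rule sum.cong) (auto simp: cut_single)
  finally show ?thesis .
qed

lemma coeff_cut_forms:
  assumes "P \<in> forms k" "l \<le> k"
  shows "coeff (cut P) l = Poly_Mapping.lookup P (mono3 k (k - l) l)"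
proof -
  have "coeff (cut P) l = (\<Sum>m\<in>Poly_Mapping.keys P. if m = mono3 k (k - l) l then Poly_Mapping.lookup P m else 0)"
    unfolding coeff_cut
  proof (rule sum.cong[OF refl])
    fix m assume "m \<in> Poly_Mapping.keys P"
    then have mk: "m \<in> mon k" using assms(1) by (auto simp: forms_iff_keys)
    have "Poly_Mapping.lookup m 0 = 0 \<and> Poly_Mapping.lookup m 2 = l \<longleftrightarrow> m = mono3 k (k - l) l"
    proof
      assume "Poly_Mapping.lookup m 0 = 0 \<and> Poly_Mapping.lookup m 2 = l"
      then show "m = mono3 k (k - l) l"
        using assms(2) mk by (intro poly_mapping_eqI3) (auto simp: mon_def wt_UNIV3)
    next
      assume m: "m = mono3 k (k - l) l"
      show "Poly_Mapping.lookup m 0 = 0 \<and> Poly_Mapping.lookup m 2 = l" unfolding m using assms(2) by simp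
    qed
    then show "(if Poly_Mapping.lookup m 0 = 0 \<and> Poly_Mapping.lookup m 2 = l then Poly_Mapping.lookup P m else 0)
        = (if m = mono3 k (k - l) l then Poly_Mapping.lookup P m else 0)" by simp
  qed
  then show ?thesis by (auto simp: in_keys_iff)
qed

lemma degree_cut: "P \<in> forms k \<Longrightarrow> degree (cut P) \<le> k"
proof (rule degree_le, intro allI impI)
  fix l assume P: "P \<in> forms k" and l: "k < l"
  show "coeff (cut P) l = 0" unfolding coeff_cut
  proof (rule sum.neutral, rule ballI)
    fix m assume "m \<in> Poly_Mapping.keys P"
    then have "m \<in> mon k" using P by (auto simp: forms_iff_keys)
    then show "(if Poly_Mapping.lookup m 0 = 0 \<and> Poly_Mapping.lookup m 2 = l then Poly_Mapping.lookup P m else 0) = 0"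
      using l by (simp add: mon_def wt_UNIV3)
  qed
qed

lemma cut_eq_0:
  assumes P: "P \<in> forms k" and 0: "cut P = 0"
  shows "\<exists>Q. P = Var 0 * Q"
proof (rule Var_dvdI)
  fix m assume m: "m \<in> Poly_Mapping.keys P"
  show "Poly_Mapping.lookup m 0 \<noteq> 0"
  proof
    assume m0: "Poly_Mapping.lookup m 0 = 0"
    have "m \<in> mon k" using m P by (auto simp: forms_iff_keys)
    then have "m = mono3 k (k - Poly_Mapping.lookup m 2) (Poly_Mapping.lookup m 2)" "Poly_Mapping.lookup m 2 \<le> k"
      using m0 by (auto intro!: poly_mapping_eqI3 simp: mon_def wt_UNIV3)
    then have "Poly_Mapping.lookup P m = 0" using coeff_cut_forms[OF P, of "Poly_Mapping.lookup m 2"] 0 by simp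
    then show False using m by (simp add: in_keys_iff)
  qed
qed

lemma poly_cut: "poly (cut P) t = ev (\<lambda>v. if v = 0 then 0 else if v = 1 then 1 else t) P"
proof (rule rhom_eqI[of "\<lambda>P. poly (cut P) t"])
  have "rhom (\<lambda>p. poly p t :: 'a)" by (rule rhomI) simp_all
  then show "rhom (\<lambda>P. poly (cut P) t)" by (rule rhom_comp[OF _ rhom_cut])
  show "poly (cut (Var v)) t = ev (\<lambda>v. if v = 0 then 0 else if v = 1 then 1 else t) (Var v)" for v
    using exhaust_3[of v] by (auto simp: cut_def evh_Var rhom_const_poly)
qed (simp_all add: rhom_ev cut_def evh_Const rhom_const_poly)

lemma good_cut:
  fixes t :: "'k::field"
  shows "good a b (\<lambda>v. if v = 0 then 0 else if v = 1 then 1 else t)"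
  unfolding good_def
proof (intro conjI allI)
  show "\<exists>v::3. (if v = 0 then 0 else if v = 1 then 1 else t) \<noteq> 0" by (intro exI[of _ 1]) simp
  show "\<exists>j. ev (\<lambda>v. if v = 0 then 0 else if v = 1 then 1 else t) (lin a b i j) \<noteq> 0" for i
    by (intro exI[of _ 0]) (simp add: ev_lin)
qed

lemma good_vertex: "good a b (unit_pt 2 :: 3 \<Rightarrow> 'k::field)"
  unfolding good_def
proof (intro conjI allI)
  show "\<exists>v. (unit_pt 2 v :: 'k) \<noteq> 0" by (intro exI[of _ 2]) (simp add: unit_pt_def)
  show "\<exists>j. ev (unit_pt 2) (lin a b i j) \<noteq> 0" for i
    by (intro exI[of _ 1]) (simp add: ev_lin unit_pt_def)
qed

text \<open>Sections of O(k) on the complement of the nine points, with \<open>k\<close> allowed to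
  be negative.\<close>

definition regular :: "(9 \<Rightarrow> 'k) \<Rightarrow> (9 \<Rightarrow> 'k::field) \<Rightarrow> int \<Rightarrow> (3, 'k) mpol fract \<Rightarrow> bool" where
  "regular a b k s \<longleftrightarrow> (\<forall>x. good a b x \<longrightarrow> (\<exists>i j N M. int i = int j + k \<and> N \<in> forms i \<and> M \<in> forms j
    \<and> ev x M \<noteq> 0 \<and> s = Fract N M))"

lemma ev_vertex: "M \<in> forms j \<Longrightarrow> ev (unit_pt 2) M = coeff (cut M) j"
proof -
  assume M: "M \<in> forms j"
  show ?thesis unfolding ev_def coeff_cut
  proof (rule sum.cong[OF refl])
    fix m assume "m \<in> Poly_Mapping.keys M"
    then have "Poly_Mapping.lookup m 0 + Poly_Mapping.lookup m 1 + Poly_Mapping.lookup m 2 = j"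
      using M by (auto simp: forms_iff_keys mon_def wt_UNIV3)
    then show "Poly_Mapping.lookup M m * (\<Prod>v\<in>UNIV. unit_pt 2 v ^ Poly_Mapping.lookup m v)
        = (if Poly_Mapping.lookup m 0 = 0 \<and> Poly_Mapping.lookup m 2 = j then Poly_Mapping.lookup M m else 0)"
      unfolding prod_3 by (auto simp: unit_pt_def power_0_left)
  qed
qed

lemma ex_cut_eq:
  assumes "degree \<gamma> \<le> k" shows "\<exists>P\<in>forms k. cut P = \<gamma>"
proof
  let ?P = "\<Sum>l\<le>k. Poly_Mapping.single (mono3 k (k - l) l) (coeff \<gamma> l)"
  show "?P \<in> forms k" unfolding forms_iff
    by (rule homg_sum) (auto simp: homg_def wt_UNIV3)
  have "cut ?P = (\<Sum>l\<le>k. monom (coeff \<gamma> l) l)" by (simp add: cut_single)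
  also have "\<dots> = \<gamma>" using assms by (rule poly_as_sum_of_monoms')
  finally show "cut ?P = \<gamma>" .
qed

lemma Var_not_wtge:
  assumes "ev x M \<noteq> 0" "x 0 = 0" shows "\<not> wtge {0} (Suc 0) (M :: (3, 'k::field) mpol)"
proof
  assume "wtge {0} (Suc 0) M"
  then have "Poly_Mapping.lookup m 0 \<noteq> 0" if "m \<in> Poly_Mapping.keys M" for m
    using that by (force simp: wtge_def wt_def)
  then obtain Q where "M = Var 0 * Q" using Var_dvdI[of M 0] by blast
  then show False using assms by simp
qed

text \<open>The line x_0 = 0 consists of good points, so the restriction of \<open>s\<close> to it
  is a polynomial. A form with the same restriction is subtracted, and the difference is divisible
  by x_0.\<close>

lemma regular_step:
  fixes a b :: "9 \<Rightarrow> 'k::alg_closed_field"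
  assumes r: "regular a b k s"
  shows "\<exists>P. P \<in> forms (nat k) \<and> (k < 0 \<longrightarrow> P = 0) \<and> regular a b (k - 1) ((s - Fract P 1) / Fract (Var 0) 1)"
proof -
  let ?x = "\<lambda>t v. if v = 0 then 0 else if v = 1 then 1 else (t :: 'k)"
  obtain iA jB A B where AB: "int iA = int jB + k" "A \<in> forms iA" "B \<in> forms jB" "ev (?x 0) B \<noteq> 0" "s = Fract A B"
    using r good_cut[of a b 0] unfolding regular_def by blast
  have B0: "B \<noteq> 0" using AB(4) by auto
  have cB: "cut B \<noteq> 0" using AB(4) poly_cut[of B 0] by auto
  have rel: "A * M = N * B" if "s = Fract N M" "M \<noteq> 0" for N M
    using that AB(5) B0 by (simp add: eq_fract)
  have "cut B dvd cut A"
  proof (rule poly_dvd_local[OF cB])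
    fix t
    obtain i j N M where NM: "ev (?x t) M \<noteq> 0" "s = Fract N M"
      using r good_cut[of a b t] unfolding regular_def by blast
    have "M \<noteq> 0" using NM(1) by auto
    have "cut A * cut M = cut N * cut B" using arg_cong[OF rel[OF NM(2) \<open>M \<noteq> 0\<close>], of cut] by simp
    moreover have "poly (cut M) t \<noteq> 0" unfolding poly_cut by (rule NM(1))
    ultimately show "\<exists>N M. poly M t \<noteq> 0 \<and> cut A * M = N * cut B" by blast
  qed
  then obtain \<gamma> where \<gamma>: "cut A = cut B * \<gamma>" by blast
  obtain i2 j2 N2 M2 where NM2: "int i2 = int j2 + k" "N2 \<in> forms i2" "M2 \<in> forms j2" "ev (unit_pt 2) M2 \<noteq> 0" "s = Fract N2 M2"
    using r good_vertex[of a b] unfolding regular_def by blast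
  have M20: "M2 \<noteq> 0" using NM2(4) by auto
  have "cut A * cut M2 = cut N2 * cut B" using arg_cong[OF rel[OF NM2(5) M20], of cut] by simp
  then have "cut B * (\<gamma> * cut M2) = cut B * cut N2" unfolding \<gamma> by (simp only: mult_ac)
  then have gM: "\<gamma> * cut M2 = cut N2" using cB by simp
  have cM: "coeff (cut M2) j2 \<noteq> 0" using ev_vertex[OF NM2(3)] NM2(4) by simp
  \<comment> \<open>Regularity at (0 : 0 : 1), the point missed by the affine parameter, bounds the
    degree of the restriction.\<close>
  have dg: "0 \<le> k \<and> degree \<gamma> \<le> nat k" if "\<gamma> \<noteq> 0"
  proof -
    have "cut M2 \<noteq> 0" using cM by auto
    then have "degree \<gamma> + degree (cut M2) = degree (cut N2)" using that gM degree_mult_eq by metis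
    moreover have "j2 \<le> degree (cut M2)" using cM by (rule le_degree)
    moreover have "degree (cut N2) \<le> i2" by (rule degree_cut[OF NM2(2)])
    ultimately show ?thesis using NM2(1) by linarith
  qed
  obtain P where P: "P \<in> forms (nat k)" "k < 0 \<longrightarrow> P = 0" "cut P = \<gamma>"
  proof (cases "\<gamma> = 0")
    case True
    show thesis by (rule that[of 0]) (simp_all add: True forms_iff)
  next
    case False
    then obtain P where "P \<in> forms (nat k)" "cut P = \<gamma>" using ex_cut_eq[of \<gamma> "nat k"] dg by blast
    then show thesis using that[of P] dg False by simp
  qed
  have "regular a b (k - 1) ((s - Fract P 1) / Fract (Var 0) 1)"
    unfolding regular_def
  proof (intro allI impI)
    fix x assume x: "good a b x"
    obtain i j N M where NM: "int i = int j + k" "N \<in> forms i" "M \<in> forms j" "ev x M \<noteq> 0" "s = Fract N M"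
      using r x unfolding regular_def by blast
    have M0: "M \<noteq> 0" using NM(4) by auto
    let ?N = "N - P * M"
    have Nf: "?N \<in> forms i"
    proof (cases "k < 0")
      case True
      then show ?thesis using P(2) NM(2) by simp
    next
      case False
      then have "nat k + j = i" using NM(1) by linarith
      then have "P * M \<in> forms i" using forms_mult[OF P(1) NM(3)] by simp
      then show ?thesis using NM(2) by (simp add: forms_iff homg_diff)
    qed
    have s': "s - Fract P 1 = Fract ?N M" using M0 by (simp add: NM(5))
    have Vf: "Var v \<in> forms 1" for v :: 3 by (simp add: forms_iff)
    show "\<exists>i j N M. int i = int j + (k - 1) \<and> N \<in> forms i \<and> M \<in> forms j \<and> ev x M \<noteq> 0
        \<and> (s - Fract P 1) / Fract (Var 0) 1 = Fract N M"
    proof (cases "x 0 = 0")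
      case False
      have "(s - Fract P 1) / Fract (Var 0) 1 = Fract ?N (M * Var 0)" unfolding s' by simp
      moreover have "int i = int (j + 1) + (k - 1)" "M * Var 0 \<in> forms (j + 1)" "ev x (M * Var 0) \<noteq> 0"
        using NM forms_mult[OF NM(3) Vf] False by auto
      ultimately show ?thesis using Nf by blast
    next
      case True
      have "A * M = N * B" by (rule rel[OF NM(5) M0])
      then have "(A - P * B) * M = ?N * B" by (simp add: algebra_simps)
      then have "cut (A - P * B) * cut M = cut ?N * cut B" by (metis rhom_mult[OF rhom_cut])
      moreover have "cut (A - P * B) = 0" using \<gamma> P(3) by (simp add: mult.commute)
      ultimately have "cut ?N = 0" using cB by simp
      then obtain Q where Q: "?N = Var 0 * Q" using cut_eq_0[OF Nf] by blast
      show ?thesis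
      proof (cases "?N = 0")
        case True
        \<comment> \<open>Multiplying the denominator by a coordinate that is nonzero at
          \<open>x\<close> only adjusts the degrees.\<close>
        obtain v where v: "x v \<noteq> 0" using x unfolding good_def by blast
        have "(s - Fract P 1) / Fract (Var 0) 1 = Fract 0 (M * Var v)" unfolding s' True using M0 by (simp add: fract_collapse)
        moreover have "int i = int (j + 1) + (k - 1)" "M * Var v \<in> forms (j + 1)" "ev x (M * Var v) \<noteq> 0"
          using NM forms_mult[OF NM(3) Vf] v by auto
        moreover have "0 \<in> forms i" by (simp add: forms_iff)
        ultimately show ?thesis by blast
      next
        case False
        have Qf: "1 \<le> i \<and> Q \<in> forms (i - 1)" by (rule forms_dvd[OF Vf Nf Q False])
        have "(s - Fract P 1) / Fract (Var 0) 1 = Fract (Var 0 * Q) (M * Var 0)" unfolding s' Q by simp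
        also have "\<dots> = Fract Q M" using M0 by (simp add: eq_fract)
        finally have "(s - Fract P 1) / Fract (Var 0) 1 = Fract Q M" .
        moreover have "int (i - 1) = int j + (k - 1)" using Qf NM(1) by linarith
        ultimately show ?thesis using Qf NM(3,4) by blast
      qed
    qed
  qed
  then show ?thesis using P by blast
qed

text \<open>In negative degree there is nothing to subtract, so \<open>s\<close> stays regular after
  division by arbitrarily high powers of x_0.\<close>

lemma regular_neg:
  fixes a b :: "9 \<Rightarrow> 'k::alg_closed_field"
  assumes r: "regular a b k s" and k: "k < 0"
  shows "s = 0"
proof -
  let ?u = "Fract (Var 0) 1 :: (3, 'k) mpol fract"
  have reg: "regular a b (k - int n) (s / ?u ^ n)" for n
  proof (induction n)
    case (Suc n)
    obtain P where "k - int n < 0 \<longrightarrow> P = 0" "regular a b (k - int n - 1) ((s / ?u ^ n - Fract P 1) / ?u)"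
      using regular_step[OF Suc.IH] by blast
    moreover have "k - int n < 0" using k by simp
    ultimately have "regular a b (k - int n - 1) ((s / ?u ^ n - Fract 0 1) / ?u)" by simp
    moreover have "(s / ?u ^ n - Fract 0 1) / ?u = s / ?u ^ Suc n" by (simp add: fract_collapse)
    moreover have "k - int n - 1 = k - int (Suc n)" by simp
    ultimately show ?case by simp
  qed (use r in simp)
  let ?x = "\<lambda>v. if v = 0 then 0 else if v = 1 then 1 else (0 :: 'k)"
  obtain iA jB A B where AB: "A \<in> forms iA" "ev ?x B \<noteq> 0" "s = Fract A B"
    using r good_cut[of a b 0] unfolding regular_def by blast
  have B0: "B \<noteq> 0" using AB(2) by auto
  \<comment> \<open>More factors x_0 than the degree of the numerator \<open>A\<close>
    admits.\<close>
  let ?n = "Suc iA"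
  obtain i j N M where NM: "ev ?x M \<noteq> 0" "s / ?u ^ ?n = Fract N M"
    using reg[of ?n] good_cut[of a b 0] unfolding regular_def by blast
  have M0: "M \<noteq> 0" using NM(1) by auto
  have pw: "?u ^ n = Fract (Var 0 ^ n) 1" for n by (induction n) (simp_all add: fract_collapse)
  have "Fract A (B * Var 0 ^ ?n) = Fract N M" using NM(2) unfolding AB(3) pw by simp
  then have "A * M = N * (B * Var 0 ^ ?n)" using B0 M0 by (simp add: eq_fract)
  then have "M * A = Var 0 ^ ?n * (N * B)" by (simp only: mult_ac)
  moreover have "wtge {0} (?n * 1) (Var 0 ^ ?n * (N * B))"
  proof (intro wtge_mult_right wtge_power)
    show "wtge {0} 1 (Var 0 :: (3, 'k) mpol)" using homg_imp_wtge[OF homg_Var[of "{0::3}" 0], of 1] by simp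
  qed
  ultimately have "wtge {0} (0 + ?n) (M * A)" by (simp only: mult_1_right add_0)
  then have "wtge {0} ?n A" by (rule wtge_cancel) (rule Var_not_wtge[OF NM(1)], simp)
  moreover have "wt {0} m \<le> wt UNIV m" for m :: "3 \<Rightarrow>\<^sub>0 nat" unfolding wt_UNIV3 by (simp add: wt_def)
  ultimately have "m \<notin> Poly_Mapping.keys A" for m
    using AB(1) unfolding wtge_def forms_iff homg_def by (metis not_less_eq_eq order_trans order_refl)
  then have "A = 0" using keys_eq_empty[of A] by blast
  then show ?thesis using AB(3) by (simp add: fract_collapse)
qed

text \<open>A Hartogs property: finitely many points of the plane carry no poles. Each step lowers
  \<open>k\<close> by one, until the negative case ends the recursion.\<close>

theorem regular_imp_form:
  fixes a b :: "9 \<Rightarrow> 'k::alg_closed_field"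
  assumes "regular a b (int k) s"
  shows "\<exists>P\<in>forms k. s = Fract P 1"
  using assms
proof (induction k arbitrary: s)
  case 0
  then obtain P where P: "P \<in> forms 0" "regular a b (-1) ((s - Fract P 1) / Fract (Var 0) 1)"
    using regular_step[OF 0] by auto
  then have "(s - Fract P 1) / Fract (Var 0) 1 = 0" using regular_neg by force
  moreover have "Fract (Var 0) 1 \<noteq> (0 :: (3, 'k) mpol fract)" by (simp add: Zero_fract_def eq_fract)
  ultimately have "s = Fract P 1" by simp
  then show ?case using P by blast
next
  case (Suc k)
  let ?u = "Fract (Var 0) 1 :: (3, 'k) mpol fract"
  obtain P where P: "P \<in> forms (Suc k)" "regular a b (int k) ((s - Fract P 1) / ?u)"
  proof -
    have "int (Suc k) - 1 = int k" by simp
    then show thesis using regular_step[OF Suc.prems] that unfolding nat_int by metis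
  qed
  obtain Q where Q: "Q \<in> forms k" "(s - Fract P 1) / ?u = Fract Q 1" using Suc.IH[OF P(2)] by blast
  have "?u \<noteq> 0" by (simp add: Zero_fract_def eq_fract)
  then have "s - Fract P 1 = Fract Q 1 * ?u" using Q(2) by (simp add: divide_eq_eq)
  then have "s = Fract P 1 + Fract Q 1 * ?u" by (simp add: diff_eq_eq add.commute)
  also have "\<dots> = Fract (P + Q * Var 0) 1" by simp
  finally have "s = Fract (P + Q * Var 0) 1" .
  moreover have "P + Q * Var 0 \<in> forms (Suc k)"
    using P(1) forms_mult[OF Q(1), of "Var 0" 1] by (simp add: forms_iff homg_add)
  ultimately show ?case by blast
qed

section \<open>Local rings\<close>

lemma multihomogeneous_mult:
  fixes P Q :: "('v, 'k::comm_ring_1) mpol"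
  shows "multihomogeneous B e P \<Longrightarrow> multihomogeneous B e' Q \<Longrightarrow> multihomogeneous B (\<lambda>b. e b + e' b) (P * Q)"
  by (simp add: multihomogeneous_iff homg_mult)

lemma multihomogeneous_add: "multihomogeneous B e P \<Longrightarrow> multihomogeneous B e Q \<Longrightarrow> multihomogeneous B e (P + Q)"
  by (simp add: multihomogeneous_iff homg_add)

lemma multihomogeneous_diff:
  fixes P Q :: "('v, 'k::comm_ring_1) mpol"
  shows "multihomogeneous B e P \<Longrightarrow> multihomogeneous B e Q \<Longrightarrow> multihomogeneous B e (P - Q)"
  by (simp add: multihomogeneous_iff homg_diff)

lemma multihomogeneous_Const: "multihomogeneous B (\<lambda>_. 0) (Const c)"
  by (simp add: multihomogeneous_iff)

lemma multihomogeneous_Var: "multihomogeneous amb_blocks (\<lambda>b. if v \<in> b then 1 else 0) (Var v :: (amb, 'k::comm_ring_1) mpol)"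
  unfolding multihomogeneous_iff using homg_Var by (metis finite)

definition emb :: "(3, 'k::comm_ring_1) mpol \<Rightarrow> (amb, 'k) mpol" where
  "emb = substitute (\<lambda>v. Var (Inl v))"

lemma gp_emb [simp]: "at_generic_point a b (emb N) = N"
  unfolding at_generic_point_def emb_def substitute_substitute by simp

lemma ev_emb [simp]: "ev q (emb N) = ev (q \<circ> Inl) N"
  unfolding emb_def ev_substitute by (simp add: comp_def)

lemma emb_multihomogeneous:
  assumes "N \<in> forms k"
  shows "multihomogeneous amb_blocks (\<lambda>b. if b = range Inl then k else 0) (emb N :: (amb, 'k::field) mpol)"
  unfolding multihomogeneous_iff ball_amb_blocks
proof (intro conjI allI)
  have "homg (range Inl) 1 (Var (Inl v :: amb) :: (amb, 'k) mpol)" for v using homg_Var[of "range Inl" "Inl v :: amb"] by simp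
  then have "homg (range Inl) (k * 1) (emb N)"
    unfolding emb_def using assms by (intro homg_substitute_forms) (simp_all only: forms_iff)
  then show "homg (range Inl) (if range Inl = range Inl then k else 0) (emb N)" by simp
  fix i
  have ne: "Inr ` ({i} \<times> UNIV) \<noteq> (range Inl :: amb set)" by auto
  have "homg (Inr ` ({i} \<times> UNIV)) 0 (Var (Inl v :: amb) :: (amb, 'k) mpol)" for v
    proof -
    have "Inl v \<notin> Inr ` ({i} \<times> (UNIV :: 2 set))" by auto
    then show ?thesis using homg_Var[of "Inr ` ({i} \<times> (UNIV :: 2 set))" "Inl v :: amb"] by simp
  qed
  then have "homg (Inr ` ({i} \<times> UNIV)) (k * 0) (emb N)"
    unfolding emb_def using assms by (intro homg_substitute_forms) (simp_all only: forms_iff)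
  then show "homg (Inr ` ({i} \<times> UNIV)) (if Inr ` ({i} \<times> UNIV) = (range Inl :: amb set) then k else 0) (emb N)"
    using ne by simp
qed

text \<open>A relation instead of a function, so membership in the local ring and the value at the
  point are carried together, without a choice of representation.\<close>

definition val_at :: "(9 \<Rightarrow> 'k) \<Rightarrow> (9 \<Rightarrow> 'k::field) \<Rightarrow> (amb \<Rightarrow> 'k) \<Rightarrow> (3, 'k) mpol fract \<Rightarrow> 'k \<Rightarrow> bool" where
  "val_at a b q f c \<longleftrightarrow> (\<exists>e G H. f = Fract (at_generic_point a b G) (at_generic_point a b H) \<and>
     multihomogeneous amb_blocks e G \<and> multihomogeneous amb_blocks e H \<and> ev q H \<noteq> 0 \<and> ev q G = c * ev q H)"

lemma local_ring_iff: "f \<in> local_ring a b q \<longleftrightarrow> (\<exists>c. val_at a b q f c)"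
proof
  assume "f \<in> local_ring a b q"
  then obtain G H e where "f = Fract (at_generic_point a b G) (at_generic_point a b H)"
      "multihomogeneous amb_blocks e G" "multihomogeneous amb_blocks e H" "ev q H \<noteq> 0"
    unfolding ideal_stalk_def by blast
  then show "\<exists>c. val_at a b q f c" unfolding val_at_def by (intro exI[of _ "ev q G / ev q H"] exI[of _ e] exI[of _ G] exI[of _ H]) simp
next
  assume "\<exists>c. val_at a b q f c"
  then show "f \<in> local_ring a b q" unfolding val_at_def ideal_stalk_def by blast
qed

locale blowup_points =
  fixes a b :: "9 \<Rightarrow> 'k::alg_closed_field"
  assumes distinct: "lines_distinct a b"
begin

abbreviation "gp \<equiv> at_generic_point a b"
abbreviation "X \<equiv> blowup a b"
abbreviation "loc q \<equiv> local_ring a b q"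
abbreviation "mh \<equiv> multihomogeneous amb_blocks"
abbreviation "lf \<equiv> lin a b"

lemma a_neq: "i \<noteq> j \<Longrightarrow> a i \<noteq> a j"
  using distinct unfolding lines_distinct_def by blast

lemma gp_nz: "q \<in> X \<Longrightarrow> mh e H \<Longrightarrow> ev q H \<noteq> 0 \<Longrightarrow> gp H \<noteq> 0"
  by (rule gp_nonzero[OF distinct])

lemma val_mult:
  assumes "val_at a b q f c" "val_at a b q g d" shows "val_at a b q (f * g) (c * d)"
proof -
  obtain e G H where 1: "f = Fract (gp G) (gp H)" "mh e G" "mh e H" "ev q H \<noteq> 0" "ev q G = c * ev q H"
    using assms(1) unfolding val_at_def by blast
  obtain e' G' H' where 2: "g = Fract (gp G') (gp H')" "mh e' G'" "mh e' H'" "ev q H' \<noteq> 0" "ev q G' = d * ev q H'"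
    using assms(2) unfolding val_at_def by blast
  have "f * g = Fract (gp (G * G')) (gp (H * H'))" unfolding 1(1) 2(1) by simp
  moreover have "ev q (G * G') = c * d * ev q (H * H')" using 1 2 by simp
  moreover have "ev q (H * H') \<noteq> 0" using 1 2 by simp
  ultimately show ?thesis unfolding val_at_def
    using multihomogeneous_mult[OF 1(2) 2(2)] multihomogeneous_mult[OF 1(3) 2(3)] by blast
qed

lemma val_add:
  assumes q: "q \<in> X" and "val_at a b q f c" "val_at a b q g d" shows "val_at a b q (f + g) (c + d)"
proof -
  obtain e G H where 1: "f = Fract (gp G) (gp H)" "mh e G" "mh e H" "ev q H \<noteq> 0" "ev q G = c * ev q H"
    using assms(2) unfolding val_at_def by blast
  obtain e' G' H' where 2: "g = Fract (gp G') (gp H')" "mh e' G'" "mh e' H'" "ev q H' \<noteq> 0" "ev q G' = d * ev q H'"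
    using assms(3) unfolding val_at_def by blast
  have "f + g = Fract (gp (G * H' + G' * H)) (gp (H * H'))"
    unfolding 1(1) 2(1) using gp_nz[OF q 1(3,4)] gp_nz[OF q 2(3,4)] by simp
  moreover have "ev q (G * H' + G' * H) = (c + d) * ev q (H * H')" using 1 2 by (simp add: algebra_simps)
  moreover have "ev q (H * H') \<noteq> 0" using 1 2 by simp
  moreover have "mh (\<lambda>b. e b + e' b) (G' * H)"
    using multihomogeneous_mult[OF 1(3) 2(2)] by (simp only: mult.commute)
  ultimately show ?thesis unfolding val_at_def
    using multihomogeneous_add[OF multihomogeneous_mult[OF 1(2) 2(3)]] multihomogeneous_mult[OF 1(3) 2(3)] by blast
qed

lemma val_inverse:
  assumes "val_at a b q f c" "c \<noteq> 0" shows "val_at a b q (inverse f) (1 / c)"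
proof -
  obtain e G H where 1: "f = Fract (gp G) (gp H)" "mh e G" "mh e H" "ev q H \<noteq> 0" "ev q G = c * ev q H"
    using assms(1) unfolding val_at_def by blast
  have "inverse f = Fract (gp H) (gp G)" "ev q G \<noteq> 0" "ev q H = 1 / c * ev q G"
    using 1 assms(2) by simp_all
  then show ?thesis unfolding val_at_def using 1 by blast
qed

lemma val_nonzero:
  assumes "q \<in> X" "val_at a b q f c" "c \<noteq> 0" shows "f \<noteq> 0"
proof -
  obtain e G H where 1: "f = Fract (gp G) (gp H)" "mh e G" "mh e H" "ev q H \<noteq> 0" "ev q G = c * ev q H"
    using assms(2) unfolding val_at_def by blast
  have "gp G \<noteq> 0" using gp_nz[OF assms(1) 1(2)] 1 assms(3) by simp
  then show ?thesis unfolding 1(1) using gp_nz[OF assms(1) 1(3,4)] by (simp add: Zero_fract_def eq_fract)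
qed

lemma val_Const: "val_at a b q (Fract (Const c) 1) c"
proof -
  have "mh (\<lambda>_. 0) (1 :: (amb, 'k) mpol)" by (simp add: multihomogeneous_iff)
  moreover have "Fract (Const c) 1 = Fract (gp (Const c)) (gp 1)" by simp
  moreover have "ev q (Const c) = c * ev q 1" "ev q (1 :: (amb, 'k) mpol) \<noteq> 0" by simp_all
  ultimately show ?thesis unfolding val_at_def using multihomogeneous_Const by blast
qed

lemma val_1: "val_at a b q 1 1"
  using val_Const[of q 1] by (simp add: Const_simps One_fract_def)

lemma O_mult: "f \<in> loc q \<Longrightarrow> g \<in> loc q \<Longrightarrow> f * g \<in> loc q"
  using val_mult unfolding local_ring_iff by blast

lemma stalk_sub: "ideal_stalk a b D q \<subseteq> loc q"
  unfolding ideal_stalk_def by blast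

lemma stalk_antimono: "D \<subseteq> D' \<Longrightarrow> ideal_stalk a b D' q \<subseteq> ideal_stalk a b D q"
  unfolding ideal_stalk_def by blast

lemma stalk_mult:
  assumes "f \<in> ideal_stalk a b D q" "g \<in> loc q" shows "f * g \<in> ideal_stalk a b D q"
proof -
  obtain e G H where 1: "f = Fract (gp G) (gp H)" "mh e G" "mh e H" "ev q H \<noteq> 0" "\<forall>r\<in>D. ev r G = 0"
    using assms(1) unfolding ideal_stalk_def by blast
  obtain e' G' H' where 2: "g = Fract (gp G') (gp H')" "mh e' G'" "mh e' H'" "ev q H' \<noteq> 0"
    using assms(2) unfolding ideal_stalk_def by blast
  have "f * g = Fract (gp (G * G')) (gp (H * H'))" unfolding 1(1) 2(1) by simp
  moreover have "\<forall>r\<in>D. ev r (G * G') = 0" "ev q (H * H') \<noteq> 0" using 1 2 by simp_all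
  ultimately show ?thesis unfolding ideal_stalk_def
    using multihomogeneous_mult[OF 1(2) 2(2)] multihomogeneous_mult[OF 1(3) 2(3)] by blast
qed

lemma stalk_add:
  assumes q: "q \<in> X" and "f \<in> ideal_stalk a b D q" "g \<in> ideal_stalk a b D q" shows "f + g \<in> ideal_stalk a b D q"
proof -
  obtain e G H where 1: "f = Fract (gp G) (gp H)" "mh e G" "mh e H" "ev q H \<noteq> 0" "\<forall>r\<in>D. ev r G = 0"
    using assms(2) unfolding ideal_stalk_def by blast
  obtain e' G' H' where 2: "g = Fract (gp G') (gp H')" "mh e' G'" "mh e' H'" "ev q H' \<noteq> 0" "\<forall>r\<in>D. ev r G' = 0"
    using assms(3) unfolding ideal_stalk_def by blast
  have "f + g = Fract (gp (G * H' + G' * H)) (gp (H * H'))"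
    unfolding 1(1) 2(1) using gp_nz[OF q 1(3,4)] gp_nz[OF q 2(3,4)] by simp
  moreover have "\<forall>r\<in>D. ev r (G * H' + G' * H) = 0" "ev q (H * H') \<noteq> 0" using 1 2 by simp_all
  moreover have "mh (\<lambda>b. e b + e' b) (G' * H)"
    using multihomogeneous_mult[OF 1(3) 2(2)] by (simp only: mult.commute)
  ultimately show ?thesis unfolding ideal_stalk_def
    using multihomogeneous_add[OF multihomogeneous_mult[OF 1(2) 2(3)]] multihomogeneous_mult[OF 1(3) 2(3)] by blast
qed

text \<open>A form that vanishes on \<open>D\<close> but not at \<open>q\<close> puts a unit into
  the stalk, so off \<open>D\<close> the local equation is trivial.\<close>

lemma local_equation_1:
  assumes q: "q \<in> X" and P: "mh e P" "ev q P \<noteq> 0" "\<And>r. r \<in> D \<Longrightarrow> ev r P = 0"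
  shows "local_equation a b D q 1"
proof -
  have "Fract (gp P) (gp P) = 1" using gp_nz[OF q P(1,2)] by (simp add: One_fract_def eq_fract)
  then have "1 = Fract (gp P) (gp P)" by simp
  then have "1 \<in> ideal_stalk a b D q" unfolding ideal_stalk_def mem_Collect_eq using P by blast
  then have "f \<in> ideal_stalk a b D q" if "f \<in> loc q" for f using stalk_mult[OF _ that, of 1 D] by simp
  then show ?thesis unfolding local_equation_def using stalk_sub[of D q] by auto
qed

lemma local_equationI:
  assumes "f \<in> ideal_stalk a b D q" "\<And>g. g \<in> ideal_stalk a b D q \<Longrightarrow> \<exists>h\<in>loc q. g = f * h"
  shows "local_equation a b D q f"
  unfolding local_equation_def using assms stalk_mult by blast

definition unit_at :: "(amb \<Rightarrow> 'k) \<Rightarrow> (3, 'k) mpol fract \<Rightarrow> bool" where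
  "unit_at q u \<longleftrightarrow> u \<noteq> 0 \<and> u \<in> loc q \<and> inverse u \<in> loc q"

lemma unit_mult: "unit_at q u \<Longrightarrow> unit_at q v \<Longrightarrow> unit_at q (u * v)"
  unfolding unit_at_def by (simp add: O_mult)

lemma unit_inverse: "unit_at q u \<Longrightarrow> unit_at q (inverse u)"
  unfolding unit_at_def by simp

lemma unit_1: "unit_at q 1"
  unfolding unit_at_def local_ring_iff using val_1 by auto

lemma unit_power: "unit_at q u \<Longrightarrow> unit_at q (u ^ n)"
  by (induction n) (simp_all add: unit_1 unit_mult)

lemma unit_val:
  assumes "q \<in> X" "val_at a b q u c" "c \<noteq> 0" shows "unit_at q u"
  unfolding unit_at_def local_ring_iff using val_nonzero[OF assms] assms(2) val_inverse[OF assms(2,3)] by blast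

lemma local_equation_unique:
  assumes "local_equation a b C q f" "local_equation a b C q f'" "f' \<noteq> 0"
  shows "\<exists>h. unit_at q h \<and> f = f' * h"
proof -
  have eq: "(\<lambda>h. f * h) ` loc q = (\<lambda>h. f' * h) ` loc q" using assms(1,2) unfolding local_equation_def by simp
  have 1: "1 \<in> loc q" using val_1 unfolding local_ring_iff by blast
  obtain h where h: "h \<in> loc q" "f = f' * h" using eq 1 by (metis (no_types, lifting) image_iff mult.right_neutral)
  obtain h' where h': "h' \<in> loc q" "f' = f * h'" using eq 1 by (metis (no_types, lifting) image_iff mult.right_neutral)
  have "f' * (h * h') = f * h'" by (simp only: h(2) mult.assoc)
  also have "\<dots> = f' * 1" by (simp only: h'(2) mult_1_right)
  finally have "f' * (h * h') = f' * 1" .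
  then have hh: "h * h' = 1" using assms(3) by (simp only: mult_cancel_left) simp
  then have "h \<noteq> 0" "inverse h = h'" by (auto simp: inverse_unique)
  then show ?thesis unfolding unit_at_def using h h' by blast
qed

lemma local_ring_good:
  assumes "N \<in> forms k" "M \<in> forms k" "ev (q \<circ> Inl) M \<noteq> 0"
  shows "Fract N M \<in> loc q"
  unfolding ideal_stalk_def
  using emb_multihomogeneous[OF assms(1)] emb_multihomogeneous[OF assms(2)] assms(3)
  by (intro CollectI exI[of _ "emb N"] exI[of _ "emb M"]) auto

lemma unit_good:
  assumes "N \<in> forms k" "M \<in> forms k" "ev (q \<circ> Inl) M \<noteq> 0" "ev (q \<circ> Inl) N \<noteq> 0"
  shows "unit_at q (Fract N M)"
proof -
  have "N \<noteq> 0" "M \<noteq> 0" using assms by auto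
  then show ?thesis unfolding unit_at_def
    using local_ring_good[OF assms(1-3)] local_ring_good[OF assms(2,1,4)] by (simp add: Zero_fract_def eq_fract)
qed

section \<open>The chart at a point of an exceptional curve\<close>

text \<open>With \<open>y\<^sub>j \<noteq> 0\<close> at the point, \<open>u = l\<^sub>j / x\<^sub>0\<close> and \<open>w = l\<^sub>j\<^sub>' / l\<^sub>j\<close> are local coordinates, in which
  the exceptional curve is \<open>u = 0\<close>; a form is a polynomial in them up to a unit common to its multidegree.\<close>

definition other :: "2 \<Rightarrow> 2" where "other j = (if j = 0 then 1 else 0)"

definition chart :: "9 \<Rightarrow> 2 \<Rightarrow> amb \<Rightarrow> (2, 'k) mpol" where
  "chart i j = (let x = (\<lambda>l. if l = j then Var 0 else Var 0 * Var 1) in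
     case_sum (\<lambda>v. if v = 0 then 1 else if v = 1 then Const (a i) + x 0 else Const (b i) + x 1)
       (\<lambda>(k, l). if k = i then (if l = j then 1 else Var 1)
         else if l = 0 then Const (a i - a k) + x 0 else Const (b i - b k) + x 1))"

definition chart_point :: "9 \<Rightarrow> 2 \<Rightarrow> 'k \<Rightarrow> 'k \<Rightarrow> amb \<Rightarrow> 'k" where
  "chart_point i j s t = (\<lambda>v. ev (\<lambda>l. if l = 0 then s else t) (chart i j v))"

text \<open>The converse of \<open>chart\<close>: polynomials in the local coordinates, read as
  rational functions on the plane.\<close>

definition chart_fract :: "9 \<Rightarrow> 2 \<Rightarrow> (2, 'k) mpol \<Rightarrow> (3, 'k) mpol fract" where
  "chart_fract i j = evh (\<lambda>c. Fract (Const c) 1) (\<lambda>l. if l = 0 then Fract (lf i j) (Var 0) else Fract (lf i (other j)) (lf i j))"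

lemma rhom_Fract_Const: "rhom (\<lambda>c. Fract (Const c :: (3, 'k) mpol) 1)"
  by (rule rhomI) (simp_all add: Const_simps One_fract_def)

lemma rhom_chart_fract: "rhom (chart_fract i j)"
  unfolding chart_fract_def by (rule rhom_evh[OF rhom_Fract_Const])

lemma chart_fract_Var: "chart_fract i j (Var 0) = Fract (lf i j) (Var 0)"
    "chart_fract i j (Var 1) = Fract (lf i (other j)) (lf i j)" "chart_fract i j (Const c) = Fract (Const c) 1"
  by (simp_all add: chart_fract_def evh_Var evh_Const rhom_Fract_Const)

lemma lin_nonzero: "lf i j \<noteq> 0"
proof
  assume "lf i j = 0"
  then have "ev (\<lambda>v. if v = 0 then 0 else 1) (lf i j) = 0" by simp
  then show False by (simp add: ev_lin split: if_splits)
qed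

lemma evh_block_scale:
  fixes G :: "(amb, 'k) mpol" and s t :: "amb \<Rightarrow> 'r::comm_ring_1"
  assumes G: "mh e G" and st: "\<And>B v. B \<in> amb_blocks \<Longrightarrow> v \<in> B \<Longrightarrow> s v = c B * t v"
  shows "evh h s G = (\<Prod>B\<in>amb_blocks. c B ^ e B) * evh h t G"
proof -
  have split: "(\<Prod>v\<in>UNIV. f v) = (\<Prod>B\<in>amb_blocks. \<Prod>v\<in>B. f v)" for f :: "amb \<Rightarrow> 'r"
    by (subst amb_blocks_cover[symmetric], subst prod.Union_disjoint) (auto dest: amb_blocks_disjoint)
  have m: "(\<Prod>v\<in>UNIV. s v ^ Poly_Mapping.lookup m v) = (\<Prod>B\<in>amb_blocks. c B ^ e B) * (\<Prod>v\<in>UNIV. t v ^ Poly_Mapping.lookup m v)"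
    if m: "m \<in> Poly_Mapping.keys G" for m
  proof -
    have "(\<Prod>v\<in>B. s v ^ Poly_Mapping.lookup m v) = c B ^ e B * (\<Prod>v\<in>B. t v ^ Poly_Mapping.lookup m v)" if B: "B \<in> amb_blocks" for B
    proof -
      have "(\<Prod>v\<in>B. s v ^ Poly_Mapping.lookup m v) = (\<Prod>v\<in>B. c B ^ Poly_Mapping.lookup m v * t v ^ Poly_Mapping.lookup m v)"
        using st[OF B] by (intro prod.cong refl) (simp add: power_mult_distrib)
      also have "\<dots> = c B ^ (\<Sum>v\<in>B. Poly_Mapping.lookup m v) * (\<Prod>v\<in>B. t v ^ Poly_Mapping.lookup m v)"
        by (simp only: prod.distrib power_sum)
      also have "(\<Sum>v\<in>B. Poly_Mapping.lookup m v) = e B" using G m B unfolding multihomogeneous_def by blast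
      finally show ?thesis .
    qed
    then have "(\<Prod>B\<in>amb_blocks. \<Prod>v\<in>B. s v ^ Poly_Mapping.lookup m v)
        = (\<Prod>B\<in>amb_blocks. c B ^ e B * (\<Prod>v\<in>B. t v ^ Poly_Mapping.lookup m v))" by (rule prod.cong[OF refl])
    then show ?thesis unfolding split by (simp only: prod.distrib)
  qed
  show ?thesis unfolding evh_def sum_distrib_left
    by (rule sum.cong[OF refl]) (simp only: m mult.left_commute)
qed

lemma other_cases: "l = j \<or> l = other j" and other_neq [simp]: "other j \<noteq> j" "j \<noteq> other j"
  using exhaust_2[of l] exhaust_2[of j] unfolding other_def by auto

text \<open>Each coordinate is its chart expression times a factor that depends only on its block;
  in a quotient of forms of equal multidegree these factors cancel.\<close>

lemma chart_fract_chart: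
  fixes i j
  defines "c \<equiv> \<lambda>B. if B = Inr ` ({i} \<times> UNIV) then Fract (lf i j) 1 else Fract (Var 0) 1 :: (3, 'k) mpol fract"
  assumes B: "B \<in> amb_blocks" "v \<in> B"
  shows "Fract (gp (Var v)) 1 = c B * chart_fract i j (chart i j v)"
proof -
  have t: "chart_fract i j (Const \<gamma> + (if l = j then Var 0 else Var 0 * Var 1)) = Fract (Const \<gamma> * Var 0 + lf i l) (Var 0)" for \<gamma> l
  proof -
    have "chart_fract i j (if l = j then Var 0 else Var 0 * Var 1) = Fract (lf i l) (Var 0)"
      using other_cases[of l j] lin_nonzero[of i j]
      by (auto simp: rhom_mult[OF rhom_chart_fract] chart_fract_Var eq_fract mult_ac)
    then show ?thesis unfolding rhom_add[OF rhom_chart_fract] chart_fract_Var by (simp add: mult.commute)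
  qed
  have cancel: "Fract (Var 0) 1 * Fract N (Var 0) = Fract N 1" for N :: "(3, 'k) mpol" by (simp add: eq_fract mult.commute)
  have lin_shift: "Const (a i - a k) * Var 0 + lf i 0 = lf k 0" "Const (b i - b k) * Var 0 + lf i 1 = lf k 1" for k
    unfolding lin_def by (simp_all add: Const_simps algebra_simps)
  show ?thesis
  proof (cases v)
    case (Inl w)
    then have c: "c B = Fract (Var 0) 1" using B(2) unfolding c_def by auto
    have "chart_fract i j (chart i j v) = Fract (Var w) (Var 0)"
    proof -
      consider "w = 0" | "w = 1" | "w = 2" using exhaust_3 by blast
      then show ?thesis
      proof cases
        case 1
        then show ?thesis unfolding Inl chart_def by (simp add: rhom_one[OF rhom_chart_fract] One_fract_def eq_fract)
      next
        case 2
        then show ?thesis unfolding Inl chart_def Let_def using t[of "a i" 0] by (simp add: lin_def)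
      next
        case 3
        then show ?thesis unfolding Inl chart_def Let_def using t[of "b i" 1] by (simp add: lin_def)
      qed
    qed
    then show ?thesis unfolding c using cancel Inl by simp
  next
    case (Inr p)
    obtain k l where p: "p = (k, l)" by (cases p)
    show ?thesis
    proof (cases "k = i")
      case True
      have "B = Inr ` ({i} \<times> UNIV)" using B Inr p True unfolding amb_blocks_def by auto
      then have c: "c B = Fract (lf i j) 1" unfolding c_def by simp
      have "chart_fract i j (chart i j v) = Fract (lf i l) (lf i j)"
        unfolding Inr p True chart_def Let_def using other_cases[of l j] lin_nonzero[of i j]
        by (auto simp: rhom_one[OF rhom_chart_fract] chart_fract_Var One_fract_def eq_fract)
      then show ?thesis unfolding c Inr p True using lin_nonzero[of i j] by (simp add: eq_fract mult.commute)
    next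
      case False
      have "B \<noteq> Inr ` ({i} \<times> UNIV)" using B(2) Inr p False by auto
      then have c: "c B = Fract (Var 0) 1" unfolding c_def by simp
      have "chart_fract i j (chart i j v) = Fract (lf k l) (Var 0)"
        unfolding Inr p chart_def Let_def using False exhaust_2[of l] t[of "a i - a k" 0] t[of "b i - b k" 1] lin_shift[of k]
        by auto
      then show ?thesis unfolding c Inr p using cancel by simp
    qed
  qed
qed

lemma Fract_gp_chart:
  assumes "mh e G"
  shows "Fract (gp G) 1 = (\<Prod>B\<in>amb_blocks. (if B = Inr ` ({i} \<times> UNIV) then Fract (lf i j) 1 else Fract (Var 0) 1) ^ e B)
    * chart_fract i j (substitute (chart i j) G)"
proof -
  have r1: "rhom (\<lambda>G. Fract (gp G) 1)" by (rule rhomI) (simp_all add: One_fract_def)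
  have r2: "rhom (\<lambda>G. chart_fract i j (substitute (chart i j) G))" by (rule rhom_comp[OF rhom_chart_fract rhom_substitute])
  show ?thesis
    unfolding rhom_eq_evh[OF r1, of G] rhom_eq_evh[OF r2, of G] substitute_Var substitute_Const chart_fract_Var gp_Var
    by (rule evh_block_scale[OF assms chart_fract_chart])
qed

lemma chart_quotient:
  assumes "mh e G" "mh e H" "gp H \<noteq> 0"
  shows "Fract (gp G) (gp H) = chart_fract i j (substitute (chart i j) G) / chart_fract i j (substitute (chart i j) H)"
proof -
  define p where "p = (\<Prod>B\<in>amb_blocks. (if B = Inr ` ({i} \<times> UNIV) then Fract (lf i j) 1 else Fract (Var 0) 1 :: (3, 'k) mpol fract) ^ e B)"
  have nz: "Fract (gp H) 1 \<noteq> 0" using assms(3) by (simp add: Zero_fract_def eq_fract)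
  have g: "Fract (gp G) 1 = p * chart_fract i j (substitute (chart i j) G)" unfolding p_def by (rule Fract_gp_chart[OF assms(1)])
  have h: "Fract (gp H) 1 = p * chart_fract i j (substitute (chart i j) H)" unfolding p_def by (rule Fract_gp_chart[OF assms(2)])
  have "p \<noteq> 0" using nz h by auto
  have "Fract (gp G) (gp H) = Fract (gp G) 1 / Fract (gp H) 1" by simp
  then show ?thesis unfolding g h using \<open>p \<noteq> 0\<close> by simp
qed

end

section \<open>Local equations of curves on the blow up\<close>

lemma mpol_induct [case_names Const Var add mult]:
  fixes P :: "('v::finite, 'k::comm_ring_1) mpol"
  assumes C: "\<And>c. Q (Const c)" and V: "\<And>v. Q (Var v)"
    and A: "\<And>F G. Q F \<Longrightarrow> Q G \<Longrightarrow> Q (F + G)" and M: "\<And>F G. Q F \<Longrightarrow> Q G \<Longrightarrow> Q (F * G)"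
  shows "Q P"
proof -
  have 0: "Q 0" and 1: "Q 1" using C[of 0] C[of 1] by (simp_all add: Const_simps)
  have pow: "Q (Var v ^ n)" for v n by (induction n) (simp_all add: 1 V M)
  have pr: "Q (\<Prod>v\<in>A. Var v ^ e v)" for A e
    by (induction A rule: infinite_finite_induct) (simp_all add: 1 M pow)
  have "Q (\<Sum>m\<in>B. Const (c m) * (\<Prod>v\<in>UNIV. Var v ^ e m v))" for B :: "('v \<Rightarrow>\<^sub>0 nat) set" and c and e :: "('v \<Rightarrow>\<^sub>0 nat) \<Rightarrow> 'v \<Rightarrow> nat"
    by (induction B rule: infinite_finite_induct) (simp_all add: 0 A M C pr)
  then have "Q (substitute Var P)" unfolding substitute_def .
  then show ?thesis by simp
qed

definition drop_var :: "'v::finite \<Rightarrow> ('v, 'k::comm_ring_1) mpol \<Rightarrow> ('v, 'k) mpol" where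
  "drop_var v = substitute (\<lambda>w. if w = v then 0 else Var w)"

lemma ev_drop_var: "ev x (drop_var v P) = ev (x(v := 0)) P"
  unfolding drop_var_def ev_substitute by (rule arg_cong[where f = "\<lambda>g. ev g P"]) auto

lemma drop_var_split:
  fixes P :: "('v::finite, 'k::comm_ring_1) mpol"
  shows "\<exists>A. P = Var v * A + drop_var v P"
proof (induction P rule: mpol_induct)
  case (Const c)
  show ?case by (intro exI[of _ 0]) (simp add: drop_var_def)
next
  case (Var w)
  show ?case
  proof (cases "w = v")
    case True
    then show ?thesis by (intro exI[of _ 1]) (simp add: drop_var_def)
  next
    case False
    then show ?thesis by (intro exI[of _ 0]) (simp add: drop_var_def)
  qed
next
  case (add F G)
  then obtain A B where "F = Var v * A + drop_var v F" "G = Var v * B + drop_var v G" by blast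
  then have "F + G = (Var v * A + drop_var v F) + (Var v * B + drop_var v G)" by (simp only:)
  also have "\<dots> = Var v * (A + B) + drop_var v (F + G)"
    by (simp add: drop_var_def algebra_simps)
  finally show ?case by blast
next
  case (mult F G)
  then obtain A B where AB: "F = Var v * A + drop_var v F" "G = Var v * B + drop_var v G" by blast
  have "(x * A' + f) * (x * B' + g) = x * (A' * (x * B' + g) + f * B') + f * g" for x A' f B' g :: "('v, 'k) mpol"
    by (simp only: distrib_left distrib_right ac_simps)
  then have "(Var v * A + drop_var v F) * (Var v * B + drop_var v G)
      = Var v * (A * (Var v * B + drop_var v G) + drop_var v F * B) + drop_var v F * drop_var v G" .
  then have "F * G = Var v * (A * G + drop_var v F * B) + drop_var v F * drop_var v G" by (simp only: AB[symmetric])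
  moreover have "drop_var v (F * G) = drop_var v F * drop_var v G" by (simp add: drop_var_def)
  ultimately show ?case by (metis (no_types))
qed

text \<open>The remainder after division by the variable does not involve it, and its product with
  the restriction of \<open>N\<close> vanishes everywhere. The point \<open>y\<close> shows that
  this restriction is nonzero.\<close>

lemma Var_factor:
  fixes P :: "('v::{finite,linorder}, 'k::alg_closed_field) mpol"
  assumes y: "y v = 0" "ev y N \<noteq> 0" and P: "\<And>x. x v = 0 \<Longrightarrow> ev x N \<noteq> 0 \<Longrightarrow> ev x P = 0"
  shows "\<exists>Q. P = Var v * Q"
proof -
  obtain A where A: "P = Var v * A + drop_var v P" using drop_var_split by blast
  have "ev x (drop_var v P * drop_var v N) = 0" for x
    using P[of "x(v := 0)"] by (auto simp: ev_drop_var)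
  then have "drop_var v P * drop_var v N = 0" by (rule ev_eq_zero_imp)
  moreover have "y(v := 0) = y" using y(1) by auto
  then have "ev y (drop_var v N) \<noteq> 0" using y(2) by (simp add: ev_drop_var)
  then have "drop_var v N \<noteq> 0" by auto
  ultimately have "drop_var v P = 0" by simp
  then show ?thesis using A by auto
qed

text \<open>Trading the factor \<open>l\<close> for another linear form keeps the degree at
  \<open>k\<close>, which avoids \<open>k - 1\<close> and the degenerate case
  \<open>k = 0\<close>.\<close>

lemma form_cofactor:
  fixes l :: "(3, 'k::field) mpol"
  assumes "l \<in> forms 1" "l * Q \<in> forms k" "l \<noteq> 0" "m \<in> forms 1"
  shows "m * Q \<in> forms k"
proof (cases "Q = 0")
  case True
  then show ?thesis by (simp add: forms_iff)
next
  case False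
  then have "l * Q \<noteq> 0" using assms(3) by simp
  then have "1 \<le> k \<and> Q \<in> forms (k - 1)" by (rule forms_dvd[OF assms(1,2) refl])
  then show ?thesis using forms_mult[OF assms(4), of Q "k - 1"] by simp
qed

text \<open>Splitting off x_0 and then x_1 leaves a multiple of a power of x_2, whose coefficient is
  the value at (0 : 0 : 1).\<close>

lemma vertex_split:
  fixes N :: "(3, 'k::alg_closed_field) mpol"
  assumes N: "N \<in> forms k" "ev (unit_pt 2) N = 0" and m: "m \<in> forms 1"
  shows "\<exists>A B. N = Var 0 * A + Var 1 * B \<and> m * A \<in> forms k \<and> m * B \<in> forms k"
proof -
  have drop: "drop_var v P \<in> forms k" if "P \<in> forms k" for v :: 3 and P :: "(3, 'k) mpol"
  proof -
    have "homg UNIV 1 (if w = v then 0 else Var w :: (3, 'k) mpol)" for w using homg_Var[of UNIV w] by simp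
    then have "homg UNIV (k * 1) (drop_var v P)"
      using that unfolding drop_var_def forms_iff by (intro homg_substitute_forms)
    then show ?thesis by (simp add: forms_iff)
  qed
  define N0 where "N0 = drop_var 0 N"
  obtain A where A: "N = Var 0 * A + N0" using drop_var_split unfolding N0_def by blast
  obtain B where B: "N0 = Var 1 * B + drop_var 1 N0" using drop_var_split by blast
  have N0: "N0 \<in> forms k" unfolding N0_def by (rule drop[OF N(1)])
  have "ev x (drop_var 1 N0 * Var 2) = 0" for x
  proof -
    have "ev x (drop_var 1 N0) = ev (\<lambda>v. x 2 * unit_pt 2 v) N"
      unfolding N0_def ev_drop_var by (rule arg_cong[where f = "\<lambda>g. ev g N"]) (use exhaust_3 in \<open>auto simp: unit_pt_def fun_eq_iff\<close>)
    also have "\<dots> = 0" using ev_homg_scale[of k N "x 2" "unit_pt 2"] N by (simp add: forms_iff)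
    finally show ?thesis by simp
  qed
  then have "drop_var 1 N0 * Var 2 = 0" by (rule ev_eq_zero_imp)
  then have d0: "drop_var 1 N0 = 0" by simp
  have eq: "N = Var 0 * A + Var 1 * B" using A B d0 by simp
  have V: "Var v \<in> forms 1" for v :: 3 by (simp add: forms_iff)
  have "Var 0 * A = N - N0" using A by (simp add: algebra_simps)
  then have "Var 0 * A \<in> forms k" using N(1) N0 by (simp add: forms_iff homg_diff)
  moreover have "Var 1 * B \<in> forms k" using B d0 N0 by simp
  ultimately show ?thesis using eq form_cofactor[OF V _ _ m] by (metis Var_nonzero)
qed

lemma Inr_multihomogeneous:
  "multihomogeneous amb_blocks (\<lambda>B. if B = Inr ` ({i} \<times> UNIV) then 1 else 0) (Var (Inr (i, j)) :: (amb, 'k::comm_ring_1) mpol)"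
proof -
  have "(if B = Inr ` ({i} \<times> UNIV) then 1 else 0 :: nat) = (if Inr (i, j) \<in> B then 1 else 0)" if "B \<in> amb_blocks" for B :: "amb set"
    using that amb_blocks_disjoint[OF that Inr_block[of i]] by auto
  then show ?thesis using multihomogeneous_Var[of "Inr (i, j)"] unfolding multihomogeneous_def by simp
qed

lemma proj_equiv_zero_iff: "proj_equiv amb_blocks p q \<Longrightarrow> q v = 0 \<longleftrightarrow> p v = 0"
proof -
  assume e: "proj_equiv amb_blocks p q"
  obtain B where "B \<in> amb_blocks" "v \<in> B" using amb_blocks_cover by blast
  then obtain c where "c \<noteq> 0" "q v = c * p v" using e unfolding proj_equiv_def by blast
  then show ?thesis by simp
qed

lemma proj_equiv_sym: "proj_equiv B p q \<Longrightarrow> proj_equiv B q p"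
  unfolding proj_equiv_def
proof
  fix b assume "\<forall>b\<in>B. \<exists>c. c \<noteq> 0 \<and> (\<forall>v\<in>b. q v = c * p v)" "b \<in> B"
  then obtain c where "c \<noteq> 0" "\<forall>v\<in>b. q v = c * p v" by blast
  then show "\<exists>c. c \<noteq> 0 \<and> (\<forall>v\<in>b. p v = c * q v)" by (intro exI[of _ "inverse c"]) simp
qed

lemma proj_equiv_trans: "proj_equiv B p q \<Longrightarrow> proj_equiv B q r \<Longrightarrow> proj_equiv B p r"
  unfolding proj_equiv_def
proof
  fix b assume "\<forall>b\<in>B. \<exists>c. c \<noteq> 0 \<and> (\<forall>v\<in>b. q v = c * p v)" "\<forall>b\<in>B. \<exists>c. c \<noteq> 0 \<and> (\<forall>v\<in>b. r v = c * q v)" "b \<in> B"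
  then obtain c d where "c \<noteq> 0" "\<forall>v\<in>b. q v = c * p v" "d \<noteq> 0" "\<forall>v\<in>b. r v = d * q v" by metis
  then show "\<exists>c. c \<noteq> 0 \<and> (\<forall>v\<in>b. r v = c * p v)" by (intro exI[of _ "d * c"]) simp
qed

lemma point_class_eq: "proj_equiv B p q \<Longrightarrow> point_class B p = point_class B q"
  unfolding point_class_def using proj_equiv_sym proj_equiv_trans by blast

lemma proportional_pair:
  fixes y l :: "2 \<Rightarrow> 'k::field"
  assumes "y 0 * l 1 = y 1 * l 0" "\<exists>j. y j \<noteq> 0" "\<exists>j. l j \<noteq> 0"
  shows "\<exists>c. c \<noteq> 0 \<and> (\<forall>j. y j = c * l j)"
proof -
  obtain j0 where j0: "l j0 \<noteq> 0" using assms(3) by blast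
  obtain j1 where j1: "y j1 \<noteq> 0" using assms(2) by blast
  have pr: "y j * l j' = y j' * l j" for j j' using assms(1) exhaust_2[of j] exhaust_2[of j'] by auto
  have e: "y j = (y j0 / l j0) * l j" for j using pr[of j j0] j0 by (simp only: eq_divide_eq times_divide_eq_left) simp
  have "y j0 \<noteq> 0"
  proof
    assume "y j0 = 0"
    then have "y j1 * l j0 = 0" using pr[of j1 j0] by simp
    then show False using j1 j0 by simp
  qed
  then have "y j0 / l j0 \<noteq> 0" using j0 by simp
  then show ?thesis using e by blast
qed

context blowup_points
begin

abbreviation "E \<equiv> exc a b"
abbreviation "L \<equiv> line_pullback a b"

text \<open>The strict transform of the line through \<open>p\<^sub>i\<close> and \<open>(0 : 0 : 1)\<close>.\<close>

definition line_thru_pt :: "9 \<Rightarrow> (amb \<Rightarrow> 'k) set" where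
  "line_thru_pt i = {q \<in> X. q (Inr (i, 0)) = 0}"

abbreviation "M \<equiv> line_thru_pt"

lemma L_iff: "q \<in> L \<longleftrightarrow> q \<in> X \<and> q (Inl 0) = 0"
  by (simp add: line_pullback_def)

lemma M_iff: "q \<in> M i \<longleftrightarrow> q \<in> X \<and> q (Inr (i, 0)) = 0"
  by (simp add: line_thru_pt_def)

lemma X_coord: "q \<in> X \<Longrightarrow> \<exists>v. q (Inl v) \<noteq> 0" "q \<in> X \<Longrightarrow> \<exists>j. q (Inr (i, j)) \<noteq> 0"
  unfolding blowup_iff multiproj_amb by blast+

lemma X_rel: "q \<in> X \<Longrightarrow> q (Inr (i, 0)) * (q (Inl 2) - b i * q (Inl 0)) = q (Inr (i, 1)) * (q (Inl 1) - a i * q (Inl 0))"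
  unfolding blowup_iff by (simp add: ev_lin)

lemma M_line: "q \<in> M i \<Longrightarrow> q (Inl 1) = a i * q (Inl 0)"
proof -
  assume q: "q \<in> M i"
  then have "q (Inr (i, 1)) \<noteq> 0" using X_coord(2)[of q i] exhaust_2 unfolding M_iff by metis
  then show ?thesis using X_rel[of q i] q unfolding M_iff by simp
qed

lemma E_coord: "q \<in> E i \<Longrightarrow> q (Inl 1) = a i * q (Inl 0)" "q \<in> E i \<Longrightarrow> q (Inl 2) = b i * q (Inl 0)"
  unfolding exc_iff by (simp_all add: ev_lin)

lemma E_coord_0: "q \<in> E i \<Longrightarrow> q (Inl 0) \<noteq> 0"
  using E_coord[of q i] X_coord(1)[of q] exhaust_3 unfolding exc_iff by (metis mult_zero_right)

lemma E_X: "q \<in> E i \<Longrightarrow> q \<in> X"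
  unfolding exc_iff by blast

lemma L_E_disjoint: "L \<inter> E i = {}"
  using E_coord_0 L_iff by auto

lemma E_E_disjoint: "i \<noteq> k \<Longrightarrow> E i \<inter> E k = {}"
proof (rule ccontr)
  assume ne: "i \<noteq> k" and "E i \<inter> E k \<noteq> {}"
  then obtain q where q: "q \<in> E i" "q \<in> E k" by blast
  then have "a i * q (Inl 0) = a k * q (Inl 0)" using E_coord(1) by metis
  then show False using E_coord_0[OF q(1)] a_neq[OF ne] by simp
qed

lemma M_E_disjoint: "i \<noteq> k \<Longrightarrow> M i \<inter> E k = {}"
proof (rule ccontr)
  assume ne: "i \<noteq> k" and "M i \<inter> E k \<noteq> {}"
  then obtain q where q: "q \<in> M i" "q \<in> E k" by blast
  then have "a i * q (Inl 0) = a k * q (Inl 0)" using E_coord(1) M_line by metis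
  then show False using E_coord_0[OF q(2)] a_neq[OF ne] by simp
qed

lemma good_off_E: "q \<in> X \<Longrightarrow> good a b (q \<circ> Inl) \<longleftrightarrow> (\<forall>i. q \<notin> E i)"
proof
  assume q: "q \<in> X" "good a b (q \<circ> Inl)"
  show "\<forall>i. q \<notin> E i"
  proof
    fix i
    obtain j where "ev (q \<circ> Inl) (lf i j) \<noteq> 0" using q(2) unfolding good_def by blast
    then show "q \<notin> E i" using exhaust_2[of j] unfolding exc_iff by auto
  qed
next
  assume "q \<in> X" "\<forall>i. q \<notin> E i"
  then show "good a b (q \<circ> Inl)" using not_exc_good by blast
qed

lemma good_form: "q \<in> X \<Longrightarrow> \<exists>m. m \<in> forms 1 \<and> ev (q \<circ> Inl) m \<noteq> 0"
proof -
  assume "q \<in> X"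
  then obtain v where "q (Inl v) \<noteq> 0" using X_coord by blast
  then show ?thesis by (intro exI[of _ "Var v"]) (simp add: forms_iff)
qed

lemma E_local_off: "q \<in> X \<Longrightarrow> q \<notin> E i \<Longrightarrow> local_equation a b (E i) q 1"
proof -
  assume q: "q \<in> X" "q \<notin> E i"
  then obtain j where j: "ev q (emb (lf i j)) \<noteq> 0" unfolding exc_iff by auto
  have "ev r (emb (lf i j)) = 0" if "r \<in> E i" for r using E_coord[OF that] by (auto simp: ev_lin)
  then show ?thesis using local_equation_1[OF q(1) emb_multihomogeneous[OF lin_forms] j] by blast
qed

lemma L_local_off: "q \<in> X \<Longrightarrow> q \<notin> L \<Longrightarrow> local_equation a b L q 1"
proof -
  assume q: "q \<in> X" "q \<notin> L"
  then have "ev q (Var (Inl 0)) \<noteq> 0" unfolding L_iff by simp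
  then show ?thesis by (rule local_equation_1[OF q(1) multihomogeneous_Var]) (simp add: L_iff)
qed

lemma M_local_off: "q \<in> X \<Longrightarrow> q \<notin> M i \<Longrightarrow> local_equation a b (M i) q 1"
proof -
  assume q: "q \<in> X" "q \<notin> M i"
  then have "ev q (Var (Inr (i, 0))) \<noteq> 0" unfolding M_iff by simp
  then show ?thesis by (rule local_equation_1[OF q(1) multihomogeneous_Var]) (simp add: M_iff)
qed

text \<open>Away from the exceptional curves the local ring consists of quotients of plane forms, so
  divisibility by \<open>l\<close> of all forms vanishing on \<open>D\<close> is enough.\<close>

lemma local_equation_good:
  assumes q: "q \<in> X" "good a b (q \<circ> Inl)" and l: "l \<in> forms 1" "l \<noteq> 0" and m: "m \<in> forms 1" "ev (q \<circ> Inl) m \<noteq> 0"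
    and D: "\<And>r. r \<in> D \<Longrightarrow> ev (r \<circ> Inl) l = 0"
    and G: "\<And>e G. mh e G \<Longrightarrow> (\<And>r. r \<in> D \<Longrightarrow> ev r G = 0) \<Longrightarrow> \<exists>Q. gp G = l * Q"
  shows "local_equation a b D q (Fract l m)"
proof (rule local_equationI)
  show "Fract l m \<in> ideal_stalk a b D q" unfolding ideal_stalk_def
    using emb_multihomogeneous[OF l(1)] emb_multihomogeneous[OF m(1)] m(2) D
    by (intro CollectI exI[of _ "emb l"] exI[of _ "emb m"]) auto
  fix g assume "g \<in> ideal_stalk a b D q"
  then obtain e F H where F: "g = Fract (gp F) (gp H)" "mh e F" "mh e H" "ev q H \<noteq> 0" "\<And>r. r \<in> D \<Longrightarrow> ev r F = 0"
    unfolding ideal_stalk_def by blast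
  obtain Q where Q: "gp F = l * Q" using G[OF F(2,5)] by blast
  have "m * Q \<in> forms (sum e amb_blocks)"
  proof (rule form_cofactor[OF l(1) _ l(2) m(1)])
    show "l * Q \<in> forms (sum e amb_blocks)" unfolding Q[symmetric] by (rule gp_forms[OF F(2)])
  qed
  moreover have h0: "ev (q \<circ> Inl) (gp H) \<noteq> 0" using ev_off_exc[OF q F(3)] F(4) by blast
  ultimately have "Fract (m * Q) (gp H) \<in> loc q" using local_ring_good gp_forms[OF F(3)] by blast
  moreover have "g = Fract l m * Fract (m * Q) (gp H)"
  proof -
    have "m \<noteq> 0" "gp H \<noteq> 0" using m(2) h0 by auto
    then show ?thesis unfolding F(1) Q by (simp add: eq_fract)
  qed
  ultimately show "\<exists>h\<in>loc q. g = Fract l m * h" by blast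
qed

lemma L_local_good:
  assumes q: "q \<in> X" "good a b (q \<circ> Inl)" and m: "m \<in> forms 1" "ev (q \<circ> Inl) m \<noteq> 0"
  shows "local_equation a b L q (Fract (Var 0) m)"
proof (rule local_equation_good[OF q _ Var_nonzero m])
  fix e G assume G: "mh e G" "\<And>r. r \<in> L \<Longrightarrow> ev r G = 0"
  show "\<exists>Q. gp G = Var 0 * Q"
  proof (rule Var_factor[where y = "unit_pt 1" and N = "Var 1"])
    fix x :: "3 \<Rightarrow> 'k" assume x: "x 0 = 0" "ev x (Var 1) \<noteq> 0"
    then have "good a b x" unfolding good_def by (auto simp: ev_lin)
    then have "pull a b x \<in> L" using pull_blowup x unfolding L_iff by simp
    then show "ev x (gp G) = 0" using G(2) by (simp add: ev_gp)
  qed (simp_all add: unit_pt_def)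
qed (simp_all add: forms_iff L_iff)

lemma M_local_good:
  assumes q: "q \<in> X" "good a b (q \<circ> Inl)" and m: "m \<in> forms 1" "ev (q \<circ> Inl) m \<noteq> 0"
  shows "local_equation a b (M i) q (Fract (lf i 0) m)"
proof (rule local_equation_good[OF q lin_forms lin_nonzero m])
  show "ev (r \<circ> Inl) (lf i 0) = 0" if "r \<in> M i" for r using M_line[OF that] by (simp add: ev_lin)
  fix e G assume G: "mh e G" "\<And>r. r \<in> M i \<Longrightarrow> ev r G = 0"
  have "\<exists>Q. shift (a i) (b i) (gp G) = Var 1 * Q"
  \<comment> \<open>On the translated line x_1 = 0 the factor x_0 x_2 excludes p_i and (0 : 0 : 1);
    the other points of the line are good because the first coordinates of the p_i differ.\<close>
  proof (rule Var_factor[where y = "\<lambda>v. if v = 1 then 0 else 1" and N = "Var 0 * Var 2"])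
    fix x :: "3 \<Rightarrow> 'k" assume x: "x 1 = 0" "ev x (Var 0 * Var 2) \<noteq> 0"
    define z where "z = (\<lambda>v::3. if v = 0 then x 0 else if v = 1 then x 1 + a i * x 0 else x 2 + b i * x 0)"
    have z: "z 0 = x 0" "z 1 = a i * x 0" "z 2 = x 2 + b i * x 0" using x(1) by (auto simp: z_def)
    have "\<exists>j. ev z (lf k j) \<noteq> 0" for k
    proof (cases "k = i")
      case True
      then show ?thesis using x(2) by (intro exI[of _ 1]) (simp add: ev_lin z)
    next
      case False
      have "ev z (lf k 0) = (a i - a k) * x 0" by (simp add: ev_lin z algebra_simps)
      then show ?thesis using x(2) a_neq[OF False] by (intro exI[of _ 0]) simp
    qed
    moreover have "z 0 \<noteq> 0" using z(1) x(2) by simp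
    ultimately have "good a b z" unfolding good_def by blast
    then have "pull a b z \<in> M i" using pull_blowup z unfolding M_iff by (simp add: ev_lin)
    then have "ev z (gp G) = 0" using G(2) by (simp add: ev_gp)
    then show "ev x (shift (a i) (b i) (gp G)) = 0" unfolding ev_shift z_def .
  qed simp_all
  then obtain Q where Q: "shift (a i) (b i) (gp G) = Var 1 * Q" by blast
  have "gp G = shift (- a i) (- b i) (Var 1 * Q)" unfolding Q[symmetric] by (rule shift_shift'[symmetric])
  also have "\<dots> = lf i 0 * shift (- a i) (- b i) Q" by (simp add: lin_def Const_simps)
  finally show "\<exists>Q. gp G = lf i 0 * Q" by blast
qed

lemma val_good:
  assumes "N \<in> forms k" "H \<in> forms k" "ev (q \<circ> Inl) H \<noteq> 0" "ev (q \<circ> Inl) N = c * ev (q \<circ> Inl) H"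
  shows "val_at a b q (Fract N H) c"
  unfolding val_at_def using emb_multihomogeneous[OF assms(1)] emb_multihomogeneous[OF assms(2)] assms(3,4)
  by (intro exI[of _ "\<lambda>b. if b = range Inl then k else 0"] exI[of _ "emb N"] exI[of _ "emb H"]) simp

definition chart_at :: "9 \<Rightarrow> 2 \<Rightarrow> (amb \<Rightarrow> 'k) \<Rightarrow> bool" where
  "chart_at i j q \<longleftrightarrow> q \<in> E i \<and> q (Inr (i, j)) \<noteq> 0"

lemma val_chart:
  assumes q: "chart_at i j q"
  shows "val_at a b q (chart_fract i j R) (ev (\<lambda>l. if l = 0 then 0 else q (Inr (i, other j)) / q (Inr (i, j))) R)"
proof (induction R rule: mpol_induct)
  case (Const c)
  show ?case unfolding chart_fract_Var(3) ev_Const by (rule val_Const)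
next
  case (Var v)
  have qE: "q \<in> E i" and qj: "q (Inr (i, j)) \<noteq> 0" using q unfolding chart_at_def by auto
  consider "v = 0" | "v = 1" using exhaust_2 by blast
  then show ?case
  proof cases
    case 1
    have "val_at a b q (Fract (lf i j) (Var 0)) 0"
    proof (rule val_good[OF lin_forms])
      show "ev (q \<circ> Inl) (lf i j) = 0 * ev (q \<circ> Inl) (Var 0)" using E_coord[OF qE] by (simp add: ev_lin)
    qed (use E_coord_0[OF qE] in \<open>simp_all add: forms_iff\<close>)
    then show ?thesis unfolding 1 chart_fract_Var by simp
  next
    case 2
    have "val_at a b q (Fract (lf i (other j)) (lf i j)) (q (Inr (i, other j)) / q (Inr (i, j)))"
      unfolding val_at_def using Inr_multihomogeneous[of i j] Inr_multihomogeneous[of i "other j"] qj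
      by (intro exI[of _ "\<lambda>B. if B = Inr ` ({i} \<times> UNIV) then 1 else 0"] exI[of _ "Var (Inr (i, other j))"] exI[of _ "Var (Inr (i, j))"]) simp
    then show ?thesis unfolding 2 chart_fract_Var by simp
  qed
next
  case (add F G)
  then show ?case unfolding rhom_add[OF rhom_chart_fract] ev_simps
    using q unfolding chart_at_def by (intro val_add) (auto dest: E_X)
next
  case (mult F G)
  then show ?case unfolding rhom_mult[OF rhom_chart_fract] ev_simps by (rule val_mult)
qed

lemma chart_point_arc: "chart_point i j 0 t = arc_point a b i (\<lambda>l. if l = j then 1 else t)"
proof
  fix v
  show "chart_point i j 0 t v = arc_point a b i (\<lambda>l. if l = j then 1 else t) v"
    by (cases v) (auto simp: chart_point_def chart_def Let_def arc_point_def pt_def ev_lin split: prod.splits)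
qed

lemma chart_point_E: "chart_point i j 0 t \<in> E i"
  unfolding chart_point_arc using exhaust_2[of j] by (intro arc_point_blowup[OF distinct]) auto

lemma chart_point_equiv:
  assumes q: "chart_at i j q"
  shows "proj_equiv amb_blocks (chart_point i j 0 (q (Inr (i, other j)) / q (Inr (i, j)))) q"
proof -
  have qE: "q \<in> E i" and qj: "q (Inr (i, j)) \<noteq> 0" using q unfolding chart_at_def by auto
  let ?y = "\<lambda>l. if l = j then 1 else q (Inr (i, other j)) / q (Inr (i, j))"
  have y: "q (Inr (i, l)) = q (Inr (i, j)) * ?y l" for l
    using qj other_cases[of l j] by (auto split: if_splits)
  have e: "proj_equiv amb_blocks (arc_point a b i (\<lambda>l. q (Inr (i, l)))) q" by (rule exc_arc_point[OF distinct qE])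
  have "proj_equiv amb_blocks (arc_point a b i ?y) (arc_point a b i (\<lambda>l. q (Inr (i, l))))"
    unfolding proj_equiv_amb
  proof (intro conjI allI)
    show "\<exists>c. c \<noteq> 0 \<and> (\<forall>v. arc_point a b i (\<lambda>l. q (Inr (i, l))) (Inl v) = c * arc_point a b i ?y (Inl v))"
      by (intro exI[of _ 1]) (simp add: arc_point_def)
    show "\<exists>c. c \<noteq> 0 \<and> (\<forall>l. arc_point a b i (\<lambda>l. q (Inr (i, l))) (Inr (k, l)) = c * arc_point a b i ?y (Inr (k, l)))" for k
    proof (cases "k = i")
      case True
      have "arc_point a b i f (Inr (k, l)) = f l" for f l using True by (simp add: arc_point_def)
      then show ?thesis using qj y by metis
    qed (intro exI[of _ 1], simp add: arc_point_def)
  qed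
  then show ?thesis unfolding chart_point_arc using e by (rule proj_equiv_trans)
qed

lemma ev_chart: "ev (\<lambda>l. if l = 0 then s else t) (substitute (chart i j) G) = ev (chart_point i j s t) G"
  unfolding ev_substitute chart_point_def ..

text \<open>The chart expression of the denominator has a nonzero value at \<open>q\<close>, so its
  inverse is the unit.\<close>

lemma chart_local:
  assumes q: "chart_at i j q" and G: "mh e G" "mh e H" "ev q H \<noteq> 0"
  shows "\<exists>v. unit_at q v \<and> Fract (gp G) (gp H) = chart_fract i j (substitute (chart i j) G) * v"
proof -
  have qX: "q \<in> X" using q E_X unfolding chart_at_def by blast
  let ?w = "q (Inr (i, other j)) / q (Inr (i, j))"
  let ?h = "chart_fract i j (substitute (chart i j) H)"
  have "val_at a b q ?h (ev (chart_point i j 0 ?w) H)"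
    using val_chart[OF q, of "substitute (chart i j) H"] unfolding ev_chart .
  moreover have "ev (chart_point i j 0 ?w) H \<noteq> 0" using ev_proj_equiv[OF chart_point_equiv[OF q] G(2)] G(3) by auto
  ultimately have "unit_at q (inverse ?h)" using unit_val[OF qX] unit_inverse by blast
  moreover have "Fract (gp G) (gp H) = chart_fract i j (substitute (chart i j) G) * inverse ?h"
    unfolding chart_quotient[OF G(1,2) gp_nz[OF qX G(2,3)], of i j] by (rule divide_inverse)
  ultimately show ?thesis by blast
qed

lemma chart_fract_loc: "chart_at i j q \<Longrightarrow> chart_fract i j R \<in> loc q"
  using val_chart local_ring_iff by blast

text \<open>A form that vanishes on the exceptional curve has a chart expression vanishing on u = 0,
  hence divisible by u.\<close>

lemma E_local:
  assumes q: "chart_at i j q"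
  shows "local_equation a b (E i) q (Fract (lf i j) (Var 0))"
proof (rule local_equationI)
  have qE: "q \<in> E i" and qj: "q (Inr (i, j)) \<noteq> 0" using q unfolding chart_at_def by auto
  have V: "Var 0 \<in> forms 1" by (simp add: forms_iff)
  have z: "ev r (emb (lf i j)) = 0" if "r \<in> E i" for r using E_coord[OF that] by (simp add: ev_lin)
  show "Fract (lf i j) (Var 0) \<in> ideal_stalk a b (E i) q" unfolding ideal_stalk_def
    using emb_multihomogeneous[OF lin_forms, of a b i j] emb_multihomogeneous[OF V] E_coord_0[OF qE] z
    by (intro CollectI exI[of _ "emb (lf i j)"] exI[of _ "emb (Var 0)"]) auto
  fix g assume "g \<in> ideal_stalk a b (E i) q"
  then obtain e G H where G: "g = Fract (gp G) (gp H)" "mh e G" "mh e H" "ev q H \<noteq> 0" "\<And>r. r \<in> E i \<Longrightarrow> ev r G = 0"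
    unfolding ideal_stalk_def by blast
  obtain v where v: "unit_at q v" "g = chart_fract i j (substitute (chart i j) G) * v"
    using chart_local[OF q G(2-4)] G(1) by blast
  have "\<exists>R. substitute (chart i j) G = Var 0 * R"
  proof (rule Var_factor[where y = "\<lambda>_. 0" and N = 1])
    fix x :: "2 \<Rightarrow> 'k" assume x0: "x 0 = 0"
    have "x = (\<lambda>l. if l = 0 then 0 else x 1)"
    proof
      show "x l = (if l = 0 then 0 else x 1)" for l using exhaust_2[of l] x0 by auto
    qed
    then have "ev x (substitute (chart i j) G) = ev (chart_point i j 0 (x 1)) G" using ev_chart[of 0 "x 1" i j G] by simp
    then show "ev x (substitute (chart i j) G) = 0" using G(5)[OF chart_point_E] by simp
  qed simp_all
  then obtain R where R: "substitute (chart i j) G = Var 0 * R" by blast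
  have "g = Fract (lf i j) (Var 0) * (chart_fract i j R * v)"
    unfolding v(2) R rhom_mult[OF rhom_chart_fract] chart_fract_Var by (rule mult.assoc)
  moreover have "chart_fract i j R * v \<in> loc q" using chart_fract_loc[OF q] v(1) O_mult unfolding unit_at_def by blast
  ultimately show "\<exists>h\<in>loc q. g = Fract (lf i j) (Var 0) * h" by blast
qed

lemma chart_point_M: "chart_point i 1 s 0 \<in> M i"
proof -
  let ?q = "chart_point i 1 s 0"
  have x: "?q (Inl 0) = 1" "?q (Inl 1) = a i" "?q (Inl 2) = b i + s"
    unfolding chart_point_def chart_def Let_def by simp_all
  have yi: "?q (Inr (i, l)) = (if l = 1 then 1 else 0)" for l
    unfolding chart_point_def chart_def Let_def by simp
  have yk: "?q (Inr (k, l)) = (if l = 0 then a i - a k else b i - b k + s)" if "k \<noteq> i" for k l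
    unfolding chart_point_def chart_def Let_def using that exhaust_2[of l] by auto
  have "\<exists>l. ?q (Inr (k, l)) \<noteq> 0" for k
    using yi[of 1] yk[of k 0] a_neq[of i k] by (cases "k = i") (auto intro: exI[of _ 0] exI[of _ 1])
  moreover have "?q (Inr (k, 0)) * ev (?q \<circ> Inl) (lf k 1) = ?q (Inr (k, 1)) * ev (?q \<circ> Inl) (lf k 0)" for k
    unfolding ev_lin comp_def x by (cases "k = i") (simp_all add: yi yk algebra_simps)
  moreover have "\<exists>v. ?q (Inl v) \<noteq> 0" using x by (intro exI[of _ 0]) simp
  ultimately show ?thesis unfolding M_iff blowup_iff multiproj_amb using yi[of 0] by simp
qed

text \<open>The strict transform meets the exceptional curve only where the second coordinate of the
  i-th line is nonzero; in that chart it is w = 0.\<close>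

lemma M_local:
  assumes q: "q \<in> E i" "q \<in> M i"
  shows "chart_at i 1 q" "local_equation a b (M i) q (Fract (lf i 0) (lf i 1))"
proof -
  show c: "chart_at i 1 q" using q X_coord(2)[of q i] exhaust_2 unfolding chart_at_def M_iff by metis
  then have qj: "q (Inr (i, 1)) \<noteq> 0" unfolding chart_at_def by blast
  have o: "other 1 = 0" by (simp add: other_def)
  show "local_equation a b (M i) q (Fract (lf i 0) (lf i 1))"
  proof (rule local_equationI)
    have z: "ev r (Var (Inr (i, 0))) = 0" if "r \<in> M i" for r using that unfolding M_iff by simp
    show "Fract (lf i 0) (lf i 1) \<in> ideal_stalk a b (M i) q" unfolding ideal_stalk_def
      using Inr_multihomogeneous[of i 0] Inr_multihomogeneous[of i 1] qj z
      by (intro CollectI exI[of _ "Var (Inr (i, 0))"] exI[of _ "Var (Inr (i, 1))"]) auto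
    fix g assume "g \<in> ideal_stalk a b (M i) q"
    then obtain e G H where G: "g = Fract (gp G) (gp H)" "mh e G" "mh e H" "ev q H \<noteq> 0" "\<And>r. r \<in> M i \<Longrightarrow> ev r G = 0"
      unfolding ideal_stalk_def by blast
    obtain v where v: "unit_at q v" "g = chart_fract i 1 (substitute (chart i 1) G) * v"
      using chart_local[OF c G(2-4)] G(1) by blast
    have "\<exists>R. substitute (chart i 1) G = Var 1 * R"
    proof (rule Var_factor[where y = "\<lambda>_. 0" and N = 1])
      fix x :: "2 \<Rightarrow> 'k" assume x0: "x 1 = 0"
      have "x = (\<lambda>l. if l = 0 then x 0 else 0)"
      proof
        show "x l = (if l = 0 then x 0 else 0)" for l using exhaust_2[of l] x0 by auto
      qed
      then have "ev x (substitute (chart i 1) G) = ev (chart_point i 1 (x 0) 0) G" using ev_chart[of "x 0" 0 i 1 G] by simp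
      then show "ev x (substitute (chart i 1) G) = 0" using G(5)[OF chart_point_M] by simp
    qed simp_all
    then obtain R where R: "substitute (chart i 1) G = Var 1 * R" by blast
    have "g = Fract (lf i 0) (lf i 1) * (chart_fract i 1 R * v)"
      unfolding v(2) R rhom_mult[OF rhom_chart_fract] chart_fract_Var o by (rule mult.assoc)
    moreover have "chart_fract i 1 R * v \<in> loc q" using chart_fract_loc[OF c] v(1) O_mult unfolding unit_at_def by blast
    ultimately show "\<exists>h\<in>loc q. g = Fract (lf i 0) (lf i 1) * h" by blast
  qed
qed

end

section \<open>Curves\<close>

text \<open>Two closed sets that cover \<open>C\<close> without containing it would each give an
  equation that is nonzero in the parameters, and the product of the two would vanish on a dense
  set.\<close>

lemma parametrised_irreducible:
  fixes \<sigma> :: "amb \<Rightarrow> (2, 'k::alg_closed_field) mpol"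
  assumes C: "\<And>x. x 0 \<noteq> 0 \<Longrightarrow> (\<lambda>v. ev x (\<sigma> v)) \<in> C" "C \<subseteq> multiproj amb_blocks"
    and par: "\<And>q. q \<in> C \<Longrightarrow> \<exists>x. proj_equiv amb_blocks (\<lambda>v. ev x (\<sigma> v)) q"
  shows "zariski_irreducible amb_blocks C"
  unfolding zariski_irreducible_def
proof (intro conjI allI impI)
  show "C \<noteq> {}" using C(1)[of "\<lambda>_. 1"] by auto
  fix S T :: "(amb \<Rightarrow> 'k) set"
  assume S: "zariski_closed amb_blocks S" and T: "zariski_closed amb_blocks T" and ST: "C \<subseteq> S \<union> T"
  have key: "\<exists>P. (\<forall>q\<in>S. ev q P = 0) \<and> substitute \<sigma> P \<noteq> 0" if S: "zariski_closed amb_blocks S" "\<not> C \<subseteq> S" for S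
  proof -
    obtain q where q: "q \<in> C" "q \<notin> S" using S(2) by blast
    then obtain e P where P: "multihomogeneous amb_blocks e P" "\<forall>q\<in>S. ev q P = 0" "ev q P \<noteq> 0"
      using S(1) C(2) unfolding zariski_closed_def by blast
    obtain x where "proj_equiv amb_blocks (\<lambda>v. ev x (\<sigma> v)) q" using par q(1) by blast
    then have "ev (\<lambda>v. ev x (\<sigma> v)) P \<noteq> 0" using ev_proj_equiv[OF _ P(1)] P(3) by force
    then have "ev x (substitute \<sigma> P) \<noteq> 0" by (simp add: ev_substitute)
    then show ?thesis using P(2) by auto
  qed
  show "C \<subseteq> S \<or> C \<subseteq> T"
  proof (rule ccontr)
    assume "\<not> (C \<subseteq> S \<or> C \<subseteq> T)"
    then obtain P Q where P: "\<forall>q\<in>S. ev q P = 0" "substitute \<sigma> P \<noteq> 0" and Q: "\<forall>q\<in>T. ev q Q = 0" "substitute \<sigma> Q \<noteq> 0"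
      using key[OF S] key[OF T] by blast
    have "Var 0 * (substitute \<sigma> P * substitute \<sigma> Q) \<noteq> 0" using P(2) Q(2) by simp
    then obtain x where "ev x (Var 0 * (substitute \<sigma> P * substitute \<sigma> Q)) \<noteq> 0" using ex_ev_nonzero by blast
    then have x: "x 0 \<noteq> 0" "ev (\<lambda>v. ev x (\<sigma> v)) P \<noteq> 0" "ev (\<lambda>v. ev x (\<sigma> v)) Q \<noteq> 0"
      by (auto simp: ev_substitute)
    then show False using C(1)[of x, OF x(1)] ST P(1) Q(1) by blast
  qed
qed

lemma not_point_class:
  assumes "p \<in> C" "p' \<in> C" "p v = 0" "p' v \<noteq> 0"
  shows "C \<noteq> point_class amb_blocks q"
proof
  assume C: "C = point_class amb_blocks q"
  then have "proj_equiv amb_blocks q p" "proj_equiv amb_blocks q p'" using assms unfolding point_class_def by auto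
  then show False using proj_equiv_zero_iff[of q p v] proj_equiv_zero_iff[of q p' v] assms by simp
qed

context blowup_points
begin

lemma closed_on_X:
  assumes S: "\<forall>P\<in>S. \<exists>e. mh e P"
  shows "zariski_closed amb_blocks {q \<in> X. \<forall>P\<in>S. ev q P = 0}"
proof -
  define rel where "rel k = Var (Inr (k, 0)) * emb (lf k 1) - Var (Inr (k, 1)) * emb (lf k 0)" for k
  have "\<exists>e. mh e (rel k)" for k
    unfolding rel_def
    by (rule exI, rule multihomogeneous_diff; rule multihomogeneous_mult[OF Inr_multihomogeneous emb_multihomogeneous[OF lin_forms]])
  then have "\<forall>P\<in>S \<union> range rel. \<exists>e. mh e P" using S by blast
  moreover have "{q \<in> X. \<forall>P\<in>S. ev q P = 0} = {q \<in> multiproj amb_blocks. \<forall>P\<in>S \<union> range rel. ev q P = 0}"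
    by (auto simp: blowup_iff rel_def ball_Un)
  ultimately show ?thesis unfolding zariski_closed_def by blast
qed

lemma X_multiproj: "X \<subseteq> multiproj amb_blocks"
  using blowup_iff by blast

lemma L_X: "q \<in> L \<Longrightarrow> q \<in> X"
  unfolding L_iff by blast

text \<open>\<open>p\<close> shows that \<open>C\<close> is not all of the surface, and
  \<open>r\<close>, \<open>r'\<close>, told apart by the vanishing of one coordinate, show that it
  is not a single point.\<close>

lemma curveI:
  assumes S: "\<And>P. P \<in> S \<Longrightarrow> \<exists>e. mh e P" "C = {q \<in> X. \<forall>P\<in>S. ev q P = 0}"
    and par: "\<And>x. x 0 \<noteq> 0 \<or> x 1 \<noteq> 0 \<Longrightarrow> (\<lambda>v. ev x (\<sigma> v)) \<in> C" "\<And>q. q \<in> C \<Longrightarrow> \<exists>x :: 2 \<Rightarrow> 'k. proj_equiv amb_blocks (\<lambda>v. ev x (\<sigma> v)) q"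
    and pt: "p \<in> X" "p \<notin> C" "r \<in> C" "r' \<in> C" "r v = 0" "r' v \<noteq> 0"
  shows "curve_on_X a b C"
  unfolding curve_on_X_def
proof (intro conjI allI)
  show "zariski_closed amb_blocks C" unfolding S(2) using S(1) by (intro closed_on_X) blast
  show CX: "C \<subseteq> X" unfolding S(2) by blast
  show "zariski_irreducible amb_blocks C"
    using par CX X_multiproj by (intro parametrised_irreducible[of \<sigma>]) auto
  show "C \<noteq> X" using pt by blast
  show "C \<noteq> point_class amb_blocks q" for q by (rule not_point_class[OF pt(3-6)])
qed

lemma L_curve: "curve_on_X a b L"
proof -
  define \<sigma> :: "amb \<Rightarrow> (2, 'k) mpol" where
    "\<sigma> = case_sum (\<lambda>v. if v = 0 then 0 else if v = 1 then Var 0 else Var 1) (\<lambda>(k, l). Var l)"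
  have pull: "(\<lambda>v. ev x (\<sigma> v)) = pull a b (\<lambda>v. if v = 0 then 0 else if v = 1 then x 0 else x 1)" for x
  proof
    fix v
    show "ev x (\<sigma> v) = pull a b (\<lambda>v. if v = 0 then 0 else if v = 1 then x 0 else x 1) v"
    proof (cases v)
      case (Inr p)
      then show ?thesis using exhaust_2[of "snd p"] by (cases p) (auto simp: \<sigma>_def ev_lin)
    qed (simp add: \<sigma>_def)
  qed
  have good: "good a b z" if "z 0 = 0" "z 1 \<noteq> 0 \<or> z 2 \<noteq> 0" for z :: "3 \<Rightarrow> 'k"
  proof -
    have "\<exists>j. ev z (lf k j) \<noteq> 0" for k
      using that by (cases "z 1 = 0") (auto simp: ev_lin intro: exI[of _ 0] exI[of _ 1])
    then show ?thesis using that unfolding good_def by blast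
  qed
  have in_L: "(\<lambda>v. ev x (\<sigma> v)) \<in> L" if "x 0 \<noteq> 0 \<or> x 1 \<noteq> 0" for x
    unfolding L_iff pull using pull_blowup[OF good] that by simp
  show ?thesis
  proof (rule curveI[where S = "{Var (Inl 0)}" and \<sigma> = \<sigma> and p = "arc_point a b 0 (\<lambda>_. 1)"
        and r = "\<lambda>v. ev (\<lambda>l. if l = 0 then 0 else 1) (\<sigma> v)" and r' = "\<lambda>v. ev (\<lambda>l. if l = 0 then 1 else 0) (\<sigma> v)" and v = "Inl 1"])
    show "\<exists>e. mh e P" if "P \<in> {Var (Inl 0)}" for P :: "(amb, 'k) mpol" using that multihomogeneous_Var by blast
    show "L = {q \<in> X. \<forall>P\<in>{Var (Inl 0)}. ev q P = 0}" by (auto simp: L_iff)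
    show "(\<lambda>v. ev x (\<sigma> v)) \<in> L" if "x 0 \<noteq> 0 \<or> x 1 \<noteq> 0" for x by (rule in_L[OF that])
    fix q assume q: "q \<in> L"
    then have "good a b (q \<circ> Inl)" using L_E_disjoint good_off_E L_iff by blast
    then have "proj_equiv amb_blocks (pull a b (q \<circ> Inl)) q" using blowup_off_exc q L_iff by blast
    moreover have "(\<lambda>v. ev (\<lambda>l. if l = 0 then q (Inl 1) else q (Inl 2)) (\<sigma> v)) = pull a b (q \<circ> Inl)"
      unfolding pull by (rule arg_cong[where f = "pull a b"]) (use q exhaust_3 in \<open>auto simp: L_iff fun_eq_iff\<close>)
    ultimately show "\<exists>x. proj_equiv amb_blocks (\<lambda>v. ev x (\<sigma> v)) q" by metis
  next
    have "arc_point a b 0 (\<lambda>_. 1) \<in> E 0" by (rule arc_point_blowup[OF distinct]) simp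
    then show "arc_point a b 0 (\<lambda>_. 1) \<in> X" "arc_point a b 0 (\<lambda>_. 1) \<notin> L" using L_E_disjoint E_X by blast+
  qed (rule in_L | simp add: \<sigma>_def)+
qed

lemma vertex_X: "pull a b (unit_pt 2) \<in> X"
  by (rule pull_blowup[OF good_vertex])

lemma E_curve: "curve_on_X a b (E i)"
proof -
  define \<sigma> :: "amb \<Rightarrow> (2, 'k) mpol" where
    "\<sigma> = case_sum (\<lambda>v. Const (pt a b i v)) (\<lambda>(k, l). if k = i then Var l else Const (ev (pt a b i) (lf k l)))"
  have arc: "(\<lambda>v. ev x (\<sigma> v)) = arc_point a b i x" for x
  proof
    show "ev x (\<sigma> v) = arc_point a b i x v" for v
      by (cases v) (auto simp: \<sigma>_def arc_point_def split: prod.splits)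
  qed
  have in_E: "arc_point a b i x \<in> E i" if "x 0 \<noteq> 0 \<or> x 1 \<noteq> 0" for x
    by (rule arc_point_blowup[OF distinct that])
  show ?thesis
  proof (rule curveI[where S = "range (\<lambda>j. emb (lf i j))" and \<sigma> = \<sigma> and p = "pull a b (unit_pt 2)"
        and r = "arc_point a b i (\<lambda>l. if l = 0 then 0 else 1)" and r' = "arc_point a b i (\<lambda>l. if l = 0 then 1 else 0)" and v = "Inr (i, 0)"])
    show "\<exists>e. mh e P" if "P \<in> range (\<lambda>j. emb (lf i j))" for P using that emb_multihomogeneous[OF lin_forms] by blast
    show "E i = {q \<in> X. \<forall>P\<in>range (\<lambda>j. emb (lf i j)). ev q P = 0}"
    proof -
      have "(\<forall>j. ev (q \<circ> Inl) (lf i j) = 0) \<longleftrightarrow> ev (q \<circ> Inl) (lf i 0) = 0 \<and> ev (q \<circ> Inl) (lf i 1) = 0" for q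
        using exhaust_2 by metis
      moreover have "(\<forall>P\<in>range (\<lambda>j. emb (lf i j)). ev q P = 0) \<longleftrightarrow> (\<forall>j. ev (q \<circ> Inl) (lf i j) = 0)" for q by simp
      ultimately show ?thesis unfolding set_eq_iff mem_Collect_eq exc_iff by (simp only:) blast
    qed
    show "(\<lambda>v. ev x (\<sigma> v)) \<in> E i" if "x 0 \<noteq> 0 \<or> x 1 \<noteq> 0" for x unfolding arc by (rule in_E[OF that])
    show "\<exists>x. proj_equiv amb_blocks (\<lambda>v. ev x (\<sigma> v)) q" if "q \<in> E i" for q
      unfolding arc using exc_arc_point[OF distinct that] by blast
    show "pull a b (unit_pt 2) \<notin> E i" using E_coord_0[of "pull a b (unit_pt 2)" i] by (auto simp: unit_pt_def)
    show "pull a b (unit_pt 2) \<in> X" by (rule vertex_X)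
  qed (rule in_E | simp add: arc_point_def)+
qed

lemma M_curve: "curve_on_X a b (M i)"
proof -
  define \<sigma> :: "amb \<Rightarrow> (2, 'k) mpol" where
    "\<sigma> = case_sum (\<lambda>v. if v = 0 then Var 0 else if v = 1 then Const (a i) * Var 0 else Var 1)
      (\<lambda>(k, l). if k = i then (if l = 0 then 0 else 1) else if l = 0 then Const (a i - a k) * Var 0 else Var 1 - Const (b k) * Var 0)"
  define z where "z x = (\<lambda>v. ev x (\<sigma> v))" for x
  have zl: "z x (Inl 0) = x 0" "z x (Inl 1) = a i * x 0" "z x (Inl 2) = x 1" for x
    by (simp_all add: z_def \<sigma>_def)
  have zi: "z x (Inr (i, l)) = (if l = 0 then 0 else 1)" for x l by (simp add: z_def \<sigma>_def)
  have zk: "z x (Inr (k, l)) = ev (z x \<circ> Inl) (lf k l)" if "k \<noteq> i" for x k l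
    unfolding ev_lin comp_def zl using that by (simp add: z_def \<sigma>_def algebra_simps)
  have lin_nz: "\<exists>l. ev (q \<circ> Inl) (lf k l) \<noteq> 0"
    if "k \<noteq> i" "q (Inl 1) = a i * q (Inl 0)" "q (Inl 0) \<noteq> 0 \<or> q (Inl 2) \<noteq> 0" for k q
  proof (cases "q (Inl 0) = 0")
    case True
    then show ?thesis using that by (intro exI[of _ 1]) (simp add: ev_lin)
  next
    case False
    have "ev (q \<circ> Inl) (lf k 0) = (a i - a k) * q (Inl 0)" by (simp add: ev_lin that(2) algebra_simps)
    then show ?thesis using False a_neq[OF that(1)] by (intro exI[of _ 0]) simp
  qed
  have in_M: "z x \<in> M i" if x: "x 0 \<noteq> 0 \<or> x 1 \<noteq> 0" for x
  proof -
    have "\<exists>l. z x (Inr (k, l)) \<noteq> 0" for k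
    proof (cases "k = i")
      case True
      then show ?thesis using zi by (intro exI[of _ 1]) simp
    next
      case False
      have "\<exists>l. ev (z x \<circ> Inl) (lf k l) \<noteq> 0" using x by (intro lin_nz[OF False]) (simp_all add: zl)
      then show ?thesis unfolding zk[OF False] .
    qed
    moreover have "\<exists>v. z x (Inl v) \<noteq> 0" using x zl(1,3) by metis
    moreover have "z x (Inr (k, 0)) * ev (z x \<circ> Inl) (lf k 1) = z x (Inr (k, 1)) * ev (z x \<circ> Inl) (lf k 0)" for k
    proof (cases "k = i")
      case True
      then show ?thesis unfolding True ev_lin comp_def zl zi by simp
    next
      case False
      show ?thesis unfolding zk[OF False] by (rule mult.commute)
    qed
    ultimately show ?thesis unfolding M_iff blowup_iff multiproj_amb zi by simp
  qed
  show ?thesis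
  proof (rule curveI[where S = "{Var (Inr (i, 0))}" and \<sigma> = \<sigma> and p = "arc_point a b i (\<lambda>_. 1)"
        and r = "z (\<lambda>l. if l = 0 then 0 else 1)" and r' = "z (\<lambda>l. if l = 0 then 1 else 0)" and v = "Inl 0"])
    show "\<exists>e. mh e P" if "P \<in> {Var (Inr (i, 0))}" for P :: "(amb, 'k) mpol" using that multihomogeneous_Var by blast
    show "M i = {q \<in> X. \<forall>P\<in>{Var (Inr (i, 0))}. ev q P = 0}" by (auto simp: M_iff)
    show "(\<lambda>v. ev x (\<sigma> v)) \<in> M i" if "x 0 \<noteq> 0 \<or> x 1 \<noteq> 0" for x using in_M[OF that] unfolding z_def .
    show "arc_point a b i (\<lambda>_. 1) \<in> X" using E_X[OF arc_point_blowup[OF distinct]] by simp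
    show "arc_point a b i (\<lambda>_. 1) \<notin> M i" by (simp add: M_iff arc_point_def)
    show "z (\<lambda>l. if l = 0 then 0 else 1) \<in> M i" by (rule in_M) simp
    show "z (\<lambda>l. if l = 0 then 1 else 0) \<in> M i" by (rule in_M) simp
    show "z (\<lambda>l. if l = 0 then 0 else 1) (Inl 0) = 0" "z (\<lambda>l. if l = 0 then 1 else 0) (Inl 0) \<noteq> 0" by (simp_all add: zl)
    fix q assume q: "q \<in> M i"
    then have qX: "q \<in> X" and qi: "q (Inr (i, 0)) = 0" unfolding M_iff by auto
    have l1: "q (Inl 1) = a i * q (Inl 0)" by (rule M_line[OF q])
    have nz: "q (Inl 0) \<noteq> 0 \<or> q (Inl 2) \<noteq> 0" using X_coord(1)[OF qX] l1 exhaust_3 by (metis mult_zero_right)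
    define x where "x = (\<lambda>l::2. if l = 0 then q (Inl 0) else q (Inl 2))"
    have zq: "z x (Inl v) = q (Inl v)" for v using exhaust_3[of v] l1 by (auto simp: zl x_def)
    then have zq': "z x \<circ> Inl = q \<circ> Inl" by auto
    have "proj_equiv amb_blocks (z x) q" unfolding proj_equiv_amb
    proof (intro conjI allI)
      show "\<exists>c. c \<noteq> 0 \<and> (\<forall>v. q (Inl v) = c * z x (Inl v))" by (intro exI[of _ 1]) (simp add: zq)
      fix k
      show "\<exists>c. c \<noteq> 0 \<and> (\<forall>j. q (Inr (k, j)) = c * z x (Inr (k, j)))"
      proof (cases "k = i")
        case True
        have "q (Inr (i, 1)) \<noteq> 0" using qi X_coord(2)[OF qX, of i] exhaust_2 by metis
        moreover have "q (Inr (i, j)) = q (Inr (i, 1)) * z x (Inr (i, j))" for j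
          using exhaust_2[of j] qi by (auto simp: zi)
        ultimately show ?thesis unfolding True by blast
      next
        case False
        have "q (Inr (k, 0)) * ev (q \<circ> Inl) (lf k 1) = q (Inr (k, 1)) * ev (q \<circ> Inl) (lf k 0)"
          using qX unfolding blowup_iff by blast
        then show ?thesis unfolding zk[OF False] zq'
          by (rule proportional_pair[OF _ X_coord(2)[OF qX] lin_nz[OF False l1 nz]])
      qed
    qed
    then show "\<exists>x. proj_equiv amb_blocks (\<lambda>v. ev x (\<sigma> v)) q" unfolding z_def by blast
  qed
qed

section \<open>Intersection numbers\<close>

lemma point_E_M: "chart_point i 1 0 0 \<in> E i \<inter> M i"
  using chart_point_E chart_point_M by blast

lemma vertex_L_M: "pull a b (unit_pt 2) \<in> L \<inter> M i"
  using vertex_X by (simp add: L_iff M_iff ev_lin unit_pt_def)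

lemma curves_distinct: "L \<noteq> M i" "L \<noteq> E i" "M i \<noteq> E i"
  using point_E_M[of i] vertex_L_M[of i] L_E_disjoint[of i] by blast+

text \<open>The line joining p_i to (0 : 0 : 1) pulls back to its strict transform plus the
  exceptional curve; the function is the quotient of x_0 by its equation.\<close>

lemma lin_equiv_line: "lin_equiv a b (prime_divisor L) (prime_divisor (M i) + prime_divisor (E i))"
  unfolding lin_equiv_def
proof (intro exI conjI)
  let ?g = "Fract (Var 0) (lf i 0) :: (3, 'k) mpol fract"
  show "?g \<noteq> 0" by (simp add: Zero_fract_def eq_fract lin_nonzero)
  let ?D = "prime_divisor L - (prime_divisor (M i) + prime_divisor (E i)) :: 'k divisor"
  have lk: "Poly_Mapping.lookup ?D C = (if C = L then 1 else if C = M i then -1 else if C = E i then -1 else 0)" for C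
    using curves_distinct[of i] by (auto simp: lookup_minus lookup_add lookup_single when_def)
  have keys: "Poly_Mapping.keys ?D = {L, M i, E i}"
    by (auto simp: in_keys_iff lk split: if_splits)
  have Vf: "Var v \<in> forms 1" for v :: 3 by (simp add: forms_iff)
  have reduce: "\<exists>f u. (\<forall>C\<in>Poly_Mapping.keys ?D. local_equation a b C q (f C)) \<and>
      u \<noteq> 0 \<and> u \<in> loc q \<and> inverse u \<in> loc q \<and> ?g = u * (\<Prod>C\<in>Poly_Mapping.keys ?D. f C powi Poly_Mapping.lookup ?D C)"
    if f: "local_equation a b L q f1" "local_equation a b (M i) q f2" "local_equation a b (E i) q f3"
      and u: "unit_at q u" "?g = u * (f1 * inverse f2 * inverse f3)" for q f1 f2 f3 u
  proof (intro exI conjI)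
    let ?f = "\<lambda>C. if C = L then f1 else if C = M i then f2 else f3"
    show "\<forall>C\<in>Poly_Mapping.keys ?D. local_equation a b C q (?f C)" unfolding keys using f by auto
    show "u \<noteq> 0" "u \<in> loc q" "inverse u \<in> loc q" using u(1) unfolding unit_at_def by auto
    show "?g = u * (\<Prod>C\<in>Poly_Mapping.keys ?D. ?f C powi Poly_Mapping.lookup ?D C)"
      unfolding keys u(2) lk using curves_distinct[of i] by (simp add: mult.assoc)
  qed
  show "is_divisor_of a b ?D ?g"
    unfolding is_divisor_of_def
  proof
    fix q assume q: "q \<in> X"
    show "\<exists>f u. (\<forall>C\<in>Poly_Mapping.keys ?D. local_equation a b C q (f C)) \<and>
      u \<noteq> 0 \<and> u \<in> loc q \<and> inverse u \<in> loc q \<and> ?g = u * (\<Prod>C\<in>Poly_Mapping.keys ?D. f C powi Poly_Mapping.lookup ?D C)"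
    proof (cases "\<exists>k. q \<in> E k")
      case False
      then have gd: "good a b (q \<circ> Inl)" using good_off_E[OF q] by blast
      obtain m where m: "m \<in> forms 1" "ev (q \<circ> Inl) m \<noteq> 0" using good_form[OF q] by blast
      have "m \<noteq> 0" using m(2) by auto
      then have "?g = 1 * (Fract (Var 0) m * inverse (Fract (lf i 0) m) * inverse 1)"
        using lin_nonzero[of i 0] by (simp add: eq_fract)
      then show ?thesis
        using reduce[OF L_local_good[OF q gd m] M_local_good[OF q gd m] E_local_off[OF q] unit_1] False by blast
    next
      case True
      then obtain k where k: "q \<in> E k" by blast
      have qL: "q \<notin> L" using L_E_disjoint k by blast
      show ?thesis
      proof (cases "k = i")
        case False
        have "unit_at q ?g"
        proof (rule unit_good[OF Vf lin_forms])
          have "ev (q \<circ> Inl) (lf i 0) = (a k - a i) * q (Inl 0)" by (simp add: ev_lin E_coord[OF k] algebra_simps)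
          then show "ev (q \<circ> Inl) (lf i 0) \<noteq> 0" using a_neq[OF False] E_coord_0[OF k] by simp
        qed (use E_coord_0[OF k] in simp)
        moreover have "q \<notin> M i" "q \<notin> E i" using M_E_disjoint[of i k] E_E_disjoint[of i k] k False by blast+
        ultimately show ?thesis
          using reduce[OF L_local_off[OF q qL] M_local_off[OF q] E_local_off[OF q]] by simp
      next
        case True
        then have qE: "q \<in> E i" using k by simp
        show ?thesis
        proof (cases "q \<in> M i")
          case False
          then have "chart_at i 0 q" using qE q unfolding chart_at_def M_iff by simp
          moreover have "?g = 1 * (1 * inverse 1 * inverse (Fract (lf i 0) (Var 0)))" by simp
          ultimately show ?thesis
            using reduce[OF L_local_off[OF q qL] M_local_off[OF q False] E_local unit_1] by blast
        next
          case True
          \<comment> \<open>Where the two curves cross, the equation of the line factors into the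
            local coordinates, l_0 / x_0 = w u.\<close>
          have "?g = 1 * (1 * inverse (Fract (lf i 0) (lf i 1)) * inverse (Fract (lf i 1) (Var 0)))"
            using lin_nonzero[of i 0] lin_nonzero[of i 1] by (simp add: eq_fract)
          then show ?thesis
            using reduce[OF L_local_off[OF q qL] M_local(2)[OF qE True] E_local[OF M_local(1)[OF qE True]] unit_1] by blast
        qed
      qed
    qed
  qed
qed

lemma transversal_disjoint: "C \<inter> D = {} \<Longrightarrow> transversal a b C D"
  by (simp add: transversal_def)

lemma transversalI:
  assumes "\<And>q. q \<in> C \<inter> D \<Longrightarrow> q \<in> X"
    and "\<And>q e G H. q \<in> C \<inter> D \<Longrightarrow> mh e G \<Longrightarrow> mh e H \<Longrightarrow> ev q H \<noteq> 0 \<Longrightarrow> ev q G = 0 \<Longrightarrow>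
      \<exists>f g. f \<in> ideal_stalk a b C q \<and> g \<in> ideal_stalk a b D q \<and> Fract (gp G) (gp H) = f + g"
  shows "transversal a b C D"
  unfolding transversal_def
proof (intro ballI equalityI subsetI)
  fix q s assume q: "q \<in> C \<inter> D"
  {
    assume "s \<in> {f + g |f g. f \<in> ideal_stalk a b C q \<and> g \<in> ideal_stalk a b D q}"
    then obtain f g where s: "s = f + g" and f: "f \<in> ideal_stalk a b C q" and g: "g \<in> ideal_stalk a b D q" by blast
    have "{q} \<subseteq> C" "{q} \<subseteq> D" using q by auto
    then show "s \<in> ideal_stalk a b {q} q" unfolding s
      using subsetD[OF stalk_antimono f] subsetD[OF stalk_antimono g] by (intro stalk_add[OF assms(1)[OF q]])
  next
    assume "s \<in> ideal_stalk a b {q} q"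
    then obtain e G H where "s = Fract (gp G) (gp H)" "mh e G" "mh e H" "ev q H \<noteq> 0" "ev q G = 0"
      unfolding ideal_stalk_def by blast
    then show "s \<in> {f + g |f g. f \<in> ideal_stalk a b C q \<and> g \<in> ideal_stalk a b D q}"
      using assms(2)[OF q] by blast
  }
qed

lemma local_equation_stalk: "local_equation a b C q f \<Longrightarrow> h \<in> loc q \<Longrightarrow> f * h \<in> ideal_stalk a b C q"
  unfolding local_equation_def by blast

text \<open>The curves cross over (0 : 0 : 1), where a form that vanishes is a combination of x_0
  and x_1.\<close>

lemma transversal_L_M: "transversal a b L (M i)"
proof (rule transversalI)
  show "q \<in> X" if "q \<in> L \<inter> M i" for q using that L_X by blast
  fix q e G H assume q: "q \<in> L \<inter> M i" and G: "mh e G" "mh e H" "ev q H \<noteq> 0" "ev q G = 0"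
  have qX: "q \<in> X" and gd: "good a b (q \<circ> Inl)" using q L_X L_E_disjoint good_off_E by blast+
  have x: "q (Inl 0) = 0" "q (Inl 1) = 0" using q M_line[of q i] by (auto simp: L_iff)
  then have x2: "q (Inl 2) \<noteq> 0" using X_coord(1)[OF qX] exhaust_3 by metis
  let ?k = "sum e amb_blocks"
  have V: "Var v \<in> forms 1" for v :: 3 by (simp add: forms_iff)
  have "(q \<circ> Inl) = (\<lambda>v. q (Inl 2) * unit_pt 2 v)"
  proof
    show "(q \<circ> Inl) v = q (Inl 2) * unit_pt 2 v" for v using exhaust_3[of v] x by (auto simp: unit_pt_def)
  qed
  then have "ev (q \<circ> Inl) (gp G) = q (Inl 2) ^ ?k * ev (unit_pt 2) (gp G)"
    using ev_homg_scale[of ?k "gp G" "q (Inl 2)" "unit_pt 2"] gp_forms[OF G(1)] by (simp add: forms_iff)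
  then have "ev (unit_pt 2) (gp G) = 0" using ev_off_exc[OF qX gd G(1)] G(4) x2 by simp
  then obtain A B where AB: "gp G = Var 0 * A + Var 1 * B" "Var 2 * A \<in> forms ?k" "Var 2 * B \<in> forms ?k"
    using vertex_split[OF gp_forms[OF G(1)] _ V] by blast
  have h0: "ev (q \<circ> Inl) (gp H) \<noteq> 0" using ev_off_exc[OF qX gd G(2)] G(3) by blast
  have H0: "gp H \<noteq> 0" using h0 by auto
  \<comment> \<open>On substituting x_1 = l_0 + a_i x_0 the combination of x_0 and x_1 becomes one
    of x_0 and l_0.\<close>
  let ?A = "A + Const (a i) * B"
  have m: "ev (q \<circ> Inl) (Var 2) \<noteq> 0" using x2 by simp
  have "Var 2 * ?A = Var 2 * A + Const (a i) * (Var 2 * B)" by (simp only: distrib_left mult.left_commute)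
  then have "Var 2 * ?A \<in> forms ?k" using AB(2,3) by (auto simp: forms_iff intro!: homg_add homg_Const_mult)
  then have 1: "Fract (Var 0) (Var 2) * Fract (Var 2 * ?A) (gp H) \<in> ideal_stalk a b L q"
    by (intro local_equation_stalk[OF L_local_good[OF qX gd V m]] local_ring_good[OF _ gp_forms[OF G(2)] h0])
  have 2: "Fract (lf i 0) (Var 2) * Fract (Var 2 * B) (gp H) \<in> ideal_stalk a b (M i) q"
    by (intro local_equation_stalk[OF M_local_good[OF qX gd V m]] local_ring_good[OF AB(3) gp_forms[OF G(2)] h0])
  have "Var 0 * ?A + lf i 0 * B = gp G" unfolding AB(1) lin_def by (simp add: algebra_simps)
  moreover have c: "Fract l (Var 2) * Fract (Var 2 * C) (gp H) = Fract (l * C) (gp H)" for l C :: "(3, 'k) mpol"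
    using H0 by (simp add: eq_fract)
  moreover have "Fract (Var 0 * ?A) (gp H) + Fract (lf i 0 * B) (gp H) = Fract (Var 0 * ?A + lf i 0 * B) (gp H)"
    using H0 by (simp add: eq_fract algebra_simps)
  ultimately have "Fract (gp G) (gp H) = Fract (Var 0) (Var 2) * Fract (Var 2 * ?A) (gp H) + Fract (lf i 0) (Var 2) * Fract (Var 2 * B) (gp H)"
    unfolding c by simp
  then show "\<exists>f g. f \<in> ideal_stalk a b L q \<and> g \<in> ideal_stalk a b (M i) q \<and> Fract (gp G) (gp H) = f + g" using 1 2 by blast
qed

text \<open>At the common point the two local equations are the chart coordinates u and w, and a
  polynomial in them without constant term is a combination of both.\<close>

lemma transversal_E_M: "transversal a b (E i) (M i)"
proof (rule transversalI)
  show "q \<in> X" if "q \<in> E i \<inter> M i" for q using that E_X by blast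
  fix q e G H assume q: "q \<in> E i \<inter> M i" and G: "mh e G" "mh e H" "ev q H \<noteq> 0" "ev q G = 0"
  have c: "chart_at i 1 q" and Mq: "local_equation a b (M i) q (Fract (lf i 0) (lf i 1))"
    using M_local[of q i] q by blast+
  have o: "other 1 = 0" by (simp add: other_def)
  have q0: "q (Inr (i, 0)) = 0" using q M_iff by blast
  let ?G = "substitute (chart i 1) G"
  obtain v where v: "unit_at q v" "Fract (gp G) (gp H) = chart_fract i 1 ?G * v"
    using chart_local[OF c G(1-3)] by blast
  have "ev (chart_point i 1 0 0) G = 0"
    using ev_proj_equiv[OF chart_point_equiv[OF c] G(1)] G(4) q0 by (auto simp: o)
  then have 0: "ev (\<lambda>_. 0) ?G = 0" using ev_chart[of 0 0 i 1 G] by simp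
  obtain A where A: "?G = Var 0 * A + drop_var 0 ?G" using drop_var_split by blast
  have "\<exists>B. drop_var 0 ?G = Var 1 * B"
  proof (rule Var_factor[where y = "\<lambda>_. 0" and N = 1])
    fix x :: "2 \<Rightarrow> 'k" assume "x 1 = 0"
    then have "x(0 := 0) = (\<lambda>_. 0)" using exhaust_2 by (metis fun_upd_apply)
    then show "ev x (drop_var 0 ?G) = 0" using 0 by (simp add: ev_drop_var)
  qed simp_all
  then obtain B where "drop_var 0 ?G = Var 1 * B" by blast
  then have AB: "?G = Var 0 * A + Var 1 * B" using A by simp
  have "Fract (gp G) (gp H) = Fract (lf i 1) (Var 0) * (chart_fract i 1 A * v) + Fract (lf i 0) (lf i 1) * (chart_fract i 1 B * v)"
    unfolding v(2) AB rhom_add[OF rhom_chart_fract] rhom_mult[OF rhom_chart_fract] chart_fract_Var o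
    by (simp only: distrib_right mult.assoc)
  moreover have "chart_fract i 1 R * v \<in> loc q" for R using chart_fract_loc[OF c] v(1) O_mult unfolding unit_at_def by blast
  ultimately show "\<exists>f g. f \<in> ideal_stalk a b (E i) q \<and> g \<in> ideal_stalk a b (M i) q \<and> Fract (gp G) (gp H) = f + g"
    using local_equation_stalk[OF E_local[OF c]] local_equation_stalk[OF Mq] by blast
qed

lemma one_point:
  assumes "p \<in> C" "\<And>q. q \<in> C \<Longrightarrow> proj_equiv amb_blocks p q"
  shows "card (point_class amb_blocks ` C) = 1"
proof -
  have "point_class amb_blocks ` C = {point_class amb_blocks p}"
    using assms point_class_eq by blast
  then show ?thesis by simp
qed

lemma card_L_M: "card (point_class amb_blocks ` (L \<inter> M i)) = 1"
proof (rule one_point[OF vertex_L_M])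
  fix q assume q: "q \<in> L \<inter> M i"
  have qX: "q \<in> X" and gd: "good a b (q \<circ> Inl)" using q L_X L_E_disjoint good_off_E by blast+
  have x: "q (Inl 0) = 0" "q (Inl 1) = 0" using q M_line[of q i] by (auto simp: L_iff)
  then have x2: "q (Inl 2) \<noteq> 0" using X_coord(1)[OF qX] exhaust_3 by metis
  have "proj_equiv amb_blocks (pull a b (unit_pt 2)) (pull a b (q \<circ> Inl))"
    unfolding proj_equiv_amb
  proof (intro conjI allI exI[of _ "q (Inl 2)"])
    show "pull a b (q \<circ> Inl) (Inl v) = q (Inl 2) * pull a b (unit_pt 2) (Inl v)" for v
      using exhaust_3[of v] x by (auto simp: unit_pt_def)
    show "pull a b (q \<circ> Inl) (Inr (k, j)) = q (Inl 2) * pull a b (unit_pt 2) (Inr (k, j))" for k j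
      using x by (simp add: unit_pt_def ev_lin)
  qed (rule x2)+
  then show "proj_equiv amb_blocks (pull a b (unit_pt 2)) q"
    using blowup_off_exc[OF qX gd] by (rule proj_equiv_trans)
qed

lemma card_E_M: "card (point_class amb_blocks ` (E i \<inter> M i)) = 1"
proof (rule one_point[OF point_E_M])
  fix q assume q: "q \<in> E i \<inter> M i"
  then have "proj_equiv amb_blocks (chart_point i 1 0 (q (Inr (i, other 1)) / q (Inr (i, 1)))) q"
    using chart_point_equiv M_local(1) by blast
  then show "proj_equiv amb_blocks (chart_point i 1 0 0) q" using q by (simp add: M_iff other_def)
qed

end

section \<open>The pairing on the span of L and the exceptional curves\<close>

context blowup_points
begin

lemma divisors_iff: "D \<in> divisors a b \<longleftrightarrow> (\<forall>C. Poly_Mapping.lookup D C \<noteq> 0 \<longrightarrow> curve_on_X a b C)"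
  by (simp add: divisors_def in_keys_iff Ball_def)

lemma divisors_single: "curve_on_X a b C \<Longrightarrow> Poly_Mapping.single C n \<in> divisors a b"
  by (simp add: divisors_iff lookup_single when_def)

lemma divisors_add: "D \<in> divisors a b \<Longrightarrow> D' \<in> divisors a b \<Longrightarrow> D + D' \<in> divisors a b"
  unfolding divisors_iff lookup_add by (metis add_0)

lemma divisors_diff: "D \<in> divisors a b \<Longrightarrow> D' \<in> divisors a b \<Longrightarrow> D - D' \<in> divisors a b"
  unfolding divisors_iff lookup_minus by (metis diff_0_right)

lemma divisors_sum: "(\<And>i. i \<in> A \<Longrightarrow> f i \<in> divisors a b) \<Longrightarrow> sum f A \<in> divisors a b"
  by (induction A rule: infinite_finite_induct) (simp_all add: divisors_add, simp_all add: divisors_iff)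

definition class_div :: "int \<Rightarrow> (9 \<Rightarrow> int) \<Rightarrow> 'k divisor" where
  "class_div d m = Poly_Mapping.single L d - (\<Sum>i\<in>UNIV. Poly_Mapping.single (E i) (m i))"

lemma class_div_divisors: "class_div d m \<in> divisors a b"
  unfolding class_div_def by (intro divisors_diff divisors_sum divisors_single L_curve E_curve)

context
  fixes I
  assumes I: "intersection_pairing a b I"
begin

lemma I_sym: "D \<in> divisors a b \<Longrightarrow> D' \<in> divisors a b \<Longrightarrow> I D D' = I D' D"
  and I_add: "D \<in> divisors a b \<Longrightarrow> D' \<in> divisors a b \<Longrightarrow> F \<in> divisors a b \<Longrightarrow> I (D + D') F = I D F + I D' F"
  and I_equiv: "D \<in> divisors a b \<Longrightarrow> D' \<in> divisors a b \<Longrightarrow> F \<in> divisors a b \<Longrightarrow> lin_equiv a b D D' \<Longrightarrow> I D F = I D' F"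
  and I_transversal: "curve_on_X a b C \<Longrightarrow> curve_on_X a b C' \<Longrightarrow> transversal a b C C' \<Longrightarrow>
    I (prime_divisor C) (prime_divisor C') = int (card (point_class amb_blocks ` (C \<inter> C')))"
  using I unfolding intersection_pairing_def by blast+

lemma I_disjoint: "curve_on_X a b C \<Longrightarrow> curve_on_X a b C' \<Longrightarrow> C \<inter> C' = {} \<Longrightarrow> I (prime_divisor C) (prime_divisor C') = 0"
  using I_transversal transversal_disjoint by simp

lemma I_0: "F \<in> divisors a b \<Longrightarrow> I 0 F = 0"
  using I_add[of 0 0 F] by (simp add: divisors_iff)

lemma I_diff: "D \<in> divisors a b \<Longrightarrow> D' \<in> divisors a b \<Longrightarrow> F \<in> divisors a b \<Longrightarrow> I (D - D') F = I D F - I D' F"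
  using I_add[of "D - D'" D' F] divisors_diff[of D D'] by simp

lemma I_single:
  assumes C: "curve_on_X a b C" and F: "F \<in> divisors a b"
  shows "I (Poly_Mapping.single C n) F = n * I (prime_divisor C) F"
proof (induction n rule: int_induct[where k = 0])
  case base
  show ?case by (simp add: I_0 F)
next
  case (step1 n)
  have "I (Poly_Mapping.single C (n + 1)) F = I (Poly_Mapping.single C n) F + I (prime_divisor C) F"
    unfolding single_add by (intro I_add divisors_single C F)
  then show ?case using step1.IH by (simp add: algebra_simps)
next
  case (step2 n)
  have "I (Poly_Mapping.single C (n - 1)) F = I (Poly_Mapping.single C n) F - I (prime_divisor C) F"
    unfolding single_diff by (intro I_diff divisors_single C F)
  then show ?case using step2.IH by (simp add: algebra_simps)
qed

lemma I_sum:
  assumes "finite A" "\<And>i. i \<in> A \<Longrightarrow> f i \<in> divisors a b" "F \<in> divisors a b"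
  shows "I (sum f A) F = (\<Sum>i\<in>A. I (f i) F)"
  using assms by (induction A rule: finite_induct) (simp_all add: I_0 I_add divisors_sum)

lemma I_L_E: "I (prime_divisor L) (prime_divisor (E i)) = 0"
  by (rule I_disjoint[OF L_curve E_curve L_E_disjoint])

lemma I_line:
  assumes "F \<in> divisors a b"
  shows "I (prime_divisor L) F = I (prime_divisor (M i)) F + I (prime_divisor (E i)) F"
  using I_equiv[OF _ _ assms lin_equiv_line] assms
  by (simp add: I_add divisors_add divisors_single L_curve M_curve E_curve)

text \<open>One copy of L is moved to M_0 + E_0, which leaves the transversal intersection with M_0;
  the choice of the point is arbitrary.\<close>

lemma I_L_L: "I (prime_divisor L) (prime_divisor L) = 1"
proof -
  have "I (prime_divisor L) (prime_divisor L) = I (prime_divisor (M 0)) (prime_divisor L) + I (prime_divisor (E 0)) (prime_divisor L)"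
    by (rule I_line[OF divisors_single[OF L_curve]])
  also have "I (prime_divisor (M 0)) (prime_divisor L) = I (prime_divisor L) (prime_divisor (M 0))"
    by (rule I_sym; intro divisors_single L_curve M_curve)
  also have "I (prime_divisor (E 0)) (prime_divisor L) = I (prime_divisor L) (prime_divisor (E 0))"
    by (rule I_sym; intro divisors_single L_curve E_curve)
  finally show ?thesis unfolding I_L_E I_transversal[OF L_curve M_curve transversal_L_M] card_L_M by simp
qed

text \<open>0 = L.E_i = M_i.E_i + E_i^2, and M_i meets E_i transversally in one point.\<close>

lemma I_E_E: "I (prime_divisor (E i)) (prime_divisor (E k)) = (if i = k then -1 else 0)"
proof (cases "i = k")
  case True
  have "0 = I (prime_divisor (M i)) (prime_divisor (E i)) + I (prime_divisor (E i)) (prime_divisor (E i))"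
    using I_line[of "prime_divisor (E i)" i, OF divisors_single[OF E_curve]] unfolding I_L_E .
  moreover have "I (prime_divisor (M i)) (prime_divisor (E i)) = I (prime_divisor (E i)) (prime_divisor (M i))"
    by (rule I_sym; intro divisors_single M_curve E_curve)
  moreover have "\<dots> = 1" unfolding I_transversal[OF E_curve M_curve transversal_E_M] card_E_M by simp
  ultimately show ?thesis using True by simp
next
  case False
  then show ?thesis using I_disjoint[OF E_curve E_curve E_E_disjoint] by simp
qed

lemma I_class:
  assumes "F \<in> divisors a b"
  shows "I (class_div d m) F = d * I (prime_divisor L) F - (\<Sum>i\<in>UNIV. m i * I (prime_divisor (E i)) F)"
proof -
  have "I (class_div d m) F = I (Poly_Mapping.single L d) F - I (\<Sum>i\<in>UNIV. Poly_Mapping.single (E i) (m i)) F"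
    unfolding class_div_def by (intro I_diff divisors_sum divisors_single L_curve E_curve assms)
  also have "I (\<Sum>i\<in>UNIV. Poly_Mapping.single (E i) (m i)) F = (\<Sum>i\<in>UNIV. I (Poly_Mapping.single (E i) (m i)) F)"
    by (rule I_sum) (simp_all add: divisors_single E_curve assms)
  also have "\<dots> = (\<Sum>i\<in>UNIV. m i * I (prime_divisor (E i)) F)"
    by (intro sum.cong refl I_single[OF E_curve assms])
  also have "I (Poly_Mapping.single L d) F = d * I (prime_divisor L) F" by (rule I_single[OF L_curve assms])
  finally show ?thesis .
qed

lemma I_class_L: "I (class_div d m) (prime_divisor L) = d"
proof -
  have "I (prime_divisor (E i)) (prime_divisor L) = 0" for i
    using I_sym[of "prime_divisor L" "prime_divisor (E i)"] I_L_E by (simp add: divisors_single L_curve E_curve)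
  then show ?thesis by (simp add: I_class divisors_single L_curve I_L_L)
qed

lemma I_class_E: "I (class_div d m) (prime_divisor (E k)) = m k"
proof -
  have "(\<Sum>i\<in>UNIV. m i * (if i = k then -1 else 0)) = (\<Sum>i\<in>UNIV. if i = k then - m i else 0)"
    by (rule sum.cong) auto
  then show ?thesis by (simp add: I_class divisors_single E_curve I_L_E I_E_E)
qed

lemma I_class_class: "I (class_div d m) (class_div d m) = d\<^sup>2 - (\<Sum>i\<in>UNIV. (m i)\<^sup>2)"
proof -
  have "I (prime_divisor L) (class_div d m) = d"
    using I_sym[of "prime_divisor L" "class_div d m"] I_class_L by (simp add: divisors_single L_curve class_div_divisors)
  moreover have "I (prime_divisor (E k)) (class_div d m) = m k" for k
    using I_sym[of "prime_divisor (E k)" "class_div d m"] I_class_E by (simp add: divisors_single E_curve class_div_divisors)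
  ultimately show ?thesis unfolding I_class[OF class_div_divisors] by (simp add: power2_eq_square)
qed

text \<open>Both arguments of C^2 are replaced by the class. C differs from L because L^2 = 1, and
  it is not inside some E_i because it would then be disjoint from L, although its degree d is
  nonzero.\<close>

lemma exceptional_numbers:
  assumes C: "curve_on_X a b C" "lin_equiv a b (prime_divisor C) (class_div d m)" "I (prime_divisor C) (prime_divisor C) = -1"
    and d: "d \<noteq> 0"
  shows "d\<^sup>2 - (\<Sum>i\<in>UNIV. (m i)\<^sup>2) = -1" "C \<noteq> L" "\<not> C \<subseteq> E i"
proof -
  have Cd: "prime_divisor C \<in> divisors a b" by (rule divisors_single[OF C(1)])
  have eq: "I (prime_divisor C) F = I (class_div d m) F" if "F \<in> divisors a b" for F
    by (rule I_equiv[OF Cd class_div_divisors that C(2)])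
  have "I (prime_divisor C) (prime_divisor C) = I (prime_divisor C) (class_div d m)"
    unfolding eq[OF Cd] by (rule I_sym[OF class_div_divisors Cd])
  then show "d\<^sup>2 - (\<Sum>i\<in>UNIV. (m i)\<^sup>2) = -1" using C(3) eq[OF class_div_divisors] I_class_class by simp
  show "C \<noteq> L" using C(3) I_L_L by auto
  show "\<not> C \<subseteq> E i"
  proof
    assume "C \<subseteq> E i"
    then have "C \<inter> L = {}" using L_E_disjoint by blast
    then have "I (prime_divisor C) (prime_divisor L) = 0" by (rule I_disjoint[OF C(1) L_curve])
    then show False using eq[OF divisors_single[OF L_curve]] I_class_L d by simp
  qed
qed

end

end

section \<open>The equation of the image of a curve\<close>

lemma Fract_power: "Fract A B ^ n = Fract (A ^ n) (B ^ n)"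
  by (induction n) (simp_all add: One_fract_def)

lemma forms_power: "P \<in> forms 1 \<Longrightarrow> P ^ n \<in> forms n"
  using homg_power[of UNIV 1 P n] by (simp add: forms_iff)

lemma X_power_dvd_mult:
  fixes p h :: "'k::field poly"
  assumes "[:0, 1:] ^ n dvd p * h" "poly h 0 \<noteq> 0"
  shows "[:0, 1:] ^ n dvd p"
proof (cases "p = 0")
  case False
  have "h \<noteq> 0" using assms(2) by auto
  then have ph: "p * h \<noteq> 0" using False by simp
  have "n \<le> order 0 (p * h)" using assms(1) ph order_divides[of 0 n "p * h"] by simp
  then have "n \<le> order 0 p" using order_mult[OF ph] order_0I[OF assms(2)] by simp
  then show ?thesis using order_divides[of 0 n p] by simp
qed simp

text \<open>Along the arc the translated coordinates x_1, x_2 become multiples of the parameter, so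
  the powers of the parameter sort the monomials by their order at p_i.\<close>

lemma coeff_along:
  "coeff (along a b i y P) r = ev (\<lambda>v. if v = 0 then 1 else if v = 1 then y 0 else y 1) (part {1, 2} r (shift (a i) (b i) P))"
proof -
  let ?Q = "shift (a i) (b i) P" and ?w = "\<lambda>v::3. if v = 0 then 1 else if v = 1 then y 0 else y 1"
  let ?s = "\<lambda>v::3. if v = 0 then 1 else if v = 1 then [:0, y 0:] else [:0, y 1:]"
  have "along a b i y P = evh (\<lambda>c. [:c:]) ?s ?Q"
  proof (rule rhom_eqI[of "along a b i y" "\<lambda>P. evh (\<lambda>c. [:c:]) ?s (shift (a i) (b i) P)"])
    show "rhom (\<lambda>P. evh (\<lambda>c. [:c:]) ?s (shift (a i) (b i) P))"
      by (rule rhom_comp[OF rhom_evh[OF rhom_const_poly] rhom_shift])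
    show "along a b i y (Var v) = evh (\<lambda>c. [:c:]) ?s (shift (a i) (b i) (Var v))" for v
      using exhaust_3[of v] by (auto simp: evh_Var evh_Const evh_add evh_mult rhom_const_poly)
  qed (simp_all add: rhom_along evh_Const rhom_const_poly)
  also have "\<dots> = (\<Sum>m\<in>Poly_Mapping.keys ?Q. monom (Poly_Mapping.lookup ?Q m * (\<Prod>v\<in>UNIV. ?w v ^ Poly_Mapping.lookup m v)) (wt {1, 2} m))"
    unfolding evh_def
  proof (rule sum.cong[OF refl])
    fix m
    have X: "[:0, c:] = monom c 1" for c :: 'a by (simp add: monom_Suc monom_0)
    show "[:Poly_Mapping.lookup ?Q m:] * (\<Prod>v\<in>UNIV. ?s v ^ Poly_Mapping.lookup m v)
      = monom (Poly_Mapping.lookup ?Q m * (\<Prod>v\<in>UNIV. ?w v ^ Poly_Mapping.lookup m v)) (wt {1, 2} m)"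
      unfolding prod_3 by (simp add: X monom_power mult_monom smult_monom wt_def)
  qed
  also have "coeff \<dots> r = (\<Sum>m\<in>Poly_Mapping.keys ?Q. if wt {1, 2} m = r then Poly_Mapping.lookup ?Q m * (\<Prod>v\<in>UNIV. ?w v ^ Poly_Mapping.lookup m v) else 0)"
    by (simp add: coeff_sum)
  also have "\<dots> = ev ?w (part {1, 2} r ?Q)"
    by (simp add: part_def sum.inter_filter[symmetric] ev_eq_evh evh_sum[OF rhom_id] evh_single[OF rhom_id])
  finally show ?thesis .
qed

text \<open>Directions with y_0 \<noteq> 0 are dense, so a part of order below \<open>n\<close> that
  vanishes for all of them is zero.\<close>

lemma ordge_along:
  fixes P :: "(3, 'k::alg_closed_field) mpol"
  assumes P: "P \<in> forms k" and y: "\<And>y. y 0 \<noteq> 0 \<Longrightarrow> [:0, 1:] ^ n dvd along a b i y P"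
  shows "ordge (a i) (b i) n P"
  unfolding ordge_def wtge_def
proof
  let ?Q = "shift (a i) (b i) P"
  fix m assume m: "m \<in> Poly_Mapping.keys ?Q"
  show "n \<le> wt {1, 2} m"
  proof (rule ccontr)
    define r where "r = wt {1, 2} m"
    assume "\<not> n \<le> wt {1, 2} m"
    then have r: "r < n" by (simp add: r_def)
    have hom: "homg UNIV k (part {1, 2} r ?Q)"
      using P by (intro homg_part_part homg_shift) (simp add: forms_iff)
    have "ev x (Var 0 * Var 1 * part {1, 2} r ?Q) = 0" for x
    proof (cases "x 0 = 0 \<or> x 1 = 0")
      case False
      define y where "y = (\<lambda>l::2. if l = 0 then x 1 / x 0 else x 2 / x 0)"
      have "x = (\<lambda>v. x 0 * (if v = 0 then 1 else if v = 1 then y 0 else y 1))"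
      proof
        show "x v = x 0 * (if v = 0 then 1 else if v = 1 then y 0 else y 1)" for v
          using exhaust_3[of v] False by (auto simp: y_def)
      qed
      then have "ev x (part {1, 2} r ?Q) = x 0 ^ k * coeff (along a b i y P) r"
        unfolding coeff_along using ev_homg_scale[OF hom, of "x 0" "\<lambda>v. if v = 0 then 1 else if v = 1 then y 0 else y 1"] by simp
      moreover have "monom 1 n dvd along a b i y P" using y[of y] False by (simp add: y_def monom_altdef)
      ultimately show ?thesis using r unfolding monom_1_dvd_iff' by simp
    qed auto
    then have "Var 0 * Var 1 * part {1, 2} r ?Q = 0" by (rule ev_eq_zero_imp)
    then have "part {1, 2} r ?Q = 0" by simp
    then have "Poly_Mapping.lookup (part {1, 2} r ?Q) m = 0" by simp
    then show False using m by (simp add: lookup_part r_def in_keys_iff)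
  qed
qed

context blowup_points
begin

lemma unit_prod: "(\<And>i. i \<in> A \<Longrightarrow> unit_at q (f i)) \<Longrightarrow> unit_at q (prod f A)"
  by (induction A rule: infinite_finite_induct) (simp_all add: unit_1 unit_mult)

lemma local_equation_unit:
  assumes "local_equation a b C q f" "unit_at q h"
  shows "local_equation a b C q (h * f)"
proof -
  have "(\<lambda>x. f * x) ` loc q = (\<lambda>x. h * f * x) ` loc q"
  proof (intro equalityI subsetI)
    fix z assume "z \<in> (\<lambda>x. f * x) ` loc q"
    then obtain x where x: "x \<in> loc q" "z = f * x" by blast
    have "z = h * f * (inverse h * x)" unfolding x(2) using assms(2) unfolding unit_at_def by simp
    moreover have "inverse h * x \<in> loc q" using O_mult x(1) assms(2) unfolding unit_at_def by blast
    ultimately show "z \<in> (\<lambda>x. h * f * x) ` loc q" by blast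
  next
    fix z assume "z \<in> (\<lambda>x. h * f * x) ` loc q"
    then obtain x where x: "x \<in> loc q" "z = f * (h * x)" by (auto simp: mult_ac)
    then show "z \<in> (\<lambda>x. f * x) ` loc q" using O_mult assms(2) unfolding unit_at_def by blast
  qed
  then show ?thesis using assms(1) unfolding local_equation_def by simp
qed

lemma local_equation_mem: "local_equation a b C q f \<Longrightarrow> f \<in> ideal_stalk a b C q"
  using local_equation_stalk[of C q f 1] unit_1[of q] unfolding unit_at_def by simp

lemma stalk_forms:
  assumes f: "f \<in> ideal_stalk a b D q" and q: "q \<in> X" "good a b (q \<circ> Inl)"
  shows "\<exists>k N H. N \<in> forms k \<and> H \<in> forms k \<and> ev (q \<circ> Inl) H \<noteq> 0 \<and> f = Fract N H \<and> (q \<in> D \<longrightarrow> ev (q \<circ> Inl) N = 0)"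
proof -
  obtain e G H where G: "f = Fract (gp G) (gp H)" "mh e G" "mh e H" "ev q H \<noteq> 0" "\<forall>r\<in>D. ev r G = 0"
    using f unfolding ideal_stalk_def by blast
  then show ?thesis using gp_forms[OF G(2)] gp_forms[OF G(3)] ev_off_exc[OF q G(2)] ev_off_exc[OF q G(3)] by metis
qed

lemma E_inj: "inj E"
proof (rule injI)
  fix i k assume "E i = E k"
  then show "i = k" using E_E_disjoint[of i k] point_E_M[of i] by blast
qed

end

text \<open>The side conditions make C, L and the \<open>E i\<close> distinct and give each a
  nonzero coefficient, so they are exactly the components of the difference of C and its
  class.\<close>

locale class_curve = blowup_points a b for a b :: "9 \<Rightarrow> 'k::alg_closed_field" +
  fixes C :: "(amb \<Rightarrow> 'k) set" and d :: nat and m :: "9 \<Rightarrow> nat"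
  assumes curve: "curve_on_X a b C" and equiv: "lin_equiv a b (prime_divisor C) (class_div (int d) (\<lambda>i. int (m i)))"
    and not_L: "C \<noteq> L" and not_E: "\<And>i. \<not> C \<subseteq> E i" and d: "0 < d" and m: "\<And>i. 0 < m i"
begin

lemma C_X: "C \<subseteq> X"
  using curve unfolding curve_on_X_def by blast

lemma rational_function:
  "\<exists>g. g \<noteq> 0 \<and> (\<forall>q\<in>X. \<exists>u fC fL fE. unit_at q u \<and> local_equation a b C q fC \<and> local_equation a b L q fL
    \<and> (\<forall>i. local_equation a b (E i) q (fE i)) \<and> g = u * (fC * inverse (fL ^ d) * (\<Prod>i\<in>UNIV. fE i ^ m i)))"
proof -
  let ?D = "prime_divisor C - class_div (int d) (\<lambda>i. int (m i))"
  have CE: "C \<noteq> E i" for i using not_E by blast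
  have lE: "(\<Sum>i\<in>UNIV. Poly_Mapping.lookup (Poly_Mapping.single (E i) (int (m i))) (E k)) = int (m k)" for k
  proof -
    have "(\<Sum>i\<in>UNIV. Poly_Mapping.lookup (Poly_Mapping.single (E i) (int (m i))) (E k)) = (\<Sum>i\<in>UNIV. if i = k then int (m i) else 0)"
      using E_inj by (intro sum.cong) (auto simp: lookup_single when_def inj_eq)
    then show ?thesis by simp
  qed
  have lk: "Poly_Mapping.lookup ?D K = Poly_Mapping.lookup (prime_divisor C) K - (Poly_Mapping.lookup (Poly_Mapping.single L (int d)) K
      - (\<Sum>i\<in>UNIV. Poly_Mapping.lookup (Poly_Mapping.single (E i) (int (m i))) K))" for K
    by (simp only: class_div_def lookup_minus lookup_sum)
  have lC: "Poly_Mapping.lookup ?D C = 1" using not_L CE[symmetric] unfolding lk by (simp add: lookup_single when_def)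
  have lL: "Poly_Mapping.lookup ?D L = - int d" using not_L curves_distinct(2)[symmetric] unfolding lk by (simp add: lookup_single when_def)
  have lEk: "Poly_Mapping.lookup ?D (E k) = int (m k)" for k
    using curves_distinct(2)[of k] CE[of k] unfolding lk lE by (simp add: lookup_single)
  have keys: "Poly_Mapping.keys ?D = insert C (insert L (range E))"
  proof (intro equalityI subsetI)
    fix K assume K: "K \<in> Poly_Mapping.keys ?D"
    show "K \<in> insert C (insert L (range E))"
    proof (rule ccontr)
      assume "K \<notin> insert C (insert L (range E))"
      then have "C \<noteq> K" "L \<noteq> K" "E i \<noteq> K" for i by auto
      then have "Poly_Mapping.lookup ?D K = 0" unfolding lk by (simp add: lookup_single)
      then show False using K by (simp add: in_keys_iff)
    qed
  next
    fix K assume "K \<in> insert C (insert L (range E))"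
    then consider "K = C" | "K = L" | i where "K = E i" by blast
    then have "Poly_Mapping.lookup ?D K \<noteq> 0"
    proof cases
      case (3 i)
      then show ?thesis using lEk[of i] m[of i] by (simp del: lookup_minus)
    qed (use lC lL d in \<open>simp_all del: lookup_minus\<close>)
    then show "K \<in> Poly_Mapping.keys ?D" by (simp add: in_keys_iff)
  qed
  obtain g where g: "g \<noteq> 0" "is_divisor_of a b ?D g" using equiv unfolding lin_equiv_def by blast
  show ?thesis
  proof (rule exI[of _ g], intro conjI ballI)
    show "g \<noteq> 0" by (rule g(1))
    fix q assume "q \<in> X"
    then obtain f u where f: "\<forall>K\<in>Poly_Mapping.keys ?D. local_equation a b K q (f K)" and u: "u \<noteq> 0" "u \<in> loc q" "inverse u \<in> loc q"
      and gf: "g = u * (\<Prod>K\<in>Poly_Mapping.keys ?D. f K powi Poly_Mapping.lookup ?D K)"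
      using g(2) unfolding is_divisor_of_def by blast
    have split: "prod h (insert x (insert y A)) = h x * (h y * prod h A)" if "x \<notin> insert y A" "y \<notin> A" "finite A"
      for h :: "(amb \<Rightarrow> 'k) set \<Rightarrow> (3, 'k) mpol fract" and x y A using that by simp
    have "L \<notin> range E" "C \<notin> insert L (range E)" using curves_distinct(2) not_L CE by auto
    then have "(\<Prod>K\<in>Poly_Mapping.keys ?D. f K powi Poly_Mapping.lookup ?D K)
      = f C powi Poly_Mapping.lookup ?D C * (f L powi Poly_Mapping.lookup ?D L * (\<Prod>K\<in>range E. f K powi Poly_Mapping.lookup ?D K))"
      unfolding keys by (intro split) simp_all
    also have "(\<Prod>K\<in>range E. f K powi Poly_Mapping.lookup ?D K) = (\<Prod>i\<in>UNIV. f (E i) ^ m i)"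
      unfolding prod.reindex[OF E_inj] comp_def lEk power_int_of_nat ..
    also have "f C powi Poly_Mapping.lookup ?D C * (f L powi Poly_Mapping.lookup ?D L * (\<Prod>i\<in>UNIV. f (E i) ^ m i))
      = f C * inverse (f L ^ d) * (\<Prod>i\<in>UNIV. f (E i) ^ m i)"
      unfolding lC lL by (simp only: power_int_minus power_int_of_nat power_int_1_right mult.assoc)
    finally have "g = u * (f C * inverse (f L ^ d) * (\<Prod>i\<in>UNIV. f (E i) ^ m i))" unfolding gf by simp
    moreover have "unit_at q u" using u unfolding unit_at_def by blast
    ultimately show "\<exists>u fC fL fE. unit_at q u \<and> local_equation a b C q fC \<and> local_equation a b L q fL
        \<and> (\<forall>i. local_equation a b (E i) q (fE i)) \<and> g = u * (fC * inverse (fL ^ d) * (\<Prod>i\<in>UNIV. fE i ^ m i))"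
      using f unfolding keys by (intro exI[of _ u] exI[of _ "f C"] exI[of _ "f L"] exI[of _ "\<lambda>i. f (E i)"]) auto
  qed
qed

text \<open>A rational function with divisor C - d L + m_1 E_1 + ... + m_9 E_9.\<close>

definition g where "g = (SOME g. g \<noteq> 0 \<and> (\<forall>q\<in>X. \<exists>u fC fL fE. unit_at q u \<and> local_equation a b C q fC \<and> local_equation a b L q fL
    \<and> (\<forall>i. local_equation a b (E i) q (fE i)) \<and> g = u * (fC * inverse (fL ^ d) * (\<Prod>i\<in>UNIV. fE i ^ m i))))"

lemma g_nonzero: "g \<noteq> 0"
  and g_local: "q \<in> X \<Longrightarrow> \<exists>u fC fL fE. unit_at q u \<and> local_equation a b C q fC \<and> local_equation a b L q fL
    \<and> (\<forall>i. local_equation a b (E i) q (fE i)) \<and> g = u * (fC * inverse (fL ^ d) * (\<Prod>i\<in>UNIV. fE i ^ m i))"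
  using someI_ex[OF rational_function, folded g_def] by blast+

lemma E_unit:
  assumes "q \<in> X" "q \<notin> E i" "local_equation a b (E i) q f"
  shows "unit_at q f"
  using local_equation_unique[OF assms(3) E_local_off[OF assms(1,2)]] by auto

lemma L_unit:
  assumes "q \<in> X" "q \<notin> L" "local_equation a b L q f"
  shows "unit_at q f"
  using local_equation_unique[OF assms(3) L_local_off[OF assms(1,2)]] by auto

text \<open>Off the exceptional curves their equations are units, and the factor (x_0 / l)^d cancels
  the pole along L.\<close>

lemma C_local:
  assumes q: "q \<in> X" "good a b (q \<circ> Inl)" and l: "l \<in> forms 1" "ev (q \<circ> Inl) l \<noteq> 0"
  shows "local_equation a b C q (g * Fract (Var 0) l ^ d)"
proof -
  obtain u fC fL fE where f: "unit_at q u" "local_equation a b C q fC" "local_equation a b L q fL"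
      "\<And>i. local_equation a b (E i) q (fE i)" "g = u * (fC * inverse (fL ^ d) * (\<Prod>i\<in>UNIV. fE i ^ m i))"
    using g_local[OF q(1)] by blast
  let ?A = "Fract (Var 0) l"
  have "l \<noteq> 0" using l(2) by auto
  then have A: "?A \<noteq> 0" by (simp add: Zero_fract_def eq_fract)
  obtain h where h: "unit_at q h" "fL = ?A * h" using local_equation_unique[OF f(3) L_local_good[OF q l] A] by blast
  have "q \<notin> E i" for i using good_off_E q by blast
  then have p: "unit_at q (\<Prod>i\<in>UNIV. fE i ^ m i)" using E_unit[OF q(1) _ f(4)] by (intro unit_prod unit_power) blast
  let ?v = "u * inverse (h ^ d) * (\<Prod>i\<in>UNIV. fE i ^ m i)"
  have "unit_at q ?v" by (intro unit_mult unit_inverse unit_power f(1) h(1) p)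
  moreover have "g * ?A ^ d = ?v * fC"
  proof -
    have "x * (y * inverse (?A ^ d * z) * w) * ?A ^ d = x * inverse z * w * y" for x y z w :: "(3, 'k) mpol fract"
      using A by (simp add: field_simps)
    then show ?thesis unfolding f(5) h(2) power_mult_distrib .
  qed
  ultimately show ?thesis using local_equation_unit[OF f(2)] by simp
qed

lemma Fract_split: "l \<noteq> 0 \<Longrightarrow> Fract (Var 0) l ^ k = Fract (Var 0) 1 ^ k * Fract 1 (l ^ k)"
  for l :: "(3, 'k) mpol"
  unfolding Fract_power by simp

text \<open>After multiplication by x_0^d no pole is left away from the nine points, so the
  extension property applies.\<close>

lemma form_exists: "\<exists>\<Phi>\<in>forms d. g * Fract (Var 0) 1 ^ d = Fract \<Phi> 1"
proof (rule regular_imp_form[of a b], unfold regular_def, intro allI impI)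
  fix x assume x: "good a b x"
  let ?q = "pull a b x" and ?S = "g * Fract (Var 0) 1 ^ d"
  have q: "?q \<in> X" "good a b (?q \<circ> Inl)" using pull_blowup[OF x] x by simp_all
  obtain l where l: "l \<in> forms 1" "ev (?q \<circ> Inl) l \<noteq> 0" using good_form[OF q(1)] by blast
  have l0: "l \<noteq> 0" using l(2) by auto
  obtain k N H where N: "N \<in> forms k" "H \<in> forms k" "ev (?q \<circ> Inl) H \<noteq> 0" "g * Fract (Var 0) l ^ d = Fract N H"
    using stalk_forms[OF local_equation_mem[OF C_local[OF q l]] q] by blast
  have "?S = g * Fract (Var 0) l ^ d * Fract (l ^ d) 1"
  proof -
    have "Fract 1 (l ^ d) * Fract (l ^ d) 1 = 1" using l0 by (simp add: One_fract_def eq_fract)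
    then show ?thesis unfolding Fract_split[OF l0] mult.assoc by simp
  qed
  also have "\<dots> = Fract (N * l ^ d) H" unfolding N(4) by simp
  finally have "?S = Fract (N * l ^ d) H" .
  moreover have "N * l ^ d \<in> forms (k + d)" by (rule forms_mult[OF N(1) forms_power[OF l(1)]])
  ultimately show "\<exists>i j N M. int i = int j + int d \<and> N \<in> forms i \<and> M \<in> forms j \<and> ev x M \<noteq> 0 \<and> ?S = Fract N M"
    using N(2,3) by (intro exI[of _ "k + d"] exI[of _ k] exI[of _ "N * l ^ d"] exI[of _ H]) simp
qed

definition \<Phi> where "\<Phi> = (SOME \<Phi>. \<Phi> \<in> forms d \<and> g * Fract (Var 0) 1 ^ d = Fract \<Phi> 1)"

lemma \<Phi>_forms: "\<Phi> \<in> forms d" and \<Phi>_g: "g * Fract (Var 0) 1 ^ d = Fract \<Phi> 1"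
  using someI_ex[of "\<lambda>\<Phi>. \<Phi> \<in> forms d \<and> g * Fract (Var 0) 1 ^ d = Fract \<Phi> 1", folded \<Phi>_def] form_exists by blast+

lemma \<Phi>_nonzero: "\<Phi> \<noteq> 0"
proof
  assume "\<Phi> = 0"
  then have "g * Fract (Var 0) 1 ^ d = 0" using \<Phi>_g by (simp add: fract_collapse)
  moreover have "Fract (Var 0) 1 \<noteq> (0 :: (3, 'k) mpol fract)" by (simp add: Zero_fract_def eq_fract)
  ultimately show False using g_nonzero by simp
qed

lemma \<Phi>_local:
  assumes q: "q \<in> X" "good a b (q \<circ> Inl)" and l: "l \<in> forms 1" "ev (q \<circ> Inl) l \<noteq> 0"
  shows "local_equation a b C q (Fract \<Phi> (l ^ d))"
proof -
  have l0: "l \<noteq> 0" using l(2) by auto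
  have "g * Fract (Var 0) l ^ d = Fract \<Phi> 1 * Fract 1 (l ^ d)"
    unfolding \<Phi>_g[symmetric] by (simp only: Fract_split[OF l0] mult.assoc)
  then show ?thesis using C_local[OF q l] by simp
qed

text \<open>At the point of \<open>E i\<close> with direction \<open>y\<close>, \<open>g\<close> is
  a regular function times the m_i-th power of the equation of \<open>E i\<close>, and along the arc
  this equation becomes y_0 times the parameter.\<close>

lemma \<Phi>_order:
  assumes y: "y 0 \<noteq> 0"
  shows "[:0, 1:] ^ m i dvd along a b i y \<Phi>"
proof -
  let ?q = "arc_point a b i y"
  have qE: "?q \<in> E i" by (rule arc_point_blowup[OF distinct]) (use y in simp)
  have q: "?q \<in> X" using E_X[OF qE] .
  have c: "chart_at i 0 ?q" using qE y unfolding chart_at_def by (simp add: arc_point_def)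
  obtain u fC fL fE where f: "unit_at ?q u" "local_equation a b C ?q fC" "local_equation a b L ?q fL"
      "\<And>i. local_equation a b (E i) ?q (fE i)" "g = u * (fC * inverse (fL ^ d) * (\<Prod>i\<in>UNIV. fE i ^ m i))"
    using g_local[OF q] by blast
  let ?U = "Fract (lf i 0) (Var 0)"
  have U: "?U \<noteq> 0" using lin_nonzero by (simp add: Zero_fract_def eq_fract)
  obtain h where h: "unit_at ?q h" "fE i = ?U * h" using local_equation_unique[OF f(4) E_local[OF c] U] by blast
  have "?q \<notin> E k" if "k \<noteq> i" for k using E_E_disjoint[OF that] qE by blast
  then have p: "unit_at ?q (\<Prod>k\<in>UNIV - {i}. fE k ^ m k)" using E_unit[OF q _ f(4)] by (intro unit_prod unit_power) auto
  have L: "unit_at ?q fL" using L_unit[OF q _ f(3)] L_E_disjoint qE by blast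
  let ?v = "u * inverse (fL ^ d) * h ^ m i * (\<Prod>k\<in>UNIV - {i}. fE k ^ m k)"
  have v: "unit_at ?q ?v" by (intro unit_mult unit_inverse unit_power f(1) h(1) p L)
  have "fC * ?v \<in> loc ?q" using O_mult stalk_sub local_equation_mem[OF f(2)] v unfolding unit_at_def by blast
  then obtain e G H where G: "fC * ?v = Fract (gp G) (gp H)" "mh e G" "mh e H" "ev ?q H \<noteq> 0"
    unfolding ideal_stalk_def by blast
  have "g = u * (fC * inverse (fL ^ d) * (fE i ^ m i * (\<Prod>k\<in>UNIV - {i}. fE k ^ m k)))"
    unfolding f(5) by (subst prod.remove[of UNIV i]) simp_all
  also have "\<dots> = fC * ?v * ?U ^ m i" unfolding h(2) power_mult_distrib by (simp only: mult_ac)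
  finally have "Fract \<Phi> 1 = Fract (gp G) (gp H) * ?U ^ m i * Fract (Var 0) 1 ^ d" unfolding \<Phi>_g[symmetric] G(1) by simp
  also have "\<dots> = Fract (gp G * lf i 0 ^ m i * Var 0 ^ d) (gp H * Var 0 ^ m i)" unfolding Fract_power by simp
  finally have "\<Phi> * (gp H * Var 0 ^ m i) = gp G * lf i 0 ^ m i * Var 0 ^ d"
    using gp_nz[OF q G(3,4)] by (simp add: eq_fract)
  then have "along a b i y (\<Phi> * (gp H * Var 0 ^ m i)) = along a b i y (gp G * lf i 0 ^ m i * Var 0 ^ d)" by simp
  moreover have "along a b i y (lf i 0) = [:0, 1:] * [:y 0:]" by (simp add: lin_def)
  ultimately have eq: "along a b i y \<Phi> * along a b i y (gp H) = along a b i y (gp G) * ([:0, 1:] * [:y 0:]) ^ m i"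
    by (simp only: along_simps along_Var power_one mult_1_right)
  \<comment> \<open>Numerator and denominator have the same degree in the i-th block, so they pick
    up the same power of the parameter.\<close>
  let ?s = "[:0, 1:] ^ e (Inr ` ({i} \<times> UNIV)) :: 'k poly"
  obtain G' where G': "along a b i y (gp G) = ?s * G'" using along_gp[OF G(2)] by blast
  obtain H' where H': "along a b i y (gp H) = ?s * H'" "poly H' 0 = ev ?q H" using along_gp[OF G(3)] by blast
  have "?s * (along a b i y \<Phi> * H') = along a b i y \<Phi> * (?s * H')" by (simp only: mult.left_commute)
  also have "\<dots> = ?s * G' * ([:0, 1:] * [:y 0:]) ^ m i" using eq unfolding H'(1) G' .
  also have "\<dots> = ?s * ([:0, 1:] ^ m i * (G' * [:y 0:] ^ m i))" by (simp only: power_mult_distrib mult_ac)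
  finally have "along a b i y \<Phi> * H' = [:0, 1:] ^ m i * (G' * [:y 0:] ^ m i)" by (simp only: mult_cancel_left) simp
  then have "[:0, 1:] ^ m i dvd along a b i y \<Phi> * H'" by (rule dvdI)
  then show ?thesis using X_power_dvd_mult G(4) H'(2) by metis
qed

lemma \<Phi>_fat: "\<Phi> \<in> fat_forms a b m d"
  unfolding fat_forms_iff using \<Phi>_forms ordge_along[OF \<Phi>_forms \<Phi>_order] by blast

lemma \<Phi>_vanishes: "q \<in> C \<Longrightarrow> good a b (q \<circ> Inl) \<Longrightarrow> ev (q \<circ> Inl) \<Phi> = 0"
proof -
  assume q: "q \<in> C" "good a b (q \<circ> Inl)"
  have qX: "q \<in> X" using q C_X by blast
  obtain l where l: "l \<in> forms 1" "ev (q \<circ> Inl) l \<noteq> 0" using good_form[OF qX] by blast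
  obtain k N H where N: "ev (q \<circ> Inl) H \<noteq> 0" "Fract \<Phi> (l ^ d) = Fract N H" "ev (q \<circ> Inl) N = 0"
    using stalk_forms[OF local_equation_mem[OF \<Phi>_local[OF qX q(2) l]] qX q(2)] q(1) by blast
  have "l ^ d \<noteq> 0" "H \<noteq> 0" using l(2) N(1) by auto
  then have "\<Phi> * H = N * l ^ d" using N(2) by (simp add: eq_fract)
  then have "ev (q \<circ> Inl) (\<Phi> * H) = ev (q \<circ> Inl) (N * l ^ d)" by (rule arg_cong)
  then show ?thesis using N(1,3) by simp
qed

definition vanishes :: "(3, 'k) mpol \<Rightarrow> bool" where
  "vanishes P \<longleftrightarrow> (\<forall>q\<in>C. ev (q \<circ> Inl) P = 0)"

text \<open>The zero sets of the two pulled-back forms are closed and cover the irreducible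
  curve.\<close>

lemma vanishes_mult:
  assumes "A \<in> forms k" "B \<in> forms l" "vanishes (A * B)"
  shows "vanishes A \<or> vanishes B"
proof -
  let ?Z = "\<lambda>P. {q \<in> multiproj amb_blocks. \<forall>P\<in>{emb P}. ev q P = 0}"
  have Z: "zariski_closed amb_blocks (?Z P)" if "P \<in> forms k" for P k
    unfolding zariski_closed_def using emb_multihomogeneous[OF that] by blast
  have CP: "C \<subseteq> multiproj amb_blocks" using C_X X_multiproj by blast
  have "C \<subseteq> ?Z A \<union> ?Z B" using CP assms(3) unfolding vanishes_def by auto
  then have "C \<subseteq> ?Z A \<or> C \<subseteq> ?Z B"
    using curve Z[OF assms(1)] Z[OF assms(2)] unfolding curve_on_X_def zariski_irreducible_def by blast
  then show ?thesis unfolding vanishes_def by auto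
qed

text \<open>\<Phi> generates the ideal of C away from the nine points, so P / \<Phi> is regular
  there. It is therefore a form, or zero when its degree is negative.\<close>

lemma vanishes_dvd:
  assumes P: "P \<in> forms k" and van: "vanishes P"
  shows "\<Phi> dvd P"
proof -
  have "regular a b (int k - int d) (Fract P \<Phi>)"
    unfolding regular_def
  proof (intro allI impI)
    fix x assume x: "good a b x"
    let ?q = "pull a b x"
    have q: "?q \<in> X" "good a b (?q \<circ> Inl)" using pull_blowup[OF x] x by simp_all
    obtain l where l: "l \<in> forms 1" "ev (?q \<circ> Inl) l \<noteq> 0" using good_form[OF q(1)] by blast
    have l0: "l \<noteq> 0" using l(2) by auto
    have "Fract P (l ^ k) \<in> ideal_stalk a b C ?q"
      unfolding ideal_stalk_def
      using emb_multihomogeneous[OF P] emb_multihomogeneous[OF forms_power[OF l(1), of k]] l(2) van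
      by (intro CollectI exI[of _ "emb P"] exI[of _ "emb (l ^ k)"]) (auto simp: vanishes_def)
    then obtain h where h: "h \<in> loc ?q" "Fract P (l ^ k) = Fract \<Phi> (l ^ d) * h"
      using \<Phi>_local[OF q l] unfolding local_equation_def by blast
    obtain j N H where N: "N \<in> forms j" "H \<in> forms j" "ev (?q \<circ> Inl) H \<noteq> 0" "h = Fract N H"
      using stalk_forms[OF h(1) q] by blast
    have H0: "H \<noteq> 0" using N(3) by auto
    have "P * (l ^ d * H) = \<Phi> * N * l ^ k" using h(2) l0 H0 unfolding N(4) by (simp add: eq_fract)
    then have "Fract P \<Phi> = Fract (l ^ k * N) (l ^ d * H)"
      using l0 H0 \<Phi>_nonzero by (simp add: eq_fract mult_ac)
    moreover have "l ^ k * N \<in> forms (k + j)" "l ^ d * H \<in> forms (d + j)"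
      using forms_mult forms_power[OF l(1)] N(1,2) by blast+
    moreover have "ev x (l ^ d * H) \<noteq> 0" using l(2) N(3) by simp
    moreover have "int (k + j) = int (d + j) + (int k - int d)" by simp
    ultimately show "\<exists>i j N M. int i = int j + (int k - int d) \<and> N \<in> forms i \<and> M \<in> forms j \<and> ev x M \<noteq> 0 \<and> Fract P \<Phi> = Fract N M"
      by blast
  qed
  then have reg: "regular a b (int k - int d) (Fract P \<Phi>)" .
  show ?thesis
  proof (cases "d \<le> k")
    case True
    then have "int k - int d = int (k - d)" by simp
    then obtain Q where "Fract P \<Phi> = Fract Q 1" using regular_imp_form reg by metis
    then have "P = \<Phi> * Q" using \<Phi>_nonzero by (simp add: eq_fract mult.commute)
    then show ?thesis by simp
  next
    case False
    then have "Fract P \<Phi> = 0" using regular_neg[OF reg] by simp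
    then have "P = 0" using \<Phi>_nonzero by (simp add: Zero_fract_def eq_fract)
    then show ?thesis by simp
  qed
qed

text \<open>If \<Phi> divides A B, then A B vanishes on C except possibly over the p_i. A factor
  that vanishes over the p_i but not on all of C repairs this, and irreducibility removes it
  again.\<close>

lemma \<Phi>_prime: "prime_form \<Phi>"
  unfolding prime_form_def
proof (intro conjI allI impI)
  show "\<Phi> \<noteq> 0" by (rule \<Phi>_nonzero)
  fix k l A B assume A: "A \<in> forms k" and B: "B \<in> forms l" and AB: "\<Phi> dvd A * B"
  have "\<exists>j. \<not> vanishes (lf i j)" for i
  proof (rule ccontr)
    assume "\<nexists>j. \<not> vanishes (lf i j)"
    then have "C \<subseteq> E i" using C_X unfolding vanishes_def by (auto simp: exc_iff)
    then show False using not_E by blast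
  qed
  \<comment> \<open>Since C is not inside \<open>E i\<close>, one of the two linear forms at p_i
    does not vanish identically on C.\<close>
  then obtain c where c: "\<And>i. \<not> vanishes (lf i (c i))" by metis
  have N: "(\<exists>n. (\<Prod>i\<in>I. lf i (c i)) \<in> forms n) \<and> \<not> vanishes (\<Prod>i\<in>I. lf i (c i))" for I :: "9 set"
  proof (induction I rule: infinite_finite_induct)
    case (insert i I)
    then obtain n where n: "(\<Prod>i\<in>I. lf i (c i)) \<in> forms n" by blast
    have "lf i (c i) * (\<Prod>i\<in>I. lf i (c i)) \<in> forms (1 + n)" by (rule forms_mult[OF lin_forms n])
    moreover have "\<not> vanishes (lf i (c i) * (\<Prod>i\<in>I. lf i (c i)))" using vanishes_mult[OF lin_forms n] c insert.IH by blast
    ultimately show ?case using insert.hyps by auto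
  next
    case empty
    obtain q where "q \<in> C" using not_E by blast
    moreover have "(1 :: (3, 'k) mpol) \<in> forms 0" by (simp add: forms_iff)
    ultimately show ?case unfolding vanishes_def by auto
  qed simp
  let ?N = "\<Prod>i\<in>UNIV. lf i (c i)"
  obtain n where n: "?N \<in> forms n" "\<not> vanishes ?N" using N by blast
  have "vanishes (A * B * ?N)"
    unfolding vanishes_def
  proof
    fix q assume q: "q \<in> C"
    show "ev (q \<circ> Inl) (A * B * ?N) = 0"
    proof (cases "\<exists>i. q \<in> E i")
      case True
      then obtain i where "q \<in> E i" by blast
      then have "ev (q \<circ> Inl) (lf i (c i)) = 0" using exhaust_2[of "c i"] unfolding exc_iff by auto
      then have "(\<Prod>i\<in>UNIV. ev (q \<circ> Inl) (lf i (c i))) = 0" by (intro prod_zero) auto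
      then show ?thesis by simp
    next
      case False
      then have "ev (q \<circ> Inl) \<Phi> = 0" using \<Phi>_vanishes[OF q] good_off_E C_X q by blast
      moreover obtain Q where "A * B = \<Phi> * Q" using AB by (elim dvdE)
      ultimately have "ev (q \<circ> Inl) (A * B) = 0" by simp
      then show ?thesis by simp
    qed
  qed
  then have "vanishes (A * B)" using vanishes_mult[OF forms_mult[OF A B] n(1)] n(2) by blast
  then show "\<Phi> dvd A \<or> \<Phi> dvd B" using vanishes_mult[OF A B] vanishes_dvd A B by blast
qed

end

theorem proposition4p3:
  fixes a b :: "9 \<Rightarrow> 'k::alg_closed_field"
    and C' :: "(amb \<Rightarrow> 'k) set"
    and d' :: nat and m' n :: "9 \<Rightarrow> nat"
  assumes "generic_points a b"
    and "exceptional_divisor a b C'"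
    and "has_type a b C' (2 * int d') (\<lambda>i. 2 * int (m' i) + 1)"
    and "d' \<ge> 2"
    and "n = (\<lambda>i. 3 * m' i + 1)"
  shows "maximal_hilbert_function a b n \<and> alpha a b n = 3 * d' - 1
    \<and> int (mpol_vs.dim (fat_forms a b n (alpha a b n + 1)))
        - 3 * int (mpol_vs.dim (fat_forms a b n (alpha a b n))) = 1
    \<and> dim_coker_mu a b n (alpha a b n) \<ge> 2
    \<and> \<not> mu_maximal_rank a b n (alpha a b n)"
proof -
  interpret blowup_points a b by unfold_locales (rule generic_distinct[OF assms(1)])
  obtain I where C: "curve_on_X a b C'" and I: "intersection_pairing a b I" "I (prime_divisor C') (prime_divisor C') = -1"
    using assms(2) unfolding exceptional_divisor_def by blast
  have type: "lin_equiv a b (prime_divisor C') (class_div (2 * int d') (\<lambda>i. 2 * int (m' i) + 1))"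
    using assms(3) unfolding has_type_def class_div_def .
  have d0: "2 * int d' \<noteq> 0" using assms(4) by simp
  note num = exceptional_numbers[OF I(1) C type I(2) d0]
  have cast: "int (2 * d') = 2 * int d'" "(\<lambda>i. int (2 * m' i + 1)) = (\<lambda>i. 2 * int (m' i) + 1)" by (simp_all add: fun_eq_iff)
  interpret class_curve a b C' "2 * d'" "\<lambda>i. 2 * m' i + 1"
  proof unfold_locales
    show "lin_equiv a b (prime_divisor C') (class_div (int (2 * d')) (\<lambda>i. int (2 * m' i + 1)))"
      unfolding cast by (rule type)
  qed (use C num(2,3) assms(4) in simp_all)
  have "4 * (int d')\<^sup>2 - (\<Sum>i\<in>UNIV. (2 * int (m' i) + 1)\<^sup>2) = -1"
    using num(1) by (simp add: power_mult_distrib)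
  then interpret odd_exceptional a b d' m' \<Phi>
    by unfold_locales (use assms(1,4) \<Phi>_fat \<Phi>_prime in simp_all)
  show ?thesis unfolding assms(5) by (rule conclusion)
qed

end
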